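(* Let $(A,\mathfrak{m})$ be a Cohen-Macaulay local ring of dimension $d\geq 1$ and let $s\colon 0\to N\to E\to M\to 0$ be an exact sequence of maximal Cohen-Macaulay $A$-modules. Assume that $s$ is $T$-split and that $G(N)$ is Cohen-Macaulay. Then the induced complex of $G(A)$-modules $$G(s)\colon\quad 0\to G(N)\to G(E)\to G(M)\to 0$$ is exact. In particular, if $G(M)$ is also Cohen-Macaulay, then $G(E)$ is Cohen-Macaulay.
   Context: All rings are commutative Noetherian and all modules are finitely generated; $\ell(-)$ denotes length; MCM means maximal Cohen-Macaulay. $G(A)=\bigoplus_{n\geq 0}\mathfrak{m}^n/\mathfrak{m}^{n+1}$ is the associated graded ring and, for an $A$-module $M$, $G(M)=\bigoplus_{n\geq 0}\mathfrak{m}^nM/\mathfrak{m}^{n+1}M$ is its associated graded module over $G(A)$. For an MCM $A$-module $M$ put $$e^T_A(M)=\lim_{n\to\infty}\frac{(d-1)!}{n^{d-1}}\,\ell\left(\mathrm{Tor}^A_1(M,A/\mathfrak{m}^{n+1})\right),$$ which exists and is finite. For an exact sequence $s\colon 0\to N\to E\to M\to 0$ of MCM $A$-modules put $e^T_A(s)=e^T_A(M)+e^T_A(N)-e^T_A(E)$; $s$ is called $T$-split if $e^T_A(s)=0$. *)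

theory Defs
  imports "HOL-Algebra.Module" "HOL-Algebra.Ideal_Product" "HOL-Algebra.QuotRing"
    "HOL-Algebra.Ring_Divisibility" "HOL-Algebra.Exact_Sequence" "HOL-Library.Extended_Nat" Complex_Main
begin

section \<open>Modules\<close>

text \<open>Module records extend ring records. In the modules constructed below the fields
  \<^const>\<open>monoid.mult\<close> and \<^const>\<open>one\<close> carry no meaning and are filled with \<^const>\<open>undefined\<close>,
  except for \<open>self_mod\<close>.\<close>

definition self_mod :: "'a ring \<Rightarrow> ('a, 'a) module"
  where "self_mod R = \<lparr>carrier = carrier R, monoid.mult = monoid.mult R, one = \<one>\<^bsub>R\<^esub>,
    ring.zero = \<zero>\<^bsub>R\<^esub>, add = add R, smult = monoid.mult R\<rparr>"

definition quot_mod :: "('a, 'b) module \<Rightarrow> 'b set \<Rightarrow> ('a, 'b set) module"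
  where "quot_mod M H = \<lparr>carrier = a_rcosets\<^bsub>M\<^esub> H, monoid.mult = undefined, one = undefined,
    ring.zero = H, add = set_add M,
    smult = (\<lambda>a X. \<Union>x\<in>X. H +>\<^bsub>M\<^esub> (a \<odot>\<^bsub>M\<^esub> x))\<rparr>"

definition gen_submod :: "'a ring \<Rightarrow> ('a, 'b) module \<Rightarrow> 'b set \<Rightarrow> 'b set"
  where "gen_submod R M S = \<Inter>{H. submodule H R M \<and> S \<subseteq> H}"

definition fg_module :: "'a ring \<Rightarrow> ('a, 'b) module \<Rightarrow> bool"
  where "fg_module R M \<longleftrightarrow>
    module R M \<and> (\<exists>S\<subseteq>carrier M. finite S \<and> carrier M = gen_submod R M S)"

definition mod_hom :: "'a ring \<Rightarrow> ('a, 'b) module \<Rightarrow> ('a, 'c) module \<Rightarrow> ('b \<Rightarrow> 'c) set"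
  where "mod_hom R M N = {h \<in> carrier M \<rightarrow> carrier N.
    (\<forall>x\<in>carrier M. \<forall>y\<in>carrier M. h (x \<oplus>\<^bsub>M\<^esub> y) = h x \<oplus>\<^bsub>N\<^esub> h y) \<and>
    (\<forall>a\<in>carrier R. \<forall>x\<in>carrier M. h (a \<odot>\<^bsub>M\<^esub> x) = a \<odot>\<^bsub>N\<^esub> h x)}"

text \<open>Exactness of \<open>0 \<rightarrow> N \<rightarrow> E \<rightarrow> M \<rightarrow> 0\<close> with maps \<open>f\<close> and \<open>g\<close>. The library's
  \<^const>\<open>short_exact_sequence\<close> is about groups and forces all of them to have the same
  element type.\<close>

definition short_exact ::
    "'a ring \<Rightarrow> ('a, 'b) module \<Rightarrow> ('a, 'c) module \<Rightarrow> ('a, 'd) module \<Rightarrow>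
     ('b \<Rightarrow> 'c) \<Rightarrow> ('c \<Rightarrow> 'd) \<Rightarrow> bool"
  where "short_exact R N E M f g \<longleftrightarrow>
    f \<in> mod_hom R N E \<and> g \<in> mod_hom R E M \<and>
    inj_on f (carrier N) \<and> f ` carrier N = a_kernel E M g \<and> g ` carrier E = carrier M"

definition ideal_smult :: "'a ring \<Rightarrow> 'a set \<Rightarrow> ('a, 'b) module \<Rightarrow> 'b set"
  where "ideal_smult R I M = gen_submod R M {a \<odot>\<^bsub>M\<^esub> x |a x. a \<in> I \<and> x \<in> carrier M}"

primrec ideal_power :: "'a ring \<Rightarrow> 'a set \<Rightarrow> nat \<Rightarrow> 'a set"
  where
    "ideal_power R I 0 = carrier R"
  | "ideal_power R I (Suc n) = ideal_prod R I (ideal_power R I n)"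

definition annihilator :: "'a ring \<Rightarrow> ('a, 'b) module \<Rightarrow> 'a set"
  where "annihilator R M = {a \<in> carrier R. \<forall>x\<in>carrier M. a \<odot>\<^bsub>M\<^esub> x = \<zero>\<^bsub>M\<^esub>}"

definition mod_length :: "'a ring \<Rightarrow> ('a, 'b) module \<Rightarrow> enat"
  where "mod_length R M = Sup {enat n |n. \<exists>H :: nat \<Rightarrow> 'b set.
    (\<forall>i\<le>n. submodule (H i) R M) \<and> (\<forall>i<n. H i \<subset> H (Suc i))}"


section \<open>Dimension, depth and the Cohen-Macaulay property\<close>

definition krull_dim :: "'a ring \<Rightarrow> enat"
  where "krull_dim R = Sup {enat n |n. \<exists>P :: nat \<Rightarrow> 'a set.
    (\<forall>i\<le>n. primeideal (P i) R) \<and> (\<forall>i<n. P i \<subset> P (Suc i))}"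

definition mod_dim :: "'a ring \<Rightarrow> ('a, 'b) module \<Rightarrow> enat"
  where "mod_dim R M = krull_dim (R Quot annihilator R M)"

definition regular_seq :: "'a ring \<Rightarrow> ('a, 'b) module \<Rightarrow> 'a list \<Rightarrow> bool"
  where "regular_seq R M xs \<longleftrightarrow>
    set xs \<subseteq> carrier R \<and>
    (\<forall>i<length xs. let Q = quot_mod M (ideal_smult R (genideal R (set (take i xs))) M) in
       \<forall>z\<in>carrier Q. (xs ! i) \<odot>\<^bsub>Q\<^esub> z = \<zero>\<^bsub>Q\<^esub> \<longrightarrow> z = \<zero>\<^bsub>Q\<^esub>) \<and>
    ideal_smult R (genideal R (set xs)) M \<noteq> carrier M"

text \<open>The depth of \<open>M\<close> with respect to the ideal \<open>I\<close>, that is \<open>grade(I, M)\<close>.\<close>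

definition depth :: "'a ring \<Rightarrow> 'a set \<Rightarrow> ('a, 'b) module \<Rightarrow> enat"
  where "depth R I M = Sup {enat (length xs) |xs. regular_seq R M xs \<and> set xs \<subseteq> I}"

text \<open>The ideal \<open>I\<close> is the maximal ideal when \<open>R\<close> is local, and the maximal homogeneous
  ideal when \<open>R\<close> is a positively graded ring over a field and \<open>M\<close> a graded module.
  The zero module is regarded as (maximal) Cohen-Macaulay.\<close>

definition cohen_macaulay :: "'a ring \<Rightarrow> 'a set \<Rightarrow> ('a, 'b) module \<Rightarrow> bool"
  where "cohen_macaulay R I M \<longleftrightarrow>
    fg_module R M \<and> (carrier M = {\<zero>\<^bsub>M\<^esub>} \<or> depth R I M = mod_dim R M)"

definition max_cohen_macaulay :: "'a ring \<Rightarrow> 'a set \<Rightarrow> ('a, 'b) module \<Rightarrow> bool"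
  where "max_cohen_macaulay R I M \<longleftrightarrow>
    cohen_macaulay R I M \<and> (carrier M = {\<zero>\<^bsub>M\<^esub>} \<or> mod_dim R M = krull_dim R)"

definition local_ring :: "'a ring \<Rightarrow> 'a set \<Rightarrow> bool"
  where "local_ring R \<mm> \<longleftrightarrow>
    cring R \<and> noetherian_ring R \<and> maximalideal \<mm> R \<and> (\<forall>J. maximalideal J R \<longrightarrow> J = \<mm>)"

definition cm_local_ring :: "'a ring \<Rightarrow> 'a set \<Rightarrow> bool"
  where "cm_local_ring R \<mm> \<longleftrightarrow> local_ring R \<mm> \<and> cohen_macaulay R \<mm> (self_mod R)"


section \<open>Associated graded ring and modules\<close>

definition gr_piece :: "'a ring \<Rightarrow> 'a set \<Rightarrow> ('a, 'b) module \<Rightarrow> nat \<Rightarrow> ('a, 'b set) module"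
  where "gr_piece R \<mm> M n =
    quot_mod (M\<lparr>carrier := ideal_smult R (ideal_power R \<mm> n) M\<rparr>)
      (ideal_smult R (ideal_power R \<mm> (Suc n)) M)"

text \<open>Elements of \<open>G(M)\<close> are finitely supported sequences whose \<open>n\<close>-th component lies in
  \<open>\<mm>\<^sup>n M / \<mm>\<^sup>n\<^sup>+\<^sup>1 M\<close>. The scalars are the elements of \<open>G(A)\<close>; the action is induced by
  \<open>(a + \<mm>\<^sup>i\<^sup>+\<^sup>1) (x + \<mm>\<^sup>j\<^sup>+\<^sup>1 M) = a x + \<mm>\<^sup>i\<^sup>+\<^sup>j\<^sup>+\<^sup>1 M\<close>.\<close>

definition gr_mod ::
    "'a ring \<Rightarrow> 'a set \<Rightarrow> ('a, 'b) module \<Rightarrow> (nat \<Rightarrow> 'a set, nat \<Rightarrow> 'b set) module"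
  where "gr_mod R \<mm> M =
    \<lparr>carrier = {x. (\<forall>n. x n \<in> carrier (gr_piece R \<mm> M n)) \<and>
                   finite {n. x n \<noteq> \<zero>\<^bsub>gr_piece R \<mm> M n\<^esub>}},
     monoid.mult = undefined, one = undefined,
     ring.zero = (\<lambda>n. \<zero>\<^bsub>gr_piece R \<mm> M n\<^esub>),
     add = (\<lambda>x y n. x n \<oplus>\<^bsub>gr_piece R \<mm> M n\<^esub> y n),
     smult = (\<lambda>a x n. finsum (gr_piece R \<mm> M n)
       (\<lambda>i. \<Union>r\<in>a i. \<Union>y\<in>x (n - i).
          ideal_smult R (ideal_power R \<mm> (Suc n)) M +>\<^bsub>M\<^esub> (r \<odot>\<^bsub>M\<^esub> y)) {..n})\<rparr>"

definition gr_ring :: "'a ring \<Rightarrow> 'a set \<Rightarrow> (nat \<Rightarrow> 'a set) ring"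
  where "gr_ring R \<mm> = (let G = gr_mod R \<mm> (self_mod R) in
    \<lparr>carrier = carrier G, monoid.mult = smult G,
     one = (\<lambda>n. if n = 0 then ideal_smult R (ideal_power R \<mm> 1) (self_mod R) +>\<^bsub>R\<^esub> \<one>\<^bsub>R\<^esub>
                else \<zero>\<^bsub>G\<^esub> n),
     ring.zero = \<zero>\<^bsub>G\<^esub>, add = add G\<rparr>)"

definition gr_irrelevant :: "'a ring \<Rightarrow> 'a set \<Rightarrow> (nat \<Rightarrow> 'a set) set"
  where "gr_irrelevant R \<mm> =
    {x \<in> carrier (gr_ring R \<mm>). x 0 = \<zero>\<^bsub>gr_ring R \<mm>\<^esub> 0}"

definition gr_map ::
    "'a ring \<Rightarrow> 'a set \<Rightarrow> ('a, 'c) module \<Rightarrow> ('b \<Rightarrow> 'c) \<Rightarrow>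
     (nat \<Rightarrow> 'b set) \<Rightarrow> (nat \<Rightarrow> 'c set)"
  where "gr_map R \<mm> N f x =
    (\<lambda>n. \<Union>y\<in>x n. ideal_smult R (ideal_power R \<mm> (Suc n)) N +>\<^bsub>N\<^esub> f y)"

text \<open>\<open>G(M)\<close> is Cohen-Macaulay if \<open>grade(G(A)\<^sub>+, G(M)) = dim G(M)\<close>, where \<open>G(A)\<^sub>+\<close> is the
  maximal homogeneous ideal of \<open>G(A)\<close>, the depth of graded modules being taken with respect
  to that ideal.\<close>

abbreviation gr_cohen_macaulay :: "'a ring \<Rightarrow> 'a set \<Rightarrow> ('a, 'b) module \<Rightarrow> bool"
  where "gr_cohen_macaulay R \<mm> M \<equiv>
    cohen_macaulay (gr_ring R \<mm>) (gr_irrelevant R \<mm>) (gr_mod R \<mm> M)"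


section \<open>Tensor products and the functor Tor\<close>

text \<open>The free module on the set \<open>S\<close>: finitely supported functions on \<open>S\<close>, extended by zero.\<close>

definition free_mod :: "'a ring \<Rightarrow> 's set \<Rightarrow> ('a, 's \<Rightarrow> 'a) module"
  where "free_mod R S =
    \<lparr>carrier = {u. u ` S \<subseteq> carrier R \<and> (\<forall>s. s \<notin> S \<longrightarrow> u s = \<zero>\<^bsub>R\<^esub>) \<and>
                   finite {s. u s \<noteq> \<zero>\<^bsub>R\<^esub>}},
     monoid.mult = undefined, one = undefined,
     ring.zero = (\<lambda>s. \<zero>\<^bsub>R\<^esub>),
     add = (\<lambda>u v s. u s \<oplus>\<^bsub>R\<^esub> v s),
     smult = (\<lambda>a u s. a \<otimes>\<^bsub>R\<^esub> u s)\<rparr>"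

definition free_gen :: "'a ring \<Rightarrow> 's \<Rightarrow> 's \<Rightarrow> 'a"
  where "free_gen R s = (\<lambda>t. if t = s then \<one>\<^bsub>R\<^esub> else \<zero>\<^bsub>R\<^esub>)"

text \<open>The linear map from the free module on a subset of \<open>M\<close> to \<open>M\<close> extending the inclusion.\<close>

definition free_eval :: "'a ring \<Rightarrow> ('a, 'b) module \<Rightarrow> ('b \<Rightarrow> 'a) \<Rightarrow> 'b"
  where "free_eval R M u = finsum M (\<lambda>x. u x \<odot>\<^bsub>M\<^esub> x) {x. u x \<noteq> \<zero>\<^bsub>R\<^esub>}"

definition tensor_rel :: "'a ring \<Rightarrow> ('a, 'b) module \<Rightarrow> ('a, 'c) module \<Rightarrow> ('b \<times> 'c \<Rightarrow> 'a) set"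
  where "tensor_rel R M B =
    (let F = free_mod R (carrier M \<times> carrier B); \<delta> = (\<lambda>x y. free_gen R (x, y)) in
     gen_submod R F
      ({\<delta> (x \<oplus>\<^bsub>M\<^esub> x') y \<ominus>\<^bsub>F\<^esub> (\<delta> x y \<oplus>\<^bsub>F\<^esub> \<delta> x' y) |x x' y.
          x \<in> carrier M \<and> x' \<in> carrier M \<and> y \<in> carrier B} \<union>
       {\<delta> x (y \<oplus>\<^bsub>B\<^esub> y') \<ominus>\<^bsub>F\<^esub> (\<delta> x y \<oplus>\<^bsub>F\<^esub> \<delta> x y') |x y y'.
          x \<in> carrier M \<and> y \<in> carrier B \<and> y' \<in> carrier B} \<union>
       {\<delta> (a \<odot>\<^bsub>M\<^esub> x) y \<ominus>\<^bsub>F\<^esub> (a \<odot>\<^bsub>F\<^esub> \<delta> x y) |a x y.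
          a \<in> carrier R \<and> x \<in> carrier M \<and> y \<in> carrier B} \<union>
       {\<delta> x (a \<odot>\<^bsub>B\<^esub> y) \<ominus>\<^bsub>F\<^esub> (a \<odot>\<^bsub>F\<^esub> \<delta> x y) |a x y.
          a \<in> carrier R \<and> x \<in> carrier M \<and> y \<in> carrier B}))"

definition tensor_mod ::
    "'a ring \<Rightarrow> ('a, 'b) module \<Rightarrow> ('a, 'c) module \<Rightarrow> ('a, ('b \<times> 'c \<Rightarrow> 'a) set) module"
  where "tensor_mod R M B =
    quot_mod (free_mod R (carrier M \<times> carrier B)) (tensor_rel R M B)"

text \<open>The map \<open>h \<otimes> B\<close> into \<open>M' \<otimes> B\<close>: a formal combination of pairs \<open>(x, y)\<close> is sent to the
  class of the combination with the same coefficients of the pairs \<open>(h x, y)\<close>.\<close>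

definition tensor_map ::
    "'a ring \<Rightarrow> ('a, 'd) module \<Rightarrow> ('a, 'c) module \<Rightarrow> ('b \<Rightarrow> 'd) \<Rightarrow>
     ('b \<times> 'c \<Rightarrow> 'a) set \<Rightarrow> ('d \<times> 'c \<Rightarrow> 'a) set"
  where "tensor_map R M' B h X =
    (\<Union>u\<in>X. tensor_rel R M' B +>\<^bsub>free_mod R (carrier M' \<times> carrier B)\<^esub>
       (\<lambda>(x', y). finsum R (\<lambda>x. u (x, y)) {x. u (x, y) \<noteq> \<zero>\<^bsub>R\<^esub> \<and> h x = x'}))"

text \<open>\<open>Tor\<^sub>1(M, B)\<close> is the homology at \<open>F\<^sub>1 \<otimes> B\<close> of \<open>F\<^sub>2 \<otimes> B \<rightarrow> F\<^sub>1 \<otimes> B \<rightarrow> F\<^sub>0 \<otimes> B\<close>, where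
  \<open>F\<^sub>2 \<rightarrow> F\<^sub>1 \<rightarrow> F\<^sub>0 \<rightarrow> M \<rightarrow> 0\<close> is the beginning of the canonical free resolution of \<open>M\<close>, in
  which each \<open>F\<^sub>i\<close> is free on the set it has to cover.\<close>

definition tor1 ::
    "'a ring \<Rightarrow> ('a, 'b) module \<Rightarrow> ('a, 'c) module \<Rightarrow>
     ('a, ((('b \<Rightarrow> 'a) \<Rightarrow> 'a) \<times> 'c \<Rightarrow> 'a) set set) module"
  where "tor1 R M B =
    (let F0 = free_mod R (carrier M);
         F1 = free_mod R (a_kernel F0 M (free_eval R M));
         F2 = free_mod R (a_kernel F1 F0 (free_eval R F0));
         d1 = tensor_map R F0 B (free_eval R F0);
         d2 = tensor_map R F1 B (free_eval R F1);
         Z1 = a_kernel (tensor_mod R F1 B) (tensor_mod R F0 B) d1;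
         B1 = d2 ` carrier (tensor_mod R F2 B)
     in quot_mod ((tensor_mod R F1 B)\<lparr>carrier := Z1\<rparr>) B1)"


section \<open>T-split sequences\<close>

definition eT :: "'a ring \<Rightarrow> 'a set \<Rightarrow> ('a, 'b) module \<Rightarrow> real"
  where "eT R \<mm> M = (let d = the_enat (krull_dim R) in
    lim (\<lambda>n. fact (d - 1) / real n ^ (d - 1) *
      real (the_enat (mod_length R
        (tor1 R M (quot_mod (self_mod R) (ideal_power R \<mm> (n + 1))))))))"

definition eT_seq ::
    "'a ring \<Rightarrow> 'a set \<Rightarrow> ('a, 'b) module \<Rightarrow> ('a, 'c) module \<Rightarrow> ('a, 'd) module \<Rightarrow> real"
  where "eT_seq R \<mm> N E M = eT R \<mm> M + eT R \<mm> N - eT R \<mm> E"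

definition T_split ::
    "'a ring \<Rightarrow> 'a set \<Rightarrow> ('a, 'b) module \<Rightarrow> ('a, 'c) module \<Rightarrow> ('a, 'd) module \<Rightarrow> bool"
  where "T_split R \<mm> N E M \<longleftrightarrow> eT_seq R \<mm> N E M = 0"

end

theory Submission
 imports Defs
begin

text \<open>The kernel of \<open>G(N) \<rightarrow> G(E)\<close> has the graded pieces \<open>(\<mm>\<^sup>iN \<inter> f\<^sup>-\<^sup>1(\<mm>\<^sup>i\<^sup>+\<^sup>1E)) / \<mm>\<^sup>i\<^sup>+\<^sup>1N\<close>. The proof
shows that these pieces are too small for a nonzero submodule of a Cohen-Macaulay module.

\<^emph>\<open>The pieces are small.\<close> If \<open>0 \<rightarrow> K \<rightarrow> F \<rightarrow> X \<rightarrow> 0\<close> is exact and \<open>F\<close> is free, then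
\<open>Tor\<^sub>1(X, A/I) = (K \<inter> IF) / IK\<close> (\<open>tor1_length\<close>). Comparing the syzygies of \<open>N\<close>, \<open>E\<close> and \<open>M\<close> inside
one free cover of \<open>E\<close> gives
\<open>\<ell>(Tor\<^sub>1(E, A/I)) + \<ell>(f\<^sup>-\<^sup>1(IE) / IN) \<le> \<ell>(Tor\<^sub>1(N, A/I)) + \<ell>(Tor\<^sub>1(M, A/I))\<close>
(\<open>torl_short_exact\<close>). For \<open>I = \<mm>\<^sup>n\<^sup>+\<^sup>1\<close> the three Tor lengths, divided by \<open>n\<^sup>d\<^sup>-\<^sup>1\<close>, converge
(\<open>tor_growth_converges\<close>, by Hilbert-Samuel), and \<open>T\<close>-splitness says that the limits cancel. Hence
\<open>\<ell>(f\<^sup>-\<^sup>1(\<mm>\<^sup>n\<^sup>+\<^sup>1E) / \<mm>\<^sup>n\<^sup>+\<^sup>1N) = o(n\<^sup>d\<^sup>-\<^sup>1)\<close> (\<open>T_split_gap\<close>), and summation shows that the kernel has colength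
\<open>o(n\<^sup>d)\<close> in its filtration by degree (\<open>kernel_growth\<close>).

\<^emph>\<open>A nonzero submodule is large.\<close> If a module has depth at least \<open>r\<close> with respect to \<open>I\<close>, then a cyclic
submodule \<open>Rz\<close> with \<open>z \<notin> I\<^sup>qM\<close> for some \<open>q\<close> is not of growth \<open>o(n\<^sup>r)\<close> in the \<open>I\<close>-adic filtration
(\<open>unmixed_growth\<close>). If \<open>G(N)\<close> is Cohen-Macaulay and not zero, its depth is its dimension, which is at
least \<open>d\<close>. So the kernel is zero.

\<^emph>\<open>Exactness.\<close> Injectivity of \<open>G(N) \<rightarrow> G(E)\<close> means \<open>f\<^sup>-\<^sup>1(\<mm>\<^sup>nE) = \<mm>\<^sup>nN\<close> for all \<open>n\<close>, and this strictness
makes the whole graded sequence exact (\<open>gr_short_exact\<close>). If \<open>G(M)\<close> is Cohen-Macaulay as well, the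
depth of the extension \<open>G(E)\<close> is at least \<open>d\<close> (\<open>depth_extension\<close>) and its dimension at most \<open>d\<close>
(\<open>mod_dim_extension_le\<close>).

Dimension enters only through growth. Let \<open>small r p\<close> mean \<open>p(n) / n\<^sup>r \<rightarrow> 0\<close>. An ideal whose
colength function is not small of order \<open>r\<close> lies below a chain of primes of length \<open>r\<close>
(\<open>prime_chain_of_growth\<close>), and the depth of a module bounds its growth from below
(\<open>unmixed_growth\<close>). These two facts replace the theory of systems of parameters, both over \<open>A\<close>
and over \<open>G(A)\<close>. They transfer because \<open>G(X)\<close> is Noetherian (\<open>acc_W\<close>), because the powers of the
irrelevant ideal cut out the vectors of order at least \<open>n\<close> (\<open>ipow_ge\<close>), and because the length
functions of \<open>X\<close> and \<open>G(X)\<close> agree (\<open>len_ge\<close>).\<close>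

section \<open>Length of intervals of submodules\<close>

text \<open>The length of the interval \<open>[V, U]\<close> in a family \<open>L\<close> of sets, possibly infinite. Working with intervals avoids forming quotient modules.\<close>

definition ilen :: "'b set set => 'b set => 'b set => enat"
 where "ilen L V U = Sup {enat n |n. \<exists>H :: nat => 'b set.
  (\<forall>i\<le>n. H i \<in> L \<and> V \<subseteq> H i \<and> H i \<subseteq> U) \<and> (\<forall>i<n. H i \<subset> H (Suc i))}"

definition ichain :: "'b set set => 'b set => 'b set => nat => bool"
 where "ichain L V U n \<longleftrightarrow> (\<exists>H :: nat => 'b set.
  (\<forall>i\<le>n. H i \<in> L \<and> V \<subseteq> H i \<and> H i \<subseteq> U) \<and> (\<forall>i<n. H i \<subset> H (Suc i)))"

lemma ichain_mono: "ichain L V U n ==> m \<le> n ==> ichain L V U m"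
 unfolding ichain_def by (erule exE, rename_tac H, rule_tac x=H in exI) (auto dest: less_le_trans)

lemma enat_Sup_ge_iff:
 assumes down: "\<And>m n. P n ==> m \<le> n ==> P m" and "P 0"
 shows "enat n \<le> Sup {enat k |k. P k} \<longleftrightarrow> P n"
proof
 assume "P n" then show "enat n \<le> Sup {enat k |k. P k}" by (auto intro: Sup_upper)
next
 assume le: "enat n \<le> Sup {enat k |k. P k}"
 show "P n"
 proof (rule ccontr)
  assume "\<not> P n"
  hence "\<And>k. P k ==> k < n" using down not_less by blast
  moreover from this have "n > 0" using assms(2) by fastforce
  ultimately have "Sup {enat k |k. P k} \<le> enat (n - 1)"
   by (intro Sup_least) fastforce
  with le have "enat n \<le> enat (n - 1)" by (rule order_trans)
  with \<open>n > 0\<close> show False by simp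
 qed
qed

lemma enat_le_ilen_iff:
 assumes "V \<in> L" "V \<subseteq> U"
 shows "enat n \<le> ilen L V U \<longleftrightarrow> ichain L V U n"
proof -
 have "ichain L V U 0" unfolding ichain_def by (rule exI[of _ "\<lambda>_. V"]) (use assms in auto)
 with enat_Sup_ge_iff[of "ichain L V U" n] ichain_mono show ?thesis
  unfolding ilen_def ichain_def[symmetric] by blast
qed

lemma enat_leI:
 assumes "\<And>n. enat n \<le> x ==> enat n \<le> y" shows "x \<le> (y::enat)"
proof (cases x)
 case infinity
 show ?thesis
 proof (cases y)
  case (enat k) with assms[of "Suc k"] infinity show ?thesis by simp
 qed simp
qed (use assms in blast)


text \<open>Comparison of lengths along a strictly monotone map of intervals; every comparison of lengths below is an instance.\<close>

lemma ilen_map_le: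
 assumes "\<And>H. H \<in> L ==> V \<subseteq> H ==> H \<subseteq> U ==> \<phi> H \<in> L' \<and> V' \<subseteq> \<phi> H \<and> \<phi> H \<subseteq> U'"
  and "\<And>H K. H \<in> L ==> K \<in> L ==> V \<subseteq> H ==> H \<subset> K ==> K \<subseteq> U ==> \<phi> H \<subset> \<phi> K"
 shows "ilen L V U \<le> ilen L' V' U'"
 unfolding ilen_def
proof (rule Sup_subset_mono, safe)
 fix n and H :: "nat => _"
 assume H: "\<forall>i\<le>n. H i \<in> L \<and> V \<subseteq> H i \<and> H i \<subseteq> U" "\<forall>i<n. H i \<subset> H (Suc i)"
 show "\<exists>m. enat n = enat m \<and> (\<exists>H. (\<forall>i\<le>m. H i \<in> L' \<and> V' \<subseteq> H i \<and> H i \<subseteq> U') \<and> (\<forall>i<m. H i \<subset> H (Suc i)))"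
  by (rule exI[of _ n], rule conjI[OF refl], rule exI[of _ "\<lambda>i. \<phi> (H i)"])
   (use H assms in \<open>auto simp: Suc_le_eq intro!: assms(2)\<close>)
qed

lemma ichain_extend:
 assumes "ichain L V U a" "U \<subset> U'" "U' \<in> L" shows "ichain L V U' (Suc a)"
proof -
 from assms(1) obtain H where H: "\<forall>i\<le>a. H i \<in> L \<and> V \<subseteq> H i \<and> H i \<subseteq> U" "\<forall>i<a. H i \<subset> H (Suc i)"
  unfolding ichain_def by blast
 have *: "H a \<subseteq> U" "V \<subseteq> U" "\<forall>i\<le>a. H i \<subseteq> U'" using H(1) assms(2) by auto
 show ?thesis unfolding ichain_def
  by (rule exI[of _ "\<lambda>i. if i \<le> a then H i else U'"])
   (use H assms(2,3) * in \<open>auto simp: le_Suc_eq less_Suc_eq\<close>)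
qed

lemma ichain_top_mono: "ichain L V U a ==> U \<subseteq> U' ==> ichain L V U' a"
 unfolding ichain_def by (erule exE, rename_tac H, rule_tac x=H in exI) auto

lemma ichain_concat:
 assumes "ichain L V U a" "ichain L U T b" shows "ichain L V T (a + b)"
proof -
 from assms(2) obtain K where K: "\<forall>i\<le>b. K i \<in> L \<and> U \<subseteq> K i \<and> K i \<subseteq> T" "\<forall>i<b. K i \<subset> K (Suc i)"
  unfolding ichain_def by blast
 have "i \<le> b ==> ichain L V (K i) (a + i)" for i
 proof (induction i)
  case 0 then show ?case using K(1) assms(1) ichain_top_mono[of L V U a] by simp
 next
  case (Suc i) then show ?case using K ichain_extend[of L V "K i" "a + i"] by simp
 qed
 from this[of b] K(1) show ?thesis using ichain_top_mono by blast
qed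


section \<open>Submodules, products with ideals and homomorphisms\<close>

locale rmod = module R M for R :: "'a ring" (structure) and M :: "('a, 'b) module" (structure)
begin

text \<open>Two structures are in scope, and the circled operations without index refer to the ring. The dotted ones refer to the module.\<close>

abbreviation module_scale (infixl "*." 70) where "a *. x \<equiv> a \<odot>\<^bsub>M\<^esub> x"
abbreviation module_plus (infixl "+." 65) where "x +. y \<equiv> x \<oplus>\<^bsub>M\<^esub> y"
abbreviation module_minus (infixl "-." 65) where "x -. y \<equiv> x \<ominus>\<^bsub>M\<^esub> y"

abbreviation sm :: "'b set => bool" where "sm H \<equiv> submodule H R M"

lemma smI:
 assumes "H \<subseteq> carrier M" "\<zero>\<^bsub>M\<^esub> \<in> H" "\<And>x y. x \<in> H ==> y \<in> H ==> x +. y \<in> H"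
  "\<And>a x. a \<in> carrier R ==> x \<in> H ==> a *. x \<in> H"
 shows "sm H"
proof (rule submoduleI)
 fix x assume x: "x \<in> H"
 have "\<ominus>\<^bsub>M\<^esub> x = (\<ominus> \<one>) *. x" using x assms(1) by (simp add: smult_l_minus subsetD)
 then show "\<ominus>\<^bsub>M\<^esub> x \<in> H" using assms(4)[of "\<ominus> \<one>" x] x by simp
qed (use assms in auto)

lemma sm_subset: "sm H ==> H \<subseteq> carrier M" by (rule submoduleE(1))
lemma sm_carr: "sm H ==> x \<in> H ==> x \<in> carrier M" using sm_subset by blast
lemma sm_add: "sm H ==> x \<in> H ==> y \<in> H ==> x +. y \<in> H" by (rule submoduleE(5))
lemma sm_neg: "sm H ==> x \<in> H ==> \<ominus>\<^bsub>M\<^esub> x \<in> H" by (rule submoduleE(3))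
lemma sm_smult: "sm H ==> a \<in> carrier R ==> x \<in> H ==> a *. x \<in> H" by (rule submoduleE(4))
lemma sm_zero: "sm H ==> \<zero>\<^bsub>M\<^esub> \<in> H"
 using submoduleE(2) sm_smult[of H \<zero>] sm_carr by (metis R.zero_closed equals0I smult_l_null)
lemma sm_sub: "sm H ==> x \<in> H ==> y \<in> H ==> x -. y \<in> H"
 unfolding M.minus_eq by (intro sm_add sm_neg)

lemma sub_add_cancel: "x \<in> carrier M ==> y \<in> carrier M ==> (x -. y) +. y = x"
 by (simp add: M.minus_eq M.a_assoc M.l_neg)
lemma add_sub_cancel: "x \<in> carrier M ==> y \<in> carrier M ==> (x +. y) -. y = x"
 by (simp add: M.minus_eq M.a_assoc M.r_neg)
lemma add_sub_cancel_l: "x \<in> carrier M ==> y \<in> carrier M ==> (x +. y) -. x = y"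
 using add_sub_cancel[of y x] by (simp add: M.a_comm)

lemma sm_sub_mem: \<open>sm H ==> y \<in> H ==> x \<in> carrier M ==> x -. y \<in> H ==> x \<in> H\<close>
 using sm_add[of H "x -. y" y] sub_add_cancel[of x y] sm_carr[of H y] by simp
lemma sm_add_mem: \<open>sm H ==> y \<in> H ==> x \<in> carrier M ==> x +. y \<in> H ==> x \<in> H\<close>
 using sm_sub[of H "x +. y" y] add_sub_cancel[of x y] sm_carr[of H y] by simp

lemma smult_sub: "a \<in> carrier R ==> x \<in> carrier M ==> y \<in> carrier M ==>
  a *. (x -. y) = a *. x -. a *. y"
 by (simp add: M.minus_eq smult_r_distr smult_r_minus)
lemma sub_smult: "a \<in> carrier R ==> b \<in> carrier R ==> x \<in> carrier M ==>
  (a \<ominus> b) *. x = a *. x -. b *. x"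
 by (simp add: M.minus_eq R.minus_eq smult_l_distr smult_l_minus)
lemma smult_commute: "a \<in> carrier R ==> b \<in> carrier R ==> x \<in> carrier M ==>
  a *. (b *. x) = b *. (a *. x)"
 by (metis R.m_comm smult_assoc1)
lemma minus_closed_M: "x \<in> carrier M ==> y \<in> carrier M ==> x -. y \<in> carrier M"
 by simp
lemma add_add_swap: "[|a \<in> carrier M; b \<in> carrier M; c \<in> carrier M; d \<in> carrier M|] ==>
  (a +. b) +. (c +. d) = (a +. c) +. (b +. d)"
 by (simp add: M.a_ac)

lemma sm_carrier: "sm (carrier M)" by (rule carrier_is_submodule)
lemma sm_null: "sm {\<zero>\<^bsub>M\<^esub>}" by (rule smI) auto
lemma sm_Int: "sm H ==> sm K ==> sm (H \<inter> K)"
 by (rule smI) (auto intro: sm_add sm_smult sm_zero dest: sm_carr)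
lemma sm_UN_chain:
 assumes "\<And>i::nat. sm (H i)" "\<And>i. H i \<subseteq> H (Suc i)" shows "sm (\<Union>i. H i)"
proof (rule smI)
 have mono: "i \<le> j ==> H i \<subseteq> H j" for i j using lift_Suc_mono_le[of H i j] assms(2) by blast
 fix x y assume "x \<in> (\<Union>i. H i)" "y \<in> (\<Union>i. H i)"
 then obtain i j where "x \<in> H i" "y \<in> H j" by blast
 hence "x \<in> H (max i j)" "y \<in> H (max i j)" using mono[of i "max i j"] mono[of j "max i j"] by auto
 then show "x +. y \<in> (\<Union>i. H i)" using sm_add assms(1) by blast
next
 show "(\<Union>i. H i) \<subseteq> carrier M" using sm_subset[OF assms(1)] by blast
 show "\<zero>\<^bsub>M\<^esub> \<in> (\<Union>i. H i)" using sm_zero[OF assms(1)] by blast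
 show "a *. x \<in> (\<Union>i. H i)" if "a \<in> carrier R" "x \<in> (\<Union>i. H i)" for a x
  using that sm_smult[OF assms(1)] by blast
qed

definition psum :: "'b set => 'b set => 'b set" (infixl \<open>[+]\<close> 65)
 where "H [+] K = {h +. k |h k. h \<in> H \<and> k \<in> K}"

lemma psumI: "h \<in> H ==> k \<in> K ==> h +. k \<in> H [+] K" unfolding psum_def by blast
lemma psumE: "x \<in> H [+] K ==> (\<And>h k. h \<in> H ==> k \<in> K ==> x = h +. k ==> P) ==> P"
 unfolding psum_def by blast
lemma psum_mono: "H \<subseteq> H' ==> K \<subseteq> K' ==> H [+] K \<subseteq> H' [+] K'" unfolding psum_def by blast

lemma sm_psum: assumes "sm H" "sm K" shows "sm (H [+] K)"
proof (rule smI)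
 show "H [+] K \<subseteq> carrier M" using assms by (auto elim!: psumE intro: sm_carr)
 show "\<zero>\<^bsub>M\<^esub> \<in> H [+] K" using psumI[OF sm_zero[OF assms(1)] sm_zero[OF assms(2)]] by simp
next
 fix x y assume "x \<in> H [+] K" "y \<in> H [+] K"
 then obtain h k h' k' where *: "h \<in> H" "k \<in> K" "h' \<in> H" "k' \<in> K" "x = h +. k" "y = h' +. k'"
  by (meson psumE)
 moreover have "x +. y = (h +. h') +. (k +. k')"
  using * add_add_swap[of h k h' k'] sm_carr[OF assms(1)] sm_carr[OF assms(2)] by simp
 ultimately show "x +. y \<in> H [+] K" by (auto intro!: psumI sm_add assms)
next
 fix a x assume a: "a \<in> carrier R" "x \<in> H [+] K"
 then obtain h k where *: "h \<in> H" "k \<in> K" "x = h +. k" by (meson psumE)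
 moreover have "a *. x = a *. h +. a *. k"
  using * a smult_r_distr sm_carr[OF assms(1)] sm_carr[OF assms(2)] by simp
 ultimately show "a *. x \<in> H [+] K" using a(1) by (auto intro!: psumI sm_smult assms)
qed

lemma psum_upper1: "H \<subseteq> carrier M ==> sm K ==> H \<subseteq> H [+] K"
 using psumI[OF _ sm_zero[of K]] by (metis M.r_zero subset_iff)
lemma psum_upper2: "sm H ==> K \<subseteq> carrier M ==> K \<subseteq> H [+] K"
 using psumI[OF sm_zero[of H]] by (metis M.l_zero subset_iff)
lemma psum_least: "sm T ==> H \<subseteq> T ==> K \<subseteq> T ==> H [+] K \<subseteq> T"
 by (auto elim!: psumE intro: sm_add)
lemma psum_comm: "H \<subseteq> carrier M ==> K \<subseteq> carrier M ==> H [+] K = K [+] H"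
 unfolding psum_def by safe (metis M.a_comm subsetD)+
lemma psum_assoc: assumes "H \<subseteq> carrier M" "K \<subseteq> carrier M" "T \<subseteq> carrier M"
 shows "(H [+] K) [+] T = H [+] (K [+] T)"
proof -
 have "(h +. k) +. t = h +. (k +. t)" if "h \<in> H" "k \<in> K" "t \<in> T" for h k t
  using that assms M.a_assoc by blast
 note eq = this
 show ?thesis
 proof (intro equalityI subsetI)
  fix x assume "x \<in> (H [+] K) [+] T"
  then obtain h k t where *: "h \<in> H" "k \<in> K" "t \<in> T" "x = (h +. k) +. t" by (auto elim!: psumE)
  then show "x \<in> H [+] (K [+] T)" by (simp add: eq psumI)
 next
  fix x assume "x \<in> H [+] (K [+] T)"
  then obtain h k t where *: "h \<in> H" "k \<in> K" "t \<in> T" "x = h +. (k +. t)" by (auto elim!: psumE)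
  then show "x \<in> (H [+] K) [+] T" by (simp add: eq[symmetric] psumI)
 qed
qed
lemma psum_absorb: "sm H ==> sm K ==> K \<subseteq> H ==> H [+] K = H"
 by (simp add: psum_least psum_upper1 sm_subset subset_antisym)

lemma psum_modular:
 assumes "sm H" "sm K" "sm T" "H \<subseteq> T" shows "(H [+] K) \<inter> T \<subseteq> H [+] (K \<inter> T)"
proof
 fix x assume x: "x \<in> (H [+] K) \<inter> T"
 then obtain h k where *: "h \<in> H" "k \<in> K" "x = h +. k" by (blast elim: psumE)
 have "k = x -. h" using * add_sub_cancel_l sm_carr assms by simp
 hence "k \<in> T" using x *(1) assms sm_sub by blast
 with * show "x \<in> H [+] (K \<inter> T)" by (auto intro: psumI)
qed

lemma modular_eqI:
 assumes "sm H" "sm K" "sm U" "H \<subseteq> K" "K \<inter> U \<subseteq> H" "K \<subseteq> H [+] U" shows "H = K"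
proof -
 have "K \<subseteq> H [+] (U \<inter> K)" using psum_modular[of H U K] assms by blast
 also have "\<dots> \<subseteq> H" by (rule psum_least) (use assms in auto)
 finally show ?thesis using assms(4) by blast
qed

definition len :: "'b set => 'b set => enat" where "len V U = ilen {H. sm H} V U"

lemma enat_le_len_iff: "sm V ==> V \<subseteq> U ==> enat n \<le> len V U \<longleftrightarrow> ichain {H. sm H} V U n"
 unfolding len_def by (rule enat_le_ilen_iff) auto

text \<open>A chain in \<open>[V, T]\<close> is traced in \<open>[V, U]\<close> by intersecting with \<open>U\<close> and in \<open>[U, T + U]\<close> by adding \<open>U\<close>. By the modular law no step is lost in both.\<close>

lemma ichain_split:
 assumes "ichain {H. sm H} V T n" "sm V" "sm U" "V \<subseteq> U"
 shows "\<exists>a b. a + b = n \<and> ichain {H. sm H} V U a \<and> ichain {H. sm H} U (T [+] U) b"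
proof -
 from assms(1) obtain H where H: "\<forall>i\<le>n. sm (H i) \<and> V \<subseteq> H i \<and> H i \<subseteq> T" "\<forall>i<n. H i \<subset> H (Suc i)"
  unfolding ichain_def by auto
 have "i \<le> n ==> \<exists>a b. a + b = i \<and> ichain {H. sm H} V (H i \<inter> U) a \<and> ichain {H. sm H} U (H i [+] U) b" for i
 proof (induction i)
  case 0
  have "sm (H 0)" "V \<subseteq> H 0" using H(1) by auto
  then have "ichain {H. sm H} V (H 0 \<inter> U) 0"
   unfolding ichain_def using assms(2-4) by (intro exI[of _ "\<lambda>_. V"]) auto
  moreover have "ichain {H. sm H} U (H 0 [+] U) 0"
   unfolding ichain_def using assms(2-4) psum_upper2[of "H 0" U] sm_subset[of U] \<open>sm (H 0)\<close>
   by (intro exI[of _ "\<lambda>_. U"]) auto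
  ultimately show ?case by auto
 next
  case (Suc i)
  then obtain a b where ab: "a + b = i" "ichain {H. sm H} V (H i \<inter> U) a" "ichain {H. sm H} U (H i [+] U) b"
   by auto
  have sm: "sm (H i)" "sm (H (Suc i))" and lt: "H i \<subset> H (Suc i)" using H Suc.prems by auto
  have le: "H i \<inter> U \<subseteq> H (Suc i) \<inter> U" "H i [+] U \<subseteq> H (Suc i) [+] U"
   using lt psum_mono[of "H i" "H (Suc i)" U U] by auto
  show ?case
  proof (cases "H i \<inter> U \<subset> H (Suc i) \<inter> U")
   case True
   with ab sm have "ichain {H. sm H} V (H (Suc i) \<inter> U) (Suc a)"
    by (intro ichain_extend[OF ab(2)]) (auto intro: sm_Int assms)
   moreover have "ichain {H. sm H} U (H (Suc i) [+] U) b" using ichain_top_mono[OF ab(3) le(2)] .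
   ultimately show ?thesis using ab(1) by (intro exI[of _ "Suc a"] exI[of _ b]) auto
  next
   case False
   have "H i [+] U \<noteq> H (Suc i) [+] U"
   proof
    assume "H i [+] U = H (Suc i) [+] U"
    with False le have "H i = H (Suc i)"
     using psum_upper1[OF sm_subset[OF sm(2)] assms(3)] lt
     by (intro modular_eqI[OF sm assms(3)]) auto
    with lt show False by blast
   qed
   with le(2) have "ichain {H. sm H} U (H (Suc i) [+] U) (Suc b)"
    by (intro ichain_extend[OF ab(3)]) (auto intro: sm_psum sm assms)
   moreover have "ichain {H. sm H} V (H (Suc i) \<inter> U) a" using ichain_top_mono[OF ab(2) le(1)] .
   ultimately show ?thesis using ab(1) by (intro exI[of _ a] exI[of _ "Suc b"]) auto
  qed
 qed
 from this[of n] obtain a b where "a + b = n" "ichain {H. sm H} V (H n \<inter> U) a" "ichain {H. sm H} U (H n [+] U) b"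
  by auto
 moreover have "H n [+] U \<subseteq> T [+] U" using H(1) by (intro psum_mono) auto
 moreover have "H n \<inter> U \<subseteq> U" by blast
 ultimately show ?thesis using ichain_top_mono by blast
qed

theorem len_add:
 assumes "sm V" "sm U" "sm T" "V \<subseteq> U" "U \<subseteq> T"
 shows "len V T = len V U + len U T"
proof (rule antisym; rule enat_leI)
 fix n assume "enat n \<le> len V T"
 hence "ichain {H. sm H} V T n" using enat_le_len_iff assms by (meson order_trans)
 then obtain a b where ab: "a + b = n" "ichain {H. sm H} V U a" "ichain {H. sm H} U (T [+] U) b"
  using ichain_split assms by blast
 moreover have "T [+] U = T" using assms by (simp add: psum_absorb)
 ultimately have "enat a \<le> len V U" "enat b \<le> len U T" using enat_le_len_iff assms by auto
 then show "enat n \<le> len V U + len U T" using ab(1) add_mono by (metis plus_enat_simps(1))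
next
 fix n assume n: "enat n \<le> len V U + len U T"
 have "\<exists>a b. a + b = n \<and> enat a \<le> len V U \<and> enat b \<le> len U T"
 proof (cases "enat n \<le> len V U")
  case True then show ?thesis by (intro exI[of _ n] exI[of _ 0]) (simp add: zero_enat_def[symmetric])
 next
  case False
  then obtain a where a: "len V U = enat a" "a < n" by (cases "len V U") auto
  with n have "enat (n - a) \<le> len U T" by (cases "len U T") auto
  with a show ?thesis by (intro exI[of _ a] exI[of _ "n - a"]) auto
 qed
 then obtain a b where "a + b = n" "enat a \<le> len V U" "enat b \<le> len U T" by blast
 then have "ichain {H. sm H} V T n"
  using enat_le_len_iff assms ichain_concat[of _ V U a T b] by auto
 then show "enat n \<le> len V T" using enat_le_len_iff assms by (meson order_trans)
qed

lemma len_refl: "len V V = 0"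
proof -
 have "n = 0" if "\<forall>i\<le>n. sm (H i) \<and> V \<subseteq> H i \<and> H i \<subseteq> V" "\<forall>i<n. H i \<subset> H (Suc i)" for n and H :: "nat => 'b set"
 proof (rule ccontr)
  assume "n \<noteq> 0"
  hence "H 0 \<subset> H 1" "V \<subseteq> H 0" "H 1 \<subseteq> V" using that[rule_format, of 0] that(1)[rule_format, of 1] by auto
  then show False by blast
 qed
 then have "{enat n |n. \<exists>H. (\<forall>i\<le>n. H i \<in> {H. sm H} \<and> V \<subseteq> H i \<and> H i \<subseteq> V) \<and> (\<forall>i<n. H i \<subset> H (Suc i))} \<subseteq> {0}"
  by (auto simp: zero_enat_def)
 then show ?thesis unfolding len_def ilen_def 
  using Sup_subset_mono[of _ "{0::enat}"] by fastforce
qed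

lemma len_mono_top: "U \<subseteq> U' ==> len V U \<le> len V U'"
 unfolding len_def by (rule ilen_map_le[where \<phi> = "\<lambda>H. H"]) auto
lemma len_mono_bot: "V' \<subseteq> V ==> len V U \<le> len V' U"
 unfolding len_def by (rule ilen_map_le[where \<phi> = "\<lambda>H. H"]) auto

lemma len_eq_0_imp: assumes "len V U = 0" "sm V" "sm U" "V \<subseteq> U" shows "V = U"
proof (rule ccontr)
 assume "V \<noteq> U"
 with assms have "ichain {H. sm H} V U 1"
  unfolding ichain_def by (intro exI[of _ "\<lambda>i. if i = 0 then V else U"]) auto
 with enat_le_len_iff[of V U 1] assms show False by (simp add: zero_enat_def)
qed

lemma len_le_1:
 assumes "\<And>H. sm H ==> V \<subseteq> H ==> H \<subseteq> U ==> H = V \<or> H = U"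
 shows "len V U \<le> 1"
 unfolding len_def ilen_def
proof (rule Sup_least, safe)
 fix n and H :: "nat => _"
 assume H: "\<forall>i\<le>n. H i \<in> Collect sm \<and> V \<subseteq> H i \<and> H i \<subseteq> U" "\<forall>i<n. H i \<subset> H (Suc i)"
 show "enat n \<le> 1"
 proof (rule ccontr)
  assume "\<not> enat n \<le> 1"
  hence n: "n \<ge> 2" by (simp add: one_enat_def)
  hence "H 0 \<subset> H 1" "H 1 \<subset> H 2" using H(2)[rule_format, of 0] H(2)[rule_format, of 1]
   by (auto simp: numeral_2_eq_2)
  moreover have "H i = V \<or> H i = U" if "i \<le> 2" for i using assms[of "H i"] H(1) that n by auto
  ultimately show False by (metis (no_types, lifting) one_le_numeral order.refl psubsetE zero_le)
 qed
qed

lemma sm_gen: assumes "S \<subseteq> carrier M" shows "sm (gen_submod R M S)"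
proof (rule smI)
 show "gen_submod R M S \<subseteq> carrier M" unfolding gen_submod_def using assms sm_carrier by blast
qed (auto simp: gen_submod_def intro: sm_add sm_smult sm_zero)
lemma gen_incl: "S \<subseteq> gen_submod R M S" unfolding gen_submod_def by blast
lemma gen_least: "sm H ==> S \<subseteq> H ==> gen_submod R M S \<subseteq> H" unfolding gen_submod_def by blast

text \<open>The submodule \<open>I H\<close>, and below \<open>I\<^sup>n H\<close> by iteration, without powers of ideals.\<close>

definition ip :: "'a set => 'b set => 'b set"
 where "ip I H = gen_submod R M {a *. x |a x. a \<in> I \<and> x \<in> H}"

lemma sm_ip: "I \<subseteq> carrier R ==> H \<subseteq> carrier M ==> sm (ip I H)"
 unfolding ip_def by (rule sm_gen) auto
lemma sm_ip': "I \<subseteq> carrier R ==> sm H ==> sm (ip I H)"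
 using sm_ip sm_subset by blast
lemma ipI: "a \<in> I ==> x \<in> H ==> a *. x \<in> ip I H"
 unfolding ip_def using gen_incl by fast
lemma ip_least: "sm K ==> (\<And>a x. a \<in> I ==> x \<in> H ==> a *. x \<in> K) ==> ip I H \<subseteq> K"
 unfolding ip_def by (rule gen_least) auto
lemma ip_mono: "I \<subseteq> carrier R ==> H' \<subseteq> carrier M ==> I' \<subseteq> I ==> H \<subseteq> H' ==> ip I' H \<subseteq> ip I H'"
 by (rule ip_least) (auto intro: ipI sm_ip)
lemma ip_subset: "I \<subseteq> carrier R ==> sm H ==> ip I H \<subseteq> H"
 by (rule ip_least) (auto intro: sm_smult)

lemma ip_psum: assumes "I \<subseteq> carrier R" "sm H" "sm K" shows "ip I (H [+] K) = ip I H [+] ip I K"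
proof
 show "ip I (H [+] K) \<subseteq> ip I H [+] ip I K"
 proof (rule ip_least)
  show "sm (ip I H [+] ip I K)" using assms by (intro sm_psum sm_ip')
  fix a x assume a: "a \<in> I" "x \<in> H [+] K"
  then obtain h k where "h \<in> H" "k \<in> K" "x = h +. k" by (meson psumE)
  moreover from this have "a *. x = a *. h +. a *. k"
   using smult_r_distr[of a h k] sm_carr[OF assms(2)] sm_carr[OF assms(3)] a(1) assms(1) by blast
  ultimately show "a *. x \<in> ip I H [+] ip I K"
   using a(1) by (auto intro!: psumI ipI)
 qed
 show "ip I H [+] ip I K \<subseteq> ip I (H [+] K)"
  using assms by (intro psum_least sm_ip' sm_psum ip_mono psum_upper1 psum_upper2 sm_subset[OF sm_psum] order.refl sm_subset)
qed

definition ipow :: "'a set => nat => 'b set => 'b set"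
 where "ipow I n H = (ip I ^^ n) H"

lemma ipow_0 [simp]: "ipow I 0 H = H" by (simp add: ipow_def)
lemma ipow_Suc: "ipow I (Suc n) H = ip I (ipow I n H)" by (simp add: ipow_def)
lemma ipow_add: "ipow I (m + n) H = ipow I m (ipow I n H)" by (simp add: ipow_def funpow_add)
lemma sm_ipow: "I \<subseteq> carrier R ==> sm H ==> sm (ipow I n H)"
 by (induction n) (auto simp: ipow_Suc intro: sm_ip')
lemma ipow_mono: "I \<subseteq> carrier R ==> sm H' ==> sm H ==> H \<subseteq> H' ==> ipow I n H \<subseteq> ipow I n H'"
 by (induction n) (simp_all add: ipow_Suc ip_mono sm_subset[OF sm_ipow])
lemma ipow_Suc_subset: "I \<subseteq> carrier R ==> sm H ==> ipow I (Suc n) H \<subseteq> ipow I n H"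
 unfolding ipow_Suc by (rule ip_subset) (auto intro: sm_ipow)
lemma ipow_antimono: "I \<subseteq> carrier R ==> sm H ==> m \<le> n ==> ipow I n H \<subseteq> ipow I m H"
 using lift_Suc_antimono_le[of "\<lambda>n. ipow I n H" m n] ipow_Suc_subset by blast
lemma ipow_subset: "I \<subseteq> carrier R ==> sm H ==> ipow I n H \<subseteq> H"
 using ipow_antimono[of I H 0 n] by simp
lemma ipow_psum: "I \<subseteq> carrier R ==> sm H ==> sm K ==> ipow I n (H [+] K) = ipow I n H [+] ipow I n K"
 by (induction n) (simp_all add: ipow_Suc ip_psum sm_ipow)

end

lemma mod_homD:
 assumes "h \<in> mod_hom R M M'"
 shows "x \<in> carrier M ==> h x \<in> carrier M'"
  and "x \<in> carrier M ==> y \<in> carrier M ==> h (x \<oplus>\<^bsub>M\<^esub> y) = h x \<oplus>\<^bsub>M'\<^esub> h y"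
  and "a \<in> carrier R ==> x \<in> carrier M ==> h (a \<odot>\<^bsub>M\<^esub> x) = a \<odot>\<^bsub>M'\<^esub> h x"
 using assms unfolding mod_hom_def by auto

locale rhom = M: rmod R M + M': rmod R M' for R :: "'a ring" (structure)
  and M :: "('a, 'b) module" (structure) and M' :: "('a, 'c) module" (structure) +
 fixes h :: "'b => 'c"
 assumes hom: "h \<in> mod_hom R M M'"
begin

lemmas h_carr [simp, intro] = mod_homD(1)[OF hom]
 and h_add = mod_homD(2)[OF hom] and h_smult = mod_homD(3)[OF hom]

lemma h_zero: "h \<zero>\<^bsub>M\<^esub> = \<zero>\<^bsub>M'\<^esub>"
 using h_smult[of "\<zero>\<^bsub>R\<^esub>" "\<zero>\<^bsub>M\<^esub>"] by simp
lemma h_neg: "x \<in> carrier M ==> h (\<ominus>\<^bsub>M\<^esub> x) = \<ominus>\<^bsub>M'\<^esub> h x"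
 using h_smult[of "\<ominus>\<^bsub>R\<^esub> \<one>\<^bsub>R\<^esub>" x] by (simp add: M.smult_l_minus M'.smult_l_minus)
lemma h_sub: "x \<in> carrier M ==> y \<in> carrier M ==> h (x \<ominus>\<^bsub>M\<^esub> y) = h x \<ominus>\<^bsub>M'\<^esub> h y"
 by (simp add: M.M.minus_eq M'.M.minus_eq h_add h_neg)

lemma sm_image: "M.sm H ==> M'.sm (h ` H)"
proof (rule M'.smI)
 assume H: "M.sm H"
 show "h ` H \<subseteq> carrier M'" using M.sm_carr[OF H] by blast
 show "\<zero>\<^bsub>M'\<^esub> \<in> h ` H" using M.sm_zero[OF H] h_zero by (metis imageI)
 show "x \<oplus>\<^bsub>M'\<^esub> y \<in> h ` H" if "x \<in> h ` H" "y \<in> h ` H" for x y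
  using that M.sm_add[OF H] h_add M.sm_carr[OF H] by (smt (verit, best) imageE imageI)
 show "a \<odot>\<^bsub>M'\<^esub> x \<in> h ` H" if "a \<in> carrier R" "x \<in> h ` H" for a x
  using that M.sm_smult[OF H] h_smult M.sm_carr[OF H] by (smt (verit, best) imageE imageI)
qed

lemma sm_vimage: "M.sm U ==> M'.sm H ==> M.sm {u \<in> U. h u \<in> H}"
 by (rule M.smI) (use M.sm_carr in \<open>auto simp: h_add h_smult h_zero M.sm_zero M'.sm_zero
    M.sm_add M.sm_smult M'.sm_add M'.sm_smult\<close>)

text \<open>If \<open>h\<close> induces an injection \<open>U/V \<rightarrow> U'/V'\<close>, then pushing chains forward preserves strictness.\<close>

lemma len_le_hom:
 assumes "M.sm U" "M'.sm V'" "M'.sm U'"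
  and "\<And>u. u \<in> U ==> h u \<in> V' ==> u \<in> V" "\<And>u. u \<in> U ==> h u \<in> U'" "V' \<subseteq> U'"
 shows "M.len V U \<le> M'.len V' U'"
 unfolding M.len_def M'.len_def
proof (rule ilen_map_le[where \<phi> = "\<lambda>H. M'.psum (h ` H) V'"])
 fix H assume "H \<in> Collect M.sm" "V \<subseteq> H" "H \<subseteq> U"
 then show "M'.psum (h ` H) V' \<in> Collect M'.sm \<and> V' \<subseteq> M'.psum (h ` H) V' \<and> M'.psum (h ` H) V' \<subseteq> U'"
  using assms(2,3,5,6) sm_image
  by (intro conjI CollectI M'.sm_psum M'.psum_upper2 M'.sm_subset M'.psum_least) auto
next
 fix H K assume HK: "H \<in> Collect M.sm" "K \<in> Collect M.sm" "V \<subseteq> H" "H \<subset> K" "K \<subseteq> U"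
 then obtain k where k: "k \<in> K" "k \<notin> H" by blast
 have "h k \<notin> M'.psum (h ` H) V'"
 proof
  assume "h k \<in> M'.psum (h ` H) V'"
  then obtain x v where x: "x \<in> H" "v \<in> V'" "h k = h x \<oplus>\<^bsub>M'\<^esub> v" by (auto elim!: M'.psumE)
  have c: "x \<in> carrier M" "k \<in> carrier M" "v \<in> carrier M'" using HK k x M.sm_carr assms(2) M'.sm_carr by auto
  have "h (k \<ominus>\<^bsub>M\<^esub> x) = v" using x c by (simp add: h_sub M'.add_sub_cancel_l)
  moreover have "k \<ominus>\<^bsub>M\<^esub> x \<in> U" using HK k x M.sm_sub[of U k x] assms(1) by auto
  ultimately have "k \<ominus>\<^bsub>M\<^esub> x \<in> H" using assms(4) x HK by auto
  then have "k \<in> H" using M.sm_sub_mem[of H x k] HK x c by auto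
  with k show False by blast
 qed
 moreover have "h k \<in> M'.psum (h ` K) V'"
  using M'.psum_upper1[OF M'.sm_subset[OF sm_image] assms(2), of K] k HK by auto
 moreover have "M'.psum (h ` H) V' \<subseteq> M'.psum (h ` K) V'" using HK by (intro M'.psum_mono) auto
 ultimately show "M'.psum (h ` H) V' \<subset> M'.psum (h ` K) V'" by blast
qed

text \<open>If \<open>h\<close> induces a surjection \<open>U/V \<rightarrow> U'/V'\<close>, then pulling chains back preserves strictness.\<close>

lemma len_ge_hom:
 assumes "M.sm U" "V \<subseteq> U" "M'.sm V'" "\<And>u. u \<in> V ==> h u \<in> V'"
  "\<And>u'. u' \<in> U' ==> \<exists>u\<in>U. u' \<ominus>\<^bsub>M'\<^esub> h u \<in> V'"
 shows "M'.len V' U' \<le> M.len V U"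
 unfolding M.len_def M'.len_def
proof (rule ilen_map_le[where \<phi> = "\<lambda>H'. {u \<in> U. h u \<in> H'}"])
 fix H assume "H \<in> Collect M'.sm" "V' \<subseteq> H" "H \<subseteq> U'"
 then show "{u \<in> U. h u \<in> H} \<in> Collect M.sm \<and> V \<subseteq> {u \<in> U. h u \<in> H} \<and> {u \<in> U. h u \<in> H} \<subseteq> U"
  using assms sm_vimage by blast
next
 fix H K assume HK: "H \<in> Collect M'.sm" "K \<in> Collect M'.sm" "V' \<subseteq> H" "H \<subset> K" "K \<subseteq> U'"
 then obtain k where k: "k \<in> K" "k \<notin> H" by blast
 then obtain u where u: "u \<in> U" "k \<ominus>\<^bsub>M'\<^esub> h u \<in> V'" using assms(5) HK by blast
 have c: "k \<in> carrier M'" "u \<in> carrier M" "h u \<in> carrier M'" using HK k u assms(1) M.sm_carr M'.sm_carr by auto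
 have "k \<ominus>\<^bsub>M'\<^esub> (k \<ominus>\<^bsub>M'\<^esub> h u) = h u" using c by (metis M'.add_sub_cancel_l M'.sub_add_cancel M'.minus_closed_M)
 hence "h u \<in> K" using M'.sm_sub[of K k "k \<ominus>\<^bsub>M'\<^esub> h u"] HK k u by auto
 moreover have "h u \<notin> H"
  using M'.sm_add[of H "k \<ominus>\<^bsub>M'\<^esub> h u" "h u"] M'.sub_add_cancel[of k "h u"] HK k u c by auto
 ultimately show "{u \<in> U. h u \<in> H} \<subset> {u \<in> U. h u \<in> K}" using HK(4) u by blast
qed

lemma image_ip: assumes "I \<subseteq> carrier R" "M.sm H" shows "h ` M.ip I H = M'.ip I (h ` H)"
proof
 have H: "H \<subseteq> carrier M" "M'.sm (h ` H)" using M.sm_subset[OF assms(2)] sm_image[OF assms(2)] by auto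
 have "M.ip I H \<subseteq> {u \<in> carrier M. h u \<in> M'.ip I (h ` H)}"
 proof (rule M.ip_least)
  show "M.sm {u \<in> carrier M. h u \<in> M'.ip I (h ` H)}"
   using assms H by (intro sm_vimage M.sm_carrier M'.sm_ip M'.sm_subset)
  fix a x assume "a \<in> I" "x \<in> H"
  then show "a \<odot>\<^bsub>M\<^esub> x \<in> {u \<in> carrier M. h u \<in> M'.ip I (h ` H)}"
   using assms H by (auto simp: h_smult subset_iff intro!: M'.ipI)
 qed
 then show "h ` M.ip I H \<subseteq> M'.ip I (h ` H)" by blast
 show "M'.ip I (h ` H) \<subseteq> h ` M.ip I H"
 proof (rule M'.ip_least)
  show "M'.sm (h ` M.ip I H)" using assms H by (intro sm_image M.sm_ip)
  fix a x assume "a \<in> I" "x \<in> h ` H"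
  then obtain y where "y \<in> H" "x = h y" "a \<in> I" by blast
  moreover from this have "h (a \<odot>\<^bsub>M\<^esub> y) = a \<odot>\<^bsub>M'\<^esub> h y" using assms H by (intro h_smult) auto
  ultimately show "a \<odot>\<^bsub>M'\<^esub> x \<in> h ` M.ip I H"
   by (intro image_eqI[of _ _ "a \<odot>\<^bsub>M\<^esub> y"]) (auto intro: M.ipI)
 qed
qed

lemma image_ipow: "I \<subseteq> carrier R ==> M.sm H ==> h ` M.ipow I n H = M'.ipow I n (h ` H)"
 by (induction n) (simp_all add: M.ipow_Suc M'.ipow_Suc image_ip M.sm_ipow)

end

section \<open>Chain conditions, Rees algebras and Krull's intersection theorem\<close>

context rmod begin

definition acc :: "'b set => 'b set => bool"
 where "acc V U \<longleftrightarrow> (\<forall>H. (\<forall>i::nat. sm (H i) \<and> V \<subseteq> H i \<and> H i \<subseteq> U \<and> H i \<subseteq> H (Suc i)) \<longrightarrow>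
  (\<exists>n. \<forall>m\<ge>n. H m = H n))"

lemma accD:
 assumes "acc V U" "\<And>i. sm (H i)" "\<And>i. V \<subseteq> H i" "\<And>i. H i \<subseteq> U" "\<And>i. H i \<subseteq> H (Suc i)"
 shows "\<exists>n. \<forall>m\<ge>n. H m = H n"
 using assms unfolding acc_def by blast

text \<open>Extensions of Noetherian modules: a chain is stable once its traces in \<open>U\<close> and its sums with \<open>U\<close> are.\<close>

lemma acc_trans:
 assumes "sm U" "V \<subseteq> U" "U \<subseteq> T" "sm T" "acc V U" "acc U T" shows "acc V T"
 unfolding acc_def
proof (intro allI impI)
 fix H :: "nat => 'b set"
 assume H: "\<forall>i. sm (H i) \<and> V \<subseteq> H i \<and> H i \<subseteq> T \<and> H i \<subseteq> H (Suc i)"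
 have sm: "sm (H i)" for i using H by blast
 have mono: "i \<le> j ==> H i \<subseteq> H j" for i j using lift_Suc_mono_le[of H i j] H by blast
 have "\<exists>n. \<forall>m\<ge>n. H m \<inter> U = H n \<inter> U"
  by (rule accD[OF assms(5)]) (use H assms in \<open>auto intro!: sm_Int\<close>)
 then obtain n1 where n1: "\<And>m. m \<ge> n1 ==> H m \<inter> U = H n1 \<inter> U" by blast
 have "\<exists>n. \<forall>m\<ge>n. H m [+] U = H n [+] U"
 proof (rule accD[OF assms(6)])
  fix i
  show "sm (H i [+] U)" by (rule sm_psum[OF sm assms(1)])
  show "U \<subseteq> H i [+] U" by (rule psum_upper2[OF sm sm_subset[OF assms(1)]])
  show "H i [+] U \<subseteq> T" using H assms by (intro psum_least) auto
  show "H i [+] U \<subseteq> H (Suc i) [+] U" using H by (intro psum_mono) auto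
 qed
 then obtain n2 where n2: "\<And>m. m \<ge> n2 ==> H m [+] U = H n2 [+] U" by blast
 define n where "n = max n1 n2"
 have "H m = H n" if "m \<ge> n" for m
 proof -
  have "H m \<inter> U = H n \<inter> U" "H m [+] U = H n [+] U" using n1[of m] n1[of n] n2[of m] n2[of n] that n_def by auto
  moreover have "H m \<subseteq> H m [+] U" by (rule psum_upper1[OF sm_subset[OF sm] assms(1)])
  ultimately have "H n = H m" using mono[OF that] by (intro modular_eqI[OF sm sm assms(1)]) auto
  then show ?thesis by simp
 qed
 then show "\<exists>n. \<forall>m\<ge>n. H m = H n" by blast
qed

lemma acc_sub: "acc V U ==> V \<subseteq> V' ==> U' \<subseteq> U ==> acc V' U'"
 unfolding acc_def by (meson order_trans)

lemma acc_imp_fg: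
 assumes "acc {\<zero>\<^bsub>M\<^esub>} U" "sm U"
 shows "\<exists>S. finite S \<and> S \<subseteq> U \<and> gen_submod R M S = U"
proof (rule ccontr)
 assume neg: "\<not> ?thesis"
 have le: "gen_submod R M S \<subseteq> U" if "S \<subseteq> U" for S using gen_least[OF assms(2) that] .
 define nxt where "nxt S = insert (SOME x. x \<in> U - gen_submod R M S) S" for S
 have nxt: "(SOME x. x \<in> U - gen_submod R M S) \<in> U - gen_submod R M S" if "finite S" "S \<subseteq> U" for S
 proof -
  have "gen_submod R M S \<noteq> U" using neg that by blast
  with le[OF that(2)] have "\<exists>x. x \<in> U - gen_submod R M S" by blast
  then show ?thesis by (rule someI_ex)
 qed
 define F where "F n = (nxt ^^ n) {}" for n
 have F: "finite (F n) \<and> F n \<subseteq> U" for n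
  by (induction n) (use nxt in \<open>auto simp: F_def nxt_def\<close>)
 have FS: "F (Suc n) = nxt (F n)" for n by (simp add: F_def)
 have cS: "S \<subseteq> U ==> S \<subseteq> carrier M" for S using sm_subset[OF assms(2)] by blast
 have "\<exists>n. \<forall>m\<ge>n. gen_submod R M (F m) = gen_submod R M (F n)"
 proof (rule accD[OF assms(1)])
  fix i
  show s: "sm (gen_submod R M (F i))" for i using F cS by (intro sm_gen) blast
  show "{\<zero>\<^bsub>M\<^esub>} \<subseteq> gen_submod R M (F i)" using sm_zero[OF s] by simp
  show "gen_submod R M (F i) \<subseteq> U" using F le by blast
  show "gen_submod R M (F i) \<subseteq> gen_submod R M (F (Suc i))"
   using gen_incl[of "F (Suc i)"] by (intro gen_least[OF s]) (auto simp: FS nxt_def)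
 qed
 then obtain n where "gen_submod R M (F (Suc n)) = gen_submod R M (F n)" using le_Suc_eq by blast
 moreover have "(SOME x. x \<in> U - gen_submod R M (F n)) \<in> F (Suc n)" by (simp add: FS nxt_def)
 ultimately show False using nxt[of "F n"] F gen_incl[of "F (Suc n)"] by blast
qed

definition sc :: "'a => 'b set => 'b set" where "sc a H = (\<lambda>u. a *. u) ` H"

lemma smult_hom: "a \<in> carrier R ==> (\<lambda>u. a *. u) \<in> mod_hom R M M"
 unfolding mod_hom_def by (auto simp: smult_r_distr smult_commute)

lemma smult_rhom: "a \<in> carrier R ==> rhom R M M (\<lambda>u. a *. u)"
 by (intro rhom.intro rhom_axioms.intro smult_hom) (rule rmod_axioms)+

lemma sm_sc: "a \<in> carrier R ==> sm H ==> sm (sc a H)"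
 unfolding sc_def by (rule rhom.sm_image[OF smult_rhom])
lemma scI: "u \<in> H ==> a *. u \<in> sc a H" by (simp add: sc_def)
lemma sc_ipow: "a \<in> carrier R ==> I \<subseteq> carrier R ==> sm H ==> sc a (ipow I n H) = ipow I n (sc a H)"
 unfolding sc_def by (rule rhom.image_ipow[OF smult_rhom])
lemma sm_colon: "a \<in> carrier R ==> sm U ==> sm H ==> sm {u \<in> U. a *. u \<in> H}"
 by (rule rhom.sm_vimage[OF smult_rhom])

primrec lsum :: "'a list => 'b set => 'b set" where
 "lsum [] H = {\<zero>\<^bsub>M\<^esub>}"
| "lsum (x # xs) H = sc x H [+] lsum xs H"

lemma sm_lsum: "set xs \<subseteq> carrier R ==> sm H ==> sm (lsum xs H)"
 by (induction xs) (auto intro: sm_null sm_psum sm_sc)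
lemma lsum_least: "sm T ==> (\<And>x h. x \<in> set xs ==> h \<in> H ==> x *. h \<in> T) ==> lsum xs H \<subseteq> T"
proof (induction xs)
 case Nil then show ?case by (simp add: sm_zero)
next
 case (Cons x xs)
 then have "sc x H \<subseteq> T" "lsum xs H \<subseteq> T" by (auto simp: sc_def)
 then show ?case using psum_least[OF Cons.prems(1)] by simp
qed
lemma lsum_mem: assumes "set xs \<subseteq> carrier R" "sm H" shows "x \<in> set xs ==> h \<in> H ==> x *. h \<in> lsum xs H"
 using assms(1)
proof (induction xs)
 case (Cons y ys)
 have s: "sm (sc y H)" "sm (lsum ys H)" using Cons.prems assms(2) by (auto intro: sm_sc sm_lsum)
 show ?case
 proof (cases "x = y")
  case True
  have "x *. h \<in> sc y H" using Cons.prems(2) True by (simp add: scI)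
  then show ?thesis using psum_upper1[OF sm_subset[OF s(1)] s(2)] by auto
 next
  case False
  then have "x *. h \<in> lsum ys H" using Cons by auto
  then show ?thesis using psum_upper2[OF s(1) sm_subset[OF s(2)]] by auto
 qed
qed simp
lemma sm_lsum_pow: "set xs \<subseteq> carrier R ==> sm H ==> sm ((lsum xs ^^ n) H)"
 by (induction n) (auto intro: sm_lsum)

lemma stable_range:
 assumes "acc {\<zero>\<^bsub>M\<^esub>} (carrier M)" "\<And>n j. sm (L n j)" "\<And>n j. L n j \<subseteq> L n (Suc j)"
 shows "\<exists>j0. \<forall>n\<le>(k::nat). \<forall>j. L n (j::nat) \<subseteq> L n j0"
proof -
 have mono: "i \<le> j ==> L n i \<subseteq> L n j" for i j n using lift_Suc_mono_le[of "L n" i j] assms(3) by blast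
 have "\<exists>j0. \<forall>j. L n j \<subseteq> L n j0" for n
 proof -
  have "\<exists>j0. \<forall>j\<ge>j0. L n j = L n j0"
   by (rule accD[OF assms(1)]) (use assms sm_subset[OF assms(2)] sm_zero[OF assms(2)] in auto)
  then show ?thesis using mono by (metis linorder_le_cases order.refl)
 qed
 then obtain J where J: "\<And>n j. L n j \<subseteq> L n (J n)" by metis
 have "L n j \<subseteq> L n (Max (J ` {..k}))" if "n \<le> k" for n j
  using J[of n j] mono[of "J n" "Max (J ` {..k})" n] that by (meson Max_ge atMost_iff dual_order.trans finite_atMost finite_imageI imageI)
 then show ?thesis by blast
qed

text \<open>A family \<open>U n \<subseteq> (x\<^sub>1, \<dots>, x\<^sub>k)\<^sup>n W\<close> closed under multiplication by the \<open>x\<^sub>i\<close> is a graded submodule of a Rees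
module, and the claim is that it is generated in finitely many degrees. This is Hilbert's basis theorem
for a module that is graded over \<open>R[x\<^sub>1, \<dots>, x\<^sub>k]\<close>, proved by adding one variable \<open>x\<close> at a time. The
submodules \<open>L n j\<close> of leading coefficients at \<open>x\<^sup>j\<close> form such a family for fewer variables, and they
increase with \<open>j\<close>.\<close>

theorem rees_generated:
 assumes acc: "acc {\<zero>\<^bsub>M\<^esub>} (carrier M)" and W: "sm W"
 shows "set xs \<subseteq> carrier R ==> (\<And>n. sm (U n)) ==> (\<And>n. U n \<subseteq> (lsum xs ^^ n) W) ==>
  (\<And>n x u. x \<in> set xs ==> u \<in> U n ==> x *. u \<in> U (Suc n)) ==>
  \<exists>n0. \<forall>n\<ge>n0. U (Suc n) \<subseteq> lsum xs (U n)"
proof (induction xs arbitrary: U)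
 case Nil
 then have "U (Suc n) \<subseteq> {\<zero>\<^bsub>M\<^esub>}" for n using Nil(3)[of "Suc n"] by simp
 then show ?case by simp
next
 case (Cons x xs)
 have x: "x \<in> carrier R" and xs: "set xs \<subseteq> carrier R" using Cons.prems(1) by auto
 note smU = Cons.prems(2)
 define W' where "W' n = (lsum xs ^^ n) W" for n
 have smW': "sm (W' n)" for n unfolding W'_def by (rule sm_lsum_pow[OF xs W])
 have W'S: "y *. w \<in> W' (Suc n)" if "y \<in> set xs" "w \<in> W' n" for y w n
  using lsum_mem[OF xs smW' that] by (simp add: W'_def)
 define P where "P j = x [^]\<^bsub>R\<^esub> (j::nat)" for j
 have P: "P j \<in> carrier R" for j using x by (simp add: P_def)
 have PS: "x *. (P j *. u) = P (Suc j) *. u" if "u \<in> carrier M" for j u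
  using that x P smult_assoc1[of x "P j" u] by (simp add: P_def R.m_comm)
 \<comment> \<open>\<open>D N j\<close> is the part of degree \<open>N\<close> whose degree in \<open>x\<close> is less than \<open>j\<close>\<close>
 define D where "D N j = rec_nat {\<zero>\<^bsub>M\<^esub>} (\<lambda>j H. H [+] sc (P j) (W' (N - j))) j" for N j
 have D0: "D N 0 = {\<zero>\<^bsub>M\<^esub>}" and DS: "D N (Suc j) = D N j [+] sc (P j) (W' (N - j))" for N j
  by (simp_all add: D_def)
 have smD: "sm (D N j)" for N j by (induction j) (auto simp: D0 DS intro: sm_null sm_psum sm_sc P smW')
 have Dup: "D N j \<subseteq> D N (Suc j)" for N j unfolding DS by (rule psum_upper1[OF sm_subset[OF smD]]) (rule sm_sc[OF P smW'])
 have DxE: "\<And>d w. d \<in> D N j ==> w \<in> W' (N - j) ==> d +. P j *. w \<in> D N (Suc j)" for N j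
  unfolding DS by (auto intro: psumI scI)
 have DE: "\<exists>d w. d \<in> D N j \<and> w \<in> W' (N - j) \<and> u = d +. P j *. w" if "u \<in> D N (Suc j)" for N j u
  using that unfolding DS sc_def by (auto elim!: psumE)
 have D2: "x *. u \<in> D (Suc N) (Suc j)" if "u \<in> D N j" for N j u
  using that
 proof (induction j arbitrary: u)
  case 0 then show ?case using sm_zero[OF smD] x by (simp add: D0)
 next
  case (Suc j)
  then obtain d w where *: "d \<in> D N j" "w \<in> W' (N - j)" "u = d +. P j *. w" using DE by blast
  then have c: "d \<in> carrier M" "w \<in> carrier M" using sm_carr smD smW' by blast+
  have "x *. u = x *. d +. P (Suc j) *. w" using * c x P by (simp add: smult_r_distr PS)
  then show ?case using DxE[of "x *. d" "Suc N" "Suc j" w] Suc.IH[OF *(1)] *(2) by simp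
 qed
 have D3: "y *. u \<in> D (Suc N) j" if "y \<in> set xs" "u \<in> D N j" "j \<le> Suc N" for N j u y
  using that(2,3)
 proof (induction j arbitrary: u)
  case 0 then show ?case using sm_zero[OF smD] xs that(1) by (auto simp: D0)
 next
  case (Suc j)
  then obtain d w where *: "d \<in> D N j" "w \<in> W' (N - j)" "u = d +. P j *. w" using DE by blast
  then have c: "d \<in> carrier M" "w \<in> carrier M" using sm_carr smD smW' by blast+
  have y: "y \<in> carrier R" using that xs by blast
  have "y *. u = y *. d +. P j *. (y *. w)" using * c y P by (simp add: smult_r_distr smult_commute)
  moreover have "y *. w \<in> W' (Suc N - j)" using W'S[OF that(1) *(2)] Suc.prems(2) by (simp add: Suc_diff_le)
  ultimately show ?case using DxE[of "y *. d" "Suc N" j "y *. w"] Suc.IH[OF *(1)] Suc.prems(2) by simp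
 qed
 have D4: "(lsum (x # xs) ^^ N) W \<subseteq> D N (Suc N)" for N
 proof (induction N)
  case 0
  have "w \<in> D 0 1" if "w \<in> W" for w
  proof -
   have "\<zero>\<^bsub>M\<^esub> +. P 0 *. w \<in> D 0 (Suc 0)" by (rule DxE) (use that in \<open>auto simp: D0 W'_def\<close>)
   then show ?thesis using sm_carr[OF W that] by (simp add: P_def)
  qed
  then show ?case by auto
 next
  case (Suc N)
  have "lsum (x # xs) ((lsum (x # xs) ^^ N) W) \<subseteq> D (Suc N) (Suc (Suc N))"
  proof (rule lsum_least[OF smD])
   fix y h assume "y \<in> set (x # xs)" "h \<in> (lsum (x # xs) ^^ N) W"
   then have "y = x \<or> y \<in> set xs" "h \<in> D N (Suc N)" using Suc by (auto simp del: lsum.simps)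
   then show "y *. h \<in> D (Suc N) (Suc (Suc N))" using D2 D3[of y h N "Suc N"] Dup[of "Suc N" "Suc N"] by auto
  qed
  then show ?case by (simp del: lsum.simps)
 qed
 \<comment> \<open>leading coefficients at \<open>x\<^sup>j\<close> of the vectors in \<open>U (n + j)\<close>\<close>
 define L where "L n j = {w \<in> W' n. P j *. w \<in> U (n + j) [+] D (n + j) j}" for n j
 have smL: "sm (L n j)" for n j unfolding L_def by (intro sm_colon P smW' sm_psum smU smD)
 have L1: "L n j \<subseteq> L n (Suc j)" for n j
 proof
  fix w assume w: "w \<in> L n j"
  then obtain u d where *: "u \<in> U (n + j)" "d \<in> D (n + j) j" "P j *. w = u +. d"
   unfolding L_def by (blast elim: psumE)
  have c: "u \<in> carrier M" "d \<in> carrier M" "w \<in> carrier M" using * w smU smD smL sm_carr by blast+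
  have "P (Suc j) *. w = x *. u +. x *. d" using PS[OF c(3), of j] * c x by (simp add: smult_r_distr)
  moreover have "x *. u \<in> U (n + Suc j)" using Cons.prems(4)[of x u "n + j"] * by simp
  moreover have "x *. d \<in> D (n + Suc j) (Suc j)" using D2[OF *(2)] by simp
  ultimately show "w \<in> L n (Suc j)" using w unfolding L_def by (auto intro: psumI)
 qed
 have L2: "y *. w \<in> L (Suc n) j" if "y \<in> set xs" "w \<in> L n j" for y w n j
 proof -
  note asm = that
  obtain u d where *: "u \<in> U (n + j)" "d \<in> D (n + j) j" "P j *. w = u +. d"
   using asm unfolding L_def by (blast elim: psumE)
  have c: "u \<in> carrier M" "d \<in> carrier M" "w \<in> carrier M" using * that smU smD smL sm_carr by blast+
  have y: "y \<in> carrier R" using that xs by blast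
  have "P j *. (y *. w) = y *. u +. y *. d" using * c y P by (simp add: smult_r_distr smult_commute[of "P j"])
  moreover have "y *. u \<in> U (Suc n + j)" using Cons.prems(4)[of y u "n + j"] * that by simp
  moreover have "y *. d \<in> D (Suc n + j) j" using D3[OF that(1) *(2)] by simp
  ultimately show ?thesis using W'S[OF that(1), of w n] that(2) unfolding L_def by (auto intro: psumI)
 qed
 have LW: "L n j \<subseteq> (lsum xs ^^ n) W" for n j unfolding L_def W'_def by blast
 have "\<exists>n0. \<forall>n\<ge>n0. L (Suc n) j \<subseteq> lsum xs (L n j)" for j
  by (rule Cons.IH[of "\<lambda>n. L n j"]) (use xs smL LW L2 in auto)
 then obtain nj where nj: "\<And>j n. n \<ge> nj j ==> L (Suc n) j \<subseteq> lsum xs (L n j)" by metis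
 define Li where "Li n = (\<Union>j. L n j)" for n
 have "\<exists>n0. \<forall>n\<ge>n0. Li (Suc n) \<subseteq> lsum xs (Li n)"
 proof (rule Cons.IH[of Li])
  show "sm (Li n)" for n unfolding Li_def using smL L1 by (intro sm_UN_chain)
  show "Li n \<subseteq> (lsum xs ^^ n) W" for n using LW unfolding Li_def by blast
  show "y *. u \<in> Li (Suc n)" if "y \<in> set xs" "u \<in> Li n" for n y u using that L2 unfolding Li_def by blast
 qed (rule xs)
 then obtain ni where ni: "\<And>n. n \<ge> ni ==> Li (Suc n) \<subseteq> lsum xs (Li n)" by blast
 obtain j0 where j0: "\<And>n j. n \<le> ni ==> L n j \<subseteq> L n j0" using stable_range[OF acc, of L ni] smL L1 by blast
 have Lij0: "Li n \<subseteq> L n j0" for n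
 proof (induction n)
  case 0 then show ?case using j0[of 0] unfolding Li_def by blast
 next
  case (Suc n)
  show ?case
  proof (cases "n < ni")
   case True then show ?thesis using j0[of "Suc n"] unfolding Li_def by auto
  next
   case False
   then have "Li (Suc n) \<subseteq> lsum xs (Li n)" using ni by simp
   also have "\<dots> \<subseteq> L (Suc n) j0" using Suc L2 by (intro lsum_least[OF smL]) auto
   finally show ?thesis .
  qed
 qed
 \<comment> \<open>one bound for the finitely many \<open>x\<close>-degrees below the stable one\<close>
 define n1 where "n1 = Max (nj ` {..j0})"
 have n1: "nj j \<le> n1" if "j \<le> j0" for j unfolding n1_def using that by simp
 have "U (Suc N) \<subseteq> lsum (x # xs) (U N)" if N: "N \<ge> n1 + j0" for N
 proof -
  define T where "T = lsum (x # xs) (U N)"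
  have smT: "sm T" unfolding T_def by (rule sm_lsum[OF Cons.prems(1) smU])
  have TU: "T \<subseteq> U (Suc N)" unfolding T_def using Cons.prems(4) by (intro lsum_least smU) auto
  have xT: "y *. u \<in> T" if "y \<in> set (x # xs)" "u \<in> U N" for y u
   unfolding T_def by (rule lsum_mem[OF Cons.prems(1) smU that])
  \<comment> \<open>division with remainder: lower the degree in \<open>x\<close> by subtracting an element of \<open>T\<close>\<close>
  have "j \<le> Suc (Suc N) ==> U (Suc N) \<inter> D (Suc N) j \<subseteq> T" for j
  proof (induction j)
   case 0 then show ?case using sm_zero[OF smT] by (auto simp: D0)
  next
   case (Suc j)
   show ?case
   proof
    fix u assume u: "u \<in> U (Suc N) \<inter> D (Suc N) (Suc j)"
    then obtain d w where *: "d \<in> D (Suc N) j" "w \<in> W' (Suc N - j)" "u = d +. P j *. w" using DE by blast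
    define n where "n = Suc N - j"
    have nj': "n + j = Suc N" using Suc.prems by (simp add: n_def)
    have c: "u \<in> carrier M" "d \<in> carrier M" "w \<in> carrier M" using u * smU smD smW' sm_carr by blast+
    have "P j *. w = u +. \<ominus>\<^bsub>M\<^esub> d" using add_sub_cancel_l[of d "P j *. w"] *(3) c P by (simp add: M.minus_eq)
    then have wL: "w \<in> L n j" unfolding L_def nj' using u *(1,2) sm_neg[OF smD] by (auto intro: psumI simp: n_def)
    have "\<exists>t e. t \<in> T \<and> e \<in> D (Suc N) j \<and> P j *. w = t +. e"
    proof (cases "j \<le> j0")
     case True
     define k where "k = N - j"
     have k: "n = Suc k" "k + j = N" "k \<ge> nj j" using N True n1[OF True] nj' by (auto simp: k_def)
     define Z where "Z = {v \<in> carrier M. P j *. v \<in> T [+] D (Suc N) j}"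
     have "lsum xs (L k j) \<subseteq> Z"
     proof (rule lsum_least)
      show "sm Z" unfolding Z_def by (intro sm_colon P sm_carrier sm_psum smT smD)
      fix y v assume y: "y \<in> set xs" and v: "v \<in> L k j"
      obtain u' d' where **: "u' \<in> U N" "d' \<in> D N j" "P j *. v = u' +. d'"
       using v unfolding L_def k(2) by (auto elim!: psumE)
      have c': "u' \<in> carrier M" "d' \<in> carrier M" "v \<in> carrier M" using ** v smU smD smL sm_carr by blast+
      have yR: "y \<in> carrier R" using y xs by blast
      have "P j *. (y *. v) = y *. u' +. y *. d'"
       using ** c' yR P by (simp add: smult_r_distr smult_commute[of "P j"])
      moreover have "y *. u' \<in> T" using xT y ** by auto
      moreover have "y *. d' \<in> D (Suc N) j" using D3[OF y **(2)] k by simp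
      ultimately show "y *. v \<in> Z" using yR c' unfolding Z_def by (auto intro: psumI)
     qed
     then have "w \<in> Z" using nj[OF k(3)] wL k(1) by auto
     then show ?thesis unfolding Z_def by (auto elim!: psumE)
    next
     case False
     then obtain j' where j': "j = Suc j'" "j0 \<le> j'" by (metis not_less_eq_eq Suc_le_D)
     have "L n j0 \<subseteq> L n j'" using lift_Suc_mono_le[of "L n" j0 j'] L1 j'(2) by blast
     then have "w \<in> L n j'" using Lij0[of n] wL unfolding Li_def by blast
     moreover have "n + j' = N" using nj' j' by simp
     ultimately obtain u' d' where **: "u' \<in> U N" "d' \<in> D N j'" "P j' *. w = u' +. d'"
      unfolding L_def by (auto elim!: psumE)
     have c': "u' \<in> carrier M" "d' \<in> carrier M" using ** smU smD sm_carr by blast+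
     have "P j *. w = x *. u' +. x *. d'"
      using PS[OF c(3), of j'] ** c' x by (simp add: smult_r_distr j')
     moreover have "x *. u' \<in> T" using xT ** by auto
     moreover have "x *. d' \<in> D (Suc N) j" using D2[OF **(2)] j' by simp
     ultimately show ?thesis by blast
    qed
    then obtain t e where te: "t \<in> T" "e \<in> D (Suc N) j" "P j *. w = t +. e" by blast
    have c': "t \<in> carrier M" "e \<in> carrier M" using te smT smD sm_carr by blast+
    have "u = (d +. e) +. t" using *(3) te(3) c c' by (simp add: M.a_ac)
    then have "u -. t = d +. e" using add_sub_cancel c c' by simp
    then have "u -. t \<in> U (Suc N) \<inter> D (Suc N) j"
     using sm_sub[OF smU, of u "Suc N" t] u te TU sm_add[OF smD *(1) te(2)] by auto
    then have "u -. t \<in> T" using Suc by auto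
    then show "u \<in> T" using sm_sub_mem[OF smT te(1)] c by blast
   qed
  qed
  from this[of "Suc (Suc N)"] D4[of "Suc N"] Cons.prems(3)[of "Suc N"] show ?thesis unfolding T_def by blast
 qed
 then show ?case by blast
qed

definition cyc :: "'b => 'b set" where "cyc z = {a *. z |a. a \<in> carrier R}"

lemma sm_mult_set: assumes "ideal I R" "z \<in> carrier M" shows "sm {a *. z |a. a \<in> I}"
proof -
 interpret I: ideal I R by fact
 show ?thesis
 proof (rule smI)
  show "{a *. z |a. a \<in> I} \<subseteq> carrier M" using assms(2) I.Icarr by auto
  show "\<zero>\<^bsub>M\<^esub> \<in> {a *. z |a. a \<in> I}" using I.zero_closed assms(2) smult_l_null by (smt (verit) mem_Collect_eq)
  fix x y assume "x \<in> {a *. z |a. a \<in> I}" "y \<in> {a *. z |a. a \<in> I}"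
  then obtain a b where "a \<in> I" "b \<in> I" "x = a *. z" "y = b *. z" by blast
  then have "x +. y = (a \<oplus> b) *. z" "a \<oplus> b \<in> I" using assms(2) I.Icarr by (auto simp: smult_l_distr)
  then show "x +. y \<in> {a *. z |a. a \<in> I}" by blast
 next
  fix b x assume "b \<in> carrier R" "x \<in> {a *. z |a. a \<in> I}"
  then obtain a where "a \<in> I" "x = a *. z" "b \<in> carrier R" by blast
  then have "b *. x = (b \<otimes> a) *. z" "b \<otimes> a \<in> I" using assms(2) I.Icarr I.I_l_closed by (auto simp: smult_assoc1)
  then show "b *. x \<in> {a *. z |a. a \<in> I}" by blast
 qed
qed

lemma sm_cyc: "z \<in> carrier M ==> sm (cyc z)"
 unfolding cyc_def by (rule sm_mult_set[OF R.oneideal])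
lemma cyc_self: "z \<in> carrier M ==> z \<in> cyc z"
 unfolding cyc_def by (auto intro: exI[of _ \<one>])
lemma cyc_least: "sm H ==> z \<in> H ==> cyc z \<subseteq> H"
 unfolding cyc_def by (auto intro: sm_smult)

lemma ip_cyc: assumes "ideal I R" "z \<in> carrier M" shows "ip I (cyc z) = {a *. z |a. a \<in> I}"
proof
 interpret I: ideal I R by fact
 show "ip I (cyc z) \<subseteq> {a *. z |a. a \<in> I}"
 proof (rule ip_least[OF sm_mult_set[OF assms]])
  fix a x assume "a \<in> I" "x \<in> cyc z"
  then obtain b where b: "b \<in> carrier R" "x = b *. z" "a \<in> I" unfolding cyc_def by blast
  then have "a *. x = (a \<otimes> b) *. z" "a \<otimes> b \<in> I" using assms(2) I.Icarr I.I_r_closed by (auto simp: smult_assoc1)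
  then show "a *. x \<in> {a *. z |a. a \<in> I}" by blast
 qed
 show "{a *. z |a. a \<in> I} \<subseteq> ip I (cyc z)" using cyc_self[OF assms(2)] by (auto intro: ipI)
qed

end

lemma ideal_subset: "ideal J R ==> J \<subseteq> carrier R"
 by (rule subsetI) (rule ideal.Icarr)

lemma self_mod_simps [simp]:
 "carrier (self_mod R) = carrier R" "\<zero>\<^bsub>self_mod R\<^esub> = \<zero>\<^bsub>R\<^esub>" "x \<oplus>\<^bsub>self_mod R\<^esub> y = x \<oplus>\<^bsub>R\<^esub> y"
 "x \<odot>\<^bsub>self_mod R\<^esub> y = x \<otimes>\<^bsub>R\<^esub> y"
 by (simp_all add: self_mod_def)

lemma self_rmod: fixes R :: "'a ring" assumes "cring R" shows "rmod R (self_mod R)"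
proof -
 interpret R: cring R by fact
 have "abelian_group (self_mod R)"
 proof (rule abelian_groupI)
  show "\<exists>y\<in>carrier (self_mod R). y \<oplus>\<^bsub>self_mod R\<^esub> x = \<zero>\<^bsub>self_mod R\<^esub>" if "x \<in> carrier (self_mod R)" for x
   using that R.l_neg by (auto intro!: bexI[of _ "\<ominus>\<^bsub>R\<^esub> x"])
 qed (auto simp: R.a_assoc intro: R.a_comm)
 then show ?thesis
  by (intro rmod.intro moduleI assms) (auto simp: R.l_distr R.r_distr R.m_assoc)
qed

lemma self_sm_iff: fixes R :: "'a ring" assumes "cring R"
 shows "submodule J R (self_mod R) \<longleftrightarrow> ideal J R"
proof -
 interpret R: cring R by fact
 interpret S: rmod R "self_mod R" by (rule self_rmod[OF assms])
 show ?thesis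
 proof
  assume J: "S.sm J"
  have neg: "\<ominus>\<^bsub>R\<^esub> x \<in> J" if "x \<in> J" for x
   using S.sm_smult[OF J, of "\<ominus>\<^bsub>R\<^esub> \<one>\<^bsub>R\<^esub>" x] that S.sm_carr[OF J that] by (simp add: R.l_minus)
  have "subgroup J (add_monoid R)"
   by (rule R.add.subgroupI) (use S.sm_subset[OF J] S.sm_zero[OF J] S.sm_add[OF J] neg in auto)
  then show "ideal J R"
  proof (rule idealI[OF R.ring_axioms])
   show "x \<otimes>\<^bsub>R\<^esub> a \<in> J" if "a \<in> J" "x \<in> carrier R" for a x using S.sm_smult[OF J that(2,1)] by simp
   then show "a \<otimes>\<^bsub>R\<^esub> x \<in> J" if "a \<in> J" "x \<in> carrier R" for a x
    using that S.sm_carr[OF J that(1)] R.m_comm[of a x] by simp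
  qed
 next
  assume "ideal J R"
  then interpret J: ideal J R .
  show "S.sm J" by (rule S.smI) (auto simp: J.Icarr J.I_l_closed)
 qed
qed

locale noeth_mod = rmod R M for R :: "'a ring" (structure) and M :: "('a, 'b) module" (structure) +
 fixes I :: "'a set"
 assumes acc_M: "acc {\<zero>\<^bsub>M\<^esub>} (carrier M)"
  and acc_R: "rmod.acc R (self_mod R) {\<zero>} (carrier R)"
  and I_ideal: "ideal I R"
begin

lemma cringR: "cring R" by (rule R.is_cring)
lemma I_sub: "I \<subseteq> carrier R" by (rule ideal_subset[OF I_ideal])

lemma ideal_fg: assumes "ideal J R" shows "\<exists>xs. set xs \<subseteq> J \<and> J = Idl (set xs)"
proof -
 interpret S: rmod R "self_mod R" by (rule self_rmod[OF cringR])
 have J: "S.sm J" using self_sm_iff[OF cringR] assms by blast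
 have "S.acc {\<zero>} J" using acc_R by (rule S.acc_sub) (use S.sm_subset[OF J] in auto)
 then obtain F where "finite F" "F \<subseteq> J" "gen_submod R (self_mod R) F = J" using S.acc_imp_fg[of J] J by auto
 moreover from this obtain xs where "F = set xs" using finite_list by blast
 moreover have "gen_submod R (self_mod R) F = Idl F"
  unfolding gen_submod_def genideal_def self_sm_iff[OF cringR] ..
 ultimately show ?thesis by blast
qed

lemma ip_eq_lsum: assumes "set xs \<subseteq> J" "J = Idl (set xs)" "ideal J R" "sm H" shows "ip J H = lsum xs H"
proof
 have JR: "J \<subseteq> carrier R" by (rule ideal_subset[OF assms(3)])
 have xs: "set xs \<subseteq> carrier R" using assms(1) JR by blast
 have sl: "sm (lsum xs H)" by (rule sm_lsum[OF xs assms(4)])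
 interpret S: rmod R "self_mod R" by (rule self_rmod[OF cringR])
 define Q where "Q = {a \<in> carrier R. \<forall>h\<in>H. a *. h \<in> lsum xs H}"
 have "S.sm Q"
  by (rule S.smI) (use sl sm_carr[OF assms(4)] in
   \<open>auto simp: Q_def smult_l_distr smult_assoc1 sm_zero intro: sm_add sm_smult\<close>)
 then have "ideal Q R" using self_sm_iff[OF cringR] by blast
 moreover have "set xs \<subseteq> Q" using xs lsum_mem[OF xs assms(4)] by (auto simp: Q_def)
 ultimately have "J \<subseteq> Q" using R.genideal_minimal assms(2) by blast
 then show "ip J H \<subseteq> lsum xs H" by (intro ip_least[OF sl]) (auto simp: Q_def)
 show "lsum xs H \<subseteq> ip J H" using assms(1) by (intro lsum_least sm_ip'[OF JR assms(4)] ipI) auto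
qed

text \<open>An \<open>I\<close>-filtration inside \<open>I\<^sup>n W\<close> is eventually \<open>I\<close>-stable, because \<open>I\<close> is finitely generated.\<close>

theorem rees_ideal:
 assumes "sm W" "\<And>n. sm (U n)" "\<And>n. U n \<subseteq> ipow I n W" "\<And>n. ip I (U n) \<subseteq> U (Suc n)"
 shows "\<exists>n0. \<forall>n\<ge>n0. U (Suc n) = ip I (U n)"
proof -
 obtain xs where xs: "set xs \<subseteq> I" "I = Idl (set xs)" using ideal_fg[OF I_ideal] by blast
 note eq = ip_eq_lsum[OF xs I_ideal]
 have xsR: "set xs \<subseteq> carrier R" using xs(1) I_sub by blast
 have "ipow I n W = (lsum xs ^^ n) W" for n
  by (induction n) (simp_all add: ipow_Suc eq sm_lsum_pow[OF xsR assms(1)])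
 then have "U n \<subseteq> (lsum xs ^^ n) W" for n using assms(3) by simp
 moreover have "x *. u \<in> U (Suc n)" if "x \<in> set xs" "u \<in> U n" for n x u
  using assms(4)[of n] ipI[of x I u "U n"] that xs(1) by blast
 ultimately have "\<exists>n0. \<forall>n\<ge>n0. U (Suc n) \<subseteq> lsum xs (U n)"
  using rees_generated[OF acc_M assms(1) xsR, of U] assms(2) by blast
 then show ?thesis using assms(4) eq[OF assms(2)] by (metis subset_antisym)
qed

text \<open>The filtration \<open>S \<inter> I\<^sup>n W\<close> is eventually \<open>I\<close>-stable by \<open>rees_ideal\<close>.\<close>

theorem artin_rees:
 assumes "sm S" "sm W"
 shows "\<exists>c. \<forall>n\<ge>c. S \<inter> ipow I n W \<subseteq> ipow I (n - c) S"
proof -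
 have smn: "sm (S \<inter> ipow I n W)" for n by (intro sm_Int assms sm_ipow I_sub)
 have "ip I (S \<inter> ipow I n W) \<subseteq> S \<inter> ipow I (Suc n) W" for n
  using ip_subset[OF I_sub assms(1)] ip_mono[OF I_sub sm_subset[OF assms(1)], of I "S \<inter> ipow I n W"]
   ip_mono[OF I_sub sm_subset[OF sm_ipow[OF I_sub assms(2)]], of I "S \<inter> ipow I n W" n]
  by (simp add: ipow_Suc)
 then obtain c where c: "\<And>n. n \<ge> c ==> S \<inter> ipow I (Suc n) W = ip I (S \<inter> ipow I n W)"
  using rees_ideal[OF assms(2), of "\<lambda>n. S \<inter> ipow I n W"] smn by blast
 have "S \<inter> ipow I (c + k) W \<subseteq> ipow I k S" for k
 proof (induction k)
  case (Suc k)
  have "S \<inter> ipow I (c + Suc k) W = ip I (S \<inter> ipow I (c + k) W)" using c[of "c + k"] by simp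
  also have "\<dots> \<subseteq> ip I (ipow I k S)"
   by (rule ip_mono[OF I_sub sm_subset[OF sm_ipow[OF I_sub assms(1)]] order.refl Suc])
  finally show ?case by (simp add: ipow_Suc)
 qed simp
 then have "S \<inter> ipow I n W \<subseteq> ipow I (n - c) S" if "n \<ge> c" for n using that by (metis le_add_diff_inverse)
 then show ?thesis by blast
qed

lemma artin_rees_mod:
 assumes "sm Y" "sm S" "sm W"
 shows "\<exists>c. \<forall>n\<ge>c. S \<inter> (Y [+] ipow I n W) \<subseteq> Y [+] ipow I (n - c) S"
proof -
 have sY: "sm (S [+] Y)" using assms by (intro sm_psum)
 obtain c where c: "\<And>n. n \<ge> c ==> (S [+] Y) \<inter> ipow I n W \<subseteq> ipow I (n - c) (S [+] Y)"
  using artin_rees[OF sY assms(3)] by blast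
 have "S \<inter> (Y [+] ipow I n W) \<subseteq> Y [+] ipow I (n - c) S" if n: "n \<ge> c" for n
 proof
  fix u assume u: "u \<in> S \<inter> (Y [+] ipow I n W)"
  then obtain y v where *: "y \<in> Y" "v \<in> ipow I n W" "u = y +. v" by (auto elim!: psumE)
  have car: "y \<in> carrier M" "v \<in> carrier M" "u \<in> carrier M"
   using * u sm_carr assms sm_ipow[OF I_sub assms(3)] by blast+
  have "v = u +. \<ominus>\<^bsub>M\<^esub> y" using add_sub_cancel_l[of y v] * car by (simp add: M.minus_eq)
  then have "v \<in> S [+] Y" using u *(1) sm_neg[OF assms(1)] by (auto intro: psumI)
  then have "v \<in> ipow I (n - c) S [+] ipow I (n - c) Y" using c[OF n] * ipow_psum[OF I_sub assms(2,1)] by blast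
  moreover have "ipow I (n - c) S [+] ipow I (n - c) Y \<subseteq> Y [+] ipow I (n - c) S"
   using psum_upper1[OF sm_subset[OF assms(1)] sm_ipow[OF I_sub assms(2)]] psum_upper2[OF assms(1) sm_subset[OF sm_ipow[OF I_sub assms(2)]]]
    order_trans[OF ipow_subset[OF I_sub assms(1)]]
   by (intro psum_least sm_psum sm_ipow I_sub assms) auto
  ultimately have "v \<in> Y [+] ipow I (n - c) S" by blast
  moreover have "y \<in> Y [+] ipow I (n - c) S"
   using psum_upper1[OF sm_subset[OF assms(1)] sm_ipow[OF I_sub assms(2)]] *(1) by blast
  ultimately show "u \<in> Y [+] ipow I (n - c) S"
   using sm_add[OF sm_psum[OF assms(1) sm_ipow[OF I_sub assms(2)]]] *(3) by blast
 qed
 then show ?thesis by blast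
qed

text \<open>A nonzerodivisor modulo \<open>Y\<close> lowers the order by a bounded amount: apply Artin-Rees to the image of multiplication by \<open>x\<close>.\<close>

lemma artin_rees_mult:
 assumes "sm Y" "sm W" "x \<in> carrier R" "\<And>u. u \<in> W ==> x *. u \<in> Y ==> u \<in> Y"
 shows "\<exists>c. \<forall>n\<ge>c. \<forall>u\<in>W. x *. u \<in> Y [+] ipow I n W \<longrightarrow> u \<in> Y [+] ipow I (n - c) W"
proof -
 have sx: "sm (sc x W)" by (rule sm_sc[OF assms(3,2)])
 obtain c where c: "\<And>n. n \<ge> c ==> sc x W \<inter> (Y [+] ipow I n W) \<subseteq> Y [+] ipow I (n - c) (sc x W)"
  using artin_rees_mod[OF assms(1) sx assms(2)] by blast
 have "u \<in> Y [+] ipow I (n - c) W" if n: "n \<ge> c" and u: "u \<in> W" "x *. u \<in> Y [+] ipow I n W" for n u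
 proof -
  have "x *. u \<in> Y [+] sc x (ipow I (n - c) W)" using c[OF n] u scI sc_ipow[OF assms(3) I_sub assms(2)] by auto
  then obtain y w where *: "y \<in> Y" "w \<in> ipow I (n - c) W" "x *. u = y +. x *. w"
   unfolding sc_def by (auto elim!: psumE)
  have wW: "w \<in> W" using *(2) ipow_subset[OF I_sub assms(2)] by blast
  have car: "y \<in> carrier M" "w \<in> carrier M" "u \<in> carrier M" using * u wW sm_carr assms(1,2) by blast+
  have "x *. (u -. w) = y" using * car assms(3) by (simp add: smult_sub add_sub_cancel)
  then have "u -. w \<in> Y" using assms(4)[of "u -. w"] sm_sub[OF assms(2) u(1) wW] *(1) by simp
  then show ?thesis using psumI[of "u -. w" Y w] *(2) sub_add_cancel car by fastforce
 qed
 then show ?thesis by blast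
qed

text \<open>By Artin-Rees for the cyclic submodule \<open>Rz\<close>, the hypothesis gives \<open>z \<in> Y + Iz\<close>.\<close>

lemma krull_intersection:
 assumes "sm Y" "z \<in> carrier M" "\<And>q. z \<in> Y [+] ipow I q (carrier M)"
 shows "\<exists>a\<in>I. z -. a *. z \<in> Y"
proof -
 obtain c where c: "\<And>n. n \<ge> c ==> cyc z \<inter> (Y [+] ipow I n (carrier M)) \<subseteq> Y [+] ipow I (n - c) (cyc z)"
  using artin_rees_mod[OF assms(1) sm_cyc[OF assms(2)] sm_carrier] by blast
 have "z \<in> Y [+] ipow I 1 (cyc z)" using c[of "Suc c"] assms(3) cyc_self[OF assms(2)] by auto
 then have "z \<in> Y [+] {a *. z |a. a \<in> I}" using ip_cyc[OF I_ideal assms(2)] ipow_Suc[of I 0] by simp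
 then obtain y a where *: "y \<in> Y" "a \<in> I" "z = y +. a *. z" by (auto elim!: psumE)
 have "z -. a *. z = y"
  using add_sub_cancel[of y "a *. z"] * sm_carr[OF assms(1)] assms(2) I_sub by auto
 then show ?thesis using * by blast
qed

end

section \<open>Orders of growth\<close>

definition small :: "nat => (nat => nat) => bool"
 where "small r p \<longleftrightarrow> (\<lambda>n. real (p n) / real n ^ r) \<longlonglongrightarrow> 0"

lemma small_mono:
 assumes "small r q" "\<And>n. n \<ge> n0 ==> p n \<le> q n" shows "small r p"
 unfolding small_def
proof (rule tendsto_sandwich[OF _ _ tendsto_const assms(1)[unfolded small_def]])
 show "\<forall>\<^sub>F n in sequentially. 0 \<le> real (p n) / real n ^ r" by simp
 show "\<forall>\<^sub>F n in sequentially. real (p n) / real n ^ r \<le> real (q n) / real n ^ r"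
  using eventually_ge_at_top[of n0] by eventually_elim (simp add: assms(2) divide_right_mono)
qed

lemma small_zero: "small r (\<lambda>_. 0)" by (simp add: small_def)

lemma small_add: "small r p ==> small r q ==> small r (\<lambda>n. p n + q n)"
 unfolding small_def using tendsto_add[of "\<lambda>n. real (p n) / real n ^ r" 0 sequentially "\<lambda>n. real (q n) / real n ^ r" 0]
 by (simp add: add_divide_distrib)

lemma small_cmult: "small r p ==> small r (\<lambda>n. k * p n)"
 unfolding small_def using tendsto_mult_left_zero[of "\<lambda>n. real (p n) / real n ^ r" sequentially "real k"]
 by (simp add: mult.commute)

lemma small_const: "small (Suc r) (\<lambda>_. k)"
proof -
 have "(\<lambda>n. real k / real n ^ Suc r) \<longlonglongrightarrow> 0"
  by (rule tendsto_divide_0[OF tendsto_const])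
   (intro filterlim_at_top_imp_at_infinity filterlim_pow_at_top filterlim_real_sequentially zero_less_Suc)
 then show ?thesis by (simp add: small_def)
qed

lemma small_shift: assumes "small r p" shows "small r (\<lambda>n. p (n + c))"
proof -
 have "(\<lambda>n. (real (n + c) / real n) ^ r) \<longlonglongrightarrow> 1 ^ r"
 proof (rule tendsto_power)
  have "(\<lambda>n. 1 + real c / real n) \<longlonglongrightarrow> 1 + 0"
   by (intro tendsto_add tendsto_const lim_const_over_n)
  moreover have "\<forall>\<^sub>F n in sequentially. 1 + real c / real n = real (n + c) / real n"
   using eventually_gt_at_top[of 0] by eventually_elim (simp add: field_simps)
  ultimately show "(\<lambda>n. real (n + c) / real n) \<longlonglongrightarrow> 1" using tendsto_cong by fastforce
 qed
 moreover have "(\<lambda>n. real (p (n + c)) / real (n + c) ^ r) \<longlonglongrightarrow> 0"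
  using LIMSEQ_ignore_initial_segment[OF assms[unfolded small_def], of c] .
 ultimately have "(\<lambda>n. real (p (n + c)) / real (n + c) ^ r * (real (n + c) / real n) ^ r) \<longlonglongrightarrow> 0 * 1 ^ r"
  by (rule tendsto_mult[rotated])
 moreover have "\<forall>\<^sub>F n in sequentially. real (p (n + c)) / real (n + c) ^ r * (real (n + c) / real n) ^ r = real (p (n + c)) / real n ^ r"
  using eventually_gt_at_top[of 0] by eventually_elim (simp add: power_divide)
 ultimately show ?thesis unfolding small_def using tendsto_cong by fastforce
qed

lemma small_unshift: assumes "small r (\<lambda>n. p (n - c))" shows "small r p"
 using small_shift[OF assms, of c] by simp

lemma small_sum:
 assumes "\<And>n. l (Suc n) \<le> l n + q (Suc n)" "small r q" shows "small (Suc r) l"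
 unfolding small_def
proof (rule LIMSEQ_I)
 fix e :: real assume e: "e > 0"
 obtain n0 where n0: "\<And>k. k \<ge> n0 ==> norm (real (q k) / real k ^ r - 0) < e / 2"
  using LIMSEQ_D[OF assms(2)[unfolded small_def], of "e / 2"] e by auto
 have qk: "real (q k) \<le> e / 2 * real k ^ r" if "k \<ge> Suc n0" for k
 proof -
  have "real (q k) / real k ^ r < e / 2" using n0[of k] that by simp
  moreover have "real k ^ r > 0" using that by simp
  ultimately show ?thesis by (simp add: field_simps)
 qed
 have l: "real (l n) \<le> real (l (Suc n0)) + real (n - Suc n0) * (e / 2 * real n ^ r)" if "n \<ge> Suc n0" for n
  using that
 proof (induction n rule: dec_induct)
  case (step n)
  have "real (l (Suc n)) \<le> real (l n) + real (q (Suc n))" using assms(1)[of n] by linarith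
  also have "\<dots> \<le> real (l (Suc n0)) + real (n - Suc n0) * (e / 2 * real n ^ r) + e / 2 * real (Suc n) ^ r"
   using step qk[of "Suc n"] by linarith
  also have "\<dots> \<le> real (l (Suc n0)) + real (n - Suc n0) * (e / 2 * real (Suc n) ^ r) + e / 2 * real (Suc n) ^ r"
   using e by (intro add_mono mult_left_mono power_mono) auto
  also have "\<dots> = real (l (Suc n0)) + real (Suc n - Suc n0) * (e / 2 * real (Suc n) ^ r)"
  proof -
   have "Suc n - Suc n0 = Suc (n - Suc n0)" using step by simp
   then show ?thesis by (simp only: of_nat_Suc distrib_right mult_1 add.assoc add.commute)
  qed
  finally show ?case .
 qed simp
 obtain n1 where n1: "\<And>n. n \<ge> n1 ==> norm (real (l (Suc n0)) / real n ^ Suc r - 0) < e / 2"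
  using LIMSEQ_D[OF small_const[of r "l (Suc n0)", unfolded small_def], of "e / 2"] e by auto
 show "\<exists>no. \<forall>n\<ge>no. norm (real (l n) / real n ^ Suc r - 0) < e"
 proof (intro exI allI impI)
  fix n assume n: "n \<ge> max n1 (Suc n0)"
  have pos: "real n ^ Suc r > 0" using n by simp
  have "real (n - Suc n0) * (e / 2 * real n ^ r) \<le> real n * (e / 2 * real n ^ r)"
   using e by (intro mult_right_mono) auto
  then have "real (l n) \<le> real (l (Suc n0)) + e / 2 * real n ^ Suc r" using l[of n] n by (simp add: mult_ac)
  then have "real (l n) / real n ^ Suc r \<le> (real (l (Suc n0)) + e / 2 * real n ^ Suc r) / real n ^ Suc r"
   using pos by (intro divide_right_mono) auto
  then have "real (l n) / real n ^ Suc r \<le> real (l (Suc n0)) / real n ^ Suc r + e / 2"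
   using pos by (simp only: add_divide_distrib nonzero_mult_div_cancel_right)
  moreover have "real (l (Suc n0)) / real n ^ Suc r < e / 2" using n1[of n] n by (simp del: power_Suc)
  moreover have "real (l n) / real n ^ Suc r \<ge> 0" by simp
  ultimately show "norm (real (l n) / real n ^ Suc r - 0) < e" unfolding real_norm_def by linarith
 qed
qed

text \<open>If \<open>q\<close> is bounded by the increments of \<open>l\<close> over steps of length \<open>c\<close> and is increasing, then adding up \<open>k\<close> increments gives \<open>k q(n) \<le> l(n + kd)\<close>. The choice \<open>k = n\<close> shows that \<open>q\<close> grows one order slower than \<open>l\<close>.\<close>

lemma small_diff:
 assumes add: "\<And>n. n \<ge> c ==> q n + l (n - c) \<le> l n" and q: "mono q" and l: "mono l" and s: "small (Suc r) l"
 shows "small r q"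
proof -
 define d where "d = Suc c"
 have add': "q n + l (n - d) \<le> l n" if "n \<ge> d" for n
 proof -
  have "l (n - d) \<le> l (n - c)" by (rule monoD[OF l]) (simp add: d_def diff_le_mono2)
  then show ?thesis using add[of n] that by (simp add: d_def)
 qed
 have *: "k * q n \<le> l (n + k * d)" for k n
 proof (induction k)
  case (Suc k)
  have "q n \<le> q (n + Suc k * d)" by (rule monoD[OF q]) simp
  then show ?case using Suc add'[of "n + Suc k * d"] by (simp add: algebra_simps)
 qed simp
 let ?f = "\<lambda>n. real (l (n * Suc d)) / real (n * Suc d) ^ Suc r"
 have "filterlim (\<lambda>n. n * Suc d) sequentially sequentially"
  by (rule filterlim_subseq, rule strict_monoI) (metis mult_less_mono1 zero_less_Suc)
 then have "?f \<longlonglongrightarrow> 0" using filterlim_compose[OF s[unfolded small_def], of "\<lambda>n. n * Suc d"] by simp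
 then have f: "(\<lambda>n. real (Suc d) ^ Suc r * ?f n) \<longlonglongrightarrow> 0" by (rule tendsto_mult_right_zero)
 show ?thesis unfolding small_def
 proof (rule tendsto_sandwich[OF _ _ tendsto_const f])
  show "\<forall>\<^sub>F n in sequentially. real (q n) / real n ^ r \<le> real (Suc d) ^ Suc r * ?f n"
   using eventually_gt_at_top[of 0]
  proof eventually_elim
   case (elim n)
   have "real n * real (q n) \<le> real (l (n * Suc d))" using *[of n n] by (simp flip: of_nat_mult)
   then have "real (q n) / real n ^ r \<le> real (l (n * Suc d)) / real n ^ Suc r" using elim by (simp add: field_simps)
   also have "\<dots> = real (Suc d) ^ Suc r * ?f n" 
    using elim by (simp only: of_nat_mult power_mult_distrib) simp
   finally show ?case .
  qed
 qed simp
qed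

section \<open>Colength functions and chains of primes\<close>

context rmod begin

lemma psum_ub1: "sm H ==> sm K ==> H \<subseteq> H [+] K"
 by (rule psum_upper1[OF sm_subset])
lemma psum_ub2: "sm H ==> sm K ==> K \<subseteq> H [+] K"
 by (rule psum_upper2[OF _ sm_subset])
lemma psum_null: assumes "sm H" shows "{\<zero>\<^bsub>M\<^esub>} [+] H = H"
 using psum_ub2[OF sm_null assms] psum_least[OF assms, of "{\<zero>\<^bsub>M\<^esub>}" H] sm_zero[OF assms] by blast
lemma acc_refl: "acc V V"
 unfolding acc_def by (metis subset_antisym)

text \<open>\<open>x\<close> is a nonzerodivisor on \<open>M/Y\<close>.\<close>

definition nzd :: "'a => 'b set => bool"
 where "nzd x Y \<longleftrightarrow> (\<forall>u\<in>carrier M. x *. u \<in> Y \<longrightarrow> u \<in> Y)"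

text \<open>There is a regular sequence of length \<open>r\<close> in \<open>I\<close> on \<open>M/Y\<close>. The quotient by the whole sequence may vanish; in particular the zero module satisfies this for every ideal \<open>I\<close> and all \<open>r\<close>.\<close>

primrec dep :: "'a set => nat => 'b set => bool" where
 "dep I 0 Y \<longleftrightarrow> True"
| "dep I (Suc r) Y \<longleftrightarrow> (\<exists>x\<in>I. nzd x Y \<and> dep I r (Y [+] sc x (carrier M)))"

text \<open>The Hilbert-Samuel function of \<open>M/Y\<close>.\<close>

definition hs :: "'a set => 'b set => nat => nat"
 where "hs I Y n = the_enat (len (Y [+] ipow I n (carrier M)) (carrier M))"

lemma ann_hom: "z \<in> carrier M ==> (\<lambda>a. a *. z) \<in> mod_hom R (self_mod R) M"
 unfolding mod_hom_def by (auto simp: smult_l_distr smult_assoc1)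
lemma ann_rhom: "z \<in> carrier M ==> rhom R (self_mod R) M (\<lambda>a. a *. z)"
 by (intro rhom.intro rhom_axioms.intro ann_hom self_rmod R.is_cring) (rule rmod_axioms)

lemma ideal_colon: assumes "sm Y" "z \<in> carrier M" shows "ideal {a \<in> carrier R. a *. z \<in> Y} R"
proof -
 interpret h: rhom R "self_mod R" M "\<lambda>a. a *. z" by (rule ann_rhom[OF assms(2)])
 have "h.M.sm {a \<in> carrier (self_mod R). a *. z \<in> Y}" by (rule h.sm_vimage[OF h.M.sm_carrier assms(1)])
 then show ?thesis using self_sm_iff[OF R.is_cring] by simp
qed

end

locale fin_mod = noeth_mod +
 assumes fin_M: "\<And>n. len (ipow I n (carrier M)) (carrier M) \<noteq> \<infinity>"
begin

abbreviation J :: "nat => 'b set" where "J n \<equiv> ipow I n (carrier M)"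

lemma smJ: "sm (J n)" by (rule sm_ipow[OF I_sub sm_carrier])
lemma J_le: "J n \<subseteq> carrier M" by (rule sm_subset[OF smJ])

lemma hsE: assumes "sm Y" shows "len (Y [+] J n) (carrier M) = enat (hs I Y n)"
proof -
 have "len (Y [+] J n) (carrier M) \<le> len (J n) (carrier M)"
  by (rule len_mono_bot[OF psum_upper2[OF assms J_le]])
 moreover obtain m where "len (J n) (carrier M) = enat m" using fin_M[of n] by auto
 ultimately obtain k where "len (Y [+] J n) (carrier M) = enat k" using enat_ile by auto
 then show ?thesis unfolding hs_def by simp
qed

lemma hs_anti: "sm Y ==> sm Y' ==> Y \<subseteq> Y' ==> hs I Y' n \<le> hs I Y n"
 using len_mono_bot[OF psum_mono[of Y Y' "J n" "J n"], of "carrier M"] hsE[of Y n] hsE[of Y' n] by simp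

lemma hs_mono: assumes "sm Y" shows "mono (hs I Y)"
proof
 fix m n :: nat assume "m \<le> n"
 then have "Y [+] J n \<subseteq> Y [+] J m" by (intro psum_mono ipow_antimono[OF I_sub sm_carrier]) auto
 then show "hs I Y m \<le> hs I Y n" using len_mono_bot[of "Y [+] J n" "Y [+] J m" "carrier M"] hsE[OF assms] by simp
qed

text \<open>By Artin-Rees the kernel of multiplication by \<open>x\<close> from \<open>M\<close> to \<open>M/(Y + I\<^sup>nM)\<close> lies in \<open>Y + I\<^sup>n\<^sup>-\<^sup>cM\<close>. So the length of \<open>M/(Y + xM + I\<^sup>nM)\<close> is at most the increment of the length of \<open>M/(Y + I\<^sup>nM)\<close> over \<open>c\<close> steps, and \<open>small_diff\<close> applies.\<close>

lemma small_nzd: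
 assumes Y: "sm Y" and x: "x \<in> carrier R" "nzd x Y" and s: "small (Suc r) (hs I Y)"
 shows "small r (hs I (Y [+] sc x (carrier M)))"
proof -
 define Y' where "Y' = Y [+] sc x (carrier M)"
 have sx: "sm (sc x (carrier M))" by (rule sm_sc[OF x(1) sm_carrier])
 have Y': "sm Y'" "Y \<subseteq> Y'" unfolding Y'_def using Y sx by (auto intro: sm_psum psum_ub1[THEN subsetD])
 obtain c where c: "\<And>n u. n \<ge> c ==> u \<in> carrier M ==> x *. u \<in> Y [+] J n ==> u \<in> Y [+] J (n - c)"
  using artin_rees_mult[OF Y sm_carrier x(1)] x(2) unfolding nzd_def by blast
 interpret h: rhom R M M "\<lambda>u. x *. u" by (rule smult_rhom[OF x(1)])
 have sYJ: "sm (Y [+] J n)" "sm (Y' [+] J n)" for n using Y Y' smJ by (auto intro: sm_psum)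
 have "hs I Y' n + hs I Y (n - c) \<le> hs I Y n" if n: "n \<ge> c" for n
 proof -
  have "len (Y [+] J (n - c)) (carrier M) \<le> len (Y [+] J n) (Y' [+] J n)"
  proof (rule h.len_le_hom)
   fix u assume u: "u \<in> carrier M"
   have "x *. u \<in> Y'" using psum_upper2[OF Y sm_subset[OF sx]] u unfolding Y'_def by (auto intro: scI)
   then show "x *. u \<in> Y' [+] J n" using psum_upper1[OF sm_subset[OF Y'(1)] smJ] by blast
  qed (use c[OF n] sYJ sm_carrier psum_mono[OF Y'(2) order.refl] in auto)
  moreover have "len (Y [+] J n) (carrier M) = len (Y [+] J n) (Y' [+] J n) + len (Y' [+] J n) (carrier M)"
   by (rule len_add) (use sYJ sm_carrier psum_mono[OF Y'(2) order.refl] sm_subset in auto)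
  ultimately have "enat (hs I Y (n - c)) + enat (hs I Y' n) \<le> enat (hs I Y n)"
   unfolding hsE[OF Y] hsE[OF Y'(1)] by (metis add_right_mono)
  then show ?thesis by simp
 qed
 then show ?thesis using small_diff[OF _ hs_mono[OF Y'(1)] hs_mono[OF Y] s] Y'_def by blast
qed

text \<open>Both estimates come from the exact sequence with multiplication by \<open>x\<close> from \<open>M/(Y : x)\<close> to \<open>M/Y\<close> and cokernel \<open>M/(Y + xM)\<close>. In the second one \<open>x \<in> I\<close> raises the order by one.\<close>

lemma hs_colon:
 assumes "sm Y" "x \<in> carrier R"
 shows "hs I Y n \<le> hs I {u \<in> carrier M. x *. u \<in> Y} n + hs I (Y [+] sc x (carrier M)) n"
  and "x \<in> I ==> nzd x Y ==> hs I Y (Suc n) \<le> hs I Y n + hs I (Y [+] sc x (carrier M)) (Suc n)"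
proof -
 define Y' where "Y' = Y [+] sc x (carrier M)"
 have sx: "sm (sc x (carrier M))" by (rule sm_sc[OF assms(2) sm_carrier])
 have Y': "sm Y'" "Y \<subseteq> Y'" unfolding Y'_def using assms(1) sx by (auto intro: sm_psum psum_ub1[THEN subsetD])
 interpret h: rhom R M M "\<lambda>u. x *. u" by (rule smult_rhom[OF assms(2)])
 have sYJ: "sm (Y [+] J n)" "sm (Y' [+] J n)" for n using assms(1) Y' smJ by (auto intro: sm_psum)
 have key: "len (Y [+] J n) (carrier M) \<le> len Z (carrier M) + len (Y' [+] J n) (carrier M)"
  if Z: "sm Z" "\<And>z. z \<in> Z ==> x *. z \<in> Y [+] J n" for n Z
 proof -
  have "len (Y [+] J n) (Y' [+] J n) \<le> len Z (carrier M)"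
  proof (rule h.len_ge_hom)
   fix u assume "u \<in> Y' [+] J n"
   then obtain y v j where *: "y \<in> Y" "v \<in> carrier M" "j \<in> J n" "u = (y +. x *. v) +. j"
    unfolding Y'_def sc_def by (auto elim!: psumE)
   have c: "y \<in> carrier M" "j \<in> carrier M" using * assms(1) smJ sm_carr by blast+
   have "u = (y +. j) +. x *. v" using * c assms(2) by (simp add: M.a_ac)
   then have "u -. x *. v = y +. j" using add_sub_cancel c * assms(2) by simp
   then show "\<exists>v\<in>carrier M. u -. x *. v \<in> Y [+] J n" using * by (metis psumI)
  qed (use Z sYJ sm_carrier sm_subset in auto)
  moreover have "len (Y [+] J n) (carrier M) = len (Y [+] J n) (Y' [+] J n) + len (Y' [+] J n) (carrier M)"
   by (rule len_add) (use sYJ sm_carrier psum_mono[OF Y'(2) order.refl] sm_subset in auto)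
  ultimately show ?thesis by (metis add_right_mono)
 qed
 define Q where "Q = {u \<in> carrier M. x *. u \<in> Y}"
 have Q: "sm Q" unfolding Q_def by (rule sm_colon[OF assms(2) sm_carrier assms(1)])
 have mem: "x *. z \<in> Y [+] J m" if "z \<in> T [+] K" "\<And>t. t \<in> T ==> x *. t \<in> Y" "\<And>t. t \<in> K ==> x *. t \<in> J m"
  "T \<subseteq> carrier M" "K \<subseteq> carrier M" for z T K m
 proof -
  note asm = that
  obtain t k where "t \<in> T" "k \<in> K" "z = t +. k" using asm(1) by (auto elim!: psumE)
  moreover from this have "x *. z = x *. t +. x *. k" using that(4,5) assms(2) smult_r_distr[of x t k] by blast
  ultimately show ?thesis using that(2,3) by (auto intro: psumI)
 qed
 have "len (Y [+] J n) (carrier M) \<le> len (Q [+] J n) (carrier M) + len (Y' [+] J n) (carrier M)"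
 proof (rule key)
  show "sm (Q [+] J n)" by (rule sm_psum[OF Q smJ])
  fix z assume "z \<in> Q [+] J n"
  then show "x *. z \<in> Y [+] J n"
   by (rule mem) (use sm_smult[OF smJ assms(2)] J_le in \<open>auto simp: Q_def\<close>)
 qed
 then show "hs I Y n \<le> hs I {u \<in> carrier M. x *. u \<in> Y} n + hs I (Y [+] sc x (carrier M)) n"
  unfolding hsE[OF assms(1)] hsE[OF Y'(1)] hsE[OF Q] unfolding Q_def Y'_def by simp
 assume x: "x \<in> I" "nzd x Y"
 have "len (Y [+] J (Suc n)) (carrier M) \<le> len (Y [+] J n) (carrier M) + len (Y' [+] J (Suc n)) (carrier M)"
 proof (rule key)
  fix z assume "z \<in> Y [+] J n"
  then show "x *. z \<in> Y [+] J (Suc n)"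
   by (rule mem) (use x sm_smult[OF assms(1,2)] sm_subset[OF assms(1)] J_le in \<open>auto simp: ipow_Suc intro: ipI\<close>)
 qed (rule sYJ)
 then show "hs I Y (Suc n) \<le> hs I Y n + hs I (Y [+] sc x (carrier M)) (Suc n)"
  unfolding hsE[OF assms(1)] hsE[OF Y'(1)] unfolding Y'_def by simp
qed

end

lemma (in noeth_mod) max_ideal_exists:
 assumes "\<And>J. Q J ==> ideal J R" "Q J0"
 shows "\<exists>J. Q J \<and> J0 \<subseteq> J \<and> (\<forall>J'. Q J' \<longrightarrow> J \<subseteq> J' \<longrightarrow> J' = J)"
proof (rule ccontr)
 assume neg: "\<not> ?thesis"
 interpret S: rmod R "self_mod R" by (rule self_rmod[OF cringR])
 have sm: "Q J ==> S.sm J" for J using assms(1) self_sm_iff[OF cringR] by blast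
 have ex: "\<exists>J'. Q J' \<and> J0 \<subseteq> J' \<and> J \<subset> J'" if "Q J" "J0 \<subseteq> J" for J using neg that by (metis psubsetI order_trans)
 define nx where "nx J = (SOME J'. Q J' \<and> J0 \<subseteq> J' \<and> J \<subset> J')" for J
 have nx: "Q (nx J) \<and> J0 \<subseteq> nx J \<and> J \<subset> nx J" if "Q J" "J0 \<subseteq> J" for J
  unfolding nx_def by (rule someI_ex[OF ex[OF that]])
 define F where "F n = (nx ^^ n) J0" for n
 have F: "Q (F n) \<and> J0 \<subseteq> F n" for n by (induction n) (use assms(2) nx in \<open>auto simp: F_def\<close>)
 have FS: "F n \<subset> F (Suc n)" for n using nx[of "F n"] F[of n] by (simp add: F_def)
 have "\<exists>n. \<forall>m\<ge>n. F m = F n"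
 proof (rule S.accD[OF acc_R])
  fix i
  show s: "S.sm (F i)" using sm F by blast
  show "{\<zero>} \<subseteq> F i" using S.sm_zero[OF s] by simp
  show "F i \<subseteq> carrier R" using S.sm_subset[OF s] by simp
  show "F i \<subseteq> F (Suc i)" using FS by blast
 qed
 then obtain n where "F (Suc n) = F n" using le_Suc_eq by blast
 then show False using FS[of n] by simp
qed

text \<open>An ideal \<open>P\<close> maximal among those above \<open>L\<close> with large colength function is prime: if \<open>ab \<in> P\<close> with
\<open>a, b \<notin> P\<close>, then \<open>(P : a)\<close> and \<open>P + aR\<close> are strictly larger, so both are small, and by \<open>hs_colon\<close> so is
\<open>P\<close>. If \<open>P\<close> contained \<open>I\<close>, its colength function would be eventually constant. So there is \<open>x \<in> I - P\<close>, and
the growth of \<open>P + xR\<close> is lower than that of \<open>P\<close> by at most one order.\<close>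

lemma prime_chain_of_growth:
 fixes R :: "'a ring"
 assumes "fin_mod R (self_mod R) I" "ideal L R" "\<not> small r (rmod.hs R (self_mod R) I L)"
 shows "\<exists>P :: nat => 'a set. (\<forall>i\<le>r. primeideal (P i) R \<and> L \<subseteq> P i) \<and> (\<forall>i<r. P i \<subset> P (Suc i))"
 using assms(2,3)
proof (induction r arbitrary: L)
 interpret S: fin_mod R "self_mod R" I by fact
 have smI: "S.sm J \<longleftrightarrow> ideal J R" for J by (rule self_sm_iff[OF S.cringR])
 have prime: "\<exists>P. primeideal P R \<and> L \<subseteq> P \<and> \<not> small r (S.hs I P)" if L: "ideal L R" "\<not> small r (S.hs I L)" for L r
 proof -
  obtain P where P: "ideal P R" "\<not> small r (S.hs I P)" "L \<subseteq> P"
   and max: "\<And>J. ideal J R ==> \<not> small r (S.hs I J) ==> P \<subseteq> J ==> J = P"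
   using S.max_ideal_exists[of "\<lambda>J. ideal J R \<and> \<not> small r (S.hs I J)" L] L by auto
  interpret P: ideal P R by fact
  have smP: "S.sm P" using P smI by blast
  have "primeideal P R"
  proof (rule primeidealI[OF P(1) S.cringR])
   show "carrier R \<noteq> P"
   proof
    assume "carrier R = P"
    then have "S.hs I P n = 0" for n
     using S.hsE[OF smP, of n] S.psum_absorb[OF S.sm_carrier S.smJ[of n] S.J_le] S.len_refl
     by (simp add: zero_enat_def)
    then show False using P(2) small_zero[of r] by presburger
   qed
   fix a b assume ab: "a \<in> carrier R" "b \<in> carrier R" "a \<otimes>\<^bsub>R\<^esub> b \<in> P"
   show "a \<in> P \<or> b \<in> P"
   proof (rule ccontr)
    assume n: "\<not> (a \<in> P \<or> b \<in> P)"
    define Q where "Q = {u \<in> carrier R. a \<otimes>\<^bsub>R\<^esub> u \<in> P}"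
    define T where "T = S.psum P (S.sc a (carrier R))"
    have Q: "ideal Q R" unfolding Q_def smI[symmetric]
     using S.sm_colon[of a "carrier R" P] ab smP S.sm_carrier by simp
    have sc: "S.sm (S.sc a (carrier R))" using S.sm_sc[OF ab(1) S.sm_carrier] by simp
    have T: "ideal T R" unfolding T_def smI[symmetric] by (rule S.sm_psum[OF smP sc])
    have PT: "P \<subseteq> T" unfolding T_def by (rule S.psum_upper1[OF S.sm_subset[OF smP] sc])
    have "a \<in> S.sc a (carrier R)" using S.scI[of "\<one>\<^bsub>R\<^esub>" "carrier R" a] ab by simp
    then have "a \<in> T" unfolding T_def using S.psum_upper2[OF smP S.sm_subset[OF sc]] by blast
    then have "small r (S.hs I T)" using max[OF T] PT n by blast
    moreover have "small r (S.hs I Q)"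
    proof -
     have "P \<subseteq> Q" unfolding Q_def using ab(1) P.I_l_closed P.Icarr by blast
     moreover have "b \<in> Q" using ab by (simp add: Q_def)
     ultimately show ?thesis using max[OF Q] n by blast
    qed
    ultimately have "small r (\<lambda>n. S.hs I Q n + S.hs I T n)" by (rule small_add[rotated])
    then have "small r (S.hs I P)"
     by (rule small_mono) (use S.hs_colon(1)[OF smP ab(1)] in \<open>simp add: Q_def T_def\<close>)
    then show False using P(2) by blast
   qed
  qed
  then show ?thesis using P by blast
 qed
 {
  case 0
  then obtain P where "primeideal P R" "L \<subseteq> P" using prime by blast
  then show ?case by (intro exI[of _ "\<lambda>_. P"]) auto
 next
  case (Suc r)
  obtain P where P: "primeideal P R" "L \<subseteq> P" "\<not> small (Suc r) (S.hs I P)" using prime[OF Suc.prems] by blast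
  interpret P: primeideal P R by fact
  have smP: "S.sm P" using P.is_ideal smI by blast
  have "\<not> I \<subseteq> P"
  proof
   assume le: "I \<subseteq> P"
   have "S.hs I P n = S.hs I P 1" if "n \<ge> 1" for n
   proof -
    have "S.J m \<subseteq> P" if "m \<ge> 1" for m
    proof -
     have "S.J m \<subseteq> S.J 1" by (rule S.ipow_antimono[OF S.I_sub S.sm_carrier that])
     also have "\<dots> \<subseteq> P" unfolding One_nat_def S.ipow_Suc S.ipow_0
      by (rule S.ip_least[OF smP]) (use le P.I_r_closed in auto)
     finally show ?thesis .
    qed
    then have "S.psum P (S.J m) = P" if "m \<ge> 1" for m using S.psum_absorb[OF smP S.smJ] that by blast
    then show ?thesis using that unfolding S.hs_def by simp
   qed
   note const = this
   have "small (Suc r) (S.hs I P)"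
   proof (rule small_mono[OF small_const[of r "S.hs I P 1"]])
    show "S.hs I P n \<le> S.hs I P 1" if "n \<ge> 1" for n using const[OF that] by (rule eq_refl)
   qed
   then show False using P(3) by blast
  qed
  then obtain x where x: "x \<in> I" "x \<notin> P" by blast
  have xR: "x \<in> carrier R" using x S.I_sub by blast
  have nz: "S.nzd x P" unfolding S.nzd_def using P.I_prime[OF xR] x by auto
  define T where "T = S.psum P (S.sc x (carrier R))"
  have sc: "S.sm (S.sc x (carrier R))" using S.sm_sc[OF xR S.sm_carrier] by simp
  have T: "ideal T R" unfolding T_def smI[symmetric] by (rule S.sm_psum[OF smP sc])
  have PT: "P \<subseteq> T" unfolding T_def by (rule S.psum_upper1[OF S.sm_subset[OF smP] sc])
  have "x \<in> S.sc x (carrier R)" using S.scI[of "\<one>\<^bsub>R\<^esub>" "carrier R" x] xR by simp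
  then have xT: "x \<in> T" unfolding T_def using S.psum_upper2[OF smP S.sm_subset[OF sc]] by blast
  have "\<not> small r (S.hs I T)"
   using small_sum[of "S.hs I P" "S.hs I T" r] S.hs_colon(2)[OF smP xR x(1) nz] P(3) by (auto simp: T_def)
  then obtain Q where Q: "\<forall>i\<le>r. primeideal (Q i) R \<and> T \<subseteq> Q i" "\<forall>i<r. Q i \<subset> Q (Suc i)" using Suc.IH[OF T] by blast
  have LQ: "L \<subseteq> Q i" if "i \<le> r" for i using Q(1) PT P(2) that by blast
  have "P \<subset> Q 0" using Q(1) PT xT x(2) by blast
  then show ?case
   by (intro exI[of _ "\<lambda>i. case i of 0 => P | Suc i => Q i"])
    (use Q P LQ in \<open>auto split: nat.splits simp: less_Suc_eq_0_disj\<close>)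
 }
qed

section \<open>Growth of submodules of modules of positive depth\<close>

locale fin_pair = noeth_mod +
 assumes fin_R: "fin_mod R (self_mod R) I"

sublocale fin_pair \<subseteq> S: fin_mod R "self_mod R" I by (rule fin_R)

context fin_pair begin

abbreviation JM :: "nat => 'b set" where "JM n \<equiv> ipow I n (carrier M)"
lemma smJM: "sm (JM n)" by (rule sm_ipow[OF I_sub sm_carrier])

abbreviation cln :: "'b set => 'b => 'a set" where "cln Y z \<equiv> {a \<in> carrier R. a *. z \<in> Y}"

lemma sm_cln: "sm Y ==> z \<in> carrier M ==> S.sm (cln Y z)"
 using ideal_colon self_sm_iff[OF cringR] by blast

lemma ipow_cyc: assumes "z \<in> carrier M" shows "(\<lambda>a. a *. z) ` S.J n = ipow I n (cyc z)"
proof -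
 interpret h: rhom R "self_mod R" M "\<lambda>a. a *. z" by (rule ann_rhom[OF assms])
 have "(\<lambda>a. a *. z) ` carrier (self_mod R) = cyc z" by (auto simp: cyc_def)
 then show ?thesis using h.image_ipow[OF I_sub S.sm_carrier, of n] by simp
qed

lemma J_smult: assumes "z \<in> carrier M" "b \<in> S.J n" shows "b *. z \<in> JM n"
 using ipow_cyc[OF assms(1), of n] ipow_mono[OF I_sub sm_carrier sm_cyc[OF assms(1)] sm_subset[OF sm_cyc[OF assms(1)]], of n] assms(2)
 by blast

text \<open>From \<open>z \<in> Y + az + I\<^sup>qM\<close> the order of \<open>z\<close> modulo \<open>Y\<close> can be raised step by step up to \<open>q\<close>.\<close>

lemma absorb_multiple:
 assumes Y: "sm Y" and z: "z \<in> carrier M" and a: "a \<in> I" "z -. a *. z \<in> Y [+] JM q"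
 shows "z \<in> Y [+] JM q"
proof -
 have aR: "a \<in> carrier R" using a I_sub by blast
 have sYJ: "sm (Y [+] JM m)" for m by (rule sm_psum[OF Y smJM])
 have "j \<le> q ==> z \<in> Y [+] JM j" for j
 proof (induction j)
  case 0 then show ?case using psum_upper2[OF Y, of "carrier M"] z by auto
 next
  case (Suc j)
  then obtain y w where *: "y \<in> Y" "w \<in> JM j" "z = y +. w" by (auto elim!: psumE)
  have c: "y \<in> carrier M" "w \<in> carrier M" using * Y smJM sm_carr by blast+
  have "a *. z = a *. y +. a *. w" using * c aR by (simp add: smult_r_distr)
  moreover have "a *. w \<in> JM (Suc j)" using a(1) *(2) by (simp add: ipow_Suc ipI)
  ultimately have az: "a *. z \<in> Y [+] JM (Suc j)" using sm_smult[OF Y aR *(1)] by (auto intro: psumI)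
  have "Y [+] JM q \<subseteq> Y [+] JM (Suc j)" using Suc.prems by (intro psum_mono ipow_antimono[OF I_sub sm_carrier]) auto
  then have "z -. a *. z \<in> Y [+] JM (Suc j)" using a(2) by blast
  then show ?case using sm_sub_mem[OF sYJ az z] by blast
 qed
 then show ?thesis by blast
qed

text \<open>If \<open>z\<close> is not separated from \<open>Y + xM\<close> by a power of \<open>I\<close>, Krull's theorem writes \<open>z - az = y + x z\<^sub>1\<close> with \<open>a \<in> I\<close>.
Then \<open>z\<^sub>1\<close> has a larger annihilator modulo \<open>Y\<close>, and its order modulo \<open>Y\<close> is smaller than that of \<open>z\<close>. The
order cannot drop forever.\<close>

lemma separated_descend:
 assumes Y: "sm Y" and x: "x \<in> I" "nzd x Y"
 shows "z \<in> carrier M ==> z \<notin> Y [+] JM q ==>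
  \<exists>z' q'. z' \<in> carrier M \<and> z' \<notin> (Y [+] sc x (carrier M)) [+] JM q' \<and> cln Y z \<subseteq> cln Y z'"
proof (induction q arbitrary: z)
 case 0
 then show ?case using psum_upper2[OF Y, of "carrier M"] by auto
next
 case (Suc q)
 define Y' where "Y' = Y [+] sc x (carrier M)"
 have xR: "x \<in> carrier R" using x I_sub by blast
 have sx: "sm (sc x (carrier M))" by (rule sm_sc[OF xR sm_carrier])
 have Y': "sm Y'" unfolding Y'_def using Y sx by (intro sm_psum)
 show ?case
 proof (cases "\<exists>q'. z \<notin> Y' [+] JM q'")
  case True then show ?thesis using Suc.prems unfolding Y'_def by blast
 next
  case False
  then obtain a where a: "a \<in> I" "z -. a *. z \<in> Y'" using krull_intersection[OF Y' Suc.prems(1)] by blast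
  then obtain y z1 where *: "y \<in> Y" "z1 \<in> carrier M" "z -. a *. z = y +. x *. z1"
   unfolding Y'_def sc_def by (auto elim!: psumE)
  have aR: "a \<in> carrier R" using a I_sub by blast
  have yM: "y \<in> carrier M" using * Y sm_carr by blast
  have sYJ: "sm (Y [+] JM m)" for m by (rule sm_psum[OF Y smJM])
  have "z1 \<notin> Y [+] JM q"
  proof
   assume "z1 \<in> Y [+] JM q"
   then obtain y' j where z1: "y' \<in> Y" "j \<in> JM q" "z1 = y' +. j" by (auto elim!: psumE)
   have c: "j \<in> carrier M" "y' \<in> carrier M" using z1 smJM Y sm_carr by blast+
   have xj: "x *. j \<in> JM (Suc q)" using x(1) z1(2) by (simp add: ipow_Suc ipI)
   have xy: "x *. y' \<in> Y" using sm_smult[OF Y xR z1(1)] .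
   have "z -. a *. z = (y +. x *. y') +. x *. j"
    using * z1 c yM xR by (simp add: smult_r_distr M.a_assoc)
   then have "z -. a *. z \<in> Y [+] JM (Suc q)" using psumI[OF sm_add[OF Y *(1) xy] xj] by simp
   then show False using absorb_multiple[OF Y Suc.prems(1) a(1)] Suc.prems(2) by blast
  qed
  then obtain z' q' where z': "z' \<in> carrier M" "z' \<notin> (Y [+] sc x (carrier M)) [+] JM q'" "cln Y z1 \<subseteq> cln Y z'"
   using Suc.IH[OF *(2)] by blast
  have "cln Y z \<subseteq> cln Y z1"
  proof
   fix b assume "b \<in> cln Y z"
   then have b: "b \<in> carrier R" "b *. z \<in> Y" by auto
   have "b *. (z -. a *. z) = b *. z -. a *. (b *. z)"
    using b aR Suc.prems(1) by (simp add: smult_sub smult_commute)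
   also have "\<dots> \<in> Y" by (intro sm_sub[OF Y] sm_smult[OF Y] b aR)
   finally have "b *. (y +. x *. z1) \<in> Y" using * by simp
   moreover have "b *. (y +. x *. z1) = x *. (b *. z1) +. b *. y"
    using b xR * yM by (simp add: smult_r_distr smult_commute M.a_comm)
   ultimately have "x *. (b *. z1) \<in> Y"
    using sm_add_mem[OF Y sm_smult[OF Y b(1) *(1)]] b xR * by simp
   then show "b \<in> cln Y z1" using x(2) b * unfolding nzd_def by simp
  qed
  then show ?thesis using z' by blast
 qed
qed

text \<open>Choose \<open>z'\<close> as in \<open>separated_descend\<close> and put \<open>L = (Y : z')\<close>. Then \<open>L + xR \<subseteq> (Y + xM : z')\<close>, where the right-hand
side is large of order \<open>r\<close> by induction. As \<open>x\<close> is a nonzerodivisor on \<open>R/L\<close>, the ring \<open>R/L\<close> grows one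
order faster, and \<open>(Y : z) \<subseteq> L\<close>.\<close>

lemma depth_growth:
 "sm Y ==> dep I r Y ==> z \<in> carrier M ==> z \<notin> Y [+] JM q ==> \<not> small r (S.hs I (cln Y z))"
proof (induction r arbitrary: Y z q)
 case 0
 have sc: "S.sm (cln Y z)" by (rule sm_cln[OF 0(1,3)])
 have "S.hs I (cln Y z) n \<ge> 1" if n: "n \<ge> q" for n
 proof (rule ccontr)
  assume "\<not> 1 \<le> S.hs I (cln Y z) n"
  then have "S.len (S.psum (cln Y z) (S.J n)) (carrier R) = 0"
   using S.hsE[OF sc, of n] by (simp add: zero_enat_def)
  then have "S.psum (cln Y z) (S.J n) = carrier R"
   using S.len_eq_0_imp[OF _ S.sm_psum[OF sc S.smJ]] S.sm_carrier S.sm_subset[OF S.sm_psum[OF sc S.smJ]] by simp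
  then have "\<one>\<^bsub>R\<^esub> \<in> S.psum (cln Y z) (S.J n)" by simp
  then obtain a b where ab: "a \<in> cln Y z" "b \<in> S.J n" "\<one>\<^bsub>R\<^esub> = a \<oplus>\<^bsub>R\<^esub> b" by (auto elim!: S.psumE)
  have bR: "b \<in> carrier R" using ab(2) S.J_le by auto
  have "z = (a \<oplus>\<^bsub>R\<^esub> b) *. z" unfolding ab(3)[symmetric] using 0(3) by simp
  also have "\<dots> = a *. z +. b *. z" using ab(1) bR 0(3) by (simp add: smult_l_distr)
  also have "\<dots> \<in> Y [+] JM n" using ab J_smult[OF 0(3)] by (auto intro: psumI)
  also have "\<dots> \<subseteq> Y [+] JM q" by (intro psum_mono ipow_antimono[OF I_sub sm_carrier] n order.refl)
  finally show False using 0(4) by blast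
 qed
 then have ge: "\<forall>\<^sub>F n in sequentially. 1 \<le> real (S.hs I (cln Y z) n)"
  unfolding eventually_sequentially by (intro exI[of _ q]) simp
 show ?case
 proof
  assume "small 0 (S.hs I (cln Y z))"
  then have "(\<lambda>n. real (S.hs I (cln Y z) n)) \<longlonglongrightarrow> 0" by (simp add: small_def)
  then have "(1::real) \<le> 0" by (rule tendsto_lowerbound[OF _ ge]) simp
  then show False by simp
 qed
next
 case (Suc r)
 then obtain x where x: "x \<in> I" "nzd x Y" "dep I r (Y [+] sc x (carrier M))" by auto
 define Y' where "Y' = Y [+] sc x (carrier M)"
 have xR: "x \<in> carrier R" using x I_sub by blast
 have sx: "sm (sc x (carrier M))" by (rule sm_sc[OF xR sm_carrier])
 have Y': "sm Y'" "Y \<subseteq> Y'" unfolding Y'_def using Suc.prems(1) sx by (auto intro: sm_psum psum_ub1[THEN subsetD])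
 obtain z' q' where z': "z' \<in> carrier M" "z' \<notin> Y' [+] JM q'" "cln Y z \<subseteq> cln Y z'"
  using separated_descend[OF Suc.prems(1) x(1,2) Suc.prems(3,4)] unfolding Y'_def by blast
 have n1: "\<not> small r (S.hs I (cln Y' z'))" using Suc.IH[OF Y'(1) _ z'(1,2)] x(3) by (simp add: Y'_def)
 define L where "L = cln Y z'"
 have smL: "S.sm L" unfolding L_def by (rule sm_cln[OF Suc.prems(1) z'(1)])
 have scR: "S.sm (S.sc x (carrier R))" using S.sm_sc[OF xR S.sm_carrier] by simp
 have smT: "S.sm (S.psum L (S.sc x (carrier R)))" by (rule S.sm_psum[OF smL scR])
 have sub: "S.psum L (S.sc x (carrier R)) \<subseteq> cln Y' z'"
 proof (rule S.psum_least[OF sm_cln[OF Y'(1) z'(1)]])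
  show "L \<subseteq> cln Y' z'" unfolding L_def using Y'(2) by auto
  show "S.sc x (carrier R) \<subseteq> cln Y' z'"
  proof
   fix b assume "b \<in> S.sc x (carrier R)"
   then obtain a where a: "a \<in> carrier R" "b = x \<otimes>\<^bsub>R\<^esub> a" unfolding S.sc_def by auto
   then have "b *. z' = x *. (a *. z')" using xR z'(1) by (simp add: smult_assoc1)
   also have "\<dots> \<in> sc x (carrier M)" using a z'(1) by (intro scI) simp
   finally show "b \<in> cln Y' z'" using a xR psum_upper2[OF Suc.prems(1) sm_subset[OF sx]] unfolding Y'_def by auto
  qed
 qed
 have "\<not> small r (S.hs I (S.psum L (S.sc x (carrier R))))"
  using n1 small_mono[of r _ 0 "S.hs I (cln Y' z')"] S.hs_anti[OF smT sm_cln[OF Y'(1) z'(1)] sub] by blast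
 moreover have "S.nzd x L" unfolding S.nzd_def L_def
  using x(2) xR z'(1) unfolding nzd_def by (auto simp: smult_assoc1)
 ultimately have "\<not> small (Suc r) (S.hs I L)"
  using S.small_nzd[OF smL xR] by auto
 then show ?case
  using small_mono[of "Suc r" "S.hs I (cln Y z)" 0 "S.hs I L"]
   S.hs_anti[OF sm_cln[OF Suc.prems(1,3)] smL] z'(3) unfolding L_def by blast
qed

text \<open>Artin-Rees compares the filtration that \<open>M\<close> induces on \<open>Rz = R/(0 : z)\<close> with the \<open>I\<close>-adic one, up to a shift; then \<open>depth_growth\<close> applies to \<open>Y = 0\<close>.\<close>

theorem unmixed_growth:
 assumes "dep I r {\<zero>\<^bsub>M\<^esub>}" "z \<in> carrier M" "z \<notin> JM q"
  and p: "\<And>n. len (JM n) (cyc z [+] JM n) \<le> enat (p n)"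
 shows "\<not> small r p"
proof
 assume "small r p"
 define L where "L = cln {\<zero>\<^bsub>M\<^esub>} z"
 have smL: "S.sm L" unfolding L_def by (rule sm_cln[OF sm_null assms(2)])
 have smc: "sm (cyc z)" by (rule sm_cyc[OF assms(2)])
 have "{\<zero>\<^bsub>M\<^esub>} [+] JM q = JM q"
  by (rule psum_null[OF smJM])
 then have ns: "\<not> small r (S.hs I L)" unfolding L_def using depth_growth[OF sm_null assms(1,2)] assms(3) by metis
 obtain c where c: "\<And>n. n \<ge> c ==> cyc z \<inter> JM n \<subseteq> ipow I (n - c) (cyc z)"
  using artin_rees[OF smc sm_carrier] by blast
 interpret h: rhom R "self_mod R" M "\<lambda>a. a *. z" by (rule ann_rhom[OF assms(2)])
 have "S.hs I L (n - c) \<le> p n" if n: "n \<ge> c" for n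
 proof -
  have "S.len (S.psum L (S.J (n - c))) (carrier (self_mod R)) \<le> len (JM n) (cyc z [+] JM n)"
  proof (rule h.len_le_hom[OF S.sm_carrier smJM sm_psum[OF smc smJM]])
   fix a assume a: "a \<in> carrier (self_mod R)"
   have "a *. z \<in> cyc z" using a by (auto simp: cyc_def)
   then show "a *. z \<in> cyc z [+] JM n" using psum_upper1[OF sm_subset[OF smc] smJM] by blast
   assume "a *. z \<in> JM n"
   with \<open>a *. z \<in> cyc z\<close> have "a *. z \<in> (\<lambda>a. a *. z) ` S.J (n - c)"
    using c[OF n] ipow_cyc[OF assms(2)] by blast
   then obtain b where b: "b \<in> S.J (n - c)" "a *. z = b *. z" by blast
   have bR: "b \<in> carrier R" using b(1) S.J_le by auto
   have "(a \<ominus>\<^bsub>R\<^esub> b) *. z = \<zero>\<^bsub>M\<^esub>" using a b bR assms(2) by (simp add: sub_smult M.r_neg M.minus_eq)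
   then have "a \<ominus>\<^bsub>R\<^esub> b \<in> L" using a bR by (simp add: L_def)
   then have "(a \<ominus>\<^bsub>R\<^esub> b) \<oplus>\<^bsub>R\<^esub> b \<in> S.psum L (S.J (n - c))" using S.psumI[OF _ b(1)] by fastforce
   moreover have "(a \<ominus>\<^bsub>R\<^esub> b) \<oplus>\<^bsub>R\<^esub> b = a" using a bR by (simp add: R.minus_eq R.a_assoc R.l_neg)
   ultimately show "a \<in> S.psum L (S.J (n - c))" by simp
  next
   show "JM n \<subseteq> cyc z [+] JM n" by (rule psum_upper2[OF smc sm_subset[OF smJM]])
  qed
  then have "enat (S.hs I L (n - c)) \<le> enat (p n)" using S.hsE[OF smL, of "n - c"] p[of n] by (metis self_mod_simps(1) order_trans)
  then show ?thesis by simp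
 qed
 then have "small r (\<lambda>n. S.hs I L (n - c))" by (rule small_mono[OF \<open>small r p\<close>])
 then show False using small_unshift ns by blast
qed

end

context rmod begin

lemma filtration_step:
 assumes Y: "sm Y" and g: "g \<in> carrier M"
 shows "\<And>L. L \<subseteq> carrier R ==> (\<And>a. a \<in> L ==> a *. g \<in> Y) ==> len Y (Y [+] cyc g) \<le> rmod.len R (self_mod R) L (carrier R)"
  and "rmod.acc R (self_mod R) {\<zero>} (carrier R) ==> acc Y (Y [+] cyc g)"
proof -
 interpret h: rhom R "self_mod R" M "\<lambda>a. a *. g" by (rule ann_rhom[OF g])
 have smc: "sm (cyc g)" by (rule sm_cyc[OF g])
 have lift: "\<exists>a\<in>carrier R. u -. a *. g \<in> Y" if "u \<in> Y [+] cyc g" for u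
 proof -
  note asm = that
  obtain y a where *: "y \<in> Y" "a \<in> carrier R" "u = y +. a *. g" using asm by (auto simp: cyc_def elim!: psumE)
  then show ?thesis using add_sub_cancel[of y "a *. g"] sm_carr[OF Y] g by (intro bexI[of _ a]) simp_all
 qed
 show "len Y (Y [+] cyc g) \<le> rmod.len R (self_mod R) L (carrier R)"
  if "L \<subseteq> carrier R" "\<And>a. a \<in> L ==> a *. g \<in> Y" for L
  using h.len_ge_hom[OF h.M.sm_carrier _ Y, of L "Y [+] cyc g"] that lift by simp
 assume acc: "rmod.acc R (self_mod R) {\<zero>} (carrier R)"
 show "acc Y (Y [+] cyc g)" unfolding acc_def
 proof (intro allI impI)
  fix H :: "nat => 'b set"
  assume H: "\<forall>i. sm (H i) \<and> Y \<subseteq> H i \<and> H i \<subseteq> Y [+] cyc g \<and> H i \<subseteq> H (Suc i)"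
  define F where "F i = {a \<in> carrier (self_mod R). a *. g \<in> H i}" for i
  have smF: "h.M.sm (F i)" for i unfolding F_def using H by (intro h.sm_vimage h.M.sm_carrier) auto
  have "\<exists>n. \<forall>m\<ge>n. F m = F n"
   by (rule h.M.accD[OF acc smF]) (use h.M.sm_zero[OF smF] H in \<open>auto simp: F_def\<close>)
  then obtain n where n: "\<And>m. m \<ge> n ==> F m = F n" by blast
  have "H m = H n" if "m \<ge> n" for m
  proof
   show "H n \<subseteq> H m" using lift_Suc_mono_le[of H n m] H that by blast
   show "H m \<subseteq> H n"
   proof
    fix u assume u: "u \<in> H m"
    then obtain a where a: "a \<in> carrier R" "u -. a *. g \<in> Y" using lift H by blast
    have smH: "sm (H k)" "Y \<subseteq> H k" for k using H by auto
    have c: "u \<in> carrier M" using u smH sm_carr by blast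
    have "u -. (u -. a *. g) = a *. g"
     using add_sub_cancel_l[of "u -. a *. g" "a *. g"] sub_add_cancel[of u "a *. g"] c a g by simp
    moreover have "u -. (u -. a *. g) \<in> H m" using sm_sub[OF smH(1)[of m] u] smH(2)[of m] a(2) by blast
    ultimately have "a \<in> F m" using a(1) by (simp add: F_def)
    then have "a \<in> F n" using n[OF that] by simp
    then have "a *. g \<in> H n" by (simp add: F_def)
    then show "u \<in> H n" using sm_sub_mem[OF smH(1) _ c, of "a *. g" n] a(2) smH(2)[of n] by blast
   qed
  qed
  then show "\<exists>n. \<forall>m\<ge>n. H m = H n" by blast
 qed
qed

primrec csum :: "'b set => 'b list => 'b set" where
 "csum Y [] = Y"
| "csum Y (g # gs) = csum Y gs [+] cyc g"

lemma csum_facts: assumes "sm Y" shows "set gs \<subseteq> carrier M ==> sm (csum Y gs) \<and> Y \<subseteq> csum Y gs \<and> set gs \<subseteq> csum Y gs"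
proof (induction gs)
 case Nil then show ?case using assms by simp
next
 case (Cons g gs)
 then have IH: "sm (csum Y gs)" "Y \<subseteq> csum Y gs" "set gs \<subseteq> csum Y gs" and g: "g \<in> carrier M" by auto
 have "csum Y gs \<subseteq> csum Y gs [+] cyc g" by (rule psum_upper1[OF sm_subset[OF IH(1)] sm_cyc[OF g]])
 moreover have "cyc g \<subseteq> csum Y gs [+] cyc g" by (rule psum_upper2[OF IH(1) sm_subset[OF sm_cyc[OF g]]])
 ultimately show ?case using IH sm_psum[OF IH(1) sm_cyc[OF g]] cyc_self[OF g] by auto
qed

text \<open>Adding one generator at a time, each step of the filtration is a quotient of \<open>R/L\<close>.\<close>

lemma fg_growth:
 assumes gs: "set gs \<subseteq> carrier M" "carrier M = gen_submod R M (set gs)" and Y: "sm Y"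
  and L: "L \<subseteq> carrier R" "\<And>a g. a \<in> L ==> g \<in> set gs ==> a *. g \<in> Y"
 shows "len Y (carrier M) \<le> enat (length gs) * rmod.len R (self_mod R) L (carrier R)"
proof -
 have "set hs \<subseteq> set gs ==> len Y (csum Y hs) \<le> enat (length hs) * rmod.len R (self_mod R) L (carrier R)" for hs
 proof (induction hs)
  case Nil then show ?case by (simp add: len_refl)
 next
  case (Cons h hs)
  then have sub: "set hs \<subseteq> carrier M" "h \<in> carrier M" using gs(1) by auto
  note f = csum_facts[OF Y sub(1)]
  have "len (csum Y hs) (csum Y hs [+] cyc h) \<le> rmod.len R (self_mod R) L (carrier R)"
   by (rule filtration_step(1)[OF _ sub(2) L(1)]) (use f L(2) Cons.prems in auto)
  moreover have "len Y (csum Y hs [+] cyc h) = len Y (csum Y hs) + len (csum Y hs) (csum Y hs [+] cyc h)"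
   by (rule len_add) (use f Y sub in \<open>auto intro: sm_psum sm_cyc psum_ub1[THEN subsetD]\<close>)
  moreover have "enat (length (h # hs)) * k = enat (length hs) * k + k" for k :: enat
   by (metis add.commute eSuc_enat length_Cons mult_eSuc)
  ultimately show ?case using Cons by (simp add: add_mono)
 qed
 moreover have "carrier M \<subseteq> csum Y gs" using csum_facts[OF Y gs(1)] gs(2) gen_least by metis
 ultimately show ?thesis using len_mono_top[of "carrier M" "csum Y gs" Y] by (meson order.refl order_trans)
qed

lemma fg_acc:
 assumes gs: "set gs \<subseteq> carrier M" "carrier M = gen_submod R M (set gs)" and R: "rmod.acc R (self_mod R) {\<zero>} (carrier R)"
 shows "acc {\<zero>\<^bsub>M\<^esub>} (carrier M)"
proof -
 have "set hs \<subseteq> set gs ==> acc {\<zero>\<^bsub>M\<^esub>} (csum {\<zero>\<^bsub>M\<^esub>} hs)" for hs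
 proof (induction hs)
  case Nil then show ?case by (simp add: acc_refl)
 next
  case (Cons h hs)
  then have sub: "set hs \<subseteq> carrier M" "h \<in> carrier M" using gs(1) by auto
  note f = csum_facts[OF sm_null sub(1)]
  have sm2: "sm (csum {\<zero>\<^bsub>M\<^esub>} hs [+] cyc h)" using f sub by (auto intro: sm_psum sm_cyc)
  have "csum {\<zero>\<^bsub>M\<^esub>} hs \<subseteq> csum {\<zero>\<^bsub>M\<^esub>} hs [+] cyc h" using f sub by (intro psum_upper1 sm_cyc sm_subset) auto
  then show ?case using acc_trans[OF _ _ _ sm2] f filtration_step(2)[OF _ sub(2) R] Cons by auto
 qed
 moreover have "carrier M \<subseteq> csum {\<zero>\<^bsub>M\<^esub>} gs" using csum_facts[OF sm_null gs(1)] gs(2) gen_least by metis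
 ultimately show ?thesis using acc_sub[of "{\<zero>\<^bsub>M\<^esub>}" "csum {\<zero>\<^bsub>M\<^esub>} gs" "{\<zero>\<^bsub>M\<^esub>}" "carrier M"] by blast
qed

end

section \<open>Functions that are eventually polynomial\<close>

text \<open>In the binomial basis summation is a shift of the index, and no bound on the degree has to be carried along.\<close>

definition evpoly :: "(nat => real) => bool"
 where "evpoly h \<longleftrightarrow> (\<exists>k c. \<forall>\<^sub>F n in sequentially. h n = (\<Sum>i<k. c i * real (n choose i)))"

lemma evpoly_cong: "\<forall>\<^sub>F n in sequentially. h n = g n ==> evpoly g ==> evpoly h"
 unfolding evpoly_def by (elim exE, intro exI, erule (1) eventually_elim2) simp

lemma evpoly_cmult: "evpoly h ==> evpoly (\<lambda>n. a * h n)"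
 unfolding evpoly_def
proof (elim exE)
 fix k c assume "\<forall>\<^sub>F n in sequentially. h n = (\<Sum>i<k. c i * real (n choose i))"
 then have "\<forall>\<^sub>F n in sequentially. a * h n = (\<Sum>i<k. (a * c i) * real (n choose i))"
  by eventually_elim (simp add: sum_distrib_left mult.assoc)
 then show "\<exists>k c. \<forall>\<^sub>F n in sequentially. a * h n = (\<Sum>i<k. c i * real (n choose i))"
  by (intro exI[of _ k] exI[of _ "\<lambda>i. a * c i"])
qed

lemma evpoly_add: assumes "evpoly h" "evpoly g" shows "evpoly (\<lambda>n. h n + g n)"
proof -
 obtain k c where h: "\<forall>\<^sub>F n in sequentially. h n = (\<Sum>i<k. c i * real (n choose i))"
  using assms(1) unfolding evpoly_def by blast
 obtain l b where g: "\<forall>\<^sub>F n in sequentially. g n = (\<Sum>i<l. b i * real (n choose i))"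
  using assms(2) unfolding evpoly_def by blast
 have pad: "(\<Sum>i<k. c i * real (n choose i)) = (\<Sum>i<m. (if i < k then c i else 0) * real (n choose i))"
  if "k \<le> m" for k m n :: nat and c
  using that by (intro sum.mono_neutral_cong_left) auto
 have "\<forall>\<^sub>F n in sequentially. h n + g n =
  (\<Sum>i<max k l. ((if i < k then c i else 0) + (if i < l then b i else 0)) * real (n choose i))"
  using h g
 proof eventually_elim
  case (elim n)
  then show ?case using pad[of k "max k l" c n] pad[of l "max k l" b n]
   by (simp add: sum.distrib[symmetric] distrib_right)
 qed
 then show ?thesis unfolding evpoly_def
  by (intro exI[of _ "max k l"] exI[of _ "\<lambda>i. (if i < k then c i else 0) + (if i < l then b i else 0)"])
qed

lemma evpoly_diff: "evpoly h ==> evpoly g ==> evpoly (\<lambda>n. h n - g n)"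
 using evpoly_add[of h "\<lambda>n. (-1) * g n"] evpoly_cmult[of g "-1"] by simp

lemma evpoly_zero: "evpoly (\<lambda>_. 0)"
 unfolding evpoly_def by (intro exI[of _ 0]) simp

lemma evpoly_choose: "evpoly (\<lambda>n. real (n choose i))"
 unfolding evpoly_def by (intro exI[of _ "Suc i"] exI[of _ "\<lambda>j. if j = i then 1 else 0"]) (simp add: if_distrib[of "\<lambda>x. x * _"] cong: if_cong)

lemma evpoly_const: "evpoly (\<lambda>_. a)"
 using evpoly_cmult[OF evpoly_choose[of 0], of a] by simp

lemma evpoly_sum: "(\<And>i. i < (k::nat) ==> evpoly (h i)) ==> evpoly (\<lambda>n. \<Sum>i<k. h i n)"
 by (induction k) (simp_all add: evpoly_zero evpoly_add)

lemma evpoly_Suc: assumes "evpoly h" shows "evpoly (\<lambda>n. h (Suc n))"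
proof -
 obtain k c where h: "\<forall>\<^sub>F n in sequentially. h n = (\<Sum>i<k. c i * real (n choose i))"
  using assms unfolding evpoly_def by blast
 have "evpoly (\<lambda>n. real (Suc n choose i))" for i
 proof (cases i)
  case 0 then show ?thesis using evpoly_const[of 1] by simp
 next
  case (Suc j)
  then show ?thesis using evpoly_add[OF evpoly_choose evpoly_choose, of j i] by simp
 qed
 then have "evpoly (\<lambda>n. \<Sum>i<k. c i * real (Suc n choose i))" by (intro evpoly_sum evpoly_cmult)
 moreover have "\<forall>\<^sub>F n in sequentially. h (Suc n) = (\<Sum>i<k. c i * real (Suc n choose i))"
  using h by (rule eventually_sequentially_Suc[THEN iffD2])
 ultimately show ?thesis by (rule evpoly_cong[rotated])
qed

text \<open>A difference \<open>\<Sum>c\<^sub>i (n choose i)\<close> is summed to \<open>\<Sum>c\<^sub>i (n choose (i+1))\<close> up to a constant.\<close>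

lemma evpoly_of_difference: assumes "evpoly (\<lambda>n. h (Suc n) - h n)" shows "evpoly h"
proof -
 obtain k c where "\<forall>\<^sub>F n in sequentially. h (Suc n) - h n = (\<Sum>i<k. c i * real (n choose i))"
  using assms unfolding evpoly_def by blast
 then obtain n0 where h: "\<And>n. n \<ge> n0 ==> h (Suc n) - h n = (\<Sum>i<k. c i * real (n choose i))"
  unfolding eventually_sequentially by blast
 define g where "g n = (\<Sum>i<k. c i * real (n choose Suc i))" for n
 have g: "evpoly g" unfolding g_def by (intro evpoly_sum evpoly_cmult evpoly_choose)
 have gS: "g (Suc n) - g n = (\<Sum>i<k. c i * real (n choose i))" for n
  unfolding g_def sum_subtractf[symmetric] by (simp add: distrib_left)
 have "h n = (h n0 - g n0) + g n" if "n \<ge> n0" for n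
  using that
 proof (induction n rule: dec_induct)
  case (step n) then show ?case using h[of n] gS[of n] by simp
 qed simp
 then have "\<forall>\<^sub>F n in sequentially. h n = (h n0 - g n0) + g n" unfolding eventually_sequentially by blast
 then show ?thesis by (rule evpoly_cong) (rule evpoly_add[OF evpoly_const g])
qed

lemma choose_over_power: "(\<lambda>n. real (n choose i) / real n ^ i) \<longlonglongrightarrow> 1 / fact i"
proof (induction i)
 case (Suc i)
 have "(\<lambda>n. 1 - real i / real n) \<longlonglongrightarrow> 1 - 0" by (intro tendsto_diff tendsto_const lim_const_over_n)
 then have "(\<lambda>n. real (n choose i) / real n ^ i * (1 - real i / real n) / real (Suc i)) \<longlonglongrightarrow> 1 / fact i * (1 - 0) / real (Suc i)"
  by (intro tendsto_divide tendsto_mult Suc tendsto_const) auto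
 moreover have "\<forall>\<^sub>F n in sequentially. real (n choose i) / real n ^ i * (1 - real i / real n) / real (Suc i) = real (n choose Suc i) / real n ^ Suc i"
  using eventually_ge_at_top[of "Suc i"]
 proof eventually_elim
  case (elim n)
  have "Suc i * (n choose Suc i) = (n - i) * (n choose i)"
   using binomial_absorption[of i n] binomial_absorb_comp[of n i] by simp
  then have "real (Suc i) * real (n choose Suc i) = (real n - real i) * real (n choose i)"
   using elim by (metis Suc_leD of_nat_diff of_nat_mult)
  then have "real (n choose Suc i) = (real n - real i) * real (n choose i) / real (Suc i)" by (simp add: field_simps)
  moreover have "1 - real i / real n = (real n - real i) / real n" using elim by (simp add: diff_divide_distrib)
  ultimately show ?case by (simp only: power_Suc times_divide_times_eq divide_divide_eq_left mult_ac times_divide_eq_left times_divide_eq_right)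
 qed
 ultimately have "(\<lambda>n. real (n choose Suc i) / real n ^ Suc i) \<longlonglongrightarrow> 1 / fact i * (1 - 0) / real (Suc i)"
  by (rule Lim_transform_eventually)
 then show ?case by (simp add: mult.commute)
qed simp

lemma choose_over_power_less: assumes "i < m" shows "(\<lambda>n. real (n choose i) / real n ^ m) \<longlonglongrightarrow> 0"
proof -
 obtain j where m: "m = Suc j + i" using assms by (metis add.commute less_iff_Suc_add add_Suc_right)
 have "(\<lambda>n. 1 / real n ^ Suc j) \<longlonglongrightarrow> 0" using small_const[of j 1] by (simp add: small_def)
 from tendsto_mult[OF choose_over_power[of i] this] show ?thesis by (simp add: m power_add mult_ac)
qed

text \<open>The growth condition kills all coefficients from index \<open>m + 1\<close> on; the limit is then the coefficient at \<open>m\<close> divided by \<open>m!\<close>.\<close>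

lemma evpoly_convergent:
 assumes "evpoly h" "(\<lambda>n. h n / real n ^ Suc m) \<longlonglongrightarrow> 0"
 shows "convergent (\<lambda>n. h n / real n ^ m)"
proof -
 obtain k0 c where "\<forall>\<^sub>F n in sequentially. h n = (\<Sum>i<k0. c i * real (n choose i))"
  using assms unfolding evpoly_def by blast
 then show ?thesis
 proof (induction k0)
  case 0
  then have "(\<lambda>n. h n / real n ^ m) \<longlonglongrightarrow> 0"
   by (intro tendsto_eventually) (auto elim: eventually_mono)
  then show ?case by (rule convergentI)
 next
  case (Suc k)
  show ?case
  proof (cases "k \<le> m")
   case True
   have "convergent (\<lambda>n. real (n choose i) / real n ^ m)" if "i \<le> m" for i
    using choose_over_power[of i] choose_over_power_less[of i m] that by (cases "i = m") (auto intro: convergentI)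
   then have "convergent (\<lambda>n. \<Sum>i<Suc k. c i * (real (n choose i) / real n ^ m))"
    using True by (intro convergent_sum convergent_mult convergent_const) auto
   moreover have "\<forall>\<^sub>F n in sequentially. (\<Sum>i<Suc k. c i * (real (n choose i) / real n ^ m)) = h n / real n ^ m"
    using Suc.prems by eventually_elim (simp add: sum_divide_distrib add_divide_distrib)
   ultimately show ?thesis using convergent_cong[of "\<lambda>n. \<Sum>i<Suc k. c i * (real (n choose i) / real n ^ m)" "\<lambda>n. h n / real n ^ m"] by simp
  next
   case False
   then obtain j where j: "k = Suc m + j" by (metis add.commute less_iff_Suc_add add_Suc_right not_le add_Suc)
   have "(\<lambda>n. h n / real n ^ k) \<longlonglongrightarrow> 0"
   proof (rule tendsto_0_le[OF assms(2), of _ 1])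
    show "\<forall>\<^sub>F n in sequentially. norm (h n / real n ^ k) \<le> norm (h n / real n ^ Suc m) * 1"
     using eventually_ge_at_top[of 1]
    proof eventually_elim
     case (elim n)
     then have "real n ^ Suc m \<le> real n ^ k" using j by (intro power_increasing) auto
     then show ?case using elim by (simp del: power_Suc add: norm_divide) (intro divide_left_mono, auto)
    qed
   qed
   moreover have "(\<lambda>n. h n / real n ^ k) \<longlonglongrightarrow> (\<Sum>i<k. c i * 0) + c k * (1 / fact k)"
   proof -
    have "(\<lambda>n. (\<Sum>i<k. c i * (real (n choose i) / real n ^ k)) + c k * (real (n choose k) / real n ^ k)) \<longlonglongrightarrow> (\<Sum>i<k. c i * 0) + c k * (1 / fact k)"
     by (intro tendsto_add tendsto_sum tendsto_mult tendsto_const choose_over_power choose_over_power_less) auto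
    moreover have "\<forall>\<^sub>F n in sequentially. (\<Sum>i<k. c i * (real (n choose i) / real n ^ k)) + c k * (real (n choose k) / real n ^ k) = h n / real n ^ k"
     using Suc.prems by eventually_elim (simp add: sum_divide_distrib add_divide_distrib)
    ultimately show ?thesis by (rule Lim_transform_eventually)
   qed
   ultimately have "c k = 0" using LIMSEQ_unique by fastforce
   then show ?thesis using Suc by simp
  qed
 qed
qed

section \<open>Hilbert functions\<close>

context rmod begin

lemma id_rhom: "rhom R M M (\<lambda>u. u)"
 by (intro rhom.intro rhom_axioms.intro) (auto simp: mod_hom_def intro: rmod_axioms)

lemma len_second_iso_le:
 assumes "sm U" "sm V'" "sm U'" "U \<inter> V' \<subseteq> V" "U \<subseteq> U'" "V' \<subseteq> U'"
 shows "len V U \<le> len V' U'"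
 using rhom.len_le_hom[OF id_rhom assms(1-3), of V] assms(4-6) by blast

text \<open>The graded module with pieces \<open>U n / V n\<close> over a polynomial ring in the variables \<open>xs\<close>: its pieces have
finite length and each of its graded submodules \<open>T n / V n\<close> is generated in finitely many degrees.\<close>

definition graded_noeth :: "'a list => (nat => 'b set) => (nat => 'b set) => bool"
 where "graded_noeth xs V U \<longleftrightarrow>
  (\<forall>n. sm (V n) \<and> sm (U n) \<and> V n \<subseteq> U n \<and> len (V n) (U n) \<noteq> \<infinity>) \<and>
  (\<forall>n. \<forall>x\<in>set xs. (\<forall>u\<in>V n. x *. u \<in> V (Suc n)) \<and> (\<forall>u\<in>U n. x *. u \<in> U (Suc n))) \<and>
  (\<forall>T. (\<forall>n. sm (T n) \<and> V n \<subseteq> T n \<and> T n \<subseteq> U n \<and> (\<forall>x\<in>set xs. \<forall>u\<in>T n. x *. u \<in> T (Suc n))) \<longrightarrow>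
   (\<exists>n0. \<forall>n\<ge>n0. T (Suc n) \<subseteq> lsum xs (T n) [+] V (Suc n)))"

lemma graded_noethD:
 assumes "graded_noeth xs V U"
 shows "sm (V n)" "sm (U n)" "V n \<subseteq> U n" "len (V n) (U n) \<noteq> \<infinity>"
  "x \<in> set xs ==> u \<in> V n ==> x *. u \<in> V (Suc n)"
  "x \<in> set xs ==> u \<in> U n ==> x *. u \<in> U (Suc n)"
  "(\<And>n. sm (T n)) ==> (\<And>n. V n \<subseteq> T n) ==> (\<And>n. T n \<subseteq> U n) ==>
   (\<And>n x u. x \<in> set xs ==> u \<in> T n ==> x *. u \<in> T (Suc n)) ==>
   \<exists>n0. \<forall>n\<ge>n0. T (Suc n) \<subseteq> lsum xs (T n) [+] V (Suc n)"
proof -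
 note a = assms[unfolded graded_noeth_def, THEN conjunct1]
  and b = assms[unfolded graded_noeth_def, THEN conjunct2, THEN conjunct1]
  and c = assms[unfolded graded_noeth_def, THEN conjunct2, THEN conjunct2, rule_format]
 show "sm (V n)" "sm (U n)" "V n \<subseteq> U n" "len (V n) (U n) \<noteq> \<infinity>" using a by blast+
 show "x *. u \<in> V (Suc n)" if "x \<in> set xs" "u \<in> V n" using b that by blast
 show "x *. u \<in> U (Suc n)" if "x \<in> set xs" "u \<in> U n" using b that by blast
 show "\<exists>n0. \<forall>n\<ge>n0. T (Suc n) \<subseteq> lsum xs (T n) [+] V (Suc n)"
  if "\<And>n. sm (T n)" "\<And>n. V n \<subseteq> T n" "\<And>n. T n \<subseteq> U n" "\<And>n x u. x \<in> set xs ==> u \<in> T n ==> x *. u \<in> T (Suc n)"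
  by (rule c) (use that in auto)
qed

lemma graded_noeth_sub:
 assumes "graded_noeth xs V U" "\<And>n. sm (V' n)" "\<And>n. sm (U' n)" "\<And>n. V n \<subseteq> V' n" "\<And>n. V' n \<subseteq> U' n" "\<And>n. U' n \<subseteq> U n"
  "\<And>n x u. x \<in> set xs ==> u \<in> V' n ==> x *. u \<in> V' (Suc n)"
  "\<And>n x u. x \<in> set xs ==> u \<in> U' n ==> x *. u \<in> U' (Suc n)"
 shows "graded_noeth xs V' U'"
 unfolding graded_noeth_def
proof (intro conjI allI ballI impI)
 fix n
 have "len (V' n) (U' n) \<le> len (V n) (U n)"
  using len_mono_bot[OF assms(4)] len_mono_top[OF assms(6)] order_trans by blast
 then show "len (V' n) (U' n) \<noteq> \<infinity>" using assms(1) unfolding graded_noeth_def by (metis enat_ord_simps(5))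
next
 fix T assume T: "\<forall>n. sm (T n) \<and> V' n \<subseteq> T n \<and> T n \<subseteq> U' n \<and> (\<forall>x\<in>set xs. \<forall>u\<in>T n. x *. u \<in> T (Suc n))"
 then have "\<forall>n. sm (T n) \<and> V n \<subseteq> T n \<and> T n \<subseteq> U n \<and> (\<forall>x\<in>set xs. \<forall>u\<in>T n. x *. u \<in> T (Suc n))"
  using assms(4,6) by blast
 then obtain n0 where "\<And>n. n \<ge> n0 ==> T (Suc n) \<subseteq> lsum xs (T n) [+] V (Suc n)"
  using assms(1) unfolding graded_noeth_def by blast
 then show "\<exists>n0. \<forall>n\<ge>n0. T (Suc n) \<subseteq> lsum xs (T n) [+] V' (Suc n)"
  using psum_mono[OF order.refl assms(4)] by (meson order_trans)
qed (use assms in auto)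

text \<open>Induction on the variables \<open>ys\<close> that may act nontrivially. Multiplication by \<open>y\<close> has kernel pieces \<open>U' n / V n\<close> and
cokernel pieces \<open>U n / V' n\<close>, on which \<open>y\<close> acts as zero. Additivity of length expresses the first difference of the Hilbert
function by the Hilbert functions of kernel and cokernel.\<close>

theorem hilbert_serre:
 assumes xs: "set xs \<subseteq> carrier R"
 shows "graded_noeth xs V U ==> (\<And>n x u. x \<in> set xs - set ys ==> u \<in> U n ==> x *. u \<in> V (Suc n)) ==>
  evpoly (\<lambda>n. real (the_enat (len (V n) (U n))))"
proof (induction ys arbitrary: V U)
 case Nil
 note g = graded_noethD(1-3)[OF Nil(1)]
 have "\<exists>n0. \<forall>n\<ge>n0. U (Suc n) \<subseteq> lsum xs (U n) [+] V (Suc n)"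
  by (rule graded_noethD(7)[OF Nil(1)]) (use g graded_noethD(6)[OF Nil(1)] in auto)
 then obtain n0 where n0: "\<And>n. n \<ge> n0 ==> U (Suc n) \<subseteq> lsum xs (U n) [+] V (Suc n)" by blast
 have "len (V n) (U n) = 0" if "n \<ge> Suc n0" for n
 proof -
  define k where "k = n - 1"
  have k: "n = Suc k" "k \<ge> n0" using that by (auto simp: k_def)
  have "lsum xs (U k) \<subseteq> V (Suc k)" using Nil(2) by (intro lsum_least g) auto
  then have "lsum xs (U k) [+] V (Suc k) \<subseteq> V (Suc k)" by (intro psum_least g) auto
  then have "U n = V n" using n0[OF k(2)] g(3)[of n] k by blast
  then show ?thesis by (simp add: len_refl)
 qed
 then have "\<forall>\<^sub>F n in sequentially. real (the_enat (len (V n) (U n))) = 0"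
  unfolding eventually_sequentially by (intro exI[of _ "Suc n0"]) (simp add: zero_enat_def)
 then show ?case by (rule evpoly_cong[OF _ evpoly_zero])
next
 case (Cons y ys)
 show ?case
 proof (cases "y \<in> set xs")
  case False
  then show ?thesis using Cons.IH[OF Cons.prems(1)] Cons.prems(2) by auto
 next
  case True
  then have y: "y \<in> carrier R" using xs by blast
  note g = graded_noethD(1-6)[OF Cons.prems(1)]
  define U' where "U' n = {u \<in> U n. y *. u \<in> V (Suc n)}" for n
  define V' where "V' n = (case n of 0 => V 0 | Suc k => V (Suc k) [+] sc y (U k))" for n
  have V'S: "V' (Suc k) = V (Suc k) [+] sc y (U k)" for k by (simp add: V'_def)
  have smU': "sm (U' n)" for n unfolding U'_def by (rule sm_colon[OF y g(2,1)])
  have smV': "sm (V' n)" for n unfolding V'_def using g y by (cases n) (auto intro: sm_psum sm_sc)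
  have VU': "V n \<subseteq> U' n" "U' n \<subseteq> U n" for n unfolding U'_def using g(3,5) True by blast+
  have VV': "V n \<subseteq> V' n" for n using psum_ub1[OF g(1) sm_sc[OF y g(2)]] by (cases n) (auto simp: V'_def)
  have V'U: "V' n \<subseteq> U n" for n
  proof (cases n)
   case 0 then show ?thesis using g(3)[of 0] by (simp add: V'_def)
  next
   case (Suc k)
   have "sc y (U k) \<subseteq> U (Suc k)" using g(6)[OF True] unfolding sc_def by blast
   then show ?thesis unfolding Suc V'S by (rule psum_least[OF g(2) g(3)])
  qed
  have G1: "graded_noeth xs V U'"
  proof (rule graded_noeth_sub[OF Cons.prems(1) g(1) smU' order.refl VU' g(5)])
   fix n x u assume x: "x \<in> set xs" and u: "u \<in> U' n"
   have "y *. (x *. u) = x *. (y *. u)"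
    using smult_commute y x u xs sm_carr[OF smU'] by blast
   then show "x *. u \<in> U' (Suc n)" using g(5,6)[OF x] u unfolding U'_def by auto
  qed
  have G2: "graded_noeth xs V' U"
  proof (rule graded_noeth_sub[OF Cons.prems(1) smV' g(2) VV' V'U order.refl _ g(6)])
   fix n x u assume x: "x \<in> set xs" and u: "u \<in> V' n"
   have xR: "x \<in> carrier R" using x xs by blast
   show "x *. u \<in> V' (Suc n)"
   proof (cases n)
    case 0 then show ?thesis using u g(5)[OF x, of u 0] VV'[of 1] by (auto simp: V'_def)
   next
    case (Suc k)
    then obtain v w where *: "v \<in> V (Suc k)" "w \<in> U k" "u = v +. y *. w" using u by (auto simp: V'S sc_def elim!: psumE)
    have c: "v \<in> carrier M" "w \<in> carrier M" using * g(1,2) sm_carr by blast+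
    have "x *. u = x *. v +. y *. (x *. w)" using * c xR y by (simp add: smult_r_distr smult_commute)
    then show ?thesis using g(5)[OF x *(1)] g(6)[OF x *(2)] unfolding V'S Suc by (auto intro: psumI scI)
   qed
  qed
  have E1: "evpoly (\<lambda>n. real (the_enat (len (V n) (U' n))))"
  proof (rule Cons.IH[OF G1])
   fix n x u assume "x \<in> set xs - set ys" "u \<in> U' n"
   then show "x *. u \<in> V (Suc n)" using Cons.prems(2)[of x u n] unfolding U'_def by (cases "x = y") auto
  qed
  have E2: "evpoly (\<lambda>n. real (the_enat (len (V' n) (U n))))"
  proof (rule Cons.IH[OF G2])
   fix n x u assume x: "x \<in> set xs - set ys" "u \<in> U n"
   show "x *. u \<in> V' (Suc n)"
   proof (cases "x = y")
    case True
    then show ?thesis using psum_ub2[OF g(1) sm_sc[OF y g(2)]] x scI unfolding V'S by blast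
   next
    case False
    then show ?thesis using Cons.prems(2)[of x u n] x VV'[of "Suc n"] by auto
   qed
  qed
  interpret h: rhom R M M "\<lambda>u. y *. u" by (rule smult_rhom[OF y])
  have eq: "len (U' n) (U n) = len (V (Suc n)) (V' (Suc n))" for n
  proof (rule antisym)
   show "len (U' n) (U n) \<le> len (V (Suc n)) (V' (Suc n))"
    using psum_ub2[OF g(1) sm_sc[OF y g(2)], of n "Suc n"]
    by (intro h.len_le_hom g smV' VV') (auto simp: U'_def V'S intro: scI)
   show "len (V (Suc n)) (V' (Suc n)) \<le> len (U' n) (U n)"
   proof (rule h.len_ge_hom[OF g(2) VU'(2) g(1)])
    fix u' assume "u' \<in> V' (Suc n)"
    then obtain v w where *: "v \<in> V (Suc n)" "w \<in> U n" "u' = v +. y *. w" by (auto simp: V'S sc_def elim!: psumE)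
    have "u' -. y *. w = v" using * add_sub_cancel[of v "y *. w"] sm_carr[OF g(1)] sm_carr[OF g(2)] y by simp
    then show "\<exists>u\<in>U n. u' -. y *. u \<in> V (Suc n)" using * by metis
   qed (simp add: U'_def)
  qed
  let ?h = "\<lambda>n. real (the_enat (len (V n) (U n)))"
  have "?h (Suc n) - ?h n = real (the_enat (len (V' (Suc n)) (U (Suc n)))) - real (the_enat (len (V n) (U' n)))" for n
  proof -
   have a: "len (V (Suc n)) (U (Suc n)) = len (V (Suc n)) (V' (Suc n)) + len (V' (Suc n)) (U (Suc n))"
    by (rule len_add[OF g(1) smV' g(2) VV' V'U])
   have b: "len (V n) (U n) = len (V n) (U' n) + len (U' n) (U n)"
    by (rule len_add[OF g(1) smU' g(2) VU'])
   obtain p q where "len (V (Suc n)) (U (Suc n)) = enat p" "len (V n) (U n) = enat q" using g(4) by (metis not_enat_eq)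
   then show ?thesis using a b eq[of n]
    by (cases "len (V (Suc n)) (V' (Suc n))"; cases "len (V' (Suc n)) (U (Suc n))"; cases "len (V n) (U' n)") auto
  qed
  then have "evpoly (\<lambda>n. ?h (Suc n) - ?h n)" using evpoly_diff[OF evpoly_Suc[OF E2] E1] by simp
  then show ?thesis by (rule evpoly_of_difference)
 qed
qed

end

context fin_mod begin

lemma fin_sub: assumes "sm S" shows "len (ipow I n S) S \<noteq> \<infinity>"
proof -
 obtain c where c: "\<And>k. k \<ge> c ==> S \<inter> J k \<subseteq> ipow I (k - c) S" using artin_rees[OF assms sm_carrier] by blast
 have "len (ipow I n S) S \<le> len (J (n + c)) (carrier M)"
  using c[of "n + c"] by (intro len_second_iso_le assms smJ sm_carrier sm_subset[OF assms] J_le) simp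
 moreover obtain k where "len (J (n + c)) (carrier M) = enat k" using fin_M[of "n + c"] by auto
 ultimately show ?thesis using enat_ile by auto
qed

text \<open>The first difference is the Hilbert function of the associated graded module, presented by the pairs \<open>(I\<^sup>n\<^sup>+\<^sup>1S, I\<^sup>nS)\<close>; \<open>rees_ideal\<close> provides finite generation.\<close>

theorem hilbert_samuel: assumes "sm S" shows "evpoly (\<lambda>n. real (the_enat (len (ipow I n S) S)))"
proof -
 obtain xs where xs: "set xs \<subseteq> I" "I = Idl (set xs)" using ideal_fg[OF I_ideal] by blast
 have xsR: "set xs \<subseteq> carrier R" using xs(1) I_sub by blast
 note eq = ip_eq_lsum[OF xs I_ideal]
 define U where "U n = ipow I n S" for n
 have smU: "sm (U n)" for n unfolding U_def by (rule sm_ipow[OF I_sub assms])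
 have US: "U (Suc n) \<subseteq> U n" for n unfolding U_def by (rule ipow_Suc_subset[OF I_sub assms])
 have finU: "len (U n) S \<noteq> \<infinity>" for n unfolding U_def by (rule fin_sub[OF assms])
 have leS: "U n \<subseteq> S" for n unfolding U_def by (rule ipow_subset[OF I_sub assms])
 have xU: "x *. u \<in> U (Suc n)" if "x \<in> set xs" "u \<in> U n" for x u n
  using that xs(1) unfolding U_def ipow_Suc by (auto intro: ipI)
 have split: "len (U (Suc n)) S = len (U (Suc n)) (U n) + len (U n) S" for n
  by (rule len_add[OF smU smU assms US leS])
 have "graded_noeth xs (\<lambda>n. U (Suc n)) U"
  unfolding graded_noeth_def
 proof (intro conjI allI ballI impI smU US)
  fix n show "len (U (Suc n)) (U n) \<noteq> \<infinity>" using split[of n] finU[of "Suc n"] by (metis plus_enat_simps(2))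
 next
  fix T assume T: "\<forall>n. sm (T n) \<and> U (Suc n) \<subseteq> T n \<and> T n \<subseteq> U n \<and> (\<forall>x\<in>set xs. \<forall>u\<in>T n. x *. u \<in> T (Suc n))"
  then have smT: "sm (T n)" for n by blast
  have "ip I (T n) \<subseteq> T (Suc n)" for n unfolding eq[OF smT] by (rule lsum_least[OF smT]) (use T in blast)
  then have "\<exists>n0. \<forall>n\<ge>n0. T (Suc n) = ip I (T n)"
   using T by (intro rees_ideal[OF assms smT]) (auto simp: U_def)
  then show "\<exists>n0. \<forall>n\<ge>n0. T (Suc n) \<subseteq> lsum xs (T n) [+] U (Suc (Suc n))"
   using eq[OF smT] psum_ub1[OF sm_lsum[OF xsR smT] smU] by metis
 qed (use xU in auto)
 then have "evpoly (\<lambda>n. real (the_enat (len (U (Suc n)) (U n))))"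
  by (rule hilbert_serre[OF xsR, of _ _ xs]) simp
 note graded = this
 have "real (the_enat (len (U (Suc n)) S)) - real (the_enat (len (U n) S)) = real (the_enat (len (U (Suc n)) (U n)))" for n
 proof -
  obtain p where "len (U (Suc n)) S = enat p" using finU by (metis not_enat_eq)
  then show ?thesis using split[of n] by (cases "len (U (Suc n)) (U n)"; cases "len (U n) S") auto
 qed
 note diff = this
 have "evpoly (\<lambda>n. real (the_enat (len (U n) S)))"
  by (rule evpoly_of_difference) (simp only: diff graded)
 then show ?thesis unfolding U_def .
qed

end

section \<open>Depth\<close>

lemma prime_avoidance:
 fixes R (structure)
 assumes "ideal I R" "finite Ps" "\<And>P. P \<in> Ps ==> primeideal P R" "\<And>P. P \<in> Ps ==> \<not> I \<subseteq> P"
 shows "\<exists>z\<in>I. \<forall>P\<in>Ps. z \<notin> P"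
 using assms(2-)
proof (induction "card Ps" arbitrary: Ps rule: less_induct)
 case less
 interpret I: ideal I R by fact
 show ?case
 proof (cases "Ps = {}")
  case True then show ?thesis 
   by (intro bexI[of _ \<zero>] additive_subgroup.zero_closed[OF ideal.axioms(1)[OF assms(1)]]) simp
 next
  case False
  then obtain P where P: "P \<in> Ps" by blast
  have "\<exists>z\<in>I. \<forall>Q\<in>Ps - {P'}. z \<notin> Q" if "P' \<in> Ps" for P'
   using less.hyps[of "Ps - {P'}"] less.prems card_Diff1_less[OF less.prems(1) that] by blast
  then obtain z where z: "\<And>P'. P' \<in> Ps ==> z P' \<in> I" "\<And>P' Q. P' \<in> Ps ==> Q \<in> Ps ==> Q \<noteq> P' ==> z P' \<notin> Q"
   by (metis DiffI empty_iff insert_iff)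
  show ?thesis
  proof (cases "\<exists>P'\<in>Ps. z P' \<notin> P'")
   case True then show ?thesis using z by metis
  next
   case no: False
   interpret P: primeideal P R using less.prems P by blast
   have "finite T ==> T \<subseteq> Ps - {P} ==> \<exists>w\<in>I. w \<notin> P \<and> (\<forall>Q\<in>T. w \<in> Q)" for T
   proof (induction T rule: finite_induct)
    case empty then show ?case using less.prems(3)[OF P] by blast
   next
    case (insert Q T)
    then obtain w where w: "w \<in> I" "w \<notin> P" "\<forall>Q\<in>T. w \<in> Q" by auto
    have Q: "Q \<in> Ps" "Q \<noteq> P" using insert by auto
    have c: "w \<in> carrier R" "z Q \<in> carrier R" using w z(1)[OF Q(1)] I.Icarr by auto
    have "w \<otimes> z Q \<notin> P" using P.I_prime[OF c] w(2) z(2)[OF Q(1) P] Q(2) by blast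
    moreover have "w \<otimes> z Q \<in> I" by (rule I.I_r_closed[OF w(1) c(2)])
    moreover have "w \<otimes> z Q \<in> Q'" if "Q' \<in> insert Q T" for Q'
    proof -
     interpret Q': primeideal Q' R using less.prems(2) insert.prems that by blast
     show ?thesis using that w(3) no Q(1) c Q'.I_l_closed[of "z Q" w] Q'.I_r_closed[of w "z Q"] by auto
    qed
    ultimately show ?case by blast
   qed
   then obtain w where w: "w \<in> I" "w \<notin> P" "\<forall>Q\<in>Ps - {P}. w \<in> Q" using less.prems(1) by blast
   have c: "w \<in> carrier R" "z P \<in> carrier R" using w z(1)[OF P] I.Icarr by auto
   have cancel: "(z P \<oplus> w) \<ominus> w = z P"
    using c by (simp add: I.minus_eq I.a_assoc I.r_neg)
   have cancel': "(z P \<oplus> w) \<ominus> z P = w"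
    unfolding I.a_comm[OF c(2,1)] using c by (simp add: I.minus_eq I.a_assoc I.r_neg)
   have "z P \<oplus> w \<notin> Q" if Q: "Q \<in> Ps" for Q
   proof
    assume a: "z P \<oplus> w \<in> Q"
    interpret Q: primeideal Q R using less.prems Q by blast
    show False
    proof (cases "Q = P")
     case True
     have "z P \<in> Q" using no P True by blast
     then have "(z P \<oplus> w) \<ominus> z P \<in> Q"
      unfolding I.minus_eq by (rule Q.a_closed[OF a Q.a_inv_closed])
     then show False using cancel' w True by simp
    next
     case False
     then have "w \<in> Q" using w Q by blast
     then have "(z P \<oplus> w) \<ominus> w \<in> Q"
      unfolding I.minus_eq by (rule Q.a_closed[OF a Q.a_inv_closed])
     then show False using cancel z(2)[OF P Q False] by simp
    qed
   qed
   moreover have "z P \<oplus> w \<in> I" 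
    using z(1)[OF P] w(1) by (rule additive_subgroup.a_closed[OF ideal.axioms(1)[OF assms(1)]])
   ultimately show ?thesis by blast
  qed
 qed
qed

context rmod begin

text \<open>No nonzero vector of \<open>M/Y\<close> is killed by \<open>I\<close>. By \<open>nzd_cover\<close> and prime avoidance this means that \<open>I\<close> contains a nonzerodivisor on \<open>M/Y\<close>, but it passes between quotients more easily.\<close>

definition noann :: "'a set => 'b set => bool"
 where "noann I Y \<longleftrightarrow> (\<forall>u\<in>carrier M. (\<forall>a\<in>I. a *. u \<in> Y) \<longrightarrow> u \<in> Y)"

lemma nzd_imp_noann: "x \<in> I ==> nzd x Y ==> noann I Y"
 unfolding nzd_def noann_def by blast
lemma dep_Suc_noann: "dep I (Suc r) Y ==> noann I Y"
 using nzd_imp_noann by auto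

lemma plus_xM_I: "y \<in> Y ==> u \<in> carrier M ==> y +. x *. u \<in> Y [+] sc x (carrier M)"
 by (auto intro: psumI scI)
lemma plus_xM_E:
 assumes "v \<in> Y [+] sc x (carrier M)"
 obtains y u where "y \<in> Y" "u \<in> carrier M" "v = y +. x *. u"
 using assms unfolding sc_def by (auto elim!: psumE)
lemma plus_xM_I': \<open>sm Y ==> x \<in> carrier R ==> v \<in> carrier M ==> u \<in> carrier M ==> v -. x *. u \<in> Y ==> v \<in> Y [+] sc x (carrier M)\<close>
 using plus_xM_I[of "v -. x *. u" Y u x] sub_add_cancel[of v "x *. u"] by simp
lemma sm_plus_xM: "sm Y ==> x \<in> carrier R ==> sm (Y [+] sc x (carrier M))"
 by (intro sm_psum sm_sc sm_carrier)
lemma plus_xM_swap: assumes "sm Y" "x \<in> carrier R" "z \<in> carrier R"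
 shows "(Y [+] sc x (carrier M)) [+] sc z (carrier M) = (Y [+] sc z (carrier M)) [+] sc x (carrier M)"
 using psum_assoc psum_comm[of "sc x (carrier M)" "sc z (carrier M)"] sm_subset[OF sm_sc[OF assms(2) sm_carrier]]
  sm_subset[OF sm_sc[OF assms(3) sm_carrier]] sm_subset[OF assms(1)] by simp

lemma nzd_swap:
 assumes Y: "sm Y" and x: "x \<in> carrier R" "nzd x Y" and z: "z \<in> carrier R" "nzd z (Y [+] sc x (carrier M))"
 shows "nzd x (Y [+] sc z (carrier M))"
 unfolding nzd_def
proof (intro ballI impI)
 fix u assume u: "u \<in> carrier M" "x *. u \<in> Y [+] sc z (carrier M)"
 from u(2) obtain y w where yw: "y \<in> Y" "w \<in> carrier M" "x *. u = y +. z *. w" by (rule plus_xM_E)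
 have yM: "y \<in> carrier M" using yw sm_carr[OF Y] by blast
 have "z *. w -. x *. u = \<ominus>\<^bsub>M\<^esub> y"
  unfolding yw(3) using yw yM z by (simp add: M.minus_eq M.minus_add M.a_ac M.r_neg1 M.r_neg2 M.r_neg M.l_neg)
 then have "z *. w \<in> Y [+] sc x (carrier M)"
  using plus_xM_I'[OF Y x(1), of "z *. w" u] u z yw sm_neg[OF Y yw(1)] by simp
 then have "w \<in> Y [+] sc x (carrier M)" using z(2) yw(2) unfolding nzd_def by blast
 then obtain y1 v where v: "y1 \<in> Y" "v \<in> carrier M" "w = y1 +. x *. v" by (rule plus_xM_E)
 have y1M: "y1 \<in> carrier M" using v sm_carr[OF Y] by blast
 have "x *. u = (y +. z *. y1) +. x *. (z *. v)"
  using yw(3) v yM y1M x z by (simp add: smult_r_distr smult_commute M.a_assoc)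
 then have "x *. (u -. z *. v) = y +. z *. y1"
  using u v x z yM y1M by (simp add: smult_sub add_sub_cancel)
 then have "x *. (u -. z *. v) \<in> Y" using sm_add[OF Y yw(1) sm_smult[OF Y z(1) v(1)]] by simp
 then have "u -. z *. v \<in> Y" using x(2) u v z unfolding nzd_def by simp
 then show "u \<in> Y [+] sc z (carrier M)" by (rule plus_xM_I'[OF Y z(1) u(1) v(2)])
qed

end

context noeth_mod begin

abbreviation cl :: "'b set => 'b => 'a set" where "cl Y u \<equiv> {a \<in> carrier R. a *. u \<in> Y}"

text \<open>The maximal annihilators of vectors of \<open>M/Y\<close> are primes and contain all zero divisors. If there were infinitely many, the corresponding vectors would generate a chain that becomes stable at some vector \<open>w\<close>. A product of elements outside the prime of \<open>w\<close> that annihilates the earlier vectors would then annihilate \<open>w\<close>.\<close>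

lemma zero_divisors_cover:
 assumes Y: "sm Y"
 shows "\<exists>Ps. finite Ps \<and> (\<forall>P\<in>Ps. primeideal P R \<and> (\<exists>u\<in>carrier M. u \<notin> Y \<and> P = cl Y u)) \<and>
  (\<forall>a\<in>carrier R. \<not> nzd a Y \<longrightarrow> (\<exists>P\<in>Ps. a \<in> P))"
proof -
 define \<A> where "\<A> = {cl Y u |u. u \<in> carrier M \<and> u \<notin> Y}"
 define Mx where "Mx = {P \<in> \<A>. \<forall>Q\<in>\<A>. P \<subseteq> Q \<longrightarrow> Q = P}"
 have idl: "ideal P R" if "P \<in> \<A>" for P using that ideal_colon[OF Y] unfolding \<A>_def by blast
 have above: "\<exists>P\<in>Mx. Q \<subseteq> P" if "Q \<in> \<A>" for Q
 proof -
  have "\<exists>J. J \<in> \<A> \<and> Q \<subseteq> J \<and> (\<forall>J'. J' \<in> \<A> \<longrightarrow> J \<subseteq> J' \<longrightarrow> J' = J)"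
   by (rule max_ideal_exists) (use idl that in auto)
  then show ?thesis by (auto simp: Mx_def)
 qed
 have prime: "primeideal P R" if "P \<in> Mx" for P
 proof -
  note PM = that
  obtain u where u: "u \<in> carrier M" "u \<notin> Y" "P = cl Y u" using PM unfolding Mx_def \<A>_def by blast
  show ?thesis
  proof (rule primeidealI[OF _ cringR])
   show "ideal P R" using idl PM unfolding Mx_def by blast
   have "\<one> \<notin> P" using u by simp
   then show "carrier R \<noteq> P" by blast
   fix a b assume ab: "a \<in> carrier R" "b \<in> carrier R" "a \<otimes> b \<in> P"
   show "a \<in> P \<or> b \<in> P"
   proof (cases "a \<in> P")
    case False
    then have au: "a *. u \<notin> Y" using ab u by simp
    then have "cl Y (a *. u) \<in> \<A>" unfolding \<A>_def using ab u by blast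
    moreover have "P \<subseteq> cl Y (a *. u)"
     unfolding u(3) using sm_smult[OF Y ab(1)] smult_commute[OF _ ab(1) u(1)] by auto
    ultimately have "cl Y (a *. u) = P" using PM unfolding Mx_def by blast
    moreover have "b \<in> cl Y (a *. u)" using ab u by (simp add: smult_assoc1 smult_commute[of b a])
    ultimately show ?thesis by blast
   qed simp
  qed
 qed
 have "\<exists>w. \<forall>P\<in>Mx. w P \<in> carrier M \<and> w P \<notin> Y \<and> P = cl Y (w P)"
  by (rule bchoice) (auto simp: Mx_def \<A>_def)
 then obtain w where w: "\<And>P. P \<in> Mx ==> w P \<in> carrier M" "\<And>P. P \<in> Mx ==> w P \<notin> Y" "\<And>P. P \<in> Mx ==> P = cl Y (w P)"
  by blast
 have "finite Mx"
 proof (rule ccontr)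
  assume "infinite Mx"
  then obtain f :: "nat => 'a set" where f: "inj f" "range f \<subseteq> Mx" using infinite_countable_subset by blast
  have fM: "f i \<in> Mx" for i using f by blast
  define H where "H n = rec_nat Y (\<lambda>i H. H [+] cyc (w (f i))) n" for n
  have H0: "H 0 = Y" and HS: "H (Suc n) = H n [+] cyc (w (f n))" for n by (simp_all add: H_def)
  have smH: "sm (H n)" for n by (induction n) (auto simp: H0 HS Y intro!: sm_psum sm_cyc w(1) fM)
  have up: "H n \<subseteq> H (Suc n)" for n unfolding HS by (rule psum_ub1[OF smH sm_cyc[OF w(1)[OF fM]]])
  have "\<exists>n. \<forall>m\<ge>n. H m = H n"
   by (rule accD[OF acc_M smH]) (use sm_zero[OF smH] sm_subset[OF smH] up in auto)
  then obtain n where n: "H (Suc n) = H n" using le_Suc_eq by blast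
  have "cyc (w (f n)) \<subseteq> H (Suc n)" unfolding HS by (rule psum_ub2[OF smH sm_cyc[OF w(1)[OF fM]]])
  then have wn: "w (f n) \<in> H n" using n cyc_self[OF w(1)[OF fM]] by blast
  interpret Pn: primeideal "f n" R by (rule prime[OF fM])
  have "m \<le> n ==> \<exists>a\<in>carrier R. a \<notin> f n \<and> (\<forall>u\<in>H m. a *. u \<in> Y)" for m
  proof (induction m)
   case 0
   have "\<one> \<notin> cl Y (w (f n))" using w(2)[OF fM, of n] w(1)[OF fM, of n] by simp
   then have "\<one> \<notin> f n" using w(3)[OF fM, of n] by blast
   then show ?case using sm_carr[OF Y] by (intro bexI[of _ \<one>]) (auto simp: H0)
  next
   case (Suc m)
   then obtain a where a: "a \<in> carrier R" "a \<notin> f n" "\<forall>u\<in>H m. a *. u \<in> Y" by auto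
   have "\<not> f m \<subseteq> f n"
   proof
    assume "f m \<subseteq> f n"
    then have "f n = f m" using fM[of m] fM[of n] unfolding Mx_def by blast
    then show False using f(1) Suc.prems by (auto dest: injD)
   qed
   then obtain b where b: "b \<in> f m" "b \<notin> f n" by blast
   have bR: "b \<in> carrier R" and bw: "b *. w (f m) \<in> Y" using b(1) w(3)[OF fM, of m] by auto
   have "(a \<otimes> b) *. u \<in> Y" if u: "u \<in> H (Suc m)" for u
   proof -
    obtain h c where hc: "h \<in> H m" "c \<in> carrier R" "u = h +. c *. w (f m)"
     using u unfolding HS cyc_def by (auto elim!: psumE)
    have car: "h \<in> carrier M" "w (f m) \<in> carrier M" using sm_carr[OF smH hc(1)] w(1)[OF fM] by auto
    have "(a \<otimes> b) *. u = b *. (a *. h) +. (a \<otimes> c) *. (b *. w (f m))"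
     using hc car a(1) bR by (simp add: smult_r_distr smult_assoc1 smult_commute)
    also have "\<dots> \<in> Y" by (rule sm_add[OF Y sm_smult[OF Y bR] sm_smult[OF Y _ bw]]) (use a(1,3) hc in auto)
    finally show ?thesis .
   qed
   moreover have "a \<otimes> b \<notin> f n" using Pn.I_prime[OF a(1) bR] a(2) b(2) by blast
   ultimately show ?case using a(1) bR by (intro bexI[of _ "a \<otimes> b"]) auto
  qed
  then obtain a where "a \<in> carrier R" "a \<notin> f n" "a *. w (f n) \<in> Y" using wn by blast
  then show False using w(3)[OF fM, of n] by blast
 qed
 moreover have "\<exists>P\<in>Mx. a \<in> P" if a: "a \<in> carrier R" "\<not> nzd a Y" for a
 proof -
  obtain u where "u \<in> carrier M" "a *. u \<in> Y" "u \<notin> Y" using a unfolding nzd_def by blast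
  then have "cl Y u \<in> \<A>" "a \<in> cl Y u" using a unfolding \<A>_def by auto
  then show ?thesis using above by blast
 qed
 moreover have "\<exists>u\<in>carrier M. u \<notin> Y \<and> P = cl Y u" if "P \<in> Mx" for P
  using w[OF that] by blast
 ultimately show ?thesis using prime by (intro exI[of _ Mx]) blast
qed

lemma nzd_cover:
 assumes "sm Y" "noann I Y"
 shows "\<exists>Ps. finite Ps \<and> (\<forall>P\<in>Ps. primeideal P R \<and> \<not> I \<subseteq> P) \<and>
  (\<forall>a\<in>carrier R. (\<forall>P\<in>Ps. a \<notin> P) \<longrightarrow> nzd a Y)"
proof -
 obtain Ps where Ps: "finite Ps" "\<forall>P\<in>Ps. primeideal P R \<and> (\<exists>u\<in>carrier M. u \<notin> Y \<and> P = cl Y u)"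
  "\<forall>a\<in>carrier R. \<not> nzd a Y \<longrightarrow> (\<exists>P\<in>Ps. a \<in> P)" using zero_divisors_cover[OF assms(1)] by blast
 have "\<not> I \<subseteq> P" if "P \<in> Ps" for P
 proof
  assume "I \<subseteq> P"
  moreover obtain u where "u \<in> carrier M" "u \<notin> Y" "P = cl Y u" using Ps(2) \<open>P \<in> Ps\<close> by blast
  ultimately show False using assms(2) unfolding noann_def by auto
 qed
 then show ?thesis using Ps by (intro exI[of _ Ps]) auto
qed

text \<open>The depth drops by one along every nonzerodivisor \<open>y\<close>, not only along the first term \<open>x\<close> of the given
regular sequence. In the induction step neither quotient \<open>M/(Y + xM)\<close>, \<open>M/(Y + yM)\<close> has vectors killed by \<open>I\<close>, so prime
avoidance finds one \<open>z \<in> I\<close> that is regular on both. The induction hypothesis moves from \<open>x, z\<close> to \<open>z, x\<close> to \<open>z, y\<close> to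
\<open>y, z\<close>.\<close>

theorem depth_exchange:
 "sm Y ==> dep I (Suc r) Y ==> y \<in> I ==> nzd y Y ==> dep I r (Y [+] sc y (carrier M))"
proof (induction r arbitrary: Y y)
 case 0 then show ?case by simp
next
 case (Suc r)
 from Suc.prems(2) obtain x where x: "x \<in> I" "nzd x Y" "dep I (Suc r) (Y [+] sc x (carrier M))"
  by (auto simp del: dep.simps simp: dep.simps(2)[of I "Suc r"])
 note Y = Suc.prems(1)
 have xR: "x \<in> carrier R" and yR: "y \<in> carrier R" using x Suc.prems(3) I_sub by auto
 define Yx where "Yx = Y [+] sc x (carrier M)"
 define Yy where "Yy = Y [+] sc y (carrier M)"
 have smx: "sm Yx" "sm Yy" unfolding Yx_def Yy_def using sm_plus_xM[OF Y] xR yR by auto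
 have nY: "noann I Y" using nzd_imp_noann x by blast
 have nYx: "noann I Yx" using dep_Suc_noann x(3) Yx_def by blast
 have nYy: "noann I Yy"
  unfolding noann_def
 proof (intro ballI impI)
  fix u assume u: "u \<in> carrier M" and Iu: "\<forall>a\<in>I. a *. u \<in> Yy"
  from Iu x(1) have "x *. u \<in> Y [+] sc y (carrier M)" unfolding Yy_def by blast
  then obtain y0 v where v: "y0 \<in> Y" "v \<in> carrier M" "x *. u = y0 +. y *. v" by (rule plus_xM_E)
  have y0: "y0 \<in> carrier M" using sm_carr[OF Y v(1)] .
  have "a *. v \<in> Yx" if a: "a \<in> I" for a
  proof -
   have aR: "a \<in> carrier R" using a I_sub by blast
   from Iu a have "a *. u \<in> Y [+] sc y (carrier M)" unfolding Yy_def by blast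
   then obtain y1 t where t: "y1 \<in> Y" "t \<in> carrier M" "a *. u = y1 +. y *. t" by (rule plus_xM_E)
   have y1: "y1 \<in> carrier M" using sm_carr[OF Y t(1)] .
   have e: "a *. (x *. u) = a *. y0 +. y *. (a *. v)"
    unfolding v(3) using v y0 aR yR by (simp add: smult_r_distr smult_commute)
   have e': "a *. (x *. u) = x *. y1 +. y *. (x *. t)"
    using t y1 aR xR yR u by (simp add: smult_r_distr smult_commute[of a x u] smult_commute[of y x t])
   have "y *. (a *. v) = (a *. y0 +. y *. (a *. v)) -. a *. y0"
    using v y0 aR yR by (simp add: add_sub_cancel_l)
   also have "\<dots> = (x *. y1 -. a *. y0) +. y *. (x *. t)"
    unfolding e[symmetric] e' using t y1 y0 aR xR yR by (simp add: M.minus_eq M.a_ac)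
   finally have "y *. (a *. v -. x *. t) = x *. y1 -. a *. y0"
    using t v y1 y0 aR xR yR by (simp add: smult_sub add_sub_cancel)
   also have "\<dots> \<in> Y" by (intro sm_sub[OF Y] sm_smult[OF Y] xR aR t v)
   finally have "a *. v -. x *. t \<in> Y" using Suc.prems(4) v t aR xR unfolding nzd_def by simp
   then show ?thesis unfolding Yx_def using plus_xM_I'[OF Y xR _ t(2)] v aR by simp
  qed
  then have "v \<in> Yx" using nYx v(2) unfolding noann_def by blast
  then obtain y2 s where s: "y2 \<in> Y" "s \<in> carrier M" "v = y2 +. x *. s" unfolding Yx_def by (rule plus_xM_E)
  have y2: "y2 \<in> carrier M" using sm_carr[OF Y s(1)] .
  have "x *. u = (y0 +. y *. y2) +. x *. (y *. s)"
   using v(3) s y0 y2 xR yR by (simp add: smult_r_distr smult_commute M.a_assoc)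
  then have "x *. (u -. y *. s) = y0 +. y *. y2"
   using u s y0 y2 xR yR by (simp add: smult_sub add_sub_cancel)
  then have "x *. (u -. y *. s) \<in> Y" using sm_add[OF Y v(1) sm_smult[OF Y yR s(1)]] by simp
  then have "u -. y *. s \<in> Y" using x(2) u s yR unfolding nzd_def by simp
  then show "u \<in> Yy" unfolding Yy_def by (rule plus_xM_I'[OF Y yR u s(2)])
 qed
 obtain P1 where P1: "finite P1" "\<And>P. P \<in> P1 ==> primeideal P R" "\<And>P. P \<in> P1 ==> \<not> I \<subseteq> P"
  "\<And>a. a \<in> carrier R ==> (\<forall>P\<in>P1. a \<notin> P) ==> nzd a Y" using nzd_cover[OF Y nY] by blast
 obtain P2 where P2: "finite P2" "\<And>P. P \<in> P2 ==> primeideal P R" "\<And>P. P \<in> P2 ==> \<not> I \<subseteq> P"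
  "\<And>a. a \<in> carrier R ==> (\<forall>P\<in>P2. a \<notin> P) ==> nzd a Yx" using nzd_cover[OF smx(1) nYx] by blast
 obtain P3 where P3: "finite P3" "\<And>P. P \<in> P3 ==> primeideal P R" "\<And>P. P \<in> P3 ==> \<not> I \<subseteq> P"
  "\<And>a. a \<in> carrier R ==> (\<forall>P\<in>P3. a \<notin> P) ==> nzd a Yy" using nzd_cover[OF smx(2) nYy] by blast
 obtain z where z: "z \<in> I" "\<forall>P\<in>P1 \<union> P2 \<union> P3. z \<notin> P"
  using prime_avoidance[OF I_ideal, of "P1 \<union> P2 \<union> P3"] P1(1-3) P2(1-3) P3(1-3) by blast
 have zR: "z \<in> carrier R" using z I_sub by blast
 have nz: "nzd z Y" "nzd z Yx" "nzd z Yy" using z P1(4) P2(4) P3(4) zR by blast+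
 define Yz where "Yz = Y [+] sc z (carrier M)"
 have smz: "sm Yz" unfolding Yz_def using sm_plus_xM[OF Y zR] .
 have "dep I r (Yx [+] sc z (carrier M))"
  by (rule Suc.IH[OF smx(1) _ z(1) nz(2)]) (use x(3) Yx_def in simp)
 then have "dep I r (Yz [+] sc x (carrier M))" unfolding Yz_def Yx_def using plus_xM_swap[OF Y xR zR] by simp
 moreover have "nzd x Yz" unfolding Yz_def by (rule nzd_swap[OF Y xR x(2) zR]) (use nz(2) Yx_def in simp)
 ultimately have dz: "dep I (Suc r) Yz" using x(1) by auto
 have "nzd y Yz" unfolding Yz_def by (rule nzd_swap[OF Y yR Suc.prems(4) zR]) (use nz(3) Yy_def in simp)
 then have "dep I r (Yz [+] sc y (carrier M))" using Suc.IH[OF smz dz Suc.prems(3)] by blast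
 then have "dep I r (Yy [+] sc z (carrier M))" unfolding Yz_def Yy_def using plus_xM_swap[OF Y yR zR] by simp
 then show ?case using z(1) nz(3) unfolding Yy_def[symmetric] by auto
qed

end

text \<open>Depth of an extension is at least the minimum of the depths. A common nonzerodivisor \<open>z\<close> on the outer modules exists by prime avoidance, it is regular on \<open>E\<close>, the sequence stays exact modulo \<open>z\<close>, and \<open>depth_exchange\<close> provides the hypotheses for the quotients.\<close>

theorem depth_extension:
 fixes R :: "'a ring" and N :: "('a, 'b) module" and E :: "('a, 'c) module" and M :: "('a, 'd) module"
 assumes "noeth_mod R N I" "rmod R E" "noeth_mod R M I" and ex: "short_exact R N E M f g"
 shows "submodule Y R E ==> rmod.dep N I r {n \<in> carrier N. f n \<in> Y} ==> rmod.dep M I r (g ` Y) ==>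
  rmod.dep E I r Y"
proof (induction r arbitrary: Y)
 interpret N: noeth_mod R N I by fact
 interpret E: rmod R E by fact
 interpret M: noeth_mod R M I by fact
 {
  case 0 show ?case by simp
 next
  case (Suc r)
  interpret f: rhom R N E f by (intro rhom.intro rhom_axioms.intro N.rmod_axioms E.rmod_axioms) (use ex short_exact_def in blast)
  interpret g: rhom R E M g by (intro rhom.intro rhom_axioms.intro M.rmod_axioms E.rmod_axioms) (use ex short_exact_def in blast)
  have surj: "\<And>m. m \<in> carrier M ==> \<exists>e\<in>carrier E. g e = m" using ex unfolding short_exact_def by (metis imageE)
  have exact: "\<And>e. e \<in> carrier E ==> g e = \<zero>\<^bsub>M\<^esub> ==> \<exists>n\<in>carrier N. f n = e"
   using ex unfolding short_exact_def a_kernel_def' by (smt (verit) imageE mem_Collect_eq)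
  have gf: "\<And>n. n \<in> carrier N ==> g (f n) = \<zero>\<^bsub>M\<^esub>"
   using ex unfolding short_exact_def a_kernel_def' by (smt (verit) imageI mem_Collect_eq)
  note Y = Suc.prems(1)
  define YN where "YN = {n \<in> carrier N. f n \<in> Y}"
  define YM where "YM = g ` Y"
  have sN: "N.sm YN" unfolding YN_def by (rule f.sm_vimage[OF N.sm_carrier Y])
  have sM: "M.sm YM" unfolding YM_def by (rule g.sm_image[OF Y])
  have dN: "N.dep I (Suc r) YN" and dM: "M.dep I (Suc r) YM" using Suc.prems unfolding YN_def YM_def by auto
  obtain P1 where P1: "finite P1" "\<And>P. P \<in> P1 ==> primeideal P R" "\<And>P. P \<in> P1 ==> \<not> I \<subseteq> P"
   "\<And>a. a \<in> carrier R ==> (\<forall>P\<in>P1. a \<notin> P) ==> N.nzd a YN" using N.nzd_cover[OF sN N.dep_Suc_noann[OF dN]] by blast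
  obtain P2 where P2: "finite P2" "\<And>P. P \<in> P2 ==> primeideal P R" "\<And>P. P \<in> P2 ==> \<not> I \<subseteq> P"
   "\<And>a. a \<in> carrier R ==> (\<forall>P\<in>P2. a \<notin> P) ==> M.nzd a YM" using M.nzd_cover[OF sM M.dep_Suc_noann[OF dM]] by blast
  obtain z where z: "z \<in> I" "\<forall>P\<in>P1 \<union> P2. z \<notin> P"
   using prime_avoidance[OF N.I_ideal, of "P1 \<union> P2"] P1(1-3) P2(1-3) by blast
  have zR: "z \<in> carrier R" using z N.I_sub by blast
  have nz: "N.nzd z YN" "M.nzd z YM" using z P1(4) P2(4) zR by blast+
  \<comment> \<open>an element of E killed modulo Y by multiplication with z, or congruent to such, differs from Y by an element of N\<close>
  have split: "\<exists>y n. y \<in> Y \<and> n \<in> carrier N \<and> e = y \<oplus>\<^bsub>E\<^esub> f n" if e: "e \<in> carrier E" "z \<odot>\<^bsub>M\<^esub> g e \<in> YM" for e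
  proof -
   have "g e \<in> YM" using nz(2) e unfolding M.nzd_def by simp
   then obtain y where y: "y \<in> Y" "g e = g y" unfolding YM_def by blast
   have yE: "y \<in> carrier E" using E.sm_carr[OF Y y(1)] .
   have "g (e \<ominus>\<^bsub>E\<^esub> y) = \<zero>\<^bsub>M\<^esub>" using e yE y by (simp add: g.h_sub M.M.minus_eq M.M.r_neg)
   then obtain n where "n \<in> carrier N" "f n = e \<ominus>\<^bsub>E\<^esub> y" using exact e yE by (metis E.minus_closed_M)
   moreover have "e = y \<oplus>\<^bsub>E\<^esub> (e \<ominus>\<^bsub>E\<^esub> y)" using E.sub_add_cancel e yE E.M.a_comm by simp
   ultimately show ?thesis using y by metis
  qed
  have nzE: "E.nzd z Y"
   unfolding E.nzd_def
  proof (intro ballI impI)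
   fix e assume e: "e \<in> carrier E" "z \<odot>\<^bsub>E\<^esub> e \<in> Y"
   then have "z \<odot>\<^bsub>M\<^esub> g e \<in> YM" unfolding YM_def using g.h_smult[OF zR e(1)] by (metis imageI)
   then obtain y n where yn: "y \<in> Y" "n \<in> carrier N" "e = y \<oplus>\<^bsub>E\<^esub> f n" using split e by blast
   have yE: "y \<in> carrier E" using E.sm_carr[OF Y yn(1)] .
   have "z \<odot>\<^bsub>E\<^esub> f n \<oplus>\<^bsub>E\<^esub> z \<odot>\<^bsub>E\<^esub> y \<in> Y" using e(2) yn yE zR by (simp add: E.smult_r_distr E.M.a_comm)
   then have "z \<odot>\<^bsub>E\<^esub> f n \<in> Y" using E.sm_add_mem[OF Y E.sm_smult[OF Y zR yn(1)]] yn zR by simp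
   then have "z \<odot>\<^bsub>N\<^esub> n \<in> YN" unfolding YN_def using yn zR by (simp add: f.h_smult)
   then have "f n \<in> Y" using nz(1) yn unfolding N.nzd_def YN_def by blast
   then show "e \<in> Y" using yn E.sm_add[OF Y] by blast
  qed
  have eN: "{n \<in> carrier N. f n \<in> E.psum Y (E.sc z (carrier E))} = N.psum YN (N.sc z (carrier N))"
  proof (intro equalityI subsetI)
   fix n assume "n \<in> {n \<in> carrier N. f n \<in> E.psum Y (E.sc z (carrier E))}"
   then have n: "n \<in> carrier N" "f n \<in> E.psum Y (E.sc z (carrier E))" by auto
   from n(2) obtain y e where ye: "y \<in> Y" "e \<in> carrier E" "f n = y \<oplus>\<^bsub>E\<^esub> z \<odot>\<^bsub>E\<^esub> e" by (rule E.plus_xM_E)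
   have yE: "y \<in> carrier E" using E.sm_carr[OF Y ye(1)] .
   have "z \<odot>\<^bsub>E\<^esub> e = f n \<oplus>\<^bsub>E\<^esub> \<ominus>\<^bsub>E\<^esub> y" using ye yE n zR E.add_sub_cancel_l[of y "z \<odot>\<^bsub>E\<^esub> e"] by (simp add: E.M.minus_eq)
   then have "g (z \<odot>\<^bsub>E\<^esub> e) = g (\<ominus>\<^bsub>E\<^esub> y)" using g.h_add[of "f n" "\<ominus>\<^bsub>E\<^esub> y"] n yE gf by simp
   then have "z \<odot>\<^bsub>M\<^esub> g e \<in> YM" unfolding YM_def using g.h_smult[OF zR ye(2)] E.sm_neg[OF Y ye(1)] by (metis imageI)
   then obtain y' n' where y': "y' \<in> Y" "n' \<in> carrier N" "e = y' \<oplus>\<^bsub>E\<^esub> f n'" using split ye(2) by blast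
   have y'E: "y' \<in> carrier E" using E.sm_carr[OF Y y'(1)] .
   have "f n = (y \<oplus>\<^bsub>E\<^esub> z \<odot>\<^bsub>E\<^esub> y') \<oplus>\<^bsub>E\<^esub> f (z \<odot>\<^bsub>N\<^esub> n')"
    using ye(3) y' yE y'E zR by (simp add: E.smult_r_distr f.h_smult E.M.a_assoc)
   then have "f (n \<ominus>\<^bsub>N\<^esub> z \<odot>\<^bsub>N\<^esub> n') = y \<oplus>\<^bsub>E\<^esub> z \<odot>\<^bsub>E\<^esub> y'"
    using n y' yE y'E zR by (simp add: f.h_sub E.add_sub_cancel)
   then have "n \<ominus>\<^bsub>N\<^esub> z \<odot>\<^bsub>N\<^esub> n' \<in> YN" unfolding YN_def
    using n y' zR E.sm_add[OF Y ye(1) E.sm_smult[OF Y zR y'(1)]] by simp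
   then show "n \<in> N.psum YN (N.sc z (carrier N))" by (rule N.plus_xM_I'[OF sN zR n(1) y'(2)])
  next
   fix n assume "n \<in> N.psum YN (N.sc z (carrier N))"
   then obtain y u where yu: "y \<in> YN" "u \<in> carrier N" "n = y \<oplus>\<^bsub>N\<^esub> z \<odot>\<^bsub>N\<^esub> u" by (rule N.plus_xM_E)
   have "y \<in> carrier N" "f y \<in> Y" using yu(1) by (auto simp: YN_def)
   then have "n \<in> carrier N" "f n = f y \<oplus>\<^bsub>E\<^esub> z \<odot>\<^bsub>E\<^esub> f u" using yu zR by (auto simp: f.h_add f.h_smult)
   then show "n \<in> {n \<in> carrier N. f n \<in> E.psum Y (E.sc z (carrier E))}"
    using E.plus_xM_I[OF \<open>f y \<in> Y\<close>, of "f u" z] yu by simp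
  qed
  have eM: "g ` E.psum Y (E.sc z (carrier E)) = M.psum YM (M.sc z (carrier M))"
  proof (intro equalityI subsetI)
   fix m assume "m \<in> g ` E.psum Y (E.sc z (carrier E))"
   then obtain y e where "y \<in> Y" "e \<in> carrier E" "m = g (y \<oplus>\<^bsub>E\<^esub> z \<odot>\<^bsub>E\<^esub> e)" by (auto elim: E.plus_xM_E)
   then have "m = g y \<oplus>\<^bsub>M\<^esub> z \<odot>\<^bsub>M\<^esub> g e" using E.sm_carr[OF Y] zR by (simp add: g.h_add g.h_smult)
   then show "m \<in> M.psum YM (M.sc z (carrier M))" using M.plus_xM_I[of "g y" YM "g e" z] \<open>y \<in> Y\<close> \<open>e \<in> carrier E\<close> YM_def by simp
  next
   fix m assume "m \<in> M.psum YM (M.sc z (carrier M))"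
   then obtain y u where yu: "y \<in> YM" "u \<in> carrier M" "m = y \<oplus>\<^bsub>M\<^esub> z \<odot>\<^bsub>M\<^esub> u" by (rule M.plus_xM_E)
   obtain y' e where "y' \<in> Y" "y = g y'" "e \<in> carrier E" "g e = u" using yu surj unfolding YM_def by blast
   then have "m = g (y' \<oplus>\<^bsub>E\<^esub> z \<odot>\<^bsub>E\<^esub> e)" using yu(3) E.sm_carr[OF Y] zR by (simp add: g.h_add g.h_smult)
   then show "m \<in> g ` E.psum Y (E.sc z (carrier E))" using E.plus_xM_I[OF \<open>y' \<in> Y\<close> \<open>e \<in> carrier E\<close>] by blast
  qed
  have "E.dep I r (E.psum Y (E.sc z (carrier E)))"
  proof (rule Suc.IH)
   show "E.sm (E.psum Y (E.sc z (carrier E)))" by (rule E.sm_plus_xM[OF Y zR])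
   show "N.dep I r {n \<in> carrier N. f n \<in> E.psum Y (E.sc z (carrier E))}"
    unfolding eN by (rule N.depth_exchange[OF sN dN z(1) nz(1)])
   show "M.dep I r (g ` E.psum Y (E.sc z (carrier E)))"
    unfolding eM by (rule M.depth_exchange[OF sM dM z(1) nz(2)])
  qed
  then show ?case using z(1) nzE by auto
 }
qed

context rmod begin

lemma coset_eq_iff: assumes "sm Y" "u \<in> carrier M" shows "Y +>\<^bsub>M\<^esub> u = Y \<longleftrightarrow> u \<in> Y"
proof -
 have sub: "subgroup Y (add_monoid M)" using assms(1) unfolding submodule_def by blast
 show ?thesis
 proof
  assume "Y +>\<^bsub>M\<^esub> u = Y"
  moreover have "\<zero>\<^bsub>M\<^esub> +. u \<in> Y +>\<^bsub>M\<^esub> u" using sm_zero[OF assms(1)] unfolding a_r_coset_def' by blast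
  ultimately show "u \<in> Y" using assms(2) by simp
 next
  assume "u \<in> Y" then show "Y +>\<^bsub>M\<^esub> u = Y" using M.a_coset_join2[OF assms(2) sub] by blast
 qed
qed

lemma coset_mem: "x \<in> Y +>\<^bsub>M\<^esub> u \<longleftrightarrow> (\<exists>y\<in>Y. x = y +. u)"
 unfolding a_r_coset_def' by blast

lemma coset_eqI: assumes "sm Y" "u \<in> carrier M" "v \<in> carrier M" "u -. v \<in> Y" shows "Y +>\<^bsub>M\<^esub> u = Y +>\<^bsub>M\<^esub> v"
proof -
 have *: "Y +>\<^bsub>M\<^esub> u \<subseteq> Y +>\<^bsub>M\<^esub> v" if "u \<in> carrier M" "v \<in> carrier M" "u -. v \<in> Y" for u v
 proof
  fix x assume "x \<in> Y +>\<^bsub>M\<^esub> u"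
  then obtain y where y: "y \<in> Y" "x = y +. u" unfolding coset_mem by blast
  have "x = (y +. (u -. v)) +. v"
   using y sm_carr[OF assms(1) y(1)] that by (simp add: M.minus_eq M.a_assoc M.l_neg)
  then show "x \<in> Y +>\<^bsub>M\<^esub> v" unfolding coset_mem using sm_add[OF assms(1) y(1) that(3)] by blast
 qed
 have "v -. u = \<ominus>\<^bsub>M\<^esub> (u -. v)" using assms(2,3) by (simp add: M.minus_eq M.minus_add M.a_comm)
 then show ?thesis using *[OF assms(2-4)] *[OF assms(3,2)] sm_neg[OF assms(1,4)] by auto
qed

lemma coset_eqD: assumes "sm Y" "u \<in> carrier M" "v \<in> carrier M" "Y +>\<^bsub>M\<^esub> u = Y +>\<^bsub>M\<^esub> v" shows "u -. v \<in> Y"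
proof -
 have "\<zero>\<^bsub>M\<^esub> +. u \<in> Y +>\<^bsub>M\<^esub> v" using assms(4) sm_zero[OF assms(1)] unfolding coset_mem[symmetric] by (metis coset_mem)
 then obtain y where "y \<in> Y" "u = y +. v" using assms(2) unfolding coset_mem by auto
 then show ?thesis using add_sub_cancel[of y v] sm_carr[OF assms(1)] assms(3) by simp
qed

text \<open>Multiplication of cosets in \<^const>\<open>quot_mod\<close> can be computed on one representative.\<close>

lemma coset_smult: assumes "sm Y" "u \<in> carrier M" "a \<in> carrier R"
 shows "(\<Union>x\<in>Y +>\<^bsub>M\<^esub> u. Y +>\<^bsub>M\<^esub> (a *. x)) = Y +>\<^bsub>M\<^esub> (a *. u)"
proof -
 have "Y +>\<^bsub>M\<^esub> (a *. x) = Y +>\<^bsub>M\<^esub> (a *. u)" if "x \<in> Y +>\<^bsub>M\<^esub> u" for x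
 proof -
  note asm = that
  obtain y where y: "y \<in> Y" "x = y +. u" using asm unfolding coset_mem by blast
  have yM: "y \<in> carrier M" using sm_carr[OF assms(1) y(1)] .
  have "a *. x -. a *. u = a *. y"
   using y yM assms by (simp add: smult_r_distr add_sub_cancel)
  then show ?thesis using sm_smult[OF assms(1,3) y(1)] y yM assms by (intro coset_eqI) auto
 qed
 moreover have "Y +>\<^bsub>M\<^esub> u \<noteq> {}" using sm_zero[OF assms(1)] unfolding a_r_coset_def' by blast
 ultimately show ?thesis by auto
qed

lemma quot_nzd_iff:
 assumes "sm Y" "a \<in> carrier R"
 shows "(\<forall>z\<in>carrier (quot_mod M Y). a \<odot>\<^bsub>quot_mod M Y\<^esub> z = \<zero>\<^bsub>quot_mod M Y\<^esub> \<longrightarrow> z = \<zero>\<^bsub>quot_mod M Y\<^esub>) \<longleftrightarrow> nzd a Y"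
proof -
 have car: "carrier (quot_mod M Y) = (\<lambda>u. Y +>\<^bsub>M\<^esub> u) ` carrier M"
  unfolding quot_mod_def A_RCOSETS_def' by auto
 show ?thesis unfolding car nzd_def using coset_smult[OF assms(1) _ assms(2)] coset_eq_iff[OF assms(1)] assms(2)
  by (simp add: quot_mod_def)
qed

primrec reg :: "'b set => 'a list => bool" where
 "reg Y [] \<longleftrightarrow> True"
| "reg Y (x # xs) \<longleftrightarrow> nzd x Y \<and> reg (Y [+] sc x (carrier M)) xs"

lemma dep_iff_reg: "dep I r Y \<longleftrightarrow> (\<exists>xs. set xs \<subseteq> I \<and> length xs = r \<and> reg Y xs)"
proof (induction r arbitrary: Y)
 case (Suc r)
 show ?case
 proof
  assume "dep I (Suc r) Y"
  then obtain x xs where "x \<in> I" "nzd x Y" "set xs \<subseteq> I" "length xs = r" "reg (Y [+] sc x (carrier M)) xs" using Suc by auto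
  then show "\<exists>xs. set xs \<subseteq> I \<and> length xs = Suc r \<and> reg Y xs" by (intro exI[of _ "x # xs"]) auto
 next
  assume "\<exists>xs. set xs \<subseteq> I \<and> length xs = Suc r \<and> reg Y xs"
  then obtain x xs where "x \<in> I" "nzd x Y" "set xs \<subseteq> I" "length xs = r" "reg (Y [+] sc x (carrier M)) xs"
   by (auto simp: length_Suc_conv)
  then show "dep I (Suc r) Y" using Suc by auto
 qed
qed simp

lemma reg_iff_nth:
 "set xs \<subseteq> carrier R ==> sm Y ==> reg Y xs \<longleftrightarrow> (\<forall>i<length xs. nzd (xs ! i) (Y [+] lsum (take i xs) (carrier M)))"
proof (induction xs arbitrary: Y)
 case (Cons x xs)
 then have x: "x \<in> carrier R" and xs: "set xs \<subseteq> carrier R" by auto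
 have sl: "sm (lsum (take i xs) (carrier M))" for i
  using xs set_take_subset[of i xs] by (intro sm_lsum sm_carrier) auto
 have sx: "sm (sc x (carrier M))" by (rule sm_sc[OF x sm_carrier])
 have "(Y [+] sc x (carrier M)) [+] lsum (take i xs) (carrier M) = Y [+] lsum (take (Suc i) (x # xs)) (carrier M)" for i
  using psum_assoc[OF sm_subset sm_subset sm_subset, OF Cons.prems(2) sx sl] by simp
 moreover have "Y [+] lsum (take 0 (x # xs)) (carrier M) = Y"
  using psum_absorb[OF Cons.prems(2) sm_null] sm_zero[OF Cons.prems(2)] by simp
 ultimately show ?case
  using Cons.IH[OF xs sm_plus_xM[OF Cons.prems(2) x]] by (simp add: All_less_Suc2 del: take_Suc_Cons lsum.simps)
qed simp

end

context noeth_mod begin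

lemma ideal_smult_lsum: "set xs \<subseteq> carrier R ==> ideal_smult R (Idl (set xs)) M = lsum xs (carrier M)"
 using ip_eq_lsum[OF R.genideal_self refl R.genideal_ideal sm_carrier] unfolding ideal_smult_def ip_def by simp

lemma regular_seq_iff:
 assumes "set xs \<subseteq> carrier R"
 shows "regular_seq R M xs \<longleftrightarrow> reg {\<zero>\<^bsub>M\<^esub>} xs \<and> ip (Idl (set xs)) (carrier M) \<noteq> carrier M"
proof -
 have t: "set (take i xs) \<subseteq> carrier R" for i using assms set_take_subset[of i xs] by blast
 have sl: "sm (lsum (take i xs) (carrier M))" for i by (rule sm_lsum[OF t sm_carrier])
 have "xs ! i \<in> carrier R" if "i < length xs" for i using assms that by auto
 then show ?thesis unfolding regular_seq_def Let_def ideal_smult_lsum[OF t]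
  using assms quot_nzd_iff[OF sl] reg_iff_nth[OF assms sm_null] psum_null[OF sl] by (simp add: ideal_smult_def ip_def)
qed

lemma dep_mono: "dep I r Y ==> r' \<le> r ==> dep I r' Y"
proof (induction r' arbitrary: r Y)
 case (Suc r')
 then obtain r0 where "r = Suc r0" using Suc_le_D by blast
 then show ?case using Suc by auto
qed simp

text \<open>A regular sequence in the sense of \<^const>\<open>regular_seq\<close> can be cut off after \<open>r\<close> terms, so the supremum that defines the depth yields one of length exactly \<open>r\<close>.\<close>

lemma depth_ge_imp_dep:
 assumes "enat r \<le> depth R I M" shows "dep I r {\<zero>\<^bsub>M\<^esub>}"
proof (cases r)
 case (Suc k)
 have "\<exists>xs. regular_seq R M xs \<and> set xs \<subseteq> I \<and> r \<le> length xs"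
 proof (rule ccontr)
  assume "\<not> ?thesis"
  then have "depth R I M \<le> enat k" unfolding depth_def using Suc by (intro Sup_least) fastforce
  then show False using assms Suc by (metis Suc_n_not_le_n enat_ord_simps(1) order_trans)
 qed
 then obtain xs where xs: "regular_seq R M xs" "set xs \<subseteq> I" "r \<le> length xs" by blast
 then have "reg {\<zero>\<^bsub>M\<^esub>} xs" using regular_seq_iff[of xs] I_sub by blast
 then have "dep I (length xs) {\<zero>\<^bsub>M\<^esub>}" unfolding dep_iff_reg using xs by blast
 then show ?thesis using dep_mono xs by blast
qed simp

lemma dep_imp_depth_ge:
 assumes "dep I r {\<zero>\<^bsub>M\<^esub>}" "ip I (carrier M) \<noteq> carrier M" shows "enat r \<le> depth R I M"
proof -
 obtain xs where xs: "set xs \<subseteq> I" "length xs = r" "reg {\<zero>\<^bsub>M\<^esub>} xs" using assms(1) unfolding dep_iff_reg by blast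
 have xsR: "set xs \<subseteq> carrier R" using xs I_sub by blast
 have "Idl (set xs) \<subseteq> I" by (rule R.genideal_minimal[OF I_ideal xs(1)])
 then have "ip (Idl (set xs)) (carrier M) \<subseteq> ip I (carrier M)" by (intro ip_mono I_sub order.refl)
 moreover have "ip I (carrier M) \<subseteq> carrier M" by (rule ip_subset[OF I_sub sm_carrier])
 ultimately have "regular_seq R M xs" unfolding regular_seq_iff[OF xsR] using xs(3) assms(2) by blast
 then show ?thesis unfolding depth_def using xs by (intro Sup_upper) blast
qed

end

section \<open>Quotients, restrictions and free modules\<close>

context rmod begin

lemma sm_abelian_subgroup: "sm Y ==> abelian_subgroup Y M"
 by (rule abelian_subgroupI3[OF additive_subgroupI]) (auto simp: submodule_def M.abelian_group_axioms)

lemma coset_add: assumes "sm Y" "u \<in> carrier M" "v \<in> carrier M"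
 shows "(Y +>\<^bsub>M\<^esub> u) <+>\<^bsub>M\<^esub> (Y +>\<^bsub>M\<^esub> v) = Y +>\<^bsub>M\<^esub> (u +. v)"
 by (rule abelian_subgroup.a_rcos_sum[OF sm_abelian_subgroup[OF assms(1)] assms(2,3)])

lemma carrier_quot: "carrier (quot_mod M Y) = (\<lambda>u. Y +>\<^bsub>M\<^esub> u) ` carrier M"
 unfolding quot_mod_def A_RCOSETS_def' by auto

lemma coset_zero: "sm Y ==> Y +>\<^bsub>M\<^esub> \<zero>\<^bsub>M\<^esub> = Y"
 using coset_eq_iff[of Y "\<zero>\<^bsub>M\<^esub>"] sm_zero by simp

lemma quot_ops: assumes "sm Y"
 shows "\<zero>\<^bsub>quot_mod M Y\<^esub> = Y"
  and "u \<in> carrier M ==> v \<in> carrier M ==> (Y +>\<^bsub>M\<^esub> u) \<oplus>\<^bsub>quot_mod M Y\<^esub> (Y +>\<^bsub>M\<^esub> v) = Y +>\<^bsub>M\<^esub> (u +. v)"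
  and "a \<in> carrier R ==> u \<in> carrier M ==> a \<odot>\<^bsub>quot_mod M Y\<^esub> (Y +>\<^bsub>M\<^esub> u) = Y +>\<^bsub>M\<^esub> (a *. u)"
 using coset_add[OF assms] coset_smult[OF assms] by (simp_all add: quot_mod_def)

lemma quot_rmod: assumes Y: "sm Y" shows "rmod R (quot_mod M Y)"
proof -
 note ops = quot_ops[OF Y] and car = carrier_quot[of Y]
 have "abelian_group (quot_mod M Y)"
 proof (rule abelian_groupI)
  show "\<zero>\<^bsub>quot_mod M Y\<^esub> \<in> carrier (quot_mod M Y)" unfolding car ops(1) using coset_zero[OF Y] by (metis imageI M.zero_closed)
  show "\<zero>\<^bsub>quot_mod M Y\<^esub> \<oplus>\<^bsub>quot_mod M Y\<^esub> x = x" if "x \<in> carrier (quot_mod M Y)" for x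
   using that ops(2)[of "\<zero>\<^bsub>M\<^esub>"] coset_zero[OF Y] unfolding car ops(1) by auto
  show "\<exists>y\<in>carrier (quot_mod M Y). y \<oplus>\<^bsub>quot_mod M Y\<^esub> x = \<zero>\<^bsub>quot_mod M Y\<^esub>" if "x \<in> carrier (quot_mod M Y)" for x
  proof -
   note asm = that
   obtain u where u: "u \<in> carrier M" "x = Y +>\<^bsub>M\<^esub> u" using asm unfolding car by blast
   show ?thesis unfolding car ops(1) u(2)
    by (rule bexI[of _ "Y +>\<^bsub>M\<^esub> (\<ominus>\<^bsub>M\<^esub> u)"]) (use u ops(2)[of "\<ominus>\<^bsub>M\<^esub> u" u] coset_zero[OF Y] in \<open>auto simp: M.l_neg\<close>)
  qed
 qed (auto simp: car ops M.a_ac)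
 then show ?thesis
  by (intro rmod.intro moduleI R.is_cring)
   (auto simp: car ops smult_l_distr smult_r_distr smult_assoc1)
qed

lemma quot_hom: assumes Y: "sm Y" shows "rhom R M (quot_mod M Y) (\<lambda>u. Y +>\<^bsub>M\<^esub> u)"
 by (intro rhom.intro rhom_axioms.intro quot_rmod[OF Y] rmod_axioms)
  (auto simp: mod_hom_def carrier_quot quot_ops[OF Y])

lemma restrict_rmod: "sm S ==> rmod R (M\<lparr>carrier := S\<rparr>)"
 by (intro rmod.intro submodule.submodule_is_module) (auto intro: module_axioms)

lemma restrict_sm: assumes S: "sm S" shows "submodule H R (M\<lparr>carrier := S\<rparr>) \<longleftrightarrow> sm H \<and> H \<subseteq> S"
proof -
 interpret S: rmod R "M\<lparr>carrier := S\<rparr>" by (rule restrict_rmod[OF S])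
 show ?thesis
 proof
  assume H: "S.sm H"
  show "sm H \<and> H \<subseteq> S"
   using S.sm_subset[OF H] S.sm_zero[OF H] S.sm_add[OF H] S.sm_smult[OF H] sm_subset[OF S]
   by (auto intro!: smI)
 next
  assume "sm H \<and> H \<subseteq> S"
  then show "S.sm H" by (intro S.smI) (auto simp: sm_zero sm_add sm_smult)
 qed
qed

lemma restrict_len: assumes "sm S" "U \<subseteq> S" shows "rmod.len R (M\<lparr>carrier := S\<rparr>) V U = len V U"
 unfolding rmod.len_def[OF restrict_rmod[OF assms(1)]] len_def
 by (rule antisym; rule ilen_map_le[where \<phi> = "\<lambda>H. H"]) (use restrict_sm[OF assms(1)] assms(2) in auto)

lemma restrict_ip: assumes S: "sm S" and "I \<subseteq> carrier R" "H \<subseteq> S" shows "rmod.ip R (M\<lparr>carrier := S\<rparr>) I H = ip I H"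
proof -
 interpret S: rmod R "M\<lparr>carrier := S\<rparr>" by (rule restrict_rmod[OF S])
 have HM: "H \<subseteq> carrier M" using assms sm_subset by blast
 show ?thesis
 proof
  have "ip I H \<subseteq> S" by (rule ip_least[OF S]) (use assms sm_smult[OF S] in blast)
  then have "S.sm (ip I H)" using restrict_sm[OF S] sm_ip[OF assms(2) HM] by blast
  then show "S.ip I H \<subseteq> ip I H" by (rule S.ip_least) (auto intro: ipI)
  have "sm (S.ip I H)" using restrict_sm[OF S] S.sm_ip[OF assms(2)] assms(3) by simp
  then show "ip I H \<subseteq> S.ip I H" by (rule ip_least) (use S.ipI[of _ I _ H] in auto)
 qed
qed

lemma mod_length_eq_len: "mod_length R M = len {\<zero>\<^bsub>M\<^esub>} (carrier M)"
 unfolding mod_length_def len_def ilen_def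
 by (rule arg_cong[where f = Sup]) (use sm_zero sm_subset in \<open>auto; metis (no_types)\<close>)

end

context rhom begin

text \<open>The case of an isomorphism \<open>U/V \<rightarrow> U\'/V\'\<close> induced by \<open>h\<close>.\<close>

lemma len_eq_hom:
 assumes "M.sm U" "M'.sm V'" "M'.sm U'" "V \<subseteq> U" "V' \<subseteq> U'"
  "\<And>u. u \<in> U ==> h u \<in> U'" "\<And>u. u \<in> U ==> h u \<in> V' \<longleftrightarrow> u \<in> V"
  "\<And>u'. u' \<in> U' ==> \<exists>u\<in>U. u' \<ominus>\<^bsub>M'\<^esub> h u \<in> V'"
 shows "M.len V U = M'.len V' U'"
 using len_le_hom[OF assms(1-3), of V] len_ge_hom[OF assms(1,4,2), of U'] assms(4-) by (intro antisym) blast+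

lemma surj_by_eq: assumes "M'.sm V'" "u' \<in> carrier M'" "h u = u'" "u \<in> U" shows "\<exists>u\<in>U. u' \<ominus>\<^bsub>M'\<^esub> h u \<in> V'"
 using assms M'.sm_zero[OF assms(1)] by (intro bexI[of _ u]) (simp_all add: M'.M.minus_eq M'.M.r_neg)

end

lemma free_simps [simp]:
 "\<zero>\<^bsub>free_mod R S\<^esub> = (\<lambda>s. \<zero>\<^bsub>R\<^esub>)" "u \<oplus>\<^bsub>free_mod R S\<^esub> v = (\<lambda>s. u s \<oplus>\<^bsub>R\<^esub> v s)" "a \<odot>\<^bsub>free_mod R S\<^esub> u = (\<lambda>s. a \<otimes>\<^bsub>R\<^esub> u s)"
 by (simp_all add: free_mod_def)

lemma free_carrier: "u \<in> carrier (free_mod R S) \<longleftrightarrow>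
  u ` S \<subseteq> carrier R \<and> (\<forall>s. s \<notin> S \<longrightarrow> u s = \<zero>\<^bsub>R\<^esub>) \<and> finite {s. u s \<noteq> \<zero>\<^bsub>R\<^esub>}"
 by (simp add: free_mod_def)

locale ucring = cring R for R :: "'a ring" (structure)
begin

lemma free_val: "u \<in> carrier (free_mod R S) ==> u s \<in> carrier R"
 unfolding free_carrier by (cases "s \<in> S") auto

lemma free_supp: "u \<in> carrier (free_mod R S) ==> finite {s. u s \<noteq> \<zero>} \<and> {s. u s \<noteq> \<zero>} \<subseteq> S"
 unfolding free_carrier by auto

lemma free_closed:
 "u \<in> carrier (free_mod R S) ==> v \<in> carrier (free_mod R S) ==> (\<lambda>s. u s \<oplus> v s) \<in> carrier (free_mod R S)"
 "a \<in> carrier R ==> u \<in> carrier (free_mod R S) ==> (\<lambda>s. a \<otimes> u s) \<in> carrier (free_mod R S)"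
proof -
 assume u: "u \<in> carrier (free_mod R S)" 
 {
  assume v: "v \<in> carrier (free_mod R S)"
  have "{s. u s \<oplus> v s \<noteq> \<zero>} \<subseteq> {s. u s \<noteq> \<zero>} \<union> {s. v s \<noteq> \<zero>}" by auto
  then have "finite {s. u s \<oplus> v s \<noteq> \<zero>}" using free_supp[OF u] free_supp[OF v] by (meson finite_UnI finite_subset)
  then show "(\<lambda>s. u s \<oplus> v s) \<in> carrier (free_mod R S)" using u v unfolding free_carrier by auto
 next
  assume a: "a \<in> carrier R"
  have "{s. a \<otimes> u s \<noteq> \<zero>} \<subseteq> {s. u s \<noteq> \<zero>}" using a by auto
  then have "finite {s. a \<otimes> u s \<noteq> \<zero>}" using free_supp[OF u] by (meson finite_subset)
  then show "(\<lambda>s. a \<otimes> u s) \<in> carrier (free_mod R S)" using u a unfolding free_carrier by auto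
 }
qed

end

sublocale rmod \<subseteq> R: ucring R
 by (rule ucring.intro) (rule R.is_cring)

lemma free_rmod: fixes R :: "'a ring" assumes "cring R" shows "rmod R (free_mod R S)"
proof -
 interpret R: ucring R by (rule ucring.intro) fact
 have "abelian_group (free_mod R S)"
 proof (rule abelian_groupI)
  fix x assume x: "x \<in> carrier (free_mod R S)"
  show "\<exists>y\<in>carrier (free_mod R S). y \<oplus>\<^bsub>free_mod R S\<^esub> x = \<zero>\<^bsub>free_mod R S\<^esub>"
   using R.free_closed(2)[of "\<ominus>\<^bsub>R\<^esub> \<one>\<^bsub>R\<^esub>" x S] x R.free_val[OF x]
   by (intro bexI[of _ "\<lambda>s. (\<ominus>\<^bsub>R\<^esub> \<one>\<^bsub>R\<^esub>) \<otimes>\<^bsub>R\<^esub> x s"]) (auto simp: R.l_minus R.l_neg)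
 next
  show "\<zero>\<^bsub>free_mod R S\<^esub> \<in> carrier (free_mod R S)" unfolding free_carrier by auto
 qed (auto simp: R.free_closed R.free_val R.a_assoc intro!: ext R.a_comm)
 then show ?thesis
  by (intro rmod.intro moduleI assms) (auto simp: R.free_closed R.free_val R.l_distr R.r_distr R.m_assoc)
qed

lemma free_gen_carrier: fixes R :: "'a ring" assumes "cring R" "s \<in> S" shows "free_gen R s \<in> carrier (free_mod R S)"
proof -
 interpret R: ucring R by (rule ucring.intro) fact
 have "{t. free_gen R s t \<noteq> \<zero>\<^bsub>R\<^esub>} \<subseteq> {s}" by (auto simp: free_gen_def)
 then show ?thesis using assms(2) unfolding free_carrier by (auto simp: free_gen_def dest: finite_subset)
qed

text \<open>Free modules are generated by their basis, by induction on the support.\<close>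

lemma free_induct:
 fixes R :: "'a ring"
 assumes "cring R" "submodule H R (free_mod R S)" "\<And>s. s \<in> S ==> free_gen R s \<in> H"
 shows "carrier (free_mod R S) \<subseteq> H"
proof
 interpret R: ucring R by (rule ucring.intro) fact
 interpret F: rmod R "free_mod R S" by (rule free_rmod[OF assms(1)])
 note H = assms(2)
 fix u assume u: "u \<in> carrier (free_mod R S)"
 have *: "finite T ==> T \<subseteq> S ==> (\<And>u. u \<in> carrier (free_mod R S) ==> {s. u s \<noteq> \<zero>\<^bsub>R\<^esub>} \<subseteq> T ==> u \<in> H)" for T
 proof (induction T rule: finite_induct)
  case empty
  then have "u = (\<lambda>s. \<zero>\<^bsub>R\<^esub>)" by auto
  then show ?case using F.sm_zero[OF H] by simp
 next
  case (insert t T)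
  define v where "v = (\<lambda>s. if s = t then \<zero>\<^bsub>R\<^esub> else u s)"
  have uc: "u s \<in> carrier R" for s by (rule R.free_val[OF insert.prems(2)])
  have "{s. v s \<noteq> \<zero>\<^bsub>R\<^esub>} \<subseteq> {s. u s \<noteq> \<zero>\<^bsub>R\<^esub>}" by (auto simp: v_def)
  then have fv: "finite {s. v s \<noteq> \<zero>\<^bsub>R\<^esub>}" using R.free_supp[OF insert.prems(2)] by (meson finite_subset)
  have v: "v \<in> carrier (free_mod R S)"
   unfolding free_carrier
  proof (intro conjI allI impI fv)
   show "v ` S \<subseteq> carrier R" using uc by (auto simp: v_def)
   show "v s = \<zero>\<^bsub>R\<^esub>" if "s \<notin> S" for s using insert.prems(2) that by (simp add: v_def free_carrier)
  qed
  have vT: "{s. v s \<noteq> \<zero>\<^bsub>R\<^esub>} \<subseteq> T" using insert.prems(3) by (auto simp: v_def)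
  have "v \<in> H" using insert.IH[OF _ v vT] insert.prems by blast
  moreover have "u t \<odot>\<^bsub>free_mod R S\<^esub> free_gen R t \<in> H"
   by (rule F.sm_smult[OF H uc assms(3)]) (use insert.prems in auto)
  moreover have "u = v \<oplus>\<^bsub>free_mod R S\<^esub> (u t \<odot>\<^bsub>free_mod R S\<^esub> free_gen R t)"
   using uc by (auto simp: v_def free_gen_def)
  ultimately show ?case using F.sm_add[OF H] by metis
 qed
 show "u \<in> H" by (rule *[OF _ _ u order.refl]) (use R.free_supp[OF u] in auto)
qed

lemma free_hom_eq:
 fixes R :: "'a ring"
 assumes "rhom R (free_mod R S) T h" "rhom R (free_mod R S) T h'" "\<And>s. s \<in> S ==> h (free_gen R s) = h' (free_gen R s)"
  "u \<in> carrier (free_mod R S)"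
 shows "h u = h' u"
proof -
 interpret h: rhom R "free_mod R S" T h by fact
 interpret h': rhom R "free_mod R S" T h' by fact
 have cr: "cring R" using assms(1) by (simp add: rhom_def rmod_def module_def)
 have "carrier (free_mod R S) \<subseteq> {u \<in> carrier (free_mod R S). h u = h' u}"
 proof (rule free_induct[OF cr])
  show "submodule {u \<in> carrier (free_mod R S). h u = h' u} R (free_mod R S)"
   by (rule h.M.smI)
    (auto simp del: free_simps simp: h.h_zero h'.h_zero h.h_add h'.h_add h.h_smult h'.h_smult)
 qed (use assms(3) free_gen_carrier[OF cr] in auto)
 then show ?thesis using assms(4) by blast
qed

context rmod begin

definition lin :: "('s => 'b) => ('s => 'a) => 'b"
 where "lin c u = finsum M (\<lambda>s. u s *. c s) {s. u s \<noteq> \<zero>}"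

lemma free_eval_lin: "free_eval R M = lin (\<lambda>x. x)"
 by (rule ext) (simp add: free_eval_def lin_def)

lemma lin_superset:
 assumes "u \<in> carrier (free_mod R S)" "\<And>s. s \<in> S ==> c s \<in> carrier M" "finite T" "{s. u s \<noteq> \<zero>} \<subseteq> T" "T \<subseteq> S"
 shows "lin c u = finsum M (\<lambda>s. u s *. c s) T"
 unfolding lin_def by (rule M.add.finprod_mono_neutral_cong_left[OF assms(3,4)])
  (use assms R.free_val[OF assms(1)] in \<open>auto simp: subset_iff\<close>)

lemma lin_hom:
 assumes c: "\<And>s. s \<in> S ==> c s \<in> carrier M"
 shows "rhom R (free_mod R S) M (lin c)"
proof -
 interpret F: rmod R "free_mod R S" by (rule free_rmod[OF R.is_cring])
 have val: "u s \<in> carrier R" if "u \<in> carrier (free_mod R S)" for u s using R.free_val[OF that] .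
 have fin: "finite {s. u s \<noteq> \<zero>}" "{s. u s \<noteq> \<zero>} \<subseteq> S" if "u \<in> carrier (free_mod R S)" for u using R.free_supp[OF that] by auto
 show ?thesis
 proof (intro rhom.intro rhom_axioms.intro F.rmod_axioms rmod_axioms)
  show "lin c \<in> mod_hom R (free_mod R S) M" unfolding mod_hom_def
  proof (intro CollectI conjI ballI funcsetI)
   fix u assume u: "u \<in> carrier (free_mod R S)"
   show "lin c u \<in> carrier M" unfolding lin_def using fin[OF u] val[OF u] c by (auto intro!: M.finsum_closed)
   fix v assume v: "v \<in> carrier (free_mod R S)"
   define T where "T = {s. u s \<noteq> \<zero>} \<union> {s. v s \<noteq> \<zero>}"
   have T: "finite T" "T \<subseteq> S" using fin[OF u] fin[OF v] by (auto simp: T_def)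
   have uv: "(\<lambda>s. u s \<oplus> v s) \<in> carrier (free_mod R S)" using F.M.a_closed[OF u v] by simp
   have "lin c (\<lambda>s. u s \<oplus> v s) = finsum M (\<lambda>s. (u s \<oplus> v s) *. c s) T"
    by (rule lin_superset[OF uv c T(1) _ T(2)]) (auto simp: T_def)
   also have "\<dots> = finsum M (\<lambda>s. u s *. c s +. v s *. c s) T"
    using val[OF u] val[OF v] c T by (intro M.finsum_cong') (auto simp: smult_l_distr subset_iff)
   also have "\<dots> = finsum M (\<lambda>s. u s *. c s) T +. finsum M (\<lambda>s. v s *. c s) T"
    using val[OF u] val[OF v] c T by (intro M.finsum_addf) (auto simp: subset_iff)
   also have "\<dots> = lin c u +. lin c v"
    using lin_superset[OF u c T(1) _ T(2)] lin_superset[OF v c T(1) _ T(2)] by (simp add: T_def)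
   finally show "lin c (u \<oplus>\<^bsub>free_mod R S\<^esub> v) = lin c u +. lin c v" by simp
  next
   fix a u assume a: "a \<in> carrier R" and u: "u \<in> carrier (free_mod R S)"
   have au: "(\<lambda>s. a \<otimes> u s) \<in> carrier (free_mod R S)" using F.smult_closed[OF a u] by simp
   have sub: "{s. a \<otimes> u s \<noteq> \<zero>} \<subseteq> {s. u s \<noteq> \<zero>}" using a by auto
   have "lin c (\<lambda>s. a \<otimes> u s) = finsum M (\<lambda>s. (a \<otimes> u s) *. c s) {s. u s \<noteq> \<zero>}"
    by (rule lin_superset[OF au c fin(1)[OF u] sub fin(2)[OF u]])
   also have "\<dots> = finsum M (\<lambda>s. a *. (u s *. c s)) {s. u s \<noteq> \<zero>}"
    using val[OF u] c fin[OF u] a by (intro M.finsum_cong') (auto simp: smult_assoc1 subset_iff)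
   also have "\<dots> = a *. lin c u" unfolding lin_def
    using val[OF u] c fin[OF u] a by (intro finsum_smult_ldistr[symmetric]) (auto simp: subset_iff)
   finally show "lin c (a \<odot>\<^bsub>free_mod R S\<^esub> u) = a *. lin c u" by simp
  qed
 qed
qed

lemma lin_gen: assumes "c s \<in> carrier M" shows "lin c (free_gen R s) = c s"
proof (cases "\<one> = \<zero>")
 case True
 then have "c s = \<zero>\<^bsub>M\<^esub>" using assms smult_one[OF assms] smult_l_null[OF assms] by simp
 then show ?thesis unfolding lin_def free_gen_def using True by (simp add: M.finsum_empty)
next
 case False
 then have "{t. free_gen R s t \<noteq> \<zero>} = {s}" by (auto simp: free_gen_def)
 then show ?thesis unfolding lin_def using assms by (simp add: free_gen_def)
qed

end

lemma finsum_free_apply: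
 fixes R :: "'a ring"
 assumes "cring R" "finite T" "\<And>s. s \<in> T ==> v s \<in> carrier (free_mod R S)"
 shows "finsum (free_mod R S) v T t = finsum R (\<lambda>s. v s t) T"
 using assms(2,3)
proof (induction T rule: finite_induct)
 interpret R: ucring R by (rule ucring.intro) fact
 interpret F: rmod R "free_mod R S" by (rule free_rmod[OF assms(1)])
 {
  case empty show ?case by (simp only: F.M.finsum_empty R.finsum_empty free_simps)
 next
  case (insert s T)
  have "finsum (free_mod R S) v (insert s T) = v s \<oplus>\<^bsub>free_mod R S\<^esub> finsum (free_mod R S) v T"
   using insert by (intro F.M.finsum_insert) auto
  moreover have "finsum R (\<lambda>s. v s t) (insert s T) = v s t \<oplus>\<^bsub>R\<^esub> finsum R (\<lambda>s. v s t) T"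
   using insert by (intro R.finsum_insert) (auto intro!: R.free_val[where S = S])
  ultimately show ?case using insert by simp
 }
qed

section \<open>Tensor products with cyclic modules\<close>

text \<open>The coefficient formula inside \<^const>\<open>tensor_map\<close>; \<open>push_lin\<close> identifies it with the linear extension of \<open>(x, y) \<mapsto> (h x, y)\<close>.\<close>

definition push :: "'a ring => ('b => 'd) => ('b \<times> 'c => 'a) => ('d \<times> 'c => 'a)"
 where "push R h u = (\<lambda>(x', y). finsum R (\<lambda>x. u (x, y)) {x. u (x, y) \<noteq> \<zero>\<^bsub>R\<^esub> \<and> h x = x'})"

lemma push_lin:
 fixes R :: "'a ring"
 assumes "cring R" "u \<in> carrier (free_mod R (X \<times> B))" "\<And>x. x \<in> X ==> h x \<in> X'"
 shows "push R h u = rmod.lin R (free_mod R (X' \<times> B)) (\<lambda>(x, y). free_gen R (h x, y)) u"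
proof
 interpret R: ucring R by (rule ucring.intro) fact
 interpret F: rmod R "free_mod R (X' \<times> B)" by (rule free_rmod[OF assms(1)])
 fix t :: "'d \<times> 'c"
 obtain x' y' where t: "t = (x', y')" by fastforce
 define supp where "supp = {s. u s \<noteq> \<zero>\<^bsub>R\<^esub>}"
 have fs: "finite supp" "supp \<subseteq> X \<times> B" using R.free_supp[OF assms(2)] by (auto simp: supp_def)
 have val: "u s \<in> carrier R" for s by (rule R.free_val[OF assms(2)])
 define g where "g s = u s \<otimes>\<^bsub>R\<^esub> (case s of (x, y) => free_gen R (h x, y)) t" for s
 have gc: "(case s of (x, y) => free_gen R (h x, y)) t \<in> carrier R" for s by (auto simp: free_gen_def split: prod.splits)
 have "rmod.lin R (free_mod R (X' \<times> B)) (\<lambda>(x, y). free_gen R (h x, y)) u t = finsum R g supp"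
  unfolding F.lin_def supp_def[symmetric] g_def
  by (subst finsum_free_apply[OF assms(1) fs(1)])
   (use fs assms(3) val in \<open>auto intro!: F.smult_closed free_gen_carrier[OF assms(1)] simp del: free_simps\<close>, simp)
 also have "\<dots> = finsum R u ((\<lambda>x. (x, y')) ` {x. u (x, y') \<noteq> \<zero>\<^bsub>R\<^esub> \<and> h x = x'})"
 proof (rule R.add.finprod_mono_neutral_cong_right[OF fs(1)])
  show "(\<lambda>x. (x, y')) ` {x. u (x, y') \<noteq> \<zero>\<^bsub>R\<^esub> \<and> h x = x'} \<subseteq> supp" by (auto simp: supp_def)
  show "g s = \<zero>\<^bsub>R\<^esub>" if "s \<in> supp - (\<lambda>x. (x, y')) ` {x. u (x, y') \<noteq> \<zero>\<^bsub>R\<^esub> \<and> h x = x'}" for s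
   using that val[of s] by (cases s) (auto simp: g_def free_gen_def t supp_def image_iff)
  show "g s = u s" if "s \<in> (\<lambda>x. (x, y')) ` {x. u (x, y') \<noteq> \<zero>\<^bsub>R\<^esub> \<and> h x = x'}" for s
   using that val by (auto simp: g_def free_gen_def t)
  show "g \<in> supp \<rightarrow> carrier R" using val gc by (auto simp: g_def)
 qed
 also have "\<dots> = finsum R (\<lambda>x. u (x, y')) {x. u (x, y') \<noteq> \<zero>\<^bsub>R\<^esub> \<and> h x = x'}"
  by (rule R.add.finprod_reindex) (use val in \<open>auto simp: inj_on_def\<close>)
 finally show "push R h u t = rmod.lin R (free_mod R (X' \<times> B)) (\<lambda>(x, y). free_gen R (h x, y)) u t"
  by (simp add: push_def t)
qed

lemma self_neg: "\<ominus>\<^bsub>self_mod R\<^esub> x = \<ominus>\<^bsub>R\<^esub> x"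
 by (simp add: a_inv_def m_inv_def)
lemma self_minus: "x \<ominus>\<^bsub>self_mod R\<^esub> y = x \<ominus>\<^bsub>R\<^esub> y"
 by (simp add: a_minus_def self_neg)

lemma rhom_comp: assumes "rhom R X Y f" "rhom R Y Z g" shows "rhom R X Z (\<lambda>u. g (f u))"
proof -
 interpret f: rhom R X Y f by fact
 interpret g: rhom R Y Z g by fact
 show ?thesis
  by (intro rhom.intro rhom_axioms.intro f.M.rmod_axioms g.M'.rmod_axioms)
   (auto simp: mod_hom_def f.h_add f.h_smult g.h_add g.h_smult)
qed

lemma (in rmod) sub_self: "x \<in> carrier M ==> x -. x = \<zero>\<^bsub>M\<^esub>"
 by (simp add: M.minus_eq M.r_neg)

lemma (in rmod) sm_congr: "sm H ==> x \<in> carrier M ==> y \<in> carrier M ==> x -. y \<in> H ==> x \<in> H \<longleftrightarrow> y \<in> H"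
 using sm_sub_mem[of H y x] sm_add[of H "x -. y" y] sm_sub[of H x "x -. y"] add_sub_cancel_l[of "x -. y" y] sub_add_cancel[of x y]
 by auto

lemma (in rmod) sub_sub_trans: "x \<in> carrier M ==> y \<in> carrier M ==> z \<in> carrier M ==>
  x -. z = (x -. y) +. (y -. z)"
 by (simp add: M.minus_eq M.a_assoc M.r_neg2 M.r_neg1 M.l_neg flip: M.a_assoc[of "\<ominus>\<^bsub>M\<^esub> y" y])

lemma (in rmod) add_sub_add: "[|a \<in> carrier M; b \<in> carrier M; c \<in> carrier M; d \<in> carrier M|] ==>
  (a +. b) -. (c +. d) = (a -. c) +. (b -. d)"
 by (simp add: M.minus_eq M.minus_add M.a_ac)

text \<open>Tensor products with \<open>B = R/I\<close>. As \<open>P \<otimes> B = P/IP\<close>, they can be replaced by subquotients of \<open>P\<close>.\<close>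

locale cyclic_quot = cring R for R :: "'a ring" (structure) + fixes I :: "'a set"
 assumes I_ideal: "ideal I R"

sublocale cyclic_quot \<subseteq> S: rmod R "self_mod R" by (rule self_rmod) (rule is_cring)

context cyclic_quot begin

abbreviation B where "B \<equiv> quot_mod (self_mod R) I"

lemma I_sub: "I \<subseteq> carrier R" by (rule ideal_subset[OF I_ideal])
lemma smI_self: "S.sm I" using I_ideal self_sm_iff[OF is_cring] by blast

text \<open>An arbitrary representative; that of the class of \<open>1\<close> is only congruent to \<open>1\<close> modulo \<open>I\<close>.\<close>

definition rep where "rep b = (SOME a. a \<in> carrier R \<and> b = I +>\<^bsub>self_mod R\<^esub> a)"
definition oneB where "oneB = I +>\<^bsub>self_mod R\<^esub> \<one>"

lemma B_rmod: "rmod R B" by (rule S.quot_rmod[OF smI_self])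

lemma rep: assumes "b \<in> carrier B" shows "rep b \<in> carrier R" "b = I +>\<^bsub>self_mod R\<^esub> rep b"
proof -
 have "\<exists>a. a \<in> carrier R \<and> b = I +>\<^bsub>self_mod R\<^esub> a" using assms unfolding S.carrier_quot by auto
 from someI_ex[OF this] show "rep b \<in> carrier R" "b = I +>\<^bsub>self_mod R\<^esub> rep b" unfolding rep_def by auto
qed

lemma oneB: "oneB \<in> carrier B" unfolding oneB_def S.carrier_quot by simp

lemma rep_congr: assumes "a \<in> carrier R" "b = I +>\<^bsub>self_mod R\<^esub> a" shows "rep b \<ominus> a \<in> I"
proof -
 have b: "b \<in> carrier B" unfolding S.carrier_quot assms(2) using assms(1) by simp
 show ?thesis using S.coset_eqD[OF smI_self, of "rep b" a] rep[OF b] assms by (simp add: self_minus)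
qed

lemma rep_one: "rep oneB \<ominus> \<one> \<in> I" by (rule rep_congr) (simp_all add: oneB_def)

lemma rep_add: assumes "b \<in> carrier B" "b' \<in> carrier B" shows "rep (b \<oplus>\<^bsub>B\<^esub> b') \<ominus> (rep b \<oplus> rep b') \<in> I"
proof (rule rep_congr)
 show "b \<oplus>\<^bsub>B\<^esub> b' = I +>\<^bsub>self_mod R\<^esub> (rep b \<oplus> rep b')"
  using S.quot_ops(2)[OF smI_self, of "rep b" "rep b'"] rep[OF assms(1)] rep[OF assms(2)] by simp
qed (use rep[OF assms(1)] rep[OF assms(2)] in simp)

lemma rep_smult: assumes "b \<in> carrier B" "a \<in> carrier R" shows "rep (a \<odot>\<^bsub>B\<^esub> b) \<ominus> (a \<otimes> rep b) \<in> I"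
proof (rule rep_congr)
 show "a \<odot>\<^bsub>B\<^esub> b = I +>\<^bsub>self_mod R\<^esub> (a \<otimes> rep b)"
  using S.quot_ops(3)[OF smI_self, of a "rep b"] rep[OF assms(1)] assms(2) by simp
qed (use rep[OF assms(1)] assms in simp)

lemma smult_oneB: "b \<in> carrier B ==> rep b \<odot>\<^bsub>B\<^esub> oneB = b"
 using S.quot_ops(3)[OF smI_self, of "rep b" \<one>] rep[of b] by (simp add: oneB_def)

lemma I_smult_oneB: assumes "a \<in> I" shows "a \<odot>\<^bsub>B\<^esub> oneB = \<zero>\<^bsub>B\<^esub>"
 using S.quot_ops[OF smI_self] S.coset_eq_iff[OF smI_self, of a] assms I_sub by (auto simp: oneB_def)

text \<open>A lift to the free module of the isomorphism \<open>P \<otimes> B \<rightarrow> P/IP\<close>, \<open>p \<otimes> b \<mapsto> bp\<close>. It depends on the chosen representatives, its class modulo \<open>IP\<close> does not.\<close>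

definition psi :: "('a, 'p) module => ('p \<times> 'a set => 'a) => 'p"
 where "psi P = rmod.lin R P (\<lambda>(p, b). rep b \<odot>\<^bsub>P\<^esub> p)"

abbreviation Fr :: "('a, 'p) module => ('a, 'p \<times> 'a set => 'a) module"
 where "Fr P \<equiv> free_mod R (carrier P \<times> carrier B)"

abbreviation dl :: "'p => 'a set => 'p \<times> 'a set => 'a" where "dl x y \<equiv> free_gen R (x, y)"

lemma psi_rhom: assumes "rmod R P" shows "rhom R (Fr P) P (psi P)"
proof -
 interpret P: rmod R P by fact
 show ?thesis unfolding psi_def by (rule P.lin_hom) (auto simp: rep)
qed

lemma dl_carrier: "x \<in> carrier P ==> y \<in> carrier B ==> dl x y \<in> carrier (Fr P)"
 by (rule free_gen_carrier[OF is_cring]) simp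

lemma psi_dl: assumes "rmod R P" "x \<in> carrier P" "y \<in> carrier B" shows "psi P (dl x y) = rep y \<odot>\<^bsub>P\<^esub> x"
proof -
 interpret P: rmod R P by fact
 show ?thesis unfolding psi_def using P.lin_gen[of "\<lambda>(p, b). rep b \<odot>\<^bsub>P\<^esub> p" "(x, y)"] rep[OF assms(3)] assms(2) by simp
qed

lemma tensor_rel_facts:
 assumes P: "rmod R P"
 shows "submodule (tensor_rel R P B) R (Fr P)"
  and "[|x \<in> carrier P; x' \<in> carrier P; y \<in> carrier B|] ==> dl (x \<oplus>\<^bsub>P\<^esub> x') y \<ominus>\<^bsub>Fr P\<^esub> (dl x y \<oplus>\<^bsub>Fr P\<^esub> dl x' y) \<in> tensor_rel R P B"
  and "[|a \<in> carrier R; x \<in> carrier P; y \<in> carrier B|] ==> dl (a \<odot>\<^bsub>P\<^esub> x) y \<ominus>\<^bsub>Fr P\<^esub> (a \<odot>\<^bsub>Fr P\<^esub> dl x y) \<in> tensor_rel R P B"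
  and "[|a \<in> carrier R; x \<in> carrier P; y \<in> carrier B|] ==> dl x (a \<odot>\<^bsub>B\<^esub> y) \<ominus>\<^bsub>Fr P\<^esub> (a \<odot>\<^bsub>Fr P\<^esub> dl x y) \<in> tensor_rel R P B"
  and "v \<in> tensor_rel R P B ==> psi P v \<in> rmod.ip R P I (carrier P)"
proof -
 interpret P: rmod R P by fact
 interpret BM: rmod R B by (rule B_rmod)
 interpret F: rmod R "Fr P" by (rule free_rmod[OF is_cring])
 interpret h: rhom R "Fr P" P "psi P" by (rule psi_rhom[OF P])
 note dlc = dl_carrier[of _ P]
 note rel = tensor_rel_def[of R P B, unfolded Let_def]
 show "submodule (tensor_rel R P B) R (Fr P)"
  unfolding rel by (rule F.sm_gen) (auto simp del: free_simps intro!: F.minus_closed_M F.M.a_closed F.smult_closed dlc)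
 show "[|x \<in> carrier P; x' \<in> carrier P; y \<in> carrier B|] ==> dl (x \<oplus>\<^bsub>P\<^esub> x') y \<ominus>\<^bsub>Fr P\<^esub> (dl x y \<oplus>\<^bsub>Fr P\<^esub> dl x' y) \<in> tensor_rel R P B"
  unfolding rel by (rule subsetD[OF F.gen_incl]) blast
 show "[|a \<in> carrier R; x \<in> carrier P; y \<in> carrier B|] ==> dl (a \<odot>\<^bsub>P\<^esub> x) y \<ominus>\<^bsub>Fr P\<^esub> (a \<odot>\<^bsub>Fr P\<^esub> dl x y) \<in> tensor_rel R P B"
  unfolding rel by (rule subsetD[OF F.gen_incl]) blast
 show "[|a \<in> carrier R; x \<in> carrier P; y \<in> carrier B|] ==> dl x (a \<odot>\<^bsub>B\<^esub> y) \<ominus>\<^bsub>Fr P\<^esub> (a \<odot>\<^bsub>Fr P\<^esub> dl x y) \<in> tensor_rel R P B"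
  unfolding rel by (rule subsetD[OF F.gen_incl]) blast
 have smIP: "P.sm (P.ip I (carrier P))" by (rule P.sm_ip[OF I_sub order.refl])
 have psi_in: "psi P v \<in> P.ip I (carrier P)" if "psi P v = c \<odot>\<^bsub>P\<^esub> x" "c \<in> I" "x \<in> carrier P" for v c x
  unfolding that(1) by (rule P.ipI[OF that(2,3)])
 have zero_in: "\<zero>\<^bsub>P\<^esub> \<in> P.ip I (carrier P)" by (rule P.sm_zero[OF smIP])
 have "tensor_rel R P B \<subseteq> {v \<in> carrier (Fr P). psi P v \<in> P.ip I (carrier P)}"
  unfolding rel
 proof (rule F.gen_least[OF h.sm_vimage[OF F.sm_carrier smIP]], safe)
  fix x x' y assume x: "x \<in> carrier P" "x' \<in> carrier P" and y: "y \<in> carrier B"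
  show "dl (x \<oplus>\<^bsub>P\<^esub> x') y \<ominus>\<^bsub>Fr P\<^esub> (dl x y \<oplus>\<^bsub>Fr P\<^esub> dl x' y) \<in> carrier (Fr P)"
   by (intro F.minus_closed_M F.M.a_closed dlc x y P.M.a_closed)
  have "psi P (dl (x \<oplus>\<^bsub>P\<^esub> x') y \<ominus>\<^bsub>Fr P\<^esub> (dl x y \<oplus>\<^bsub>Fr P\<^esub> dl x' y)) = rep y \<odot>\<^bsub>P\<^esub> (x \<oplus>\<^bsub>P\<^esub> x') \<ominus>\<^bsub>P\<^esub> (rep y \<odot>\<^bsub>P\<^esub> x \<oplus>\<^bsub>P\<^esub> rep y \<odot>\<^bsub>P\<^esub> x')"
   using x y dlc by (simp del: free_simps add: h.h_sub h.h_add psi_dl[OF P])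
  also have "\<dots> = \<zero>\<^bsub>P\<^esub>" using x rep[OF y] by (simp add: P.smult_r_distr P.sub_self)
  finally show "psi P (dl (x \<oplus>\<^bsub>P\<^esub> x') y \<ominus>\<^bsub>Fr P\<^esub> (dl x y \<oplus>\<^bsub>Fr P\<^esub> dl x' y)) \<in> P.ip I (carrier P)" using zero_in by simp
 next
  fix x y y' assume x: "x \<in> carrier P" and y: "y \<in> carrier B" "y' \<in> carrier B"
  show "dl x (y \<oplus>\<^bsub>B\<^esub> y') \<ominus>\<^bsub>Fr P\<^esub> (dl x y \<oplus>\<^bsub>Fr P\<^esub> dl x y') \<in> carrier (Fr P)"
   by (intro F.minus_closed_M F.M.a_closed dlc x y BM.M.a_closed)
  have r: "rep y \<in> carrier R" "rep y' \<in> carrier R" "rep (y \<oplus>\<^bsub>B\<^esub> y') \<in> carrier R" using rep y BM.M.a_closed by auto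
  have "psi P (dl x (y \<oplus>\<^bsub>B\<^esub> y') \<ominus>\<^bsub>Fr P\<^esub> (dl x y \<oplus>\<^bsub>Fr P\<^esub> dl x y')) = rep (y \<oplus>\<^bsub>B\<^esub> y') \<odot>\<^bsub>P\<^esub> x \<ominus>\<^bsub>P\<^esub> (rep y \<odot>\<^bsub>P\<^esub> x \<oplus>\<^bsub>P\<^esub> rep y' \<odot>\<^bsub>P\<^esub> x)"
   using x y dlc BM.M.a_closed[OF y] by (simp del: free_simps add: h.h_sub h.h_add psi_dl[OF P])
  also have "\<dots> = (rep (y \<oplus>\<^bsub>B\<^esub> y') \<ominus> (rep y \<oplus> rep y')) \<odot>\<^bsub>P\<^esub> x"
   using x r by (simp add: P.sub_smult P.smult_l_distr)
  finally show "psi P (dl x (y \<oplus>\<^bsub>B\<^esub> y') \<ominus>\<^bsub>Fr P\<^esub> (dl x y \<oplus>\<^bsub>Fr P\<^esub> dl x y')) \<in> P.ip I (carrier P)"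
   using psi_in rep_add[OF y] x by blast
 next
  fix a x y assume a: "a \<in> carrier R" and x: "x \<in> carrier P" and y: "y \<in> carrier B"
  show "dl (a \<odot>\<^bsub>P\<^esub> x) y \<ominus>\<^bsub>Fr P\<^esub> (a \<odot>\<^bsub>Fr P\<^esub> dl x y) \<in> carrier (Fr P)"
   by (intro F.minus_closed_M F.smult_closed dlc x y a P.smult_closed)
  have "psi P (dl (a \<odot>\<^bsub>P\<^esub> x) y \<ominus>\<^bsub>Fr P\<^esub> (a \<odot>\<^bsub>Fr P\<^esub> dl x y)) = rep y \<odot>\<^bsub>P\<^esub> (a \<odot>\<^bsub>P\<^esub> x) \<ominus>\<^bsub>P\<^esub> a \<odot>\<^bsub>P\<^esub> (rep y \<odot>\<^bsub>P\<^esub> x)"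
   using x y a dlc by (simp del: free_simps add: h.h_sub h.h_smult psi_dl[OF P])
  also have "\<dots> = \<zero>\<^bsub>P\<^esub>" using x a rep[OF y] by (simp add: P.smult_commute[of a] P.sub_self)
  finally show "psi P (dl (a \<odot>\<^bsub>P\<^esub> x) y \<ominus>\<^bsub>Fr P\<^esub> (a \<odot>\<^bsub>Fr P\<^esub> dl x y)) \<in> P.ip I (carrier P)" using zero_in by simp
 next
  fix a x y assume a: "a \<in> carrier R" and x: "x \<in> carrier P" and y: "y \<in> carrier B"
  show "dl x (a \<odot>\<^bsub>B\<^esub> y) \<ominus>\<^bsub>Fr P\<^esub> (a \<odot>\<^bsub>Fr P\<^esub> dl x y) \<in> carrier (Fr P)"
   by (intro F.minus_closed_M F.smult_closed dlc x y a BM.smult_closed)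
  have r: "rep y \<in> carrier R" "rep (a \<odot>\<^bsub>B\<^esub> y) \<in> carrier R" using rep y a BM.smult_closed by auto
  have "psi P (dl x (a \<odot>\<^bsub>B\<^esub> y) \<ominus>\<^bsub>Fr P\<^esub> (a \<odot>\<^bsub>Fr P\<^esub> dl x y)) = rep (a \<odot>\<^bsub>B\<^esub> y) \<odot>\<^bsub>P\<^esub> x \<ominus>\<^bsub>P\<^esub> a \<odot>\<^bsub>P\<^esub> (rep y \<odot>\<^bsub>P\<^esub> x)"
   using x y a dlc BM.smult_closed[OF a y] by (simp del: free_simps add: h.h_sub h.h_smult psi_dl[OF P])
  also have "\<dots> = (rep (a \<odot>\<^bsub>B\<^esub> y) \<ominus> (a \<otimes> rep y)) \<odot>\<^bsub>P\<^esub> x" using x r a by (simp add: P.sub_smult P.smult_assoc1)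
  finally show "psi P (dl x (a \<odot>\<^bsub>B\<^esub> y) \<ominus>\<^bsub>Fr P\<^esub> (a \<odot>\<^bsub>Fr P\<^esub> dl x y)) \<in> P.ip I (carrier P)"
   using psi_in rep_smult[OF y a] x by blast
 qed
 then show "v \<in> tensor_rel R P B ==> psi P v \<in> rmod.ip R P I (carrier P)" by blast
qed

text \<open>Injectivity of \<open>P \<otimes> B \<rightarrow> P/IP\<close>. Modulo the relations every \<open>v\<close> equals \<open>psi v \<otimes> 1\<close>, and \<open>p \<otimes> 1\<close> is a relation for \<open>p \<in> IP\<close>.\<close>

lemma tensor_rel_iff:
 assumes P: "rmod R P" and v: "v \<in> carrier (Fr P)"
 shows "v \<in> tensor_rel R P B \<longleftrightarrow> psi P v \<in> rmod.ip R P I (carrier P)"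
proof
 interpret P: rmod R P by fact
 interpret BM: rmod R B by (rule B_rmod)
 interpret F: rmod R "Fr P" by (rule free_rmod[OF is_cring])
 interpret h: rhom R "Fr P" P "psi P" by (rule psi_rhom[OF P])
 note dlc = dl_carrier[of _ P]
 define K where "K = tensor_rel R P B"
 note fs = tensor_rel_facts[OF P, folded K_def]
 note K = fs(1)
 have d1: "dl p oneB \<in> carrier (Fr P)" if "p \<in> carrier P" for p by (rule dlc[OF that oneB])
 have add1: "dl (p \<oplus>\<^bsub>P\<^esub> q) oneB \<ominus>\<^bsub>Fr P\<^esub> (dl p oneB \<oplus>\<^bsub>Fr P\<^esub> dl q oneB) \<in> K" if "p \<in> carrier P" "q \<in> carrier P" for p q
  by (rule fs(2)[OF that oneB])
 have smult1: "dl (a \<odot>\<^bsub>P\<^esub> p) oneB \<ominus>\<^bsub>Fr P\<^esub> (a \<odot>\<^bsub>Fr P\<^esub> dl p oneB) \<in> K" if "a \<in> carrier R" "p \<in> carrier P" for p a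
  by (rule fs(3)[OF that oneB])
 have zB: "dl p \<zero>\<^bsub>B\<^esub> \<in> K" if p: "p \<in> carrier P" for p
 proof -
  have "dl p (\<zero> \<odot>\<^bsub>B\<^esub> \<zero>\<^bsub>B\<^esub>) \<ominus>\<^bsub>Fr P\<^esub> (\<zero> \<odot>\<^bsub>Fr P\<^esub> dl p \<zero>\<^bsub>B\<^esub>) \<in> K" by (rule fs(4)) (use p BM.M.zero_closed in auto)
  moreover have "\<zero> \<odot>\<^bsub>B\<^esub> \<zero>\<^bsub>B\<^esub> = \<zero>\<^bsub>B\<^esub>" by (rule BM.smult_l_null[OF BM.M.zero_closed])
  moreover have "\<zero> \<odot>\<^bsub>Fr P\<^esub> dl p \<zero>\<^bsub>B\<^esub> = \<zero>\<^bsub>Fr P\<^esub>" by (rule F.smult_l_null[OF dlc[OF p BM.M.zero_closed]])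
  ultimately have "dl p \<zero>\<^bsub>B\<^esub> \<ominus>\<^bsub>Fr P\<^esub> \<zero>\<^bsub>Fr P\<^esub> \<in> K" by (simp del: free_simps)
  then show ?thesis by (rule F.sm_sub_mem[OF K F.sm_zero[OF K] dlc[OF p BM.M.zero_closed]])
 qed
 have J: "P.sm {p \<in> carrier P. dl p oneB \<in> K}"
 proof (rule P.smI)
  have "dl (\<zero> \<odot>\<^bsub>P\<^esub> \<zero>\<^bsub>P\<^esub>) oneB \<ominus>\<^bsub>Fr P\<^esub> (\<zero> \<odot>\<^bsub>Fr P\<^esub> dl \<zero>\<^bsub>P\<^esub> oneB) \<in> K" by (rule smult1) auto
  moreover have "\<zero> \<odot>\<^bsub>Fr P\<^esub> dl \<zero>\<^bsub>P\<^esub> oneB = \<zero>\<^bsub>Fr P\<^esub>" by (rule F.smult_l_null[OF d1]) simp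
  ultimately have "dl \<zero>\<^bsub>P\<^esub> oneB \<ominus>\<^bsub>Fr P\<^esub> \<zero>\<^bsub>Fr P\<^esub> \<in> K" by (simp del: free_simps)
  then have "dl \<zero>\<^bsub>P\<^esub> oneB \<in> K" by (rule F.sm_sub_mem[OF K F.sm_zero[OF K] d1[OF P.M.zero_closed]])
  then show "\<zero>\<^bsub>P\<^esub> \<in> {p \<in> carrier P. dl p oneB \<in> K}" by simp
 next
  fix p q assume "p \<in> {p \<in> carrier P. dl p oneB \<in> K}" "q \<in> {p \<in> carrier P. dl p oneB \<in> K}"
  then have pq: "p \<in> carrier P" "q \<in> carrier P" "dl p oneB \<oplus>\<^bsub>Fr P\<^esub> dl q oneB \<in> K" using F.sm_add[OF K] by auto
  then show "p \<oplus>\<^bsub>P\<^esub> q \<in> {p \<in> carrier P. dl p oneB \<in> K}"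
   using F.sm_sub_mem[OF K pq(3) d1 add1] by (simp del: free_simps)
 next
  fix a p assume "a \<in> carrier R" "p \<in> {p \<in> carrier P. dl p oneB \<in> K}"
  then have ap: "a \<in> carrier R" "p \<in> carrier P" "a \<odot>\<^bsub>Fr P\<^esub> dl p oneB \<in> K" using F.sm_smult[OF K] by auto
  then show "a \<odot>\<^bsub>P\<^esub> p \<in> {p \<in> carrier P. dl p oneB \<in> K}"
   using F.sm_sub_mem[OF K ap(3) d1 smult1] by (simp del: free_simps)
 qed auto
 have IPJ: "P.ip I (carrier P) \<subseteq> {p \<in> carrier P. dl p oneB \<in> K}"
 proof (rule P.ip_least[OF J])
  fix a p assume a: "a \<in> I" and p: "p \<in> carrier P"
  have aR: "a \<in> carrier R" using a I_sub by blast
  have "dl p (a \<odot>\<^bsub>B\<^esub> oneB) \<ominus>\<^bsub>Fr P\<^esub> (a \<odot>\<^bsub>Fr P\<^esub> dl p oneB) \<in> K" by (rule fs(4)[OF aR p oneB])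
  then have "dl p \<zero>\<^bsub>B\<^esub> \<ominus>\<^bsub>Fr P\<^esub> (a \<odot>\<^bsub>Fr P\<^esub> dl p oneB) \<in> K" by (simp only: I_smult_oneB[OF a])
  then have "a \<odot>\<^bsub>Fr P\<^esub> dl p oneB \<in> K"
   using F.sm_congr[OF K dlc[OF p BM.M.zero_closed] F.smult_closed[OF aR d1[OF p]]] zB[OF p] by blast
  then have "dl (a \<odot>\<^bsub>P\<^esub> p) oneB \<in> K"
   using F.sm_sub_mem[OF K _ d1 smult1[OF aR p]] aR p by blast
  then show "a \<odot>\<^bsub>P\<^esub> p \<in> {p \<in> carrier P. dl p oneB \<in> K}" using aR p by simp
 qed
 define Q where "Q = {v \<in> carrier (Fr P). v \<ominus>\<^bsub>Fr P\<^esub> dl (psi P v) oneB \<in> K}"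
 have "carrier (Fr P) \<subseteq> Q"
 proof (rule free_induct[OF is_cring])
  show "F.sm Q"
  proof (rule F.smI)
   have "dl \<zero>\<^bsub>P\<^esub> oneB \<in> K" using P.sm_zero[OF J] by blast
   then have "\<zero>\<^bsub>Fr P\<^esub> \<ominus>\<^bsub>Fr P\<^esub> dl \<zero>\<^bsub>P\<^esub> oneB \<in> K" by (rule F.sm_sub[OF K F.sm_zero[OF K]])
   then show "\<zero>\<^bsub>Fr P\<^esub> \<in> Q" unfolding Q_def using h.h_zero by (simp del: free_simps)
  next
   fix v w assume "v \<in> Q" "w \<in> Q"
   then have v: "v \<in> carrier (Fr P)" "v \<ominus>\<^bsub>Fr P\<^esub> dl (psi P v) oneB \<in> K"
    and w: "w \<in> carrier (Fr P)" "w \<ominus>\<^bsub>Fr P\<^esub> dl (psi P w) oneB \<in> K" by (auto simp: Q_def)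
   have pv: "psi P v \<in> carrier P" "psi P w \<in> carrier P" using v w by auto
   have vw: "v \<oplus>\<^bsub>Fr P\<^esub> w \<in> carrier (Fr P)" by (rule F.M.a_closed[OF v(1) w(1)])
   let ?s = "dl (psi P v) oneB \<oplus>\<^bsub>Fr P\<^esub> dl (psi P w) oneB"
   have "(v \<oplus>\<^bsub>Fr P\<^esub> w) \<ominus>\<^bsub>Fr P\<^esub> ?s \<in> K"
    using F.sm_add[OF K v(2) w(2)] F.add_sub_add[OF v(1) w(1) d1[OF pv(1)] d1[OF pv(2)]] by (simp del: free_simps)
   moreover have "?s \<ominus>\<^bsub>Fr P\<^esub> dl (psi P v \<oplus>\<^bsub>P\<^esub> psi P w) oneB \<in> K"
   proof -
    have c: "?s \<in> carrier (Fr P)" "dl (psi P v \<oplus>\<^bsub>P\<^esub> psi P w) oneB \<in> carrier (Fr P)" using d1 pv by (auto simp del: free_simps)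
    have "?s \<ominus>\<^bsub>Fr P\<^esub> dl (psi P v \<oplus>\<^bsub>P\<^esub> psi P w) oneB = \<ominus>\<^bsub>Fr P\<^esub> (dl (psi P v \<oplus>\<^bsub>P\<^esub> psi P w) oneB \<ominus>\<^bsub>Fr P\<^esub> ?s)"
     using c by (simp del: free_simps add: F.M.minus_eq F.M.minus_add F.M.a_comm)
    then show ?thesis using F.sm_neg[OF K add1[OF pv]] by simp
   qed
   ultimately have "(v \<oplus>\<^bsub>Fr P\<^esub> w) \<ominus>\<^bsub>Fr P\<^esub> dl (psi P v \<oplus>\<^bsub>P\<^esub> psi P w) oneB \<in> K"
    using F.sub_sub_trans[OF vw, of ?s "dl (psi P v \<oplus>\<^bsub>P\<^esub> psi P w) oneB"] F.sm_add[OF K] d1 pv by (simp del: free_simps)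
   then show "v \<oplus>\<^bsub>Fr P\<^esub> w \<in> Q" unfolding Q_def using vw v w by (simp del: free_simps add: h.h_add)
  next
   fix a v assume a: "a \<in> carrier R" and "v \<in> Q"
   then have v: "v \<in> carrier (Fr P)" "v \<ominus>\<^bsub>Fr P\<^esub> dl (psi P v) oneB \<in> K" by (auto simp: Q_def)
   have pv: "psi P v \<in> carrier P" using v by auto
   have av: "a \<odot>\<^bsub>Fr P\<^esub> v \<in> carrier (Fr P)" by (rule F.smult_closed[OF a v(1)])
   let ?s = "a \<odot>\<^bsub>Fr P\<^esub> dl (psi P v) oneB"
   have s: "?s \<in> carrier (Fr P)" by (rule F.smult_closed[OF a d1[OF pv]])
   have dp: "dl (a \<odot>\<^bsub>P\<^esub> psi P v) oneB \<in> carrier (Fr P)" using d1 a pv by blast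
   have "a \<odot>\<^bsub>Fr P\<^esub> v \<ominus>\<^bsub>Fr P\<^esub> ?s \<in> K" using F.sm_smult[OF K a v(2)] F.smult_sub[OF a v(1) d1[OF pv]] by (simp del: free_simps)
   moreover have "?s \<ominus>\<^bsub>Fr P\<^esub> dl (a \<odot>\<^bsub>P\<^esub> psi P v) oneB \<in> K"
   proof -
    have "?s \<ominus>\<^bsub>Fr P\<^esub> dl (a \<odot>\<^bsub>P\<^esub> psi P v) oneB = \<ominus>\<^bsub>Fr P\<^esub> (dl (a \<odot>\<^bsub>P\<^esub> psi P v) oneB \<ominus>\<^bsub>Fr P\<^esub> ?s)"
     using s dp by (simp del: free_simps add: F.M.minus_eq F.M.minus_add F.M.a_comm)
    then show ?thesis using F.sm_neg[OF K smult1[OF a pv]] by simp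
   qed
   ultimately have "a \<odot>\<^bsub>Fr P\<^esub> v \<ominus>\<^bsub>Fr P\<^esub> dl (a \<odot>\<^bsub>P\<^esub> psi P v) oneB \<in> K"
    using F.sub_sub_trans[OF av s dp] F.sm_add[OF K] by (simp del: free_simps)
   then show "a \<odot>\<^bsub>Fr P\<^esub> v \<in> Q" unfolding Q_def using av a v by (simp del: free_simps add: h.h_smult)
  qed (auto simp: Q_def)
  fix s assume "s \<in> carrier P \<times> carrier B"
  then obtain p b where pb: "s = (p, b)" "p \<in> carrier P" "b \<in> carrier B" by blast
  have r: "rep b \<in> carrier R" by (rule rep[OF pb(3)])
  let ?s = "rep b \<odot>\<^bsub>Fr P\<^esub> dl p oneB"
  have s: "?s \<in> carrier (Fr P)" by (rule F.smult_closed[OF r d1[OF pb(2)]])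
  have c: "dl p b \<in> carrier (Fr P)" "dl (rep b \<odot>\<^bsub>P\<^esub> p) oneB \<in> carrier (Fr P)" using dlc d1 pb r by auto
  have "dl p b \<ominus>\<^bsub>Fr P\<^esub> ?s \<in> K" using fs(4)[OF r pb(2) oneB] smult_oneB[OF pb(3)] by (simp del: free_simps)
  moreover have "?s \<ominus>\<^bsub>Fr P\<^esub> dl (rep b \<odot>\<^bsub>P\<^esub> p) oneB \<in> K"
  proof -
   have "?s \<ominus>\<^bsub>Fr P\<^esub> dl (rep b \<odot>\<^bsub>P\<^esub> p) oneB = \<ominus>\<^bsub>Fr P\<^esub> (dl (rep b \<odot>\<^bsub>P\<^esub> p) oneB \<ominus>\<^bsub>Fr P\<^esub> ?s)"
    using s c by (simp del: free_simps add: F.M.minus_eq F.M.minus_add F.M.a_comm)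
   then show ?thesis using F.sm_neg[OF K smult1[OF r pb(2)]] by simp
  qed
  ultimately have "dl p b \<ominus>\<^bsub>Fr P\<^esub> dl (rep b \<odot>\<^bsub>P\<^esub> p) oneB \<in> K"
   using F.sub_sub_trans[OF c(1) s c(2)] F.sm_add[OF K] by (simp del: free_simps)
  then show "free_gen R s \<in> Q" unfolding Q_def using psi_dl[OF P pb(2,3)] c pb(1) by (simp del: free_simps)
 qed
 then have red: "v \<ominus>\<^bsub>Fr P\<^esub> dl (psi P v) oneB \<in> K" using v unfolding Q_def by blast
 assume "psi P v \<in> rmod.ip R P I (carrier P)"
 then have "dl (psi P v) oneB \<in> K" using IPJ by blast
 then show "v \<in> tensor_rel R P B" using F.sm_sub_mem[OF K _ v red] K_def by blast
next
 assume "v \<in> tensor_rel R P B"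
 then show "psi P v \<in> rmod.ip R P I (carrier P)" by (rule tensor_rel_facts(5)[OF P])
qed

lemma push_rhom:
 assumes "rhom R P P' h"
 shows "rhom R (Fr P) (Fr P') (rmod.lin R (Fr P') (\<lambda>(x, y). dl (h x) y))"
  and "u \<in> carrier (Fr P) ==> push R h u = rmod.lin R (Fr P') (\<lambda>(x, y). dl (h x) y) u"
  and "u \<in> carrier (Fr P) ==> push R h u \<in> carrier (Fr P')"
  and "u \<in> carrier (Fr P) ==> psi P' (push R h u) = h (psi P u)"
  and "u \<in> carrier (Fr P) ==> tensor_map R P' B h (tensor_rel R P B +>\<^bsub>Fr P\<^esub> u) = tensor_rel R P' B +>\<^bsub>Fr P'\<^esub> push R h u"
proof -
 interpret h: rhom R P P' h by fact
 interpret F: rmod R "Fr P" by (rule free_rmod[OF is_cring])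
 interpret F': rmod R "Fr P'" by (rule free_rmod[OF is_cring])
 define L where "L = rmod.lin R (Fr P') (\<lambda>(x, y). dl (h x) y)"
 have L: "rhom R (Fr P) (Fr P') L" unfolding L_def by (rule F'.lin_hom) (auto intro: dl_carrier)
 then show "rhom R (Fr P) (Fr P') (rmod.lin R (Fr P') (\<lambda>(x, y). dl (h x) y))" unfolding L_def .
 interpret L: rhom R "Fr P" "Fr P'" L by (rule L)
 have pL: "push R h u = L u" if "u \<in> carrier (Fr P)" for u
  unfolding L_def by (rule push_lin[OF is_cring that]) simp
 then show "u \<in> carrier (Fr P) ==> push R h u = rmod.lin R (Fr P') (\<lambda>(x, y). dl (h x) y) u" unfolding L_def .
 show pc: "push R h u \<in> carrier (Fr P')" if "u \<in> carrier (Fr P)" for u using pL[OF that] that by simp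
 note pr = psi_rhom[OF h.M'.rmod_axioms] psi_rhom[OF h.M.rmod_axioms]
 show pp: "psi P' (push R h u) = h (psi P u)" if "u \<in> carrier (Fr P)" for u
  unfolding pL[OF that]
 proof (rule free_hom_eq[OF rhom_comp[OF L pr(1)] rhom_comp[OF pr(2) assms] _ that])
  fix s assume "s \<in> carrier P \<times> carrier B"
  then obtain x y where xy: "s = (x, y)" "x \<in> carrier P" "y \<in> carrier B" by blast
  have "L (free_gen R s) = dl (h x) y" unfolding L_def xy(1)
   using F'.lin_gen[of "\<lambda>(x, y). dl (h x) y" "(x, y)"] dl_carrier[of "h x" P' y] xy by simp
  then show "psi P' (L (free_gen R s)) = h (psi P (free_gen R s))"
   using xy psi_dl[OF h.M'.rmod_axioms, of "h x" y] psi_dl[OF h.M.rmod_axioms xy(2,3)] rep[OF xy(3)] by (simp add: h.h_smult)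
 qed
 note K' = tensor_rel_facts(1)[OF h.M'.rmod_axioms] and K = tensor_rel_facts(1)[OF h.M.rmod_axioms]
 assume u: "u \<in> carrier (Fr P)"
 have "tensor_rel R P' B +>\<^bsub>Fr P'\<^esub> push R h u' = tensor_rel R P' B +>\<^bsub>Fr P'\<^esub> push R h u"
  if u': "u' \<in> tensor_rel R P B +>\<^bsub>Fr P\<^esub> u" for u'
 proof -
  obtain k where k: "k \<in> tensor_rel R P B" "u' = k \<oplus>\<^bsub>Fr P\<^esub> u" using u' unfolding F.coset_mem by blast
  have kc: "k \<in> carrier (Fr P)" by (rule F.sm_carr[OF K k(1)])
  have u'c: "u' \<in> carrier (Fr P)" unfolding k(2) by (rule F.M.a_closed[OF kc u])
  have "push R h u' \<ominus>\<^bsub>Fr P'\<^esub> push R h u = push R h k"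
   unfolding pL[OF u'c] pL[OF u] pL[OF kc] unfolding k(2) L.h_add[OF kc u]
   by (rule F'.add_sub_cancel) (use kc u in auto)
  moreover have "push R h k \<in> tensor_rel R P' B"
  proof -
   have "psi P k \<in> h.M.ip I (carrier P)" by (rule tensor_rel_facts(5)[OF h.M.rmod_axioms k(1)])
   then have "h (psi P k) \<in> h.M'.ip I (h ` carrier P)" using h.image_ip[OF I_sub h.M.sm_carrier] by blast
   then have "h (psi P k) \<in> h.M'.ip I (carrier P')"
    using h.M'.ip_mono[OF I_sub order.refl order.refl, of "h ` carrier P"] by auto
   then show ?thesis using tensor_rel_iff[OF h.M'.rmod_axioms pc[OF kc]] pp[OF kc] by simp
  qed
  ultimately show ?thesis by (intro F'.coset_eqI[OF K' pc[OF u'c] pc[OF u]]) simp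
 qed
 moreover have "tensor_rel R P B +>\<^bsub>Fr P\<^esub> u \<noteq> {}" using F.sm_zero[OF K] unfolding a_r_coset_def' by blast
 ultimately show "tensor_map R P' B h (tensor_rel R P B +>\<^bsub>Fr P\<^esub> u) = tensor_rel R P' B +>\<^bsub>Fr P'\<^esub> push R h u"
  unfolding tensor_map_def push_def[symmetric] by auto
qed

text \<open>Let \<open>F\<^sub>2 \<rightarrow> F\<^sub>1 \<rightarrow> F\<^sub>0 \<rightarrow> M\<close> be the canonical resolution with kernels \<open>K\<^sub>1 \<subseteq> F\<^sub>1\<close> and \<open>K\<^sub>0 \<subseteq> F\<^sub>0\<close>. After
identifying \<open>F\<^sub>i \<otimes> B\<close> with \<open>F\<^sub>i/IF\<^sub>i\<close>, the cycles are the preimage of \<open>IF\<^sub>0\<close> in \<open>F\<^sub>1\<close> and the boundaries are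
\<open>IF\<^sub>1 + K\<^sub>1\<close>, the preimage of \<open>IK\<^sub>0\<close>. As \<open>F\<^sub>1 \<rightarrow> K\<^sub>0\<close> is onto, the homology is \<open>(K\<^sub>0 \<inter> IF\<^sub>0) / IK\<^sub>0\<close>.\<close>

theorem tor1_length:
 fixes M :: "('a, 'm) module"
 assumes M: "rmod R M"
 defines "F0 \<equiv> free_mod R (carrier M)"
 defines "K0 \<equiv> a_kernel F0 M (free_eval R M)"
 shows "mod_length R (tor1 R M B) = rmod.len R F0 (rmod.ip R F0 I K0) (K0 \<inter> rmod.ip R F0 I (carrier F0))"
proof -
 interpret M: rmod R M by fact
 interpret F0: rmod R F0 unfolding F0_def by (rule free_rmod[OF is_cring])
 have e0: "rhom R F0 M (free_eval R M)" unfolding F0_def M.free_eval_lin by (rule M.lin_hom)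
 interpret e0: rhom R F0 M "free_eval R M" by (rule e0)
 have K0_eq: "K0 = {x \<in> carrier F0. free_eval R M x \<in> {\<zero>\<^bsub>M\<^esub>}}" unfolding K0_def a_kernel_def' by auto
 have K0: "F0.sm K0" unfolding K0_eq by (rule e0.sm_vimage[OF F0.sm_carrier M.sm_null])
 define F1 where "F1 = free_mod R K0"
 interpret F1: rmod R F1 unfolding F1_def by (rule free_rmod[OF is_cring])
 have e1: "rhom R F1 F0 (free_eval R F0)" unfolding F1_def F0.free_eval_lin by (rule F0.lin_hom) (rule F0.sm_carr[OF K0])
 interpret e1: rhom R F1 F0 "free_eval R F0" by (rule e1)
 define K1 where "K1 = a_kernel F1 F0 (free_eval R F0)"
 have K1_eq: "K1 = {x \<in> carrier F1. free_eval R F0 x \<in> {\<zero>\<^bsub>F0\<^esub>}}" unfolding K1_def a_kernel_def' by auto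
 have K1: "F1.sm K1" unfolding K1_eq by (rule e1.sm_vimage[OF F1.sm_carrier F0.sm_null])
 define F2 where "F2 = free_mod R K1"
 interpret F2: rmod R F2 unfolding F2_def by (rule free_rmod[OF is_cring])
 have e2: "rhom R F2 F1 (free_eval R F1)" unfolding F2_def F1.free_eval_lin by (rule F1.lin_hom) (rule F1.sm_carr[OF K1])
 interpret e2: rhom R F2 F1 "free_eval R F1" by (rule e2)
 have gen1: "free_gen R s \<in> carrier F1 \<and> free_eval R F0 (free_gen R s) = s" if "s \<in> K0" for s
  using free_gen_carrier[OF is_cring that] F0.lin_gen[of "\<lambda>x. x" s] F0.sm_carr[OF K0 that] by (simp add: F1_def F0.free_eval_lin)
 have gen2: "free_gen R s \<in> carrier F2 \<and> free_eval R F1 (free_gen R s) = s" if "s \<in> K1" for s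
  using free_gen_carrier[OF is_cring that] F1.lin_gen[of "\<lambda>x. x" s] F1.sm_carr[OF K1 that] by (simp add: F2_def F1.free_eval_lin)
 have im1: "free_eval R F0 u \<in> K0" if "u \<in> carrier F1" for u
 proof -
  have "carrier F1 \<subseteq> {u \<in> carrier F1. free_eval R F0 u \<in> K0}"
   unfolding F1_def by (rule free_induct[OF is_cring]) (use e1.sm_vimage[OF F1.sm_carrier K0] gen1 in \<open>auto simp: F1_def\<close>)
  then show ?thesis using that by blast
 qed
 have im2: "free_eval R F1 u \<in> K1" if "u \<in> carrier F2" for u
 proof -
  have "carrier F2 \<subseteq> {u \<in> carrier F2. free_eval R F1 u \<in> K1}"
   unfolding F2_def by (rule free_induct[OF is_cring]) (use e2.sm_vimage[OF F2.sm_carrier K1] gen2 in \<open>auto simp: F2_def\<close>)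
  then show ?thesis using that by blast
 qed
 have surj1: "free_eval R F0 ` carrier F1 = K0" using im1 gen1 by (auto simp: image_iff) metis
 define IF0 where "IF0 = F0.ip I (carrier F0)"
 define IF1 where "IF1 = F1.ip I (carrier F1)"
 have IF0: "F0.sm IF0" unfolding IF0_def by (rule F0.sm_ip[OF I_sub order.refl])
 have IF1: "F1.sm IF1" unfolding IF1_def by (rule F1.sm_ip[OF I_sub order.refl])
 have IK0: "F0.sm (F0.ip I K0)" by (rule F0.sm_ip'[OF I_sub K0])
 define V1 where "V1 = F1.psum IF1 K1"
 define U1 where "U1 = {p \<in> carrier F1. free_eval R F0 p \<in> IF0}"
 have V1: "F1.sm V1" unfolding V1_def by (rule F1.sm_psum[OF IF1 K1])
 have U1: "F1.sm U1" unfolding U1_def by (rule e1.sm_vimage[OF F1.sm_carrier IF0])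
 have imIF1: "free_eval R F0 ` IF1 = F0.ip I K0" unfolding IF1_def using e1.image_ip[OF I_sub F1.sm_carrier] surj1 by simp
 have IK0_le: "F0.ip I K0 \<subseteq> K0 \<inter> IF0" unfolding IF0_def
  using F0.ip_subset[OF I_sub K0] F0.ip_mono[OF I_sub order.refl order.refl F0.sm_subset[OF K0]] by blast
 have V1_iff: "p \<in> V1 \<longleftrightarrow> free_eval R F0 p \<in> F0.ip I K0" if p: "p \<in> carrier F1" for p
 proof
  assume "p \<in> V1"
  then obtain i k where ik: "i \<in> IF1" "k \<in> K1" "p = i \<oplus>\<^bsub>F1\<^esub> k" unfolding V1_def by (auto elim!: F1.psumE)
  have c: "i \<in> carrier F1" "k \<in> carrier F1" using F1.sm_carr[OF IF1 ik(1)] F1.sm_carr[OF K1 ik(2)] by auto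
  have "free_eval R F0 p = free_eval R F0 i" using ik(3) c e1.h_add[OF c] ik(2) e1.h_carr[OF c(1)] by (simp add: K1_eq)
  then show "free_eval R F0 p \<in> F0.ip I K0" using imIF1 ik(1) by blast
 next
  assume "free_eval R F0 p \<in> F0.ip I K0"
  then obtain i where i: "i \<in> IF1" "free_eval R F0 p = free_eval R F0 i" using imIF1 by blast
  have ic: "i \<in> carrier F1" using F1.sm_carr[OF IF1 i(1)] .
  have "p \<ominus>\<^bsub>F1\<^esub> i \<in> K1" unfolding K1_eq using p ic i(2) by (simp add: e1.h_sub F0.sub_self)
  then have "i \<oplus>\<^bsub>F1\<^esub> (p \<ominus>\<^bsub>F1\<^esub> i) \<in> V1" unfolding V1_def using i(1) by (intro F1.psumI)
  then show "p \<in> V1" using F1.sub_add_cancel[OF p ic] F1.M.a_comm[OF ic] p ic by simp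
 qed
 have step1: "F1.len V1 U1 = F0.len (F0.ip I K0) (K0 \<inter> IF0)"
 proof (rule e1.len_eq_hom[OF U1 IK0 F0.sm_Int[OF K0 IF0]])
  show "V1 \<subseteq> U1" using V1_iff F1.sm_carr[OF V1] IK0_le unfolding U1_def by blast
  show "F0.ip I K0 \<subseteq> K0 \<inter> IF0" by (rule IK0_le)
  show "free_eval R F0 u \<in> K0 \<inter> IF0" if "u \<in> U1" for u using that im1 unfolding U1_def by auto
  show "free_eval R F0 u \<in> F0.ip I K0 \<longleftrightarrow> u \<in> V1" if "u \<in> U1" for u using that V1_iff unfolding U1_def by auto
  show "\<exists>u\<in>U1. u' \<ominus>\<^bsub>F0\<^esub> free_eval R F0 u \<in> F0.ip I K0" if "u' \<in> K0 \<inter> IF0" for u'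
   by (rule e1.surj_by_eq[OF IK0, of _ "free_gen R u'"]) (use that gen1 F0.sm_carr[OF K0] in \<open>auto simp: U1_def\<close>)
 qed
 define r0 where "r0 = tensor_rel R F0 B"
 define r1 where "r1 = tensor_rel R F1 B"
 define r2 where "r2 = tensor_rel R F2 B"
 interpret G0: rmod R "Fr F0" by (rule free_rmod[OF is_cring])
 interpret G1: rmod R "Fr F1" by (rule free_rmod[OF is_cring])
 interpret G2: rmod R "Fr F2" by (rule free_rmod[OF is_cring])
 have r0: "G0.sm r0" unfolding r0_def by (rule tensor_rel_facts(1)[OF F0.rmod_axioms])
 have r1: "G1.sm r1" unfolding r1_def by (rule tensor_rel_facts(1)[OF F1.rmod_axioms])
 have r2: "G2.sm r2" unfolding r2_def by (rule tensor_rel_facts(1)[OF F2.rmod_axioms])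
 interpret p1: rhom R "Fr F1" F1 "psi F1" by (rule psi_rhom[OF F1.rmod_axioms])
 interpret p2: rhom R "Fr F2" F2 "psi F2" by (rule psi_rhom[OF F2.rmod_axioms])
 define T1 where "T1 = tensor_mod R F1 B"
 have T1_eq: "T1 = quot_mod (Fr F1) r1" unfolding T1_def tensor_mod_def r1_def ..
 interpret T1: rmod R T1 unfolding T1_eq by (rule G1.quot_rmod[OF r1])
 interpret q1: rhom R "Fr F1" T1 "\<lambda>u. r1 +>\<^bsub>Fr F1\<^esub> u" unfolding T1_eq by (rule G1.quot_hom[OF r1])
 define d1 where "d1 = tensor_map R F0 B (free_eval R F0)"
 define d2 where "d2 = tensor_map R F1 B (free_eval R F1)"
 have d1: "d1 (r1 +>\<^bsub>Fr F1\<^esub> u) = r0 +>\<^bsub>Fr F0\<^esub> push R (free_eval R F0) u" if "u \<in> carrier (Fr F1)" for u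
  unfolding d1_def r1_def r0_def by (rule push_rhom(5)[OF e1 that])
 have d2: "d2 (r2 +>\<^bsub>Fr F2\<^esub> u) = r1 +>\<^bsub>Fr F1\<^esub> push R (free_eval R F1) u" if "u \<in> carrier (Fr F2)" for u
  unfolding d2_def r1_def r2_def by (rule push_rhom(5)[OF e2 that])
 define Z1 where "Z1 = a_kernel T1 (tensor_mod R F0 B) d1"
 define B1 where "B1 = d2 ` carrier (tensor_mod R F2 B)"
 define U where "U = {u \<in> carrier (Fr F1). psi F1 u \<in> U1}"
 define V where "V = {u \<in> carrier (Fr F1). psi F1 u \<in> V1}"
 have U: "G1.sm U" unfolding U_def by (rule p1.sm_vimage[OF G1.sm_carrier U1])
 have V: "G1.sm V" unfolding V_def by (rule p1.sm_vimage[OF G1.sm_carrier V1])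
 have V1U1: "V1 \<subseteq> U1" using V1_iff F1.sm_carr[OF V1] IK0_le unfolding U1_def by blast
 have VU: "V \<subseteq> U" unfolding U_def V_def using V1U1 by blast
 have ro: "rep oneB \<in> carrier R" by (rule rep[OF oneB])
 have one_sub: "\<one> \<ominus> rep oneB \<in> I"
 proof -
  have "\<one> \<ominus> rep oneB = \<ominus> (rep oneB \<ominus> \<one>)" using ro by (simp add: minus_eq minus_add a_comm)
  then show ?thesis using additive_subgroup.a_inv_closed[OF ideal.axioms(1)[OF I_ideal] rep_one] by simp
 qed
 have corr: "p \<ominus>\<^bsub>F1\<^esub> rep oneB \<odot>\<^bsub>F1\<^esub> p \<in> IF1" if p: "p \<in> carrier F1" for p
 proof -
  have "p \<ominus>\<^bsub>F1\<^esub> rep oneB \<odot>\<^bsub>F1\<^esub> p = (\<one> \<ominus> rep oneB) \<odot>\<^bsub>F1\<^esub> p" using p ro by (simp add: F1.sub_smult)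
  then show ?thesis unfolding IF1_def using F1.ipI[OF one_sub p] by simp
 qed
 have IF1V1: "IF1 \<subseteq> V1" unfolding V1_def by (rule F1.psum_ub1[OF IF1 K1])
 have step2: "G1.len V U = F1.len V1 U1"
 proof (rule p1.len_eq_hom[OF U V1 U1 VU V1U1])
  show "\<exists>u\<in>U. p \<ominus>\<^bsub>F1\<^esub> psi F1 u \<in> V1" if p: "p \<in> U1" for p
  proof -
   have pc: "p \<in> carrier F1" by (rule F1.sm_carr[OF U1 p])
   have "psi F1 (dl p oneB) = rep oneB \<odot>\<^bsub>F1\<^esub> p" by (rule psi_dl[OF F1.rmod_axioms pc oneB])
   then show ?thesis using dl_carrier[OF pc oneB] F1.sm_smult[OF U1 ro p] corr[OF pc] IF1V1
    by (intro bexI[of _ "dl p oneB"]) (auto simp: U_def)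
  qed
 qed (auto simp: U_def V_def)
 have Z1_iff: "r1 +>\<^bsub>Fr F1\<^esub> u \<in> Z1 \<longleftrightarrow> u \<in> U" if u: "u \<in> carrier (Fr F1)" for u
 proof -
  have pc: "push R (free_eval R F0) u \<in> carrier (Fr F0)" by (rule push_rhom(3)[OF e1 u])
  have z: "\<zero>\<^bsub>tensor_mod R F0 B\<^esub> = r0" unfolding tensor_mod_def r0_def[symmetric] by (rule G0.quot_ops(1)[OF r0])
  have "r1 +>\<^bsub>Fr F1\<^esub> u \<in> Z1 \<longleftrightarrow> r0 +>\<^bsub>Fr F0\<^esub> push R (free_eval R F0) u = r0"
   unfolding Z1_def a_kernel_def' using q1.h_carr[OF u] d1[OF u] z by simp
  also have "\<dots> \<longleftrightarrow> push R (free_eval R F0) u \<in> r0" by (rule G0.coset_eq_iff[OF r0 pc])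
  also have "\<dots> \<longleftrightarrow> psi F0 (push R (free_eval R F0) u) \<in> IF0"
   unfolding r0_def IF0_def by (rule tensor_rel_iff[OF F0.rmod_axioms pc])
  also have "\<dots> \<longleftrightarrow> u \<in> U" unfolding push_rhom(4)[OF e1 u] U_def U1_def using u by auto
  finally show ?thesis .
 qed
 have B1_iff: "r1 +>\<^bsub>Fr F1\<^esub> u \<in> B1 \<longleftrightarrow> u \<in> V" if u: "u \<in> carrier (Fr F1)" for u
 proof
  assume "r1 +>\<^bsub>Fr F1\<^esub> u \<in> B1"
  then obtain w where w: "w \<in> carrier (Fr F2)" "r1 +>\<^bsub>Fr F1\<^esub> u = d2 (r2 +>\<^bsub>Fr F2\<^esub> w)"
   unfolding B1_def tensor_mod_def r2_def[symmetric] G2.carrier_quot by blast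
  define v where "v = push R (free_eval R F1) w"
  have vc: "v \<in> carrier (Fr F1)" unfolding v_def by (rule push_rhom(3)[OF e2 w(1)])
  have "u \<ominus>\<^bsub>Fr F1\<^esub> v \<in> r1" using G1.coset_eqD[OF r1 u vc] w(2) d2[OF w(1)] v_def by simp
  then have "psi F1 (u \<ominus>\<^bsub>Fr F1\<^esub> v) \<in> IF1" unfolding r1_def IF1_def by (rule tensor_rel_facts(5)[OF F1.rmod_axioms])
  then have "psi F1 u \<ominus>\<^bsub>F1\<^esub> psi F1 v \<in> V1" using p1.h_sub[OF u vc] IF1V1 by auto
  moreover have "psi F1 v \<in> V1"
   unfolding v_def push_rhom(4)[OF e2 w(1)] V1_def using im2 w(1) F1.psum_ub2[OF IF1 K1] by blast
  ultimately have "psi F1 u \<in> V1" using F1.sm_sub_mem[OF V1] u by blast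
  then show "u \<in> V" unfolding V_def using u by simp
 next
  assume "u \<in> V"
  then obtain i k where ik: "i \<in> IF1" "k \<in> K1" "psi F1 u = i \<oplus>\<^bsub>F1\<^esub> k" unfolding V_def V1_def by (auto elim!: F1.psumE)
  have c: "i \<in> carrier F1" "k \<in> carrier F1" using F1.sm_carr[OF IF1 ik(1)] F1.sm_carr[OF K1 ik(2)] by auto
  define w where "w = dl (free_gen R k) oneB"
  have gk: "free_gen R k \<in> carrier F2" "free_eval R F1 (free_gen R k) = k" using gen2[OF ik(2)] by auto
  have wc: "w \<in> carrier (Fr F2)" unfolding w_def by (rule dl_carrier[OF gk(1) oneB])
  define v where "v = push R (free_eval R F1) w"
  have vc: "v \<in> carrier (Fr F1)" unfolding v_def by (rule push_rhom(3)[OF e2 wc])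
  have "psi F1 v = free_eval R F1 (psi F2 w)" unfolding v_def by (rule push_rhom(4)[OF e2 wc])
  also have "psi F2 w = rep oneB \<odot>\<^bsub>F2\<^esub> free_gen R k" unfolding w_def by (rule psi_dl[OF F2.rmod_axioms gk(1) oneB])
  finally have "psi F1 v = rep oneB \<odot>\<^bsub>F1\<^esub> k" using e2.h_smult[OF ro gk(1)] gk(2) by simp
  then have "psi F1 (u \<ominus>\<^bsub>Fr F1\<^esub> v) = i \<oplus>\<^bsub>F1\<^esub> (k \<ominus>\<^bsub>F1\<^esub> rep oneB \<odot>\<^bsub>F1\<^esub> k)"
   using p1.h_sub[OF u vc] ik(3) c ro by (simp add: F1.M.minus_eq F1.M.a_assoc)
  also have "\<dots> \<in> IF1" by (rule F1.sm_add[OF IF1 ik(1) corr[OF c(2)]])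
  finally have "u \<ominus>\<^bsub>Fr F1\<^esub> v \<in> r1" unfolding r1_def IF1_def
   using tensor_rel_iff[OF F1.rmod_axioms G1.minus_closed_M[OF u vc]] by blast
  then have "r1 +>\<^bsub>Fr F1\<^esub> u = d2 (r2 +>\<^bsub>Fr F2\<^esub> w)" using G1.coset_eqI[OF r1 u vc] d2[OF wc] v_def by simp
  then show "r1 +>\<^bsub>Fr F1\<^esub> u \<in> B1" unfolding B1_def tensor_mod_def r2_def[symmetric] G2.carrier_quot using wc by blast
 qed
 have T1c: "carrier T1 = (\<lambda>u. r1 +>\<^bsub>Fr F1\<^esub> u) ` carrier (Fr F1)" unfolding T1_eq by (rule G1.carrier_quot)
 have B1_sub: "B1 \<subseteq> carrier T1"
 proof
  fix X assume "X \<in> B1"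
  then obtain w where "w \<in> carrier (Fr F2)" "X = d2 (r2 +>\<^bsub>Fr F2\<^esub> w)"
   unfolding B1_def tensor_mod_def r2_def[symmetric] G2.carrier_quot by blast
  then show "X \<in> carrier T1" using d2 push_rhom(3)[OF e2] T1c by auto
 qed
 have Z1_im: "Z1 = (\<lambda>u. r1 +>\<^bsub>Fr F1\<^esub> u) ` U"
 proof (intro equalityI subsetI)
  fix X assume X: "X \<in> Z1"
  then have "X \<in> carrier T1" unfolding Z1_def a_kernel_def' by blast
  then show "X \<in> (\<lambda>u. r1 +>\<^bsub>Fr F1\<^esub> u) ` U" using X Z1_iff unfolding T1c by blast
 qed (use Z1_iff G1.sm_carr[OF U] in blast)
 have B1_im: "B1 = (\<lambda>u. r1 +>\<^bsub>Fr F1\<^esub> u) ` V"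
 proof (intro equalityI subsetI)
  fix X assume X: "X \<in> B1"
  then have "X \<in> carrier T1" using B1_sub by blast
  then show "X \<in> (\<lambda>u. r1 +>\<^bsub>Fr F1\<^esub> u) ` V" using X B1_iff unfolding T1c by blast
 qed (use B1_iff G1.sm_carr[OF V] in blast)
 have Z1: "T1.sm Z1" unfolding Z1_im by (rule q1.sm_image[OF U])
 have B1: "T1.sm B1" unfolding B1_im by (rule q1.sm_image[OF V])
 have B1Z1: "B1 \<subseteq> Z1" unfolding Z1_im B1_im using VU by blast
 have step3: "G1.len V U = T1.len B1 Z1"
 proof (rule q1.len_eq_hom[OF U B1 Z1 VU B1Z1])
  show "\<exists>u\<in>U. X \<ominus>\<^bsub>T1\<^esub> (r1 +>\<^bsub>Fr F1\<^esub> u) \<in> B1" if "X \<in> Z1" for X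
  proof -
   note asm = that
   obtain u where "u \<in> U" "X = r1 +>\<^bsub>Fr F1\<^esub> u" using asm unfolding Z1_im by blast
   then show ?thesis by (intro q1.surj_by_eq[OF B1 T1.sm_carr[OF Z1 asm], of u U]) simp_all
  qed
 qed (use Z1_iff B1_iff G1.sm_carr[OF U] in auto)
 have TZ: "rmod R (T1\<lparr>carrier := Z1\<rparr>)" by (rule T1.restrict_rmod[OF Z1])
 interpret TZ: rmod R "T1\<lparr>carrier := Z1\<rparr>" by (rule TZ)
 have B1': "TZ.sm B1" using T1.restrict_sm[OF Z1] B1 B1Z1 by blast
 define Q where "Q = quot_mod (T1\<lparr>carrier := Z1\<rparr>) B1"
 interpret Q: rmod R Q unfolding Q_def by (rule TZ.quot_rmod[OF B1'])
 interpret q: rhom R "T1\<lparr>carrier := Z1\<rparr>" Q "\<lambda>u. B1 +>\<^bsub>T1\<lparr>carrier := Z1\<rparr>\<^esub> u" unfolding Q_def by (rule TZ.quot_hom[OF B1'])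
 have Qz: "\<zero>\<^bsub>Q\<^esub> = B1" unfolding Q_def by (rule TZ.quot_ops(1)[OF B1'])
 have Qc: "carrier Q = (\<lambda>u. B1 +>\<^bsub>T1\<lparr>carrier := Z1\<rparr>\<^esub> u) ` Z1" unfolding Q_def using TZ.carrier_quot by simp
 have step4: "TZ.len B1 Z1 = Q.len {\<zero>\<^bsub>Q\<^esub>} (carrier Q)"
 proof (rule q.len_eq_hom[OF _ Q.sm_null Q.sm_carrier B1Z1])
  show "TZ.sm Z1" using TZ.sm_carrier by simp
  show "\<exists>u\<in>Z1. X \<ominus>\<^bsub>Q\<^esub> (B1 +>\<^bsub>T1\<lparr>carrier := Z1\<rparr>\<^esub> u) \<in> {\<zero>\<^bsub>Q\<^esub>}" if "X \<in> carrier Q" for X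
   using that q.surj_by_eq[OF Q.sm_null that] unfolding Qc by blast
  show "B1 +>\<^bsub>T1\<lparr>carrier := Z1\<rparr>\<^esub> u \<in> {\<zero>\<^bsub>Q\<^esub>} \<longleftrightarrow> u \<in> B1" if "u \<in> Z1" for u
   using TZ.coset_eq_iff[OF B1', of u] that Qz by simp
 qed (use Qc in auto)
 have "tor1 R M B = Q"
  unfolding tor1_def Let_def Q_def Z1_def B1_def T1_def d1_def d2_def F2_def K1_def F1_def K0_def F0_def ..
 then have "mod_length R (tor1 R M B) = Q.len {\<zero>\<^bsub>Q\<^esub>} (carrier Q)" using Q.mod_length_eq_len by simp
 also have "\<dots> = TZ.len B1 Z1" using step4 by simp
 also have "\<dots> = T1.len B1 Z1" by (rule T1.restrict_len[OF Z1 order.refl])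
 also have "\<dots> = F0.len (F0.ip I K0) (K0 \<inter> IF0)" using step1 step2 step3 by simp
 finally show ?thesis unfolding IF0_def .
qed

end

context cyclic_quot begin

definition torl :: "('a, 'm) module => enat" where "torl X = mod_length R (tor1 R X B)"

abbreviation kern :: "('a, 't) module => ('a, 'm) module => ('t => 'm) => 't set"
 where "kern T X p \<equiv> {t \<in> carrier T. p t = \<zero>\<^bsub>X\<^esub>}"

text \<open>The length of \<open>(K \<inter> IT) / IK\<close> for a map \<open>T \<rightarrow> X\<close> with kernel \<open>K\<close>, which is the length of \<open>Tor\<^sub>1(X, R/I)\<close> if \<open>T\<close> is free and the map onto.\<close>

definition rel_len :: "('a, 't) module => ('a, 'm) module => ('t => 'm) => enat"
 where "rel_len T X p = rmod.len R T (rmod.ip R T I (kern T X p)) (kern T X p \<inter> rmod.ip R T I (carrier T))"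

lemma sm_kern: assumes "rhom R T X p" shows "submodule (kern T X p) R T"
proof -
 interpret p: rhom R T X p by fact
 have "p.M.sm {t \<in> carrier T. p t \<in> {\<zero>\<^bsub>X\<^esub>}}" by (rule p.sm_vimage[OF p.M.sm_carrier p.M'.sm_null])
 then show ?thesis by simp
qed

text \<open>A map \<open>T \<rightarrow> T\'\<close> over \<open>X\<close> induces a surjection of the subquotients, because \<open>T\' = K\' + h T\<close> if \<open>T\<close> covers \<open>X\<close>.\<close>

lemma rel_len_lift:
 assumes p: "rhom R T X p" "p ` carrier T = carrier X" and p': "rhom R T' X p'" and h: "rhom R T T' h"
  and comm: "\<And>t. t \<in> carrier T ==> p' (h t) = p t"
 shows "rel_len T' X p' \<le> rel_len T X p"
proof -
 interpret p: rhom R T X p by fact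
 interpret p': rhom R T' X p' by fact
 interpret h: rhom R T T' h by fact
 define K where "K = kern T X p"
 define K' where "K' = kern T' X p'"
 have K: "p.M.sm K" unfolding K_def by (rule sm_kern[OF p(1)])
 have K': "p'.M.sm K'" unfolding K'_def by (rule sm_kern[OF p'])
 have IT: "p.M.sm (p.M.ip I (carrier T))" by (rule p.M.sm_ip[OF I_sub order.refl])
 have IK: "p.M.sm (p.M.ip I K)" by (rule p.M.sm_ip'[OF I_sub K])
 have IK': "p'.M.sm (p'.M.ip I K')" by (rule p'.M.sm_ip'[OF I_sub K'])
 have hK: "h ` K \<subseteq> K'" unfolding K_def K'_def using comm by auto
 have IKT: "p.M.ip I K \<subseteq> K \<inter> p.M.ip I (carrier T)"
  using p.M.ip_subset[OF I_sub K] p.M.ip_mono[OF I_sub order.refl order.refl p.M.sm_subset[OF K]] by blast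
 define G where "G = {t' \<in> carrier T'. \<exists>u\<in>p.M.ip I (carrier T). t' \<ominus>\<^bsub>T'\<^esub> h u \<in> p'.M.ip I K'}"
 have G: "p'.M.sm G"
 proof (rule p'.M.smI)
  show "\<zero>\<^bsub>T'\<^esub> \<in> G" unfolding G_def using p.M.sm_zero[OF IT] h.h_zero p'.M.sm_zero[OF IK'] p'.M.sub_self[of "\<zero>\<^bsub>T'\<^esub>"]
   by (auto intro!: bexI[of _ "\<zero>\<^bsub>T\<^esub>"])
 next
  fix x y assume "x \<in> G" "y \<in> G"
  then obtain u v where *: "x \<in> carrier T'" "y \<in> carrier T'" "u \<in> p.M.ip I (carrier T)" "v \<in> p.M.ip I (carrier T)"
   "x \<ominus>\<^bsub>T'\<^esub> h u \<in> p'.M.ip I K'" "y \<ominus>\<^bsub>T'\<^esub> h v \<in> p'.M.ip I K'" unfolding G_def by blast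
  have c: "u \<in> carrier T" "v \<in> carrier T" using * p.M.sm_carr[OF IT] by auto
  have "(x \<oplus>\<^bsub>T'\<^esub> y) \<ominus>\<^bsub>T'\<^esub> h (u \<oplus>\<^bsub>T\<^esub> v) \<in> p'.M.ip I K'"
   using p'.M.add_sub_add[of x y "h u" "h v"] * c p'.M.sm_add[OF IK' *(5,6)] by (simp add: h.h_add)
  then show "x \<oplus>\<^bsub>T'\<^esub> y \<in> G" unfolding G_def using * p.M.sm_add[OF IT *(3,4)] by auto
 next
  fix a x assume a: "a \<in> carrier R" and "x \<in> G"
  then obtain u where *: "x \<in> carrier T'" "u \<in> p.M.ip I (carrier T)" "x \<ominus>\<^bsub>T'\<^esub> h u \<in> p'.M.ip I K'" unfolding G_def by blast
  have c: "u \<in> carrier T" using * p.M.sm_carr[OF IT] by auto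
  have "a \<odot>\<^bsub>T'\<^esub> x \<ominus>\<^bsub>T'\<^esub> h (a \<odot>\<^bsub>T\<^esub> u) \<in> p'.M.ip I K'"
   using p'.M.smult_sub[OF a *(1), of "h u"] p'.M.sm_smult[OF IK' a *(3)] c a by (simp add: h.h_smult)
  then show "a \<odot>\<^bsub>T'\<^esub> x \<in> G" unfolding G_def using * a p.M.sm_smult[OF IT a *(2)] by auto
 qed (auto simp: G_def)
 have "p'.M.ip I (carrier T') \<subseteq> G"
 proof (rule p'.M.ip_least[OF G])
  fix a t' assume a: "a \<in> I" and t': "t' \<in> carrier T'"
  have aR: "a \<in> carrier R" using a I_sub by blast
  obtain t where t: "t \<in> carrier T" "p t = p' t'" using p(2) p'.h_carr[OF t'] by (metis imageE)
  have "t' \<ominus>\<^bsub>T'\<^esub> h t \<in> K'" unfolding K'_def using t t' comm by (simp add: p'.h_sub p.M'.sub_self)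
  then have "a \<odot>\<^bsub>T'\<^esub> t' \<ominus>\<^bsub>T'\<^esub> h (a \<odot>\<^bsub>T\<^esub> t) \<in> p'.M.ip I K'"
   using p'.M.smult_sub[OF aR t', of "h t"] p'.M.ipI[OF a, of "t' \<ominus>\<^bsub>T'\<^esub> h t" K'] t aR by (simp add: h.h_smult)
  then show "a \<odot>\<^bsub>T'\<^esub> t' \<in> G" unfolding G_def using aR t' p.M.ipI[OF a t(1)] by auto
 qed
 note IG = this
 have "p'.M.len (p'.M.ip I K') (K' \<inter> p'.M.ip I (carrier T')) \<le> p.M.len (p.M.ip I K) (K \<inter> p.M.ip I (carrier T))"
 proof (rule h.len_ge_hom[OF p.M.sm_Int[OF K IT] IKT IK'])
  show "h u \<in> p'.M.ip I K'" if "u \<in> p.M.ip I K" for u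
  proof -
   have "h u \<in> p'.M.ip I (h ` K)" using h.image_ip[OF I_sub K] that by blast
   then show ?thesis using p'.M.ip_mono[OF I_sub p'.M.sm_subset[OF K'] order.refl hK] by blast
  qed
  fix t' assume t': "t' \<in> K' \<inter> p'.M.ip I (carrier T')"
  then obtain u where u: "u \<in> p.M.ip I (carrier T)" "t' \<ominus>\<^bsub>T'\<^esub> h u \<in> p'.M.ip I K'" using IG unfolding G_def by blast
  have c: "u \<in> carrier T" "t' \<in> carrier T'" using u p.M.sm_carr[OF IT] t' p'.M.sm_carr[OF K'] by auto
  have "t' \<ominus>\<^bsub>T'\<^esub> h u \<in> K'" using u(2) p'.M.ip_subset[OF I_sub K'] by blast
  then have "h u \<in> K'" using p'.M.sm_congr[OF K' c(2) h.h_carr[OF c(1)]] t' by blast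
  then have "u \<in> K" unfolding K_def K'_def using comm c by simp
  then show "\<exists>u\<in>K \<inter> p.M.ip I (carrier T). t' \<ominus>\<^bsub>T'\<^esub> h u \<in> p'.M.ip I K'" using u by blast
 qed
 then show ?thesis unfolding rel_len_def K_def K'_def .
qed

text \<open>A free cover maps to every other cover.\<close>

lemma rel_len_free:
 fixes S :: "'s set" and X :: "('a, 'm) module" and T' :: "('a, 't) module"
 assumes p: "rhom R (free_mod R S) X p" "p ` carrier (free_mod R S) = carrier X"
  and p': "rhom R T' X p'" "p' ` carrier T' = carrier X"
 shows "rel_len T' X p' \<le> rel_len (free_mod R S) X p"
proof -
 interpret p: rhom R "free_mod R S" X p by fact
 interpret p': rhom R T' X p' by fact
 define c where "c s = (SOME t. t \<in> carrier T' \<and> p' t = p (free_gen R s))" for s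
 have c: "c s \<in> carrier T' \<and> p' (c s) = p (free_gen R s)" if "s \<in> S" for s
 proof -
  have "p (free_gen R s) \<in> p' ` carrier T'" unfolding p'(2) using free_gen_carrier[OF is_cring that] by simp
  then have "\<exists>t. t \<in> carrier T' \<and> p' t = p (free_gen R s)" by force
  then show ?thesis unfolding c_def by (rule someI_ex)
 qed
 have h: "rhom R (free_mod R S) T' (p'.M.lin c)" by (rule p'.M.lin_hom) (use c in blast)
 show ?thesis
 proof (rule rel_len_lift[OF p p'(1) h])
  show "p' (p'.M.lin c t) = p t" if "t \<in> carrier (free_mod R S)" for t
   by (rule free_hom_eq[OF rhom_comp[OF h p'(1)] p(1) _ that]) (use c p'.M.lin_gen[of c] in simp)
 qed
qed

lemma torl_eval:
 assumes "rmod R X"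
 shows "rhom R (free_mod R (carrier X)) X (free_eval R X)" "free_eval R X ` carrier (free_mod R (carrier X)) = carrier X"
  "torl X = rel_len (free_mod R (carrier X)) X (free_eval R X)"
proof -
 interpret X: rmod R X by fact
 show h: "rhom R (free_mod R (carrier X)) X (free_eval R X)" unfolding X.free_eval_lin by (rule X.lin_hom)
 interpret h: rhom R "free_mod R (carrier X)" X "free_eval R X" by (rule h)
 have "x \<in> free_eval R X ` carrier (free_mod R (carrier X))" if "x \<in> carrier X" for x
  using free_gen_carrier[OF is_cring that] X.lin_gen[of "\<lambda>x. x" x] that by (auto simp: X.free_eval_lin image_iff intro!: bexI[of _ "free_gen R x"])
 then show "free_eval R X ` carrier (free_mod R (carrier X)) = carrier X" by auto
 show "torl X = rel_len (free_mod R (carrier X)) X (free_eval R X)"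
  unfolding torl_def tor1_length[OF assms] rel_len_def a_kernel_def' ..
qed

lemma torl_ge: assumes "rhom R T X p" "p ` carrier T = carrier X" shows "rel_len T X p \<le> torl X"
proof -
 interpret p: rhom R T X p by fact
 show ?thesis unfolding torl_eval(3)[OF p.M'.rmod_axioms]
  by (rule rel_len_free[OF torl_eval(1,2)[OF p.M'.rmod_axioms] assms])
qed

lemma torl_free: assumes "rhom R (free_mod R S) X p" "p ` carrier (free_mod R S) = carrier X"
 shows "torl X = rel_len (free_mod R S) X p"
proof -
 interpret p: rhom R "free_mod R S" X p by fact
 show ?thesis
  using rel_len_free[OF assms torl_eval(1,2)[OF p.M'.rmod_axioms]] torl_ge[OF assms]
  unfolding torl_eval(3)[OF p.M'.rmod_axioms] by (rule antisym)
qed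

text \<open>Let \<open>F\<close> be a free cover of \<open>E\<close> and let \<open>S\<^sub>E \<subseteq> S\<^sub>M\<close> be the kernels of \<open>F \<rightarrow> E\<close> and \<open>F \<rightarrow> M\<close>. Then \<open>S\<^sub>M\<close> covers \<open>N\<close>
with kernel \<open>S\<^sub>E\<close>. Filter \<open>Tor\<^sub>1(E) = (S\<^sub>E \<inter> IF) / IS\<^sub>E\<close> by \<open>(S\<^sub>E \<inter> IS\<^sub>M) / IS\<^sub>E\<close>, which is no longer than \<open>Tor\<^sub>1(N)\<close>, with
quotient \<open>(S\<^sub>E \<inter> IF) / (S\<^sub>E \<inter> IS\<^sub>M)\<close>, which embeds into \<open>Tor\<^sub>1(M) = (S\<^sub>M \<inter> IF) / IS\<^sub>M\<close>. What remains of \<open>Tor\<^sub>1(M)\<close> is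
\<open>(S\<^sub>M \<inter> IF) / (IS\<^sub>M + (S\<^sub>E \<inter> IF))\<close>, and this maps onto \<open>f\<^sup>-\<^sup>1(IE) / IN\<close>.\<close>

theorem torl_short_exact:
 fixes N :: "('a, 'n) module" and E :: "('a, 'e) module" and M :: "('a, 'm) module"
 assumes mods: "rmod R N" "rmod R E" "rmod R M" and ex: "short_exact R N E M f g"
 shows "torl E + rmod.len R N (rmod.ip R N I (carrier N)) {n \<in> carrier N. f n \<in> rmod.ip R E I (carrier E)} \<le> torl N + torl M"
proof -
 interpret N: rmod R N by fact
 interpret E: rmod R E by fact
 interpret M: rmod R M by fact
 have fh: "rhom R N E f" and gh: "rhom R E M g" using ex unfolding short_exact_def by (auto intro!: rhom.intro rhom_axioms.intro mods)
 interpret f: rhom R N E f by (rule fh)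
 interpret g: rhom R E M g by (rule gh)
 have inj: "inj_on f (carrier N)" and exact: "f ` carrier N = {e \<in> carrier E. g e = \<zero>\<^bsub>M\<^esub>}" and surj: "g ` carrier E = carrier M"
  using ex unfolding short_exact_def a_kernel_def' by auto
 define F where "F = free_mod R (carrier E)"
 define p where "p = free_eval R E"
 have p: "rhom R F E p" "p ` carrier F = carrier E" "torl E = rel_len F E p" unfolding F_def p_def using torl_eval[OF mods(2)] by auto
 interpret p: rhom R F E p by (rule p(1))
 have gp: "rhom R F M (\<lambda>u. g (p u))" by (rule rhom_comp[OF p(1) gh])
 have gps: "(\<lambda>u. g (p u)) ` carrier F = carrier M" using p(2) surj by (simp add: image_image[symmetric])
 have tM: "torl M = rel_len F M (\<lambda>u. g (p u))" using gp gps torl_free unfolding F_def by blast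
 define SE where "SE = kern F E p"
 define SM where "SM = kern F M (\<lambda>u. g (p u))"
 have SE: "p.M.sm SE" unfolding SE_def by (rule sm_kern[OF p(1)])
 have SM: "p.M.sm SM" unfolding SM_def by (rule sm_kern[OF gp])
 have SEM: "SE \<subseteq> SM" unfolding SE_def SM_def using g.h_zero by auto
 define IF where "IF = p.M.ip I (carrier F)"
 have IF: "p.M.sm IF" unfolding IF_def by (rule p.M.sm_ip[OF I_sub order.refl])
 define ISE where "ISE = p.M.ip I SE"
 define ISM where "ISM = p.M.ip I SM"
 have ISE: "p.M.sm ISE" unfolding ISE_def by (rule p.M.sm_ip'[OF I_sub SE])
 have ISM: "p.M.sm ISM" unfolding ISM_def by (rule p.M.sm_ip'[OF I_sub SM])
 have ISE_le: "ISE \<subseteq> SE \<inter> ISM" unfolding ISE_def ISM_def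
  using p.M.ip_subset[OF I_sub SE] p.M.ip_mono[OF I_sub p.M.sm_subset[OF SM] order.refl SEM] by blast
 have ISM_le: "ISM \<subseteq> SM \<inter> IF" unfolding ISM_def IF_def
  using p.M.ip_subset[OF I_sub SM] p.M.ip_mono[OF I_sub order.refl order.refl p.M.sm_subset[OF SM]] by blast
 \<comment> \<open>the syzygy of M maps onto N with kernel the syzygy of E\<close>
 define T where "T = F\<lparr>carrier := SM\<rparr>"
 interpret T: rmod R T unfolding T_def by (rule p.M.restrict_rmod[OF SM])
 define q where "q s = the_inv_into (carrier N) f (p s)" for s
 have pim: "p s \<in> f ` carrier N" if "s \<in> SM" for s using that unfolding exact SM_def by auto
 have q: "q s \<in> carrier N" "f (q s) = p s" if "s \<in> SM" for s
  unfolding q_def using the_inv_into_into[OF inj pim[OF that] order.refl] f_the_inv_into_f[OF inj pim[OF that]] by auto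
 have qeq: "q s = n" if "s \<in> SM" "n \<in> carrier N" "p s = f n" for s n
  using q[OF that(1)] that inj by (auto dest: inj_onD)
 have qh: "rhom R T N q"
 proof (intro rhom.intro rhom_axioms.intro T.rmod_axioms N.rmod_axioms)
  have "q (s \<oplus>\<^bsub>F\<^esub> t) = q s \<oplus>\<^bsub>N\<^esub> q t" if "s \<in> SM" "t \<in> SM" for s t
   by (rule qeq) (use that q p.M.sm_add[OF SM] p.M.sm_carr[OF SM] in \<open>auto simp: f.h_add p.h_add\<close>)
  moreover have "q (a \<odot>\<^bsub>F\<^esub> s) = a \<odot>\<^bsub>N\<^esub> q s" if "a \<in> carrier R" "s \<in> SM" for a s
   by (rule qeq) (use that q p.M.sm_smult[OF SM] p.M.sm_carr[OF SM] in \<open>auto simp: f.h_smult p.h_smult\<close>)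
  ultimately show "q \<in> mod_hom R T N" unfolding mod_hom_def T_def using q by auto
 qed
 have qs: "q ` carrier T = carrier N"
 proof -
  have "n \<in> q ` SM" if n: "n \<in> carrier N" for n
  proof -
   have "f n \<in> p ` carrier F" unfolding p(2) using n by simp
   then obtain s where s: "s \<in> carrier F" "p s = f n" by (metis imageE)
   then have "s \<in> SM" unfolding SM_def using exact n by auto
   then show ?thesis using qeq[OF _ n s(2)] by force
  qed
  then show ?thesis using q unfolding T_def by auto
 qed
 have qk: "kern T N q = SE"
 proof -
  have "q s = \<zero>\<^bsub>N\<^esub> \<longleftrightarrow> p s = \<zero>\<^bsub>E\<^esub>" if "s \<in> SM" for s
   using q(2)[OF that] f.h_zero qeq[OF that N.M.zero_closed] by auto
  then show ?thesis using SEM unfolding T_def SE_def SM_def by auto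
 qed
 have eqs: "T.ip I SE = ISE" "T.ip I (carrier T) = ISM"
  unfolding T_def ISE_def ISM_def using p.M.restrict_ip[OF SM I_sub SEM] p.M.restrict_ip[OF SM I_sub order.refl] by auto
 have "rel_len T N q = T.len ISE (SE \<inter> ISM)" unfolding rel_len_def qk eqs ..
 also have "\<dots> = p.M.len ISE (SE \<inter> ISM)" unfolding T_def by (rule p.M.restrict_len[OF SM]) (use SEM in blast)
 finally have tN: "p.M.len ISE (SE \<inter> ISM) \<le> torl N" using torl_ge[OF qh qs] by simp
 have smi: "p.M.sm (SE \<inter> ISM)" "p.M.sm (SE \<inter> IF)" "p.M.sm (SM \<inter> IF)"
  using p.M.sm_Int SE SM IF ISM by auto
 have le2: "SE \<inter> ISM \<subseteq> SE \<inter> IF" using ISM_le by blast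
 have tE: "torl E = p.M.len ISE (SE \<inter> ISM) + p.M.len (SE \<inter> ISM) (SE \<inter> IF)"
  unfolding p(3) rel_len_def SE_def[symmetric] IF_def[symmetric] ISE_def[symmetric]
  by (rule p.M.len_add[OF ISE smi(1,2) ISE_le le2])
 define Q where "Q = p.M.psum ISM (SE \<inter> IF)"
 have Q: "p.M.sm Q" unfolding Q_def by (rule p.M.sm_psum[OF ISM smi(2)])
 have ISMQ: "ISM \<subseteq> Q" "SE \<inter> IF \<subseteq> Q" unfolding Q_def by (rule p.M.psum_ub1[OF ISM smi(2)], rule p.M.psum_ub2[OF ISM smi(2)])
 have Qle: "Q \<subseteq> SM \<inter> IF" unfolding Q_def by (rule p.M.psum_least[OF smi(3) ISM_le]) (use SEM in blast)
 have tM': "torl M = p.M.len ISM Q + p.M.len Q (SM \<inter> IF)"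
  unfolding tM rel_len_def SM_def[symmetric] IF_def[symmetric] ISM_def[symmetric]
  by (rule p.M.len_add[OF ISM Q smi(3) ISMQ(1) Qle])
 have a: "p.M.len (SE \<inter> ISM) (SE \<inter> IF) \<le> p.M.len ISM Q"
  by (rule p.M.len_second_iso_le[OF smi(2) ISM Q _ ISMQ(2,1)]) blast
 have pIF: "p ` IF = E.ip I (carrier E)" unfolding IF_def using p.image_ip[OF I_sub p.M.sm_carrier] p(2) by simp
 have qISM: "q ` ISM = N.ip I (carrier N)"
  using rhom.image_ip[OF qh I_sub T.sm_carrier] qs eqs(2) by simp
 have T2: "T.sm (SM \<inter> IF)" using p.M.restrict_sm[OF SM] smi(3) unfolding T_def by auto
 define KN where "KN = {n \<in> carrier N. f n \<in> E.ip I (carrier E)}"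
 have KN: "N.sm KN" unfolding KN_def by (rule f.sm_vimage[OF N.sm_carrier E.sm_ip[OF I_sub order.refl]])
 have IN: "N.sm (N.ip I (carrier N))" by (rule N.sm_ip[OF I_sub order.refl])
 have b: "N.len (N.ip I (carrier N)) KN \<le> p.M.len Q (SM \<inter> IF)"
 proof -
  have "N.len (N.ip I (carrier N)) KN \<le> T.len Q (SM \<inter> IF)"
  proof (rule rhom.len_ge_hom[OF qh T2 Qle IN])
   fix u assume "u \<in> Q"
   then obtain i s where ise: "i \<in> ISM" "s \<in> SE \<inter> IF" "u = i \<oplus>\<^bsub>F\<^esub> s" unfolding Q_def by (auto elim!: p.M.psumE)
   have c: "i \<in> SM" "s \<in> SM" using ise ISM_le SEM by auto
   have "q u = q i"
    by (rule qeq) (use ise c q p.M.sm_add[OF SM] p.M.sm_carr[OF SM] in \<open>auto simp: p.h_add SE_def\<close>)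
   then show "q u \<in> N.ip I (carrier N)" using qISM ise(1) by blast
  next
   fix n assume n: "n \<in> KN"
   then have nN: "n \<in> carrier N" and "f n \<in> p ` IF" unfolding KN_def pIF by auto
   then obtain s where s: "s \<in> IF" "p s = f n" by force
   have "s \<in> SM" unfolding SM_def using p.M.sm_carr[OF IF s(1)] exact nN s(2) by auto
   then show "\<exists>u\<in>SM \<inter> IF. n \<ominus>\<^bsub>N\<^esub> q u \<in> N.ip I (carrier N)"
    using s qeq[OF _ nN s(2)] N.sm_zero[OF IN] nN by (intro bexI[of _ s]) (auto simp: N.sub_self)
  qed
  also have "T.len Q (SM \<inter> IF) = p.M.len Q (SM \<inter> IF)" unfolding T_def by (rule p.M.restrict_len[OF SM]) blast
  finally show ?thesis .
 qed
 have "torl E + N.len (N.ip I (carrier N)) KN \<le> (torl N + p.M.len ISM Q) + p.M.len Q (SM \<inter> IF)"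
  unfolding tE by (intro add_mono tN a b)
 then show ?thesis unfolding tM' KN_def by (simp add: add.assoc)
qed

end

section \<open>Powers of an ideal\<close>

context rmod begin

lemma ip_carrier: assumes "sm H" shows "ip (carrier R) H = H"
proof
 show "ip (carrier R) H \<subseteq> H" by (rule ip_subset[OF order.refl assms])
 show "H \<subseteq> ip (carrier R) H" using ipI[OF R.one_closed, of _ H] sm_carr[OF assms] by fastforce
qed

lemma ip_prod: assumes "ideal I R" "ideal J R" "sm H" shows "ip (ideal_prod R I J) H = ip I (ip J H)"
proof
 have sub: "I \<subseteq> carrier R" "J \<subseteq> carrier R" by (rule ideal_subset[OF assms(1)], rule ideal_subset[OF assms(2)])
 have IJ: "ideal_prod R I J \<subseteq> carrier R" by (rule R.ideal_prod_in_carrier[OF assms(1,2)])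
 have JH: "sm (ip J H)" by (rule sm_ip'[OF sub(2) assms(3)])
 have IJH: "sm (ip I (ip J H))" by (rule sm_ip'[OF sub(1) JH])
 have P: "sm (ip (ideal_prod R I J) H)" by (rule sm_ip'[OF IJ assms(3)])
 show "ip (ideal_prod R I J) H \<subseteq> ip I (ip J H)"
 proof (rule ip_least[OF IJH])
  fix a x assume a: "a \<in> ideal_prod R I J" and x: "x \<in> H"
  have xM: "x \<in> carrier M" by (rule sm_carr[OF assms(3) x])
  show "a *. x \<in> ip I (ip J H)"
   using a
  proof (induction a rule: ideal_prod.induct)
   case (prod i j)
   then have "(i \<otimes> j) *. x = i *. (j *. x)" using sub xM by (auto intro!: smult_assoc1)
   then show ?case using prod x by (auto intro!: ipI)
  next
   case (sum s t)
   have "s \<in> carrier R" "t \<in> carrier R" using sum IJ by auto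
   then show ?case using sum.IH xM sm_add[OF IJH] by (simp add: smult_l_distr)
  qed
 qed
 show "ip I (ip J H) \<subseteq> ip (ideal_prod R I J) H"
 proof (rule ip_least[OF P])
  fix a x assume a: "a \<in> I" and x: "x \<in> ip J H"
  have aR: "a \<in> carrier R" using a sub by blast
  have "ip J H \<subseteq> {x \<in> carrier M. a *. x \<in> ip (ideal_prod R I J) H}"
  proof (rule ip_least[OF sm_colon[OF aR sm_carrier P]])
   fix b y assume b: "b \<in> J" and y: "y \<in> H"
   have c: "b \<in> carrier R" "y \<in> carrier M" using b sub y sm_carr[OF assms(3)] by auto
   have "a *. (b *. y) = (a \<otimes> b) *. y" using aR c by (simp add: smult_assoc1)
   then show "b *. y \<in> {x \<in> carrier M. a *. x \<in> ip (ideal_prod R I J) H}"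
    using c ipI[OF ideal_prod.prod[OF a b] y] by simp
  qed
  then show "a *. x \<in> ip (ideal_prod R I J) H" using x by blast
 qed
qed

lemma ideal_power_ideal: "ideal I R ==> ideal (ideal_power R I n) R"
 by (induction n) (auto intro: R.oneideal R.ideal_prod_is_ideal)

lemma ip_ideal_power: "ideal I R ==> sm H ==> ip (ideal_power R I n) H = ipow I n H"
 by (induction n) (simp_all add: ip_carrier ip_prod ideal_power_ideal ipow_Suc)

lemma ideal_smult_power: "ideal I R ==> ideal_smult R (ideal_power R I n) M = ipow I n (carrier M)"
 using ip_ideal_power[OF _ sm_carrier] unfolding ip_def ideal_smult_def by blast

end

section \<open>Growth of Tor\<close>

text \<open>Generators \<open>g\<^sub>1, \<dots>, g\<^sub>k\<close> filter \<open>X/I\<^sup>nX\<close> by quotients of \<open>R/(ann X + I\<^sup>n)\<close>.\<close>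

lemma fg_fin:
 fixes R :: "'a ring"
 assumes base: "fin_mod R (self_mod R) I" and X: "fg_module R X"
 shows "fin_pair R X I" "fin_mod R X I"
  "\<exists>k. \<forall>n. rmod.len R X (rmod.ipow R X I n (carrier X)) (carrier X) \<le> enat (k * rmod.hs R (self_mod R) I (annihilator R X) n)"
proof -
 interpret S: fin_mod R "self_mod R" I by fact
 interpret X: rmod R X using X unfolding fg_module_def by (auto intro: rmod.intro)
 obtain gs where gs: "set gs \<subseteq> carrier X" "carrier X = gen_submod R X (set gs)"
  using X unfolding fg_module_def by (metis finite_list)
 have nm: "noeth_mod R X I"
  by (intro noeth_mod.intro noeth_mod_axioms.intro X.rmod_axioms X.fg_acc[OF gs] S.I_ideal S.acc_R)
 then interpret X: noeth_mod R X I .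
 show fp: "fin_pair R X I" by (intro fin_pair.intro fin_pair_axioms.intro nm base)
 interpret XP: fin_pair R X I by (rule fp)
 define L where "L = annihilator R X"
 have L: "S.sm L"
  by (rule S.smI) (auto simp: L_def annihilator_def X.smult_l_distr X.smult_assoc1)
 have growth: "X.len (X.ipow I n (carrier X)) (carrier X) \<le> enat (length gs) * enat (S.hs I L n)" for n
 proof -
  have "X.len (X.ipow I n (carrier X)) (carrier X) \<le> enat (length gs) * S.len (S.psum L (S.J n)) (carrier R)"
  proof (rule X.fg_growth[OF gs XP.smJM])
   show "S.psum L (S.J n) \<subseteq> carrier R" using S.sm_subset[OF S.sm_psum[OF L S.smJ]] by simp
   fix a g assume a: "a \<in> S.psum L (S.J n)" and g: "g \<in> set gs"
   then obtain l b where lb: "l \<in> L" "b \<in> S.J n" "a = l \<oplus>\<^bsub>R\<^esub> b" by (auto elim!: S.psumE)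
   have c: "l \<in> carrier R" "b \<in> carrier R" "g \<in> carrier X" using S.sm_carr[OF L lb(1)] S.J_le lb(2) g gs(1) by auto
   have "a \<odot>\<^bsub>X\<^esub> g = b \<odot>\<^bsub>X\<^esub> g" using lb c by (simp add: X.smult_l_distr L_def annihilator_def)
   then show "a \<odot>\<^bsub>X\<^esub> g \<in> X.ipow I n (carrier X)" using XP.J_smult[OF c(3) lb(2)] by simp
  qed
  then show ?thesis using S.hsE[OF L, of n] by simp
 qed
 then show "\<exists>k. \<forall>n. X.len (X.ipow I n (carrier X)) (carrier X) \<le> enat (k * S.hs I (annihilator R X) n)"
  unfolding L_def by (intro exI[of _ "length gs"]) simp
 show "fin_mod R X I"
  by (intro fin_mod.intro fin_mod_axioms.intro nm) (use growth in \<open>metis enat_ord_simps(5) infinity_ileE times_enat_simps(1)\<close>)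
qed

lemma limit_shift: fixes p :: "nat => real" assumes "(\<lambda>n. p n / real n ^ r) \<longlonglongrightarrow> L" shows "(\<lambda>n. p (n + c) / real n ^ r) \<longlonglongrightarrow> L"
proof -
 have "(\<lambda>n. (real (n + c) / real n) ^ r) \<longlonglongrightarrow> 1 ^ r"
 proof (rule tendsto_power)
  have "(\<lambda>n. 1 + real c / real n) \<longlonglongrightarrow> 1 + 0"
   by (intro tendsto_add tendsto_const lim_const_over_n)
  moreover have "\<forall>\<^sub>F n in sequentially. 1 + real c / real n = real (n + c) / real n"
   using eventually_gt_at_top[of 0] by eventually_elim (simp add: field_simps)
  ultimately have "(\<lambda>n. real (n + c) / real n) \<longlonglongrightarrow> 1 + 0" by (rule Lim_transform_eventually)
  then show "(\<lambda>n. real (n + c) / real n) \<longlonglongrightarrow> 1" by simp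
 qed
 moreover have "(\<lambda>n. p (n + c) / real (n + c) ^ r) \<longlonglongrightarrow> L"
  using LIMSEQ_ignore_initial_segment[OF assms, of c] .
 ultimately have "(\<lambda>n. p (n + c) / real (n + c) ^ r * (real (n + c) / real n) ^ r) \<longlonglongrightarrow> L * 1 ^ r"
  by (rule tendsto_mult[rotated])
 moreover have "\<forall>\<^sub>F n in sequentially. p (n + c) / real (n + c) ^ r * (real (n + c) / real n) ^ r = p (n + c) / real n ^ r"
  using eventually_gt_at_top[of 0] by eventually_elim (simp add: power_divide)
 ultimately have "(\<lambda>n. p (n + c) / real n ^ r) \<longlonglongrightarrow> L * 1 ^ r" by (rule Lim_transform_eventually)
 then show ?thesis by simp
qed

context fin_mod begin

definition pl :: "'b set => nat => nat" where "pl S n = the_enat (len (ipow I n S) S)"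

lemma plE: "sm S ==> len (ipow I n S) S = enat (pl S n)"
 using fin_sub[of S n] unfolding pl_def by auto

lemma small_pl_sub: assumes "sm S" "small r (pl (carrier M))" shows "small r (pl S)"
proof -
 obtain c where c: "\<And>k. k \<ge> c ==> S \<inter> J k \<subseteq> ipow I (k - c) S" using artin_rees[OF assms(1) sm_carrier] by blast
 have "pl S n \<le> pl (carrier M) (n + c)" for n
 proof -
  have "len (ipow I n S) S \<le> len (J (n + c)) (carrier M)"
   using c[of "n + c"] by (intro len_second_iso_le assms(1) smJ sm_carrier sm_subset[OF assms(1)] J_le) simp
  then show ?thesis using plE[OF assms(1)] plE[OF sm_carrier] by simp
 qed
 then show ?thesis using small_mono[OF small_shift[OF assms(2), of c]] by blast
qed

text \<open>The length of \<open>K/I\<^sup>nK\<close> is eventually polynomial, of degree at most \<open>d\<close>. By Artin-Rees \<open>K \<inter> I\<^sup>nM \<subseteq> I\<^sup>n\<^sup>-\<^sup>cK\<close>, so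
\<open>t n\<close> is at most the difference of two values of this polynomial at distance \<open>c\<close>.\<close>

lemma relation_growth:
 assumes K: "sm K" and s: "small (Suc d) (pl (carrier M))"
  and t: "\<And>n. len (ipow I (Suc n) K) (K \<inter> J (Suc n)) = enat (t n)"
 shows "(\<lambda>n. real (t n) / real n ^ d) \<longlonglongrightarrow> 0"
proof -
 obtain c where c: "\<And>k. k \<ge> c ==> K \<inter> J k \<subseteq> ipow I (k - c) K" using artin_rees[OF K sm_carrier] by blast
 have smK: "sm (ipow I n K)" for n by (rule sm_ipow[OF I_sub K])
 have "convergent (\<lambda>n. real (pl K n) / real n ^ d)"
  using hilbert_samuel[OF K] small_pl_sub[OF K s] unfolding small_def pl_def by (intro evpoly_convergent) auto
 then obtain L where L: "(\<lambda>n. real (pl K n) / real n ^ d) \<longlonglongrightarrow> L" unfolding convergent_def by blast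
 have le: "real (t (j + c)) / real (j + c) ^ d \<le> (real (pl K (j + Suc c)) - real (pl K (j + 1))) / real j ^ d" if j: "j \<ge> 1" for j
 proof -
  have "K \<inter> J (Suc (j + c)) \<subseteq> ipow I (j + 1) K" using c[of "Suc (j + c)"] by simp
  then have "enat (t (j + c)) \<le> len (ipow I (Suc (j + c)) K) (ipow I (j + 1) K)" unfolding t[symmetric] by (rule len_mono_top)
  moreover have "len (ipow I (Suc (j + c)) K) K = len (ipow I (Suc (j + c)) K) (ipow I (j + 1) K) + len (ipow I (j + 1) K) K"
   by (rule len_add[OF smK smK K ipow_antimono[OF I_sub K] ipow_subset[OF I_sub K]]) simp
  ultimately have "enat (t (j + c)) + enat (pl K (j + 1)) \<le> enat (pl K (Suc (j + c)))" unfolding plE[OF K] by (metis add_right_mono)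
  then have "real (t (j + c)) \<le> real (pl K (j + Suc c)) - real (pl K (j + 1))" by simp
  moreover have "real j ^ d \<le> real (j + c) ^ d" by (intro power_mono) auto
  ultimately show ?thesis using j by (intro frac_le) auto
 qed
 have "(\<lambda>j. real (pl K (j + Suc c)) / real j ^ d - real (pl K (j + 1)) / real j ^ d) \<longlonglongrightarrow> L - L"
  by (intro tendsto_diff limit_shift L)
 then have lim: "(\<lambda>j. (real (pl K (j + Suc c)) - real (pl K (j + 1))) / real j ^ d) \<longlonglongrightarrow> 0" by (simp add: diff_divide_distrib)
 have "(\<lambda>j. real (t (j + c)) / real (j + c) ^ d) \<longlonglongrightarrow> 0"
  by (rule tendsto_sandwich[OF _ _ tendsto_const lim])
   (use le in \<open>auto simp: eventually_sequentially intro!: exI[of _ 1]\<close>)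
 then show ?thesis using LIMSEQ_offset[of "\<lambda>j. real (t j) / real j ^ d" c] by simp
qed

text \<open>Additivity of length along \<open>I\<^sup>nK \<subseteq> K \<inter> I\<^sup>nM \<subseteq> K\<close>, with \<open>K/(K \<inter> I\<^sup>nM)\<close> the kernel of \<open>M/I\<^sup>nM \<rightarrow> X/I\<^sup>nX\<close>.\<close>

lemma relation_length:
 assumes p: "rhom R M X p" "p ` carrier M = carrier X" and X: "fin_mod R X I"
 defines "K \<equiv> {u \<in> carrier M. p u = \<zero>\<^bsub>X\<^esub>}"
 shows "\<exists>t. \<forall>n. len (ipow I n K) (K \<inter> J n) = enat (t n) \<and>
  real (t n) = real (pl K n) - real (pl (carrier M) n) + real (fin_mod.pl R X I (carrier X) n)"
proof -
 interpret p: rhom R M X p by fact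
 interpret X: fin_mod R X I by fact
 have "sm {u \<in> carrier M. p u \<in> {\<zero>\<^bsub>X\<^esub>}}" by (rule p.sm_vimage[OF sm_carrier p.M'.sm_null])
 then have K: "sm K" by (simp add: K_def)
 have smK: "sm (ipow I n K)" for n by (rule sm_ipow[OF I_sub K])
 have KJ: "sm (K \<inter> J n)" "sm (K [+] J n)" for n using sm_Int[OF K smJ] sm_psum[OF K smJ] by auto
 have "\<exists>t. len (ipow I n K) (K \<inter> J n) = enat t \<and> real t = real (pl K n) - real (pl (carrier M) n) + real (X.pl (carrier X) n)" for n
 proof -
  have le1: "ipow I n K \<subseteq> K \<inter> J n" using ipow_subset[OF I_sub K] ipow_mono[OF I_sub sm_carrier K sm_subset[OF K]] by blast
  have e1: "enat (pl K n) = len (ipow I n K) (K \<inter> J n) + len (K \<inter> J n) K"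
   unfolding plE[OF K, symmetric] by (rule len_add[OF smK KJ(1) K le1]) blast
  interpret i: rhom R M M "\<lambda>u. u" by (rule id_rhom)
  have e2: "len (K \<inter> J n) K = len (J n) (K [+] J n)"
  proof (rule i.len_eq_hom[OF K smJ KJ(2)])
   show "J n \<subseteq> K [+] J n" by (rule psum_ub2[OF K smJ])
   show "u \<in> K [+] J n" if "u \<in> K" for u using psum_ub1[OF K smJ] that by blast
   fix u' assume "u' \<in> K [+] J n"
   then obtain k j where kj: "k \<in> K" "j \<in> J n" "u' = k +. j" by (auto elim!: psumE)
   then have "u' -. k = j" using add_sub_cancel_l sm_carr[OF K] sm_carr[OF smJ] by blast
   then show "\<exists>u\<in>K. u' -. u \<in> J n" using kj by blast
  qed auto
  have e3: "enat (pl (carrier M) n) = len (J n) (K [+] J n) + len (K [+] J n) (carrier M)"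
   unfolding plE[OF sm_carrier, symmetric] by (rule len_add[OF smJ KJ(2) sm_carrier psum_ub2[OF K smJ] sm_subset[OF KJ(2)]])
  have pJ: "p ` J n = X.J n" using p.image_ipow[OF I_sub sm_carrier] p(2) by simp
  have e4: "len (K [+] J n) (carrier M) = enat (X.pl (carrier X) n)"
   unfolding X.plE[OF p.M'.sm_carrier, symmetric]
  proof (rule p.len_eq_hom[OF sm_carrier X.smJ p.M'.sm_carrier sm_subset[OF KJ(2)] X.J_le])
   fix u assume u: "u \<in> carrier M"
   show "p u \<in> X.J n \<longleftrightarrow> u \<in> K [+] J n"
   proof
    assume "p u \<in> X.J n"
    then obtain j where j: "j \<in> J n" "p u = p j" unfolding pJ[symmetric] by blast
    have jc: "j \<in> carrier M" using sm_carr[OF smJ j(1)] .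
    have "u -. j \<in> K" unfolding K_def using u jc j(2) by (simp add: p.h_sub p.M'.sub_self)
    then show "u \<in> K [+] J n" using psumI[OF _ j(1)] sub_add_cancel[OF u jc] by fastforce
   next
    assume "u \<in> K [+] J n"
    then obtain k j where kj: "k \<in> K" "j \<in> J n" "u = k +. j" by (auto elim!: psumE)
    have c: "k \<in> carrier M" "j \<in> carrier M" using kj sm_carr[OF K] sm_carr[OF smJ] by auto
    have "p u = p j" using kj c by (simp add: p.h_add K_def)
    then show "p u \<in> X.J n" using pJ kj by blast
   qed
  next
   show "\<exists>u\<in>carrier M. x \<ominus>\<^bsub>X\<^esub> p u \<in> X.J n" if "x \<in> carrier X" for x
    using p.surj_by_eq[OF X.smJ that] p(2) that by (metis imageE)
  qed auto
  show ?thesis using e1 e2 e3 e4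
   by (cases "len (ipow I n K) (K \<inter> J n)"; cases "len (J n) (K [+] J n)") auto
 qed
 then show ?thesis by metis
qed

end

text \<open>For a finite free cover the Tor lengths are eventually polynomial by \<open>relation_length\<close> and Hilbert-Samuel, and \<open>relation_growth\<close> bounds the degree by \<open>d\<close>.\<close>

theorem tor_growth_converges:
 fixes R :: "'a ring" and X :: "('a, 'm) module"
 assumes base: "fin_mod R (self_mod R) I" and X: "fg_module R X"
  and s: "small (Suc (Suc d)) (rmod.hs R (self_mod R) I {\<zero>\<^bsub>R\<^esub>})"
 shows "\<exists>t. (\<forall>n. mod_length R (tor1 R X (quot_mod (self_mod R) (ideal_power R I (n + 1)))) = enat (t n)) \<and>
  convergent (\<lambda>n. real (t n) / real n ^ d)"
proof -
 interpret S: fin_mod R "self_mod R" I by fact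
 interpret X: fin_mod R X I by (rule fg_fin(2)[OF base X])
 obtain G where G: "finite G" "G \<subseteq> carrier X" "carrier X = gen_submod R X G" using X unfolding fg_module_def by blast
 define F where "F = free_mod R G"
 interpret F: rmod R F unfolding F_def by (rule free_rmod[OF S.cringR])
 define p where "p = X.lin (\<lambda>x. x)"
 have p: "rhom R F X p" unfolding F_def p_def by (rule X.lin_hom) (use G(2) in blast)
 interpret p: rhom R F X p by (rule p)
 have ps: "p ` carrier F = carrier X"
 proof
  have "G \<subseteq> p ` carrier F"
  proof
   fix x assume x: "x \<in> G"
   have "p (free_gen R x) = x" unfolding p_def using X.lin_gen[of "\<lambda>x. x" x] x G(2) by blast
   then show "x \<in> p ` carrier F" using free_gen_carrier[OF S.cringR x] unfolding F_def by force
  qed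
  then show "carrier X \<subseteq> p ` carrier F" unfolding G(3) by (rule X.gen_least[OF p.sm_image[OF F.sm_carrier]])
 qed auto
 have Ffg: "fg_module R F"
 proof -
  have sub: "free_gen R ` G \<subseteq> carrier F" using free_gen_carrier[OF S.cringR, of _ G] by (auto simp: F_def)
  have sg: "F.sm (gen_submod R F (free_gen R ` G))" by (rule F.sm_gen[OF sub])
  have gi: "free_gen R s \<in> gen_submod R F (free_gen R ` G)" if "s \<in> G" for s
   using F.gen_incl[of "free_gen R ` G"] that by blast
  have "carrier F \<subseteq> gen_submod R F (free_gen R ` G)"
   unfolding F_def by (rule free_induct[OF S.cringR]) (use sg gi in \<open>auto simp only: F_def\<close>)
  then have "carrier F = gen_submod R F (free_gen R ` G)" using F.gen_least[OF F.sm_carrier sub] by blast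
  then show ?thesis unfolding fg_module_def using F.module_axioms G(1) sub by blast
 qed
 interpret FM: fin_mod R F I by (rule fg_fin(2)[OF base Ffg])
 obtain k where k: "\<And>n. F.len (FM.J n) (carrier F) \<le> enat (k * S.hs I (annihilator R F) n)" using fg_fin(3)[OF base Ffg] by blast
 have ann: "S.sm (annihilator R F)"
  by (rule S.smI) (auto simp: annihilator_def F.smult_l_distr F.smult_assoc1 simp del: free_simps)
 have "FM.pl (carrier F) n \<le> k * S.hs I {\<zero>\<^bsub>R\<^esub>} n" for n
 proof -
  have "FM.pl (carrier F) n \<le> k * S.hs I (annihilator R F) n" using k[of n] FM.plE[OF F.sm_carrier, of n] by simp
  also have "\<dots> \<le> k * S.hs I {\<zero>\<^bsub>R\<^esub>} n"
   using S.hs_anti[OF S.sm_null ann, of n] S.sm_zero[OF ann] by (intro mult_le_mono2) simp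
  finally show ?thesis .
 qed
 then have small: "small (Suc (Suc d)) (FM.pl (carrier F))" using small_mono[OF small_cmult[OF s, of k]] by blast
 define K where "K = {u \<in> carrier F. p u = \<zero>\<^bsub>X\<^esub>}"
 obtain t where t: "\<And>n. F.len (F.ipow I n K) (K \<inter> FM.J n) = enat (t n)"
   "\<And>n. real (t n) = real (FM.pl K n) - real (FM.pl (carrier F) n) + real (X.pl (carrier X) n)"
  using FM.relation_length[OF p ps X.fin_mod_axioms] unfolding K_def by blast
 have K: "F.sm K"
 proof -
  have "F.sm {u \<in> carrier F. p u \<in> {\<zero>\<^bsub>X\<^esub>}}" by (rule p.sm_vimage[OF F.sm_carrier X.sm_null])
  then show ?thesis by (simp add: K_def)
 qed
 have tor: "mod_length R (tor1 R X (quot_mod (self_mod R) (ideal_power R I (n + 1)))) = enat (t (Suc n))" for n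
 proof -
  define Q where "Q = ideal_power R I (n + 1)"
  interpret C: cyclic_quot R Q
   by (intro cyclic_quot.intro cyclic_quot_axioms.intro S.cringR) (simp only: Q_def X.ideal_power_ideal[OF S.I_ideal])
  have "mod_length R (tor1 R X (quot_mod (self_mod R) Q)) = C.rel_len F X p"
   unfolding C.torl_def[symmetric] F_def by (rule C.torl_free) (use p ps F_def in auto)
  also have "\<dots> = F.len (F.ip Q K) (K \<inter> F.ip Q (carrier F))" unfolding C.rel_len_def K_def ..
  also have "\<dots> = F.len (F.ipow I (Suc n) K) (K \<inter> FM.J (Suc n))"
   using F.ip_ideal_power[OF S.I_ideal K, of "Suc n"] F.ip_ideal_power[OF S.I_ideal F.sm_carrier, of "Suc n"] unfolding Q_def by simp
  finally show ?thesis using t(1) Q_def by simp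
 qed
 have "evpoly (\<lambda>n. real (t n))"
  unfolding t(2) FM.pl_def X.pl_def
  by (intro evpoly_add evpoly_diff FM.hilbert_samuel X.hilbert_samuel K F.sm_carrier X.sm_carrier)
 then have "evpoly (\<lambda>n. real (t (Suc n)))" by (rule evpoly_Suc)
 moreover have "(\<lambda>n. real (t (Suc n)) / real n ^ Suc d) \<longlonglongrightarrow> 0"
  by (rule FM.relation_growth[OF K small]) (rule t(1))
 ultimately have "convergent (\<lambda>n. real (t (Suc n)) / real n ^ d)" by (rule evpoly_convergent)
 then show ?thesis using tor by (intro exI[of _ "\<lambda>n. t (Suc n)"]) simp
qed

section \<open>The associated graded module\<close>

lemma (in rmod) rcoset_restrict: "Y +>\<^bsub>M\<lparr>carrier := S\<rparr>\<^esub> u = Y +>\<^bsub>M\<^esub> u"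
 unfolding a_r_coset_def' by simp

lemma self_rcoset: "Y +>\<^bsub>self_mod R\<^esub> u = Y +>\<^bsub>R\<^esub> u"
 unfolding a_r_coset_def' by simp

lemma (in rmod) finsum_self_rdistr:
 assumes "finite T" "f \<in> T \<rightarrow> carrier R" "x \<in> carrier M"
 shows "finsum (self_mod R) f T *. x = finsum M (\<lambda>i. f i *. x) T"
proof -
 interpret S: rmod R "self_mod R" by (rule self_rmod) (rule R.is_cring)
 show ?thesis using assms
 proof (induction T rule: finite_induct)
  case (insert i T)
  have c: "finsum (self_mod R) f T \<in> carrier R" using S.M.finsum_closed[of f T] insert.prems by auto
  have "finsum (self_mod R) f (insert i T) = f i \<oplus> finsum (self_mod R) f T"
   using S.M.finsum_insert[of T i f] insert by auto
  moreover have "finsum M (\<lambda>i. f i *. x) (insert i T) = f i *. x +. finsum M (\<lambda>i. f i *. x) T"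
   using insert by (intro M.finsum_insert) auto
  ultimately show ?case using insert c by (auto simp: smult_l_distr)
 qed (simp add: S.M.finsum_empty[simplified])
qed

text \<open>Vectors are handled through representing sequences: the class of a sequence with \<open>n\<close>-th term in
 \<open>I\<^sup>n M\<close> is an element of the graded module, and the action becomes a Cauchy product.\<close>

locale gr_noeth = noeth_mod +
 assumes gr_cring: "cring (gr_ring R I)"
begin

abbreviation G :: "(nat => 'a set) ring" where "G \<equiv> gr_ring R I"
abbreviation W :: "(nat => 'a set, nat => 'b set) module" where "W \<equiv> gr_mod R I M"
abbreviation V :: "nat => 'b set" where "V n \<equiv> ipow I n (carrier M)"

lemma smV: "sm (V n)" by (rule sm_ipow[OF I_sub sm_carrier])
lemma V_carr: "v \<in> V n ==> v \<in> carrier M" by (rule sm_carr[OF smV])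
lemma V_Suc: "V (Suc n) \<subseteq> V n" by (rule ipow_Suc_subset[OF I_sub sm_carrier])
lemma V_minus: "u \<in> V n ==> v \<in> V n ==> u -. v \<in> V n" by (rule sm_sub[OF smV])

definition cls :: "(nat => 'b) => nat => 'b set" where "cls y = (\<lambda>n. V (Suc n) +>\<^bsub>M\<^esub> y n)"

text \<open>Finite support is required of the representatives themselves; every vector of finite support has such a representative.\<close>

definition sq :: "(nat => 'b) set"
 where "sq = {y. (\<forall>n. y n \<in> V n) \<and> (\<exists>k. \<forall>n\<ge>k. y n = \<zero>\<^bsub>M\<^esub>)}"

definition cauchy :: "(nat => 'a) => (nat => 'b) => nat => 'b"
 where "cauchy a y n = finsum M (\<lambda>i. a i *. y (n - i)) {..n}"

lemma sqD: "y \<in> sq ==> y n \<in> V n" "y \<in> sq ==> y n \<in> carrier M"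
 unfolding sq_def using V_carr by blast+

lemma cls_cong_iff: "y \<in> sq ==> z \<in> sq ==> cls y n = cls z n \<longleftrightarrow> y n -. z n \<in> V (Suc n)"
 using coset_eqI[OF smV] coset_eqD[OF smV] sqD(2) unfolding cls_def by metis

lemma cls_zero_iff: "y \<in> sq ==> cls y n = V (Suc n) \<longleftrightarrow> y n \<in> V (Suc n)"
 unfolding cls_def using coset_eq_iff[OF smV sqD(2)] by simp

lemma piece: "gr_piece R I M n = quot_mod (M\<lparr>carrier := V n\<rparr>) (V (Suc n))"
 unfolding gr_piece_def ideal_smult_power[OF I_ideal] ..

lemma piece_rmod: "rmod R (M\<lparr>carrier := V n\<rparr>)" by (rule restrict_rmod[OF smV])

lemma piece_sm: "submodule (V (Suc n)) R (M\<lparr>carrier := V n\<rparr>)" unfolding restrict_sm[OF smV] using smV V_Suc by blast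

lemma piece_carrier: "carrier (gr_piece R I M n) = (\<lambda>v. V (Suc n) +>\<^bsub>M\<^esub> v) ` V n"
 unfolding piece rmod.carrier_quot[OF piece_rmod] by (simp add: rcoset_restrict)

lemma piece_zero: "\<zero>\<^bsub>gr_piece R I M n\<^esub> = V (Suc n)" unfolding piece by (simp add: quot_mod_def)

lemma piece_add: "u \<in> V n ==> v \<in> V n ==>
  (V (Suc n) +>\<^bsub>M\<^esub> u) \<oplus>\<^bsub>gr_piece R I M n\<^esub> (V (Suc n) +>\<^bsub>M\<^esub> v) = V (Suc n) +>\<^bsub>M\<^esub> (u +. v)"
 using rmod.quot_ops(2)[OF piece_rmod piece_sm, of u n v] unfolding piece by (simp add: rcoset_restrict)

lemma piece_finsum:
 assumes "finite T" "\<And>i. i \<in> T ==> t i \<in> V n"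
 shows "finsum (gr_piece R I M n) (\<lambda>i. V (Suc n) +>\<^bsub>M\<^esub> t i) T = V (Suc n) +>\<^bsub>M\<^esub> finsum M t T \<and> finsum M t T \<in> V n"
proof -
 interpret P: rmod R "gr_piece R I M n" unfolding piece by (rule rmod.quot_rmod[OF piece_rmod piece_sm])
 show ?thesis using assms
 proof (induction T rule: finite_induct)
  case empty then show ?case using coset_zero[OF smV] sm_zero[OF smV] piece_zero by simp
 next
  case (insert i T)
  then have t: "t i \<in> V n" "finsum M t T \<in> V n" "t \<in> T \<rightarrow> carrier M" "t i \<in> carrier M" using V_carr by auto
  have "finsum (gr_piece R I M n) (\<lambda>i. V (Suc n) +>\<^bsub>M\<^esub> t i) (insert i T)
    = (V (Suc n) +>\<^bsub>M\<^esub> t i) \<oplus>\<^bsub>gr_piece R I M n\<^esub> finsum (gr_piece R I M n) (\<lambda>i. V (Suc n) +>\<^bsub>M\<^esub> t i) T"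
   using insert by (intro P.M.finsum_insert) (auto simp: piece_carrier)
  also have "\<dots> = V (Suc n) +>\<^bsub>M\<^esub> (t i +. finsum M t T)" using insert piece_add[OF t(1,2)] by simp
  also have "t i +. finsum M t T = finsum M t (insert i T)"
   using M.finsum_insert[OF insert.hyps(1,2) t(3,4)] by simp
  finally show ?case using sm_add[OF smV t(1,2)] M.finsum_insert[OF insert.hyps(1,2) t(3,4)] by simp
 qed
qed

lemma W_zero: "\<zero>\<^bsub>W\<^esub> = (\<lambda>n. V (Suc n))" by (simp add: gr_mod_def piece_zero)

lemma zero_sq: "(\<lambda>_. \<zero>\<^bsub>M\<^esub>) \<in> sq" by (simp add: sq_def sm_zero[OF smV])
lemma cls_zero: "cls (\<lambda>_. \<zero>\<^bsub>M\<^esub>) = \<zero>\<^bsub>W\<^esub>" by (simp add: cls_def W_zero coset_zero[OF smV])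

lemma W_carrier: "carrier W = cls ` sq"
proof (intro equalityI subsetI)
 fix x assume "x \<in> carrier W"
 then have x: "\<And>n. x n \<in> (\<lambda>v. V (Suc n) +>\<^bsub>M\<^esub> v) ` V n" "finite {n. x n \<noteq> V (Suc n)}"
  by (auto simp: gr_mod_def piece_zero piece_carrier)
 have "\<exists>v. v \<in> V n \<and> x n = V (Suc n) +>\<^bsub>M\<^esub> v \<and> (x n = V (Suc n) \<longrightarrow> v = \<zero>\<^bsub>M\<^esub>)" for n
  using x(1)[of n] coset_zero[OF smV] sm_zero[OF smV, of n] by (cases "x n = V (Suc n)") auto
 then obtain y where y: "\<And>n. y n \<in> V n" "\<And>n. x n = V (Suc n) +>\<^bsub>M\<^esub> y n" "\<And>n. x n = V (Suc n) ==> y n = \<zero>\<^bsub>M\<^esub>" by metis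
 obtain k where "{n. x n \<noteq> V (Suc n)} \<subseteq> {..<k}" using x(2) finite_nat_iff_bounded by blast
 then have "\<forall>n\<ge>k. y n = \<zero>\<^bsub>M\<^esub>" using y(3) by force
 then have "y \<in> sq" unfolding sq_def using y(1) by blast
 then show "x \<in> cls ` sq" using y(2) by (intro image_eqI[of _ _ y]) (auto simp: cls_def)
next
 fix x assume "x \<in> cls ` sq"
 then obtain y where y: "y \<in> sq" "x = cls y" by blast
 obtain k where k: "\<forall>n\<ge>k. y n = \<zero>\<^bsub>M\<^esub>" using y(1) unfolding sq_def by blast
 have "{n. x n \<noteq> V (Suc n)} \<subseteq> {..<k}"
  using k by (auto simp: y(2) cls_def coset_zero[OF smV] simp flip: not_le)
 then have "finite {n. x n \<noteq> V (Suc n)}" using finite_subset by blast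
 then show "x \<in> carrier W" using sqD(1)[OF y(1)] by (simp add: gr_mod_def piece_zero piece_carrier y(2) cls_def)
qed

lemma W_E: assumes "x \<in> carrier W" obtains y where "y \<in> sq" "x = cls y"
 using assms unfolding W_carrier by blast

lemma add_sq: "y \<in> sq ==> z \<in> sq ==> (\<lambda>n. y n +. z n) \<in> sq"
proof -
 assume yz: "y \<in> sq" "z \<in> sq"
 then obtain k k' where "\<forall>n\<ge>k. y n = \<zero>\<^bsub>M\<^esub>" "\<forall>n\<ge>k'. z n = \<zero>\<^bsub>M\<^esub>" unfolding sq_def by blast
 then have "\<forall>n\<ge>k + k'. y n +. z n = \<zero>\<^bsub>M\<^esub>" by simp
 then show ?thesis unfolding sq_def using sm_add[OF smV] sqD(1) yz by blast
qed

lemma neg_sq: "y \<in> sq ==> (\<lambda>n. \<ominus>\<^bsub>M\<^esub> y n) \<in> sq"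
 unfolding sq_def using sm_neg[OF smV] by force

lemma cls_add: "y \<in> sq ==> z \<in> sq ==> cls y \<oplus>\<^bsub>W\<^esub> cls z = cls (\<lambda>n. y n +. z n)"
 by (rule ext) (simp add: gr_mod_def cls_def piece_add sqD)

end

sublocale gr_noeth \<subseteq> S: gr_noeth R "self_mod R" I
 by (intro gr_noeth.intro gr_noeth_axioms.intro gr_cring noeth_mod.intro noeth_mod_axioms.intro self_rmod cringR I_ideal acc_R)
  (simp add: acc_R)

context gr_noeth begin

lemma S_V: "S.V n \<subseteq> carrier R" using S.sm_subset[OF S.smV] by simp

lemma V_smult: assumes "a \<in> S.V i" "v \<in> V j" shows "a *. v \<in> V (i + j)"
proof -
 interpret v: rhom R "self_mod R" M "\<lambda>a. a *. v" by (rule ann_rhom[OF V_carr[OF assms(2)]])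
 have "(\<lambda>a. a *. v) ` S.V i = ipow I i ((\<lambda>a. a *. v) ` carrier R)"
  using v.image_ipow[OF I_sub S.sm_carrier, of i] by simp
 also have "\<dots> \<subseteq> ipow I i (V j)"
 proof (rule ipow_mono[OF I_sub smV])
  show "sm ((\<lambda>a. a *. v) ` carrier R)" using v.sm_image[OF S.sm_carrier] by simp
  show "(\<lambda>a. a *. v) ` carrier R \<subseteq> V j" using sm_smult[OF smV] assms(2) by blast
 qed
 finally show ?thesis using assms(1) unfolding ipow_add by blast
qed

lemma smult_terms: assumes "a \<in> S.sq" "y \<in> sq"
 shows "i \<in> {..n} ==> a i *. y (n - i) \<in> V n" "(\<lambda>i. a i *. y (n - i)) \<in> {..n} \<rightarrow> carrier M"
proof -
 show t: "i \<in> {..n} ==> a i *. y (n - i) \<in> V n" for i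
  using V_smult[OF S.sqD(1)[OF assms(1)] sqD(1)[OF assms(2)], of i "n - i"] by simp
 then show "(\<lambda>i. a i *. y (n - i)) \<in> {..n} \<rightarrow> carrier M" using V_carr by blast
qed

lemma cauchy_sq: assumes a: "a \<in> S.sq" and y: "y \<in> sq" shows "cauchy a y \<in> sq"
proof -
 obtain k k' where k: "\<forall>n\<ge>k. a n = \<zero>" "\<forall>n\<ge>k'. y n = \<zero>\<^bsub>M\<^esub>" using a y unfolding S.sq_def sq_def by auto
 have "cauchy a y n = \<zero>\<^bsub>M\<^esub>" if n: "n \<ge> k + k'" for n
 proof -
  have "a i *. y (n - i) = \<zero>\<^bsub>M\<^esub>" if "i \<in> {..n}" for i
  proof (cases "i \<ge> k")
   case True then show ?thesis using k(1) sqD(2)[OF y] by simp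
  next
   case False
   then show ?thesis using k(2) n S.sqD(2)[OF a, of i] by simp
  qed
  then have "cauchy a y n = finsum M (\<lambda>i. \<zero>\<^bsub>M\<^esub>) {..n}" unfolding cauchy_def by (intro M.finsum_cong') auto
  then show ?thesis by simp
 qed
 moreover have "cauchy a y n \<in> V n" for n unfolding cauchy_def
  using piece_finsum[OF _ smult_terms(1)[OF a y], of "{..n}"] by simp
 ultimately show ?thesis unfolding sq_def by blast
qed

text \<open>The product of classes of degrees \<open>i\<close> and \<open>j\<close> is independent of the representatives.\<close>

lemma coset_product: assumes "a \<in> S.V i" "v \<in> V j"
 shows "(\<Union>r\<in>S.V (Suc i) +>\<^bsub>self_mod R\<^esub> a. \<Union>y\<in>V (Suc j) +>\<^bsub>M\<^esub> v. V (Suc (i + j)) +>\<^bsub>M\<^esub> (r *. y))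
  = V (Suc (i + j)) +>\<^bsub>M\<^esub> (a *. v)"
proof -
 have "V (Suc (i + j)) +>\<^bsub>M\<^esub> (r *. y) = V (Suc (i + j)) +>\<^bsub>M\<^esub> (a *. v)"
  if asm: "r \<in> S.V (Suc i) +>\<^bsub>self_mod R\<^esub> a" "y \<in> V (Suc j) +>\<^bsub>M\<^esub> v" for r y
 proof -
  obtain b where b: "b \<in> S.V (Suc i)" "r = b \<oplus> a" using asm(1) unfolding S.coset_mem by auto
  obtain w where w: "w \<in> V (Suc j)" "y = w +. v" using asm(2) unfolding coset_mem by auto
  have c: "a \<in> carrier R" "b \<in> carrier R" "w \<in> carrier M" "v \<in> carrier M"
   using assms b(1) w(1) S_V V_carr by blast+
  have y: "y \<in> V j" using sm_add[OF smV] w assms(2) V_Suc by blast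
  have "r *. y = (b *. y +. a *. w) +. a *. v"
   using c by (simp add: b(2) w(2) smult_l_distr smult_r_distr M.a_assoc M.a_lcomm)
  then have "r *. y -. a *. v = b *. y +. a *. w"
   using c V_carr[OF y] by (simp add: add_sub_cancel)
  also have "\<dots> \<in> V (Suc (i + j))"
   using sm_add[OF smV V_smult[OF b(1) y], of "a *. w"] V_smult[OF assms(1) w(1)] by simp
  finally show ?thesis using c V_carr[OF y] by (intro coset_eqI[OF smV]) (auto simp: b(2))
 qed
 moreover have "S.V (Suc i) +>\<^bsub>self_mod R\<^esub> a \<noteq> {}" "V (Suc j) +>\<^bsub>M\<^esub> v \<noteq> {}"
  using S.sm_zero[OF S.smV] sm_zero[OF smV] unfolding a_r_coset_def' by blast+
 ultimately show ?thesis by auto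
qed

lemma cls_smult: assumes "a \<in> S.sq" "y \<in> sq" shows "S.cls a \<odot>\<^bsub>W\<^esub> cls y = cls (cauchy a y)"
proof
 fix n
 have "(S.cls a \<odot>\<^bsub>W\<^esub> cls y) n = finsum (gr_piece R I M n) (\<lambda>i. \<Union>r\<in>S.cls a i. \<Union>u\<in>cls y (n - i). V (Suc n) +>\<^bsub>M\<^esub> (r *. u)) {..n}"
  by (simp add: gr_mod_def ideal_smult_power[OF I_ideal] del: ideal_power.simps)
 also have "\<dots> = finsum (gr_piece R I M n) (\<lambda>i. V (Suc n) +>\<^bsub>M\<^esub> (a i *. y (n - i))) {..n}"
 proof -
  interpret P: rmod R "gr_piece R I M n" unfolding piece by (rule rmod.quot_rmod[OF piece_rmod piece_sm])
  have "(\<Union>r\<in>S.cls a i. \<Union>u\<in>cls y (n - i). V (Suc n) +>\<^bsub>M\<^esub> (r *. u)) = V (Suc n) +>\<^bsub>M\<^esub> (a i *. y (n - i))"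
   if "i \<le> n" for i
   using coset_product[OF S.sqD(1)[OF assms(1)] sqD(1)[OF assms(2)], of i "n - i"] that unfolding S.cls_def cls_def by simp
  then show ?thesis
   using smult_terms(1)[OF assms] by (intro P.M.finsum_cong') (auto simp: piece_carrier)
 qed
 also have "\<dots> = cls (cauchy a y) n"
  unfolding cls_def cauchy_def using piece_finsum[OF _ smult_terms(1)[OF assms], of "{..n}"] by simp
 finally show "(S.cls a \<odot>\<^bsub>W\<^esub> cls y) n = cls (cauchy a y) n" .
qed

end

context gr_noeth begin

lemma G_simps: "carrier G = carrier S.W" "x \<oplus>\<^bsub>G\<^esub> y = x \<oplus>\<^bsub>S.W\<^esub> y" "\<zero>\<^bsub>G\<^esub> = \<zero>\<^bsub>S.W\<^esub>" "x \<otimes>\<^bsub>G\<^esub> y = x \<odot>\<^bsub>S.W\<^esub> y"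
 by (simp_all add: gr_ring_def Let_def)

text \<open>As for polynomials, both triple sums are compared on the initial segments \<open>{..k}\<close>.\<close>

lemma cauchy_assoc:
 assumes a: "a \<in> S.sq" and b: "b \<in> S.sq" and y: "y \<in> sq"
 shows "cauchy (S.cauchy a b) y = cauchy a (cauchy b y)"
proof
 fix n
 have c [simp]: "\<And>i. a i \<in> carrier R" "\<And>i. b i \<in> carrier R" "\<And>i. y i \<in> carrier M"
  using S.sqD(2)[OF a] S.sqD(2)[OF b] sqD(2)[OF y] by auto
 have bc: "S.cauchy a b j \<in> carrier R" for j using S.sqD(2)[OF S.cauchy_sq[OF a b]] by simp
 have "finsum M (\<lambda>j. S.cauchy a b j *. y (n - j)) {..k}
   = finsum M (\<lambda>j. a j *. finsum M (\<lambda>i. b i *. y (n - j - i)) {..k - j}) {..k}" if "k \<le> n" for k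
  using that
 proof (induction k)
  case 0
  have "S.cauchy a b 0 = a 0 \<otimes> b 0" unfolding S.cauchy_def using S.M.finsum_0[of "\<lambda>i. a i \<otimes> b (0 - i)"] by simp
  then show ?case by (simp add: smult_assoc1)
 next
  case (Suc k)
  define t where "t = y (n - Suc k)"
  have t: "t \<in> carrier M" by (simp add: t_def)
  define h where "h j = finsum M (\<lambda>i. b i *. y (n - j - i)) {..k - j}" for j
  have h: "h j \<in> carrier M" for j unfolding h_def by (rule M.finsum_closed) simp
  have split: "finsum M (\<lambda>i. b i *. y (n - j - i)) {..Suc k - j} = b (Suc k - j) *. t +. h j" if "j \<le> k" for j
  proof -
   have "Suc k - j = Suc (k - j)" "n - j - Suc (k - j) = n - Suc k" using that Suc.prems by auto
   then show ?thesis unfolding h_def t_def by (simp add: M.finsum_Suc)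
  qed
  have "finsum M (\<lambda>j. a j *. finsum M (\<lambda>i. b i *. y (n - j - i)) {..Suc k - j}) {..Suc k}
   = a (Suc k) *. (b 0 *. t) +. finsum M (\<lambda>j. a j *. finsum M (\<lambda>i. b i *. y (n - j - i)) {..Suc k - j}) {..k}"
   by (simp add: M.finsum_Suc t_def M.finsum_closed)
  also have "finsum M (\<lambda>j. a j *. finsum M (\<lambda>i. b i *. y (n - j - i)) {..Suc k - j}) {..k}
   = finsum M (\<lambda>j. (a j \<otimes> b (Suc k - j)) *. t +. a j *. h j) {..k}"
  proof (rule M.finsum_cong'[OF refl])
   show "a j *. finsum M (\<lambda>i. b i *. y (n - j - i)) {..Suc k - j}
    = (a j \<otimes> b (Suc k - j)) *. t +. a j *. h j" if "j \<in> {..k}" for j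
    unfolding split[OF that[unfolded atMost_iff]] using h t by (simp add: smult_r_distr smult_assoc1)
  qed (use h t in auto)
  also have "\<dots> = finsum M (\<lambda>j. (a j \<otimes> b (Suc k - j)) *. t) {..k} +. finsum M (\<lambda>j. a j *. h j) {..k}"
   using h t by (intro M.finsum_addf) auto
  also have "finsum M (\<lambda>j. a j *. h j) {..k} = finsum M (\<lambda>j. S.cauchy a b j *. y (n - j)) {..k}"
   using Suc unfolding h_def by simp
  finally have R: "finsum M (\<lambda>j. a j *. finsum M (\<lambda>i. b i *. y (n - j - i)) {..Suc k - j}) {..Suc k} =
   a (Suc k) *. (b 0 *. t) +. (finsum M (\<lambda>j. (a j \<otimes> b (Suc k - j)) *. t) {..k}
    +. finsum M (\<lambda>j. S.cauchy a b j *. y (n - j)) {..k})" .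
  have "S.cauchy a b (Suc k) *. t = finsum M (\<lambda>j. (a j \<otimes> b (Suc k - j)) *. t) {..Suc k}"
   unfolding S.cauchy_def using finsum_self_rdistr[of "{..Suc k}" "\<lambda>j. a j \<otimes> b (Suc k - j)" t] t by simp
  also have "\<dots> = a (Suc k) *. (b 0 *. t) +. finsum M (\<lambda>j. (a j \<otimes> b (Suc k - j)) *. t) {..k}"
   using t by (simp add: M.finsum_Suc smult_assoc1)
  finally have "finsum M (\<lambda>j. S.cauchy a b j *. y (n - j)) {..Suc k} =
   (a (Suc k) *. (b 0 *. t) +. finsum M (\<lambda>j. (a j \<otimes> b (Suc k - j)) *. t) {..k})
    +. finsum M (\<lambda>j. S.cauchy a b j *. y (n - j)) {..k}"
   using bc by (simp add: M.finsum_Suc t_def[symmetric])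
  then show ?case unfolding R using t bc by (simp add: M.a_assoc M.finsum_closed)
 qed
 from this[of n] show "cauchy (S.cauchy a b) y n = cauchy a (cauchy b y) n" unfolding cauchy_def by simp
qed

text \<open>The module axioms hold already for representing sequences under the Cauchy product.\<close>

lemma gr_rmod: "rmod G W"
proof -
 have GE: "\<And>x. x \<in> carrier G ==> \<exists>a\<in>S.sq. x = S.cls a" unfolding G_simps S.W_carrier by blast
 have WE: "\<And>x. x \<in> carrier W ==> \<exists>y\<in>sq. x = cls y" unfolding W_carrier by blast
 have WI: "y \<in> sq ==> cls y \<in> carrier W" for y unfolding W_carrier by blast
 have "abelian_group W"
 proof (rule abelian_groupI)
  show "\<zero>\<^bsub>W\<^esub> \<in> carrier W" using WI[OF zero_sq] cls_zero by simp
  fix x y z assume "x \<in> carrier W" "y \<in> carrier W" "z \<in> carrier W"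
  then obtain u v w where u: "u \<in> sq" "x = cls u" "v \<in> sq" "y = cls v" "w \<in> sq" "z = cls w" using WE by metis
  show "x \<oplus>\<^bsub>W\<^esub> y \<in> carrier W" using u by (simp add: cls_add WI add_sq)
  show "(x \<oplus>\<^bsub>W\<^esub> y) \<oplus>\<^bsub>W\<^esub> z = x \<oplus>\<^bsub>W\<^esub> (y \<oplus>\<^bsub>W\<^esub> z)" using u by (simp add: cls_add add_sq M.a_assoc sqD)
  show "x \<oplus>\<^bsub>W\<^esub> y = y \<oplus>\<^bsub>W\<^esub> x" using u by (simp add: cls_add M.a_comm sqD)
  show "\<zero>\<^bsub>W\<^esub> \<oplus>\<^bsub>W\<^esub> x = x" using u by (simp add: cls_zero[symmetric] cls_add zero_sq sqD)
  show "\<exists>x'\<in>carrier W. x' \<oplus>\<^bsub>W\<^esub> x = \<zero>\<^bsub>W\<^esub>"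
   using u by (intro bexI[of _ "cls (\<lambda>n. \<ominus>\<^bsub>M\<^esub> u n)"]) (simp_all add: cls_add neg_sq WI sqD M.l_neg cls_zero)
 qed
 moreover have smc: "a \<in> S.sq ==> y \<in> sq ==> S.cls a \<odot>\<^bsub>W\<^esub> cls y \<in> carrier W" for a y
  by (simp add: cls_smult WI cauchy_sq)
 moreover have "S.cls a \<odot>\<^bsub>W\<^esub> (cls y \<oplus>\<^bsub>W\<^esub> cls z) = S.cls a \<odot>\<^bsub>W\<^esub> cls y \<oplus>\<^bsub>W\<^esub> S.cls a \<odot>\<^bsub>W\<^esub> cls z"
  if "a \<in> S.sq" "y \<in> sq" "z \<in> sq" for a y z
 proof -
  have "cauchy a (\<lambda>n. y n +. z n) n = cauchy a y n +. cauchy a z n" for n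
   unfolding cauchy_def using that S.sqD(2)[OF that(1)] sqD(2)[OF that(2)] sqD(2)[OF that(3)]
   by (subst M.finsum_addf[symmetric]) (auto simp: smult_r_distr)
  then have "cauchy a (\<lambda>n. y n +. z n) = (\<lambda>n. cauchy a y n +. cauchy a z n)" by (rule ext)
  then show ?thesis using that by (simp add: cls_add cls_smult cauchy_sq add_sq)
 qed
 moreover have "(S.cls a \<oplus>\<^bsub>S.W\<^esub> S.cls b) \<odot>\<^bsub>W\<^esub> cls y = S.cls a \<odot>\<^bsub>W\<^esub> cls y \<oplus>\<^bsub>W\<^esub> S.cls b \<odot>\<^bsub>W\<^esub> cls y"
  if "a \<in> S.sq" "b \<in> S.sq" "y \<in> sq" for a b y
 proof -
  have "cauchy (\<lambda>n. a n \<oplus>\<^bsub>self_mod R\<^esub> b n) y n = cauchy a y n +. cauchy b y n" for n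
   unfolding cauchy_def using that S.sqD(2)[OF that(1)] S.sqD(2)[OF that(2)] sqD(2)[OF that(3)]
   by (subst M.finsum_addf[symmetric]) (auto simp: smult_l_distr)
  then have "cauchy (\<lambda>n. a n \<oplus>\<^bsub>self_mod R\<^esub> b n) y = (\<lambda>n. cauchy a y n +. cauchy b y n)" by (rule ext)
  then show ?thesis using that by (simp add: S.cls_add cls_add cls_smult cauchy_sq S.add_sq del: self_mod_simps)
 qed
 moreover have "(S.cls a \<odot>\<^bsub>S.W\<^esub> S.cls b) \<odot>\<^bsub>W\<^esub> cls y = S.cls a \<odot>\<^bsub>W\<^esub> (S.cls b \<odot>\<^bsub>W\<^esub> cls y)"
  if "a \<in> S.sq" "b \<in> S.sq" "y \<in> sq" for a b y
  using that by (simp add: S.cls_smult cls_smult S.cauchy_sq cauchy_sq cauchy_assoc)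
 moreover have "\<one>\<^bsub>G\<^esub> \<odot>\<^bsub>W\<^esub> cls y = cls y" if y: "y \<in> sq" for y
 proof -
  let ?e = "\<lambda>n. if n = 0 then \<one> else \<zero>"
  have e: "?e \<in> S.sq" using S.sm_zero[OF S.smV] by (auto simp: S.sq_def)
  have i1: "ideal_smult R (ideal_power R I 1) (self_mod R) = S.V 1" by (rule S.ideal_smult_power[OF I_ideal])
  have "\<one>\<^bsub>G\<^esub> = S.cls ?e"
  proof
   fix n show "\<one>\<^bsub>G\<^esub> n = S.cls ?e n"
    unfolding gr_ring_def Let_def i1 S.W_zero S.cls_def using S.coset_zero[OF S.smV, of "Suc n"] by (simp add: self_rcoset)
  qed
  moreover have "cauchy ?e y n = y n" for n
  proof (cases n)
   case 0 then show ?thesis using sqD(2)[OF y, of 0] by (simp add: cauchy_def)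
  next
   case (Suc k)
   have "cauchy ?e y n = finsum M (\<lambda>i. ?e (Suc i) *. y (n - Suc i)) {..k} +. ?e 0 *. y n"
    unfolding cauchy_def Suc by (subst M.finsum_Suc2) (auto simp: sqD(2)[OF y])
   also have "finsum M (\<lambda>i. ?e (Suc i) *. y (n - Suc i)) {..k} = finsum M (\<lambda>i. \<zero>\<^bsub>M\<^esub>) {..k}"
    by (intro M.finsum_cong') (auto simp: sqD(2)[OF y])
   finally show ?thesis using sqD(2)[OF y, of n] by simp
  qed
  ultimately show ?thesis using cls_smult[OF e y] by (metis ext)
 qed
 ultimately show ?thesis
  by (intro rmod.intro moduleI gr_cring) (auto simp: G_simps S.W_carrier dest!: WE simp del: self_mod_simps)
qed

end

lemma (in rmod) sm_finsum: assumes "sm B" "finite T" "\<And>i. i \<in> T ==> t i \<in> B" shows "finsum M t T \<in> B"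
 using assms(2,3)
proof (induction T rule: finite_induct)
 case (insert i T)
 then have "t i \<in> carrier M" "t \<in> T \<rightarrow> carrier M" using sm_carr[OF assms(1)] by auto
 then show ?case using M.finsum_insert[OF insert.hyps] insert sm_add[OF assms(1)] by simp
qed (simp add: sm_zero[OF assms(1)])

sublocale gr_noeth \<subseteq> W: rmod "gr_ring R I" "gr_mod R I M" by (rule gr_rmod)

context gr_noeth begin

definition single :: "nat => 'b => nat => 'b" where "single n v = (\<lambda>k. if k = n then v else \<zero>\<^bsub>M\<^esub>)"

text \<open>The homogeneous vector of degree \<open>n\<close> with component \<open>v + I\<^sup>n\<^sup>+\<^sup>1M\<close>.\<close>

definition dl :: "nat => 'b => nat => 'b set" where "dl n v = cls (single n v)"

lemma single_sq: "v \<in> V n ==> single n v \<in> sq"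
 unfolding sq_def single_def using sm_zero[OF smV] by (intro CollectI conjI allI exI[of _ "Suc n"]) auto

lemma cls_W [simp, intro]: "y \<in> sq ==> cls y \<in> carrier W" unfolding W_carrier by blast

lemma dl_W: "v \<in> V n ==> dl n v \<in> carrier W" unfolding dl_def by (rule cls_W[OF single_sq])

lemma cls_sub: assumes "y \<in> sq" "z \<in> sq"
 shows "cls y \<ominus>\<^bsub>W\<^esub> cls z = cls (\<lambda>n. y n -. z n)" "(\<lambda>n. y n -. z n) \<in> sq"
proof -
 show s: "(\<lambda>n. y n -. z n) \<in> sq" using add_sq[OF assms(1) neg_sq[OF assms(2)]] by (simp add: M.minus_eq)
 have "cls (\<lambda>n. y n -. z n) \<oplus>\<^bsub>W\<^esub> cls z = cls (\<lambda>n. (y n -. z n) +. z n)" by (rule cls_add[OF s assms(2)])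
 also have "\<dots> = cls y" using sqD(2)[OF assms(1)] sqD(2)[OF assms(2)] by (simp add: sub_add_cancel)
 finally have "cls y = cls (\<lambda>n. y n -. z n) \<oplus>\<^bsub>W\<^esub> cls z" ..
 then show "cls y \<ominus>\<^bsub>W\<^esub> cls z = cls (\<lambda>n. y n -. z n)" using W.add_sub_cancel[OF cls_W[OF s] cls_W[OF assms(2)]] by simp
qed

lemma dl_add: assumes "u \<in> V n" "v \<in> V n" shows "dl n u \<oplus>\<^bsub>W\<^esub> dl n v = dl n (u +. v)"
proof -
 have "(\<lambda>k. single n u k +. single n v k) = single n (u +. v)" by (rule ext) (simp add: single_def)
 then show ?thesis unfolding dl_def cls_add[OF single_sq[OF assms(1)] single_sq[OF assms(2)]] by simp
qed

lemma dl_null: "v \<in> V (Suc n) ==> dl n v = \<zero>\<^bsub>W\<^esub>"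
 unfolding dl_def W_zero cls_def single_def
 by (rule ext) (use coset_eq_iff[OF smV V_carr[of v "Suc n"], of "Suc n"] coset_zero[OF smV] in auto)

end

context gr_noeth begin

lemma cauchy_single: assumes a: "a \<in> S.V i" and y: "y \<in> sq"
 shows "cauchy (S.single i a) y = (\<lambda>n. if i \<le> n then a *. y (n - i) else \<zero>\<^bsub>M\<^esub>)"
proof
 fix n
 have aR: "a \<in> carrier R" using S_V a by blast
 have eq: "finsum M (\<lambda>k. S.single i a k *. y (n - k)) {..n} = finsum M (\<lambda>k. if i = k then a *. y (n - k) else \<zero>\<^bsub>M\<^esub>) {..n}"
  by (rule M.finsum_cong') (use aR sqD(2)[OF y] in \<open>auto simp: S.single_def\<close>)
 have "cauchy (S.single i a) y n = finsum M (\<lambda>k. if i = k then a *. y (n - k) else \<zero>\<^bsub>M\<^esub>) {..n}"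
  unfolding cauchy_def by (rule eq)
 also have "\<dots> = (if i \<le> n then a *. y (n - i) else \<zero>\<^bsub>M\<^esub>)"
 proof (cases "i \<le> n")
  case True
  then show ?thesis using M.add.finprod_singleton[of i "{..n}" "\<lambda>k. a *. y (n - k)"] aR sqD(2)[OF y] by simp
 next
  case False
  then have "finsum M (\<lambda>k. if i = k then a *. y (n - k) else \<zero>\<^bsub>M\<^esub>) {..n} = finsum M (\<lambda>k. \<zero>\<^bsub>M\<^esub>) {..n}"
   by (intro M.finsum_cong') auto
  then show ?thesis using False by simp
 qed
 finally show "cauchy (S.single i a) y n = (if i \<le> n then a *. y (n - i) else \<zero>\<^bsub>M\<^esub>)" .
qed

lemma dl_cls: assumes "a \<in> S.V i" "y \<in> sq"
 shows "S.dl i a \<odot>\<^bsub>W\<^esub> cls y = cls (\<lambda>n. if i \<le> n then a *. y (n - i) else \<zero>\<^bsub>M\<^esub>)"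
  "(\<lambda>n. if i \<le> n then a *. y (n - i) else \<zero>\<^bsub>M\<^esub>) \<in> sq"
 using cls_smult[OF S.single_sq[OF assms(1)] assms(2)] cauchy_sq[OF S.single_sq[OF assms(1)] assms(2)]
 unfolding S.dl_def cauchy_single[OF assms] by auto

lemma dl_smult: assumes "a \<in> S.V i" "v \<in> V j" shows "S.dl i a \<odot>\<^bsub>W\<^esub> dl j v = dl (i + j) (a *. v)"
proof -
 have aR: "a \<in> carrier R" using S_V assms(1) by blast
 have "(\<lambda>n. if i \<le> n then a *. single j v (n - i) else \<zero>\<^bsub>M\<^esub>) = single (i + j) (a *. v)"
  by (rule ext) (use aR in \<open>auto simp: single_def\<close>)
 then show ?thesis using dl_cls(1)[OF assms(1) single_sq[OF assms(2)]] unfolding dl_def by simp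
qed

lemma G_W [simp]: "carrier S.W = carrier G" by (simp add: G_simps)

lemma dl_scalar: "a \<in> carrier R ==> v \<in> V j ==> S.dl 0 a \<odot>\<^bsub>W\<^esub> dl j v = dl j (a *. v)" "a \<in> carrier R ==> S.dl 0 a \<in> carrier G"
 using dl_smult[of a 0 v j] S.dl_W[of a 0] by simp_all

lemma I_V1: "I \<subseteq> S.V 1"
proof
 fix a assume a: "a \<in> I"
 have "a \<odot>\<^bsub>self_mod R\<^esub> \<one> \<in> S.ip I (carrier (self_mod R))" by (rule S.ipI[OF a]) simp
 then show "a \<in> S.V 1" using I_sub a by (auto simp: S.ipow_Suc)
qed

lemma sm_dl: assumes "W.sm H" shows "sm {v \<in> V n. dl n v \<in> H}"
proof (rule smI)
 show "\<zero>\<^bsub>M\<^esub> \<in> {v \<in> V n. dl n v \<in> H}" using sm_zero[OF smV] dl_null[of "\<zero>\<^bsub>M\<^esub>" n] W.sm_zero[OF assms] by simp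
 show "x +. y \<in> {v \<in> V n. dl n v \<in> H}" if "x \<in> {v \<in> V n. dl n v \<in> H}" "y \<in> {v \<in> V n. dl n v \<in> H}" for x y
  using that sm_add[OF smV] W.sm_add[OF assms] dl_add by force
 show "a *. x \<in> {v \<in> V n. dl n v \<in> H}" if "a \<in> carrier R" "x \<in> {v \<in> V n. dl n v \<in> H}" for a x
  using that sm_smult[OF smV] W.sm_smult[OF assms dl_scalar(2)] dl_scalar(1) by force
qed (use V_carr in blast)

text \<open>For \<open>I\<^sup>n\<^sup>+\<^sup>1 M \<subseteq> B \<subseteq> I\<^sup>n M\<close> these are the vectors of order at least \<open>n\<close> whose part of degree \<open>n\<close> comes from \<open>B\<close>.\<close>

definition lead :: "nat => 'b set => (nat => 'b set) set"
 where "lead n B = {cls y |y. y \<in> sq \<and> (\<forall>i<n. y i \<in> V (Suc i)) \<and> y n \<in> B}"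

definition ge :: "nat => (nat => 'b set) set" where "ge n = lead n (V n)"

lemma cls_lead_iff: assumes "sm B" "V (Suc n) \<subseteq> B" "y \<in> sq"
 shows "cls y \<in> lead n B \<longleftrightarrow> (\<forall>i<n. y i \<in> V (Suc i)) \<and> y n \<in> B"
proof
 assume "cls y \<in> lead n B"
 then obtain z where z: "z \<in> sq" "\<forall>i<n. z i \<in> V (Suc i)" "z n \<in> B" "cls y = cls z" unfolding lead_def by blast
 have d: "y i -. z i \<in> V (Suc i)" for i using cls_cong_iff[OF assms(3) z(1)] z(4) by metis
 have "y i \<in> V (Suc i)" if "i < n" for i
  using sm_sub_mem[OF smV _ sqD(2)[OF assms(3)] d] z(2) that by blast
 moreover have "y n \<in> B" using sm_sub_mem[OF assms(1) z(3) sqD(2)[OF assms(3)]] d assms(2) by blast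
 ultimately show "(\<forall>i<n. y i \<in> V (Suc i)) \<and> y n \<in> B" by blast
qed (use assms(3) lead_def in blast)

lemma sm_lead: assumes "sm B" "V (Suc n) \<subseteq> B" shows "W.sm (lead n B)"
proof (rule W.smI)
 show "lead n B \<subseteq> carrier W" unfolding lead_def by auto
 have "cls (\<lambda>_. \<zero>\<^bsub>M\<^esub>) \<in> lead n B" unfolding cls_lead_iff[OF assms zero_sq] using sm_zero[OF smV] sm_zero[OF assms(1)] by blast
 then show "\<zero>\<^bsub>W\<^esub> \<in> lead n B" by (simp add: cls_zero)
 fix x assume "x \<in> lead n B"
 then obtain y where y: "y \<in> sq" "\<forall>i<n. y i \<in> V (Suc i)" "y n \<in> B" "x = cls y" unfolding lead_def by blast
 show "x \<oplus>\<^bsub>W\<^esub> x' \<in> lead n B" if "x' \<in> lead n B" for x'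
 proof -
  note asm = that
  obtain z where z: "z \<in> sq" "\<forall>i<n. z i \<in> V (Suc i)" "z n \<in> B" "x' = cls z" using asm unfolding lead_def by blast
  show ?thesis unfolding y(4) z(4) cls_add[OF y(1) z(1)] cls_lead_iff[OF assms add_sq[OF y(1) z(1)]]
   using y z sm_add[OF smV] sm_add[OF assms(1)] by blast
 qed
 show "a \<odot>\<^bsub>W\<^esub> x \<in> lead n B" if "a \<in> carrier G" for a
 proof -
  have aW: "a \<in> carrier S.W" using that by simp
  obtain b where b: "b \<in> S.sq" "a = S.cls b" using S.W_E[OF aW] by blast
  have t: "b i *. y (k - i) \<in> V (Suc k)" if "k \<le> n" "i \<le> k" "k - i < n" for k i
   using V_smult[OF S.sqD(1)[OF b(1)], of "y (k - i)" "Suc (k - i)" i] y(2) that by auto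
  have "cauchy b y k \<in> V (Suc k)" if "k < n" for k
   unfolding cauchy_def by (rule sm_finsum[OF smV]) (use t that in auto)
  moreover have "cauchy b y n \<in> B" unfolding cauchy_def
  proof (rule sm_finsum[OF assms(1)])
   fix i assume i: "i \<in> {..n}"
   show "b i *. y (n - i) \<in> B"
   proof (cases "i = 0")
    case True then show ?thesis using sm_smult[OF assms(1) _ y(3)] S.sqD(2)[OF b(1)] by simp
   next
    case False then show ?thesis using t[of n i] i assms(2) by auto
   qed
  qed simp
  ultimately show ?thesis unfolding y(4) b(2) cls_smult[OF b(1) y(1)] cls_lead_iff[OF assms cauchy_sq[OF b(1) y(1)]] by blast
 qed
qed

lemma cls_ge_iff: "y \<in> sq ==> cls y \<in> ge n \<longleftrightarrow> (\<forall>i<n. y i \<in> V (Suc i))"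
 unfolding ge_def using cls_lead_iff[OF smV V_Suc] sqD(1) by blast

lemma ge_0: "ge 0 = carrier W" unfolding ge_def lead_def W_carrier using sqD(1)[of _ 0] by auto

lemma ge_Suc: "ge (Suc n) = lead n (V (Suc n))"
proof -
 have "y \<in> sq ==> y (Suc n) \<in> V (Suc n)" for y using sqD(1)[of y "Suc n"] .
 then show ?thesis unfolding ge_def lead_def by (auto simp: less_Suc_eq)
qed

lemma sm_ge: "W.sm (ge n)" unfolding ge_def by (rule sm_lead[OF smV V_Suc])

lemma ge_W: "ge n \<subseteq> carrier W" by (rule W.sm_subset[OF sm_ge])

lemma dl_ge: "v \<in> V k ==> n \<le> k ==> dl k v \<in> ge n"
 unfolding dl_def cls_ge_iff[OF single_sq] by (auto simp: single_def sm_zero[OF smV])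

text \<open>Every vector is the sum of its homogeneous components, by induction on the length of its support.\<close>

lemma ge_generated:
 assumes H: "W.sm H" and d: "\<And>k v. n \<le> k ==> v \<in> V k ==> dl k v \<in> H" shows "ge n \<subseteq> H"
proof
 fix x assume x: "x \<in> ge n"
 then obtain y where y: "y \<in> sq" "x = cls y" using ge_W W_E by blast
 have "y \<in> sq ==> cls y \<in> ge n ==> \<forall>k\<ge>j. y k = \<zero>\<^bsub>M\<^esub> ==> cls y \<in> H" for j y
 proof (induction j arbitrary: y)
  case 0
  then have "y = (\<lambda>_. \<zero>\<^bsub>M\<^esub>)" by auto
  then show ?case using W.sm_zero[OF H] cls_zero by simp
 next
  case (Suc j)
  let ?z = "y(j := \<zero>\<^bsub>M\<^esub>)"
  have z: "?z \<in> sq" using Suc.prems(1) sm_zero[OF smV] unfolding sq_def by (auto simp: fun_upd_def)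
  have zn: "\<forall>i<n. ?z i \<in> V (Suc i)" using Suc.prems(2) sm_zero[OF smV] unfolding cls_ge_iff[OF Suc.prems(1)] by auto
  have zH: "cls ?z \<in> H"
  proof (rule Suc.IH[OF z])
   show "cls ?z \<in> ge n" unfolding cls_ge_iff[OF z] by (rule zn)
   show "\<forall>k\<ge>j. ?z k = \<zero>\<^bsub>M\<^esub>"
   proof (intro allI impI)
    fix k assume "j \<le> k"
    then show "?z k = \<zero>\<^bsub>M\<^esub>" using Suc.prems(3) by (cases "k = j") auto
   qed
  qed
  have s: "single j (y j) \<in> sq" by (rule single_sq[OF sqD(1)[OF Suc.prems(1)]])
  have "(\<lambda>k. ?z k +. single j (y j) k) = y" using sqD(2)[OF Suc.prems(1)] by (auto simp: single_def)
  then have e: "cls ?z \<oplus>\<^bsub>W\<^esub> dl j (y j) = cls y" unfolding dl_def using cls_add[OF z s] by simp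
  have "dl j (y j) \<in> H"
  proof (cases "n \<le> j")
   case True then show ?thesis by (rule d[OF _ sqD(1)[OF Suc.prems(1)]])
  next
   case False
   then have "y j \<in> V (Suc j)" using Suc.prems(2) unfolding cls_ge_iff[OF Suc.prems(1)] by auto
   then show ?thesis using dl_null W.sm_zero[OF H] by simp
  qed
  then show ?case using W.sm_add[OF H zH] e by metis
 qed
 then show "x \<in> H" using y x unfolding sq_def by blast
qed

lemma lead_split: assumes x: "x \<in> ge n"
 obtains v where "v \<in> V n" "x \<ominus>\<^bsub>W\<^esub> dl n v \<in> ge (Suc n)" "\<And>B. sm B ==> V (Suc n) \<subseteq> B ==> x \<in> lead n B ==> v \<in> B"
proof -
 obtain y where y: "y \<in> sq" "x = cls y" using ge_W x W_E by blast
 have v: "y n \<in> V n" by (rule sqD(1)[OF y(1)])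
 have sz: "w -. \<zero>\<^bsub>M\<^esub> = w" if "w \<in> carrier M" for w using add_sub_cancel[of w "\<zero>\<^bsub>M\<^esub>"] that by simp
 have "x \<ominus>\<^bsub>W\<^esub> dl n (y n) \<in> ge (Suc n)"
  unfolding y(2) dl_def cls_sub(1)[OF y(1) single_sq[OF v]] cls_ge_iff[OF cls_sub(2)[OF y(1) single_sq[OF v]]]
  using x[unfolded y(2) cls_ge_iff[OF y(1)]] sqD(2)[OF y(1)] sm_zero[OF smV]
  by (auto simp: single_def less_Suc_eq sub_self sz)
 then show ?thesis using that[OF v] cls_lead_iff y by blast
qed

text \<open>Submodules between \<open>ge (n + 1)\<close> and \<open>lead n B\<close> correspond to submodules between \<open>I\<^sup>n\<^sup>+\<^sup>1M\<close> and \<open>B\<close>, since \<open>G\<close> acts on a quotient concentrated in one degree through its part of degree \<open>0\<close>.\<close>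

theorem len_lead:
 assumes B: "sm B" "V (Suc n) \<subseteq> B" "B \<subseteq> V n"
 shows "W.len (ge (Suc n)) (lead n B) = len (V (Suc n)) B"
proof (rule antisym)
 have leadB: "lead n B \<subseteq> ge n" unfolding lead_def ge_def using B(3) by blast
 show "W.len (ge (Suc n)) (lead n B) \<le> len (V (Suc n)) B" unfolding W.len_def len_def
 proof (rule ilen_map_le[where \<phi> = "\<lambda>H. {v \<in> V n. dl n v \<in> H} \<inter> B"])
  fix H assume H: "H \<in> {H. W.sm H}" "ge (Suc n) \<subseteq> H" "H \<subseteq> lead n B"
  then show "{v \<in> V n. dl n v \<in> H} \<inter> B \<in> {H. sm H} \<and> V (Suc n) \<subseteq> {v \<in> V n. dl n v \<in> H} \<inter> B \<and> {v \<in> V n. dl n v \<in> H} \<inter> B \<subseteq> B"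
   using sm_Int[OF sm_dl B(1)] V_Suc B(2) dl_null W.sm_zero by force
 next
  fix H K assume HK: "H \<in> {H. W.sm H}" "K \<in> {H. W.sm H}" "ge (Suc n) \<subseteq> H" "H \<subset> K" "K \<subseteq> lead n B"
  then obtain x where x: "x \<in> K" "x \<notin> H" by blast
  have xn: "x \<in> ge n" "x \<in> lead n B" using x HK leadB by blast+
  obtain v where v: "v \<in> V n" "x \<ominus>\<^bsub>W\<^esub> dl n v \<in> ge (Suc n)" "v \<in> B" using lead_split[OF xn(1)] B xn(2) by metis
  have c: "x \<in> carrier W" "dl n v \<in> carrier W" using xn ge_W dl_W v by auto
  have "dl n v \<in> K" "dl n v \<notin> H"
   using W.sm_congr[of K x "dl n v"] W.sm_congr[of H x "dl n v"] HK c v(2) x by auto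
  then show "{v \<in> V n. dl n v \<in> H} \<inter> B \<subset> {v \<in> V n. dl n v \<in> K} \<inter> B" using v(1,3) HK(4) by blast
 qed
 show "len (V (Suc n)) B \<le> W.len (ge (Suc n)) (lead n B)" unfolding W.len_def len_def
 proof (rule ilen_map_le[where \<phi> = "lead n"])
  fix H assume H: "H \<in> {H. sm H}" "V (Suc n) \<subseteq> H" "H \<subseteq> B"
  then show "lead n H \<in> {H. W.sm H} \<and> ge (Suc n) \<subseteq> lead n H \<and> lead n H \<subseteq> lead n B"
   using sm_lead unfolding ge_Suc lead_def by blast
 next
  fix H K assume HK: "H \<in> {H. sm H}" "K \<in> {H. sm H}" "V (Suc n) \<subseteq> H" "H \<subset> K" "K \<subseteq> B"
  then obtain v where v: "v \<in> K" "v \<notin> H" by blast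
  have vn: "v \<in> V n" using v HK B(3) by blast
  have iff: "dl n v \<in> lead n L \<longleftrightarrow> v \<in> L" if "sm L" "V (Suc n) \<subseteq> L" for L
   unfolding dl_def cls_lead_iff[OF that single_sq[OF vn]] using sm_zero[OF smV] by (auto simp: single_def)
  have "dl n v \<in> lead n K" "dl n v \<notin> lead n H" using iff HK v by auto
  then show "lead n H \<subset> lead n K" using HK(4) unfolding lead_def by blast
 qed
qed

lemma len_ge: "W.len (ge n) (carrier W) = len (V n) (carrier M)"
proof (induction n)
 case 0 then show ?case by (simp add: ge_0 W.len_refl len_refl)
next
 case (Suc n)
 have sub: "ge (Suc n) \<subseteq> ge n" unfolding ge_Suc unfolding ge_def lead_def using V_Suc by blast
 have "W.len (ge (Suc n)) (carrier W) = W.len (ge (Suc n)) (ge n) + W.len (ge n) (carrier W)"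
  by (rule W.len_add[OF sm_ge sm_ge W.sm_carrier sub ge_W])
 also have "W.len (ge (Suc n)) (ge n) = len (V (Suc n)) (V n)"
  using len_lead[OF smV V_Suc, of n] unfolding ge_def[of n] by simp
 also have "len (V (Suc n)) (V n) + W.len (ge n) (carrier W) = len (V (Suc n)) (carrier M)"
  unfolding Suc using len_add[OF smV smV sm_carrier V_Suc sm_subset[OF smV], of n] by simp
 finally show ?case .
qed

end

context gr_noeth begin

abbreviation Gp :: "(nat => 'a set) set" where "Gp \<equiv> gr_irrelevant R I"

lemma Gp_ge: "Gp = S.ge 1"
proof (intro equalityI subsetI)
 fix x assume "x \<in> Gp"
 then have x: "x \<in> carrier S.W" "x 0 = S.V (Suc 0)" by (auto simp: gr_irrelevant_def G_simps(3) S.W_zero)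
 obtain a where a: "a \<in> S.sq" "x = S.cls a" using S.W_E[OF x(1)] by blast
 then have "a 0 \<in> S.V (Suc 0)" using S.cls_zero_iff[of a 0] x(2) by simp
 then show "x \<in> S.ge 1" unfolding a(2) S.cls_ge_iff[OF a(1)] by simp
next
 fix x assume x: "x \<in> S.ge 1"
 then have xW: "x \<in> carrier S.W" using S.ge_W by blast
 obtain a where a: "a \<in> S.sq" "x = S.cls a" using S.W_E[OF xW] by blast
 then have "a 0 \<in> S.V (Suc 0)" using x[unfolded a(2) S.cls_ge_iff[OF a(1)]] by blast
 then have "x 0 = S.V (Suc 0)" using S.cls_zero_iff[OF a(1), of 0] a(2) by simp
 then show "x \<in> Gp" using xW by (simp add: gr_irrelevant_def G_simps(3) S.W_zero)
qed

text \<open>The ideals of \<open>G\<close> are the graded module of \<open>R\<close> over itself in another record; facts on \<^const>\<open>gr_mod\<close> apply to the ring \<open>G\<close> in this way.\<close>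

lemma self_gr_sm: "submodule H G (self_mod G) \<longleftrightarrow> S.W.sm H"
proof -
 interpret P: rmod G "self_mod G" by (rule self_rmod[OF gr_cring])
 show ?thesis
 proof
  assume H: "P.sm H"
  show "S.W.sm H"
   using P.sm_subset[OF H] P.sm_zero[OF H] P.sm_add[OF H] P.sm_smult[OF H] by (intro S.W.smI) (auto simp: G_simps(2-4))
 next
  assume H: "S.W.sm H"
  show "P.sm H"
   using S.W.sm_subset[OF H] S.W.sm_zero[OF H] S.W.sm_add[OF H] S.W.sm_smult[OF H] by (intro P.smI) (auto simp: G_simps(2-4))
 qed
qed

lemma self_gr_len: "rmod.len G (self_mod G) = S.W.len"
 using rmod.len_def[OF self_rmod[OF gr_cring]] S.W.len_def by (intro ext) (simp add: self_gr_sm)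

lemma self_gr_acc: "rmod.acc G (self_mod G) = S.W.acc"
 using rmod.acc_def[OF self_rmod[OF gr_cring]] S.W.acc_def by (intro ext) (simp add: self_gr_sm)

lemma Gp_ideal: "ideal Gp G"
 unfolding Gp_ge self_sm_iff[OF gr_cring, symmetric] self_gr_sm by (rule S.sm_ge)

lemma Gp_G: "Gp \<subseteq> carrier G" by (rule ideal_subset[OF Gp_ideal])

lemma self_gr_ipow: "rmod.ipow G (self_mod G) Gp n (carrier G) = S.W.ipow Gp n (carrier S.W)"
proof -
 interpret h: rhom G S.W "self_mod G" "\<lambda>x. x"
  by (intro rhom.intro rhom_axioms.intro S.gr_rmod self_rmod[OF gr_cring]) (auto simp: mod_hom_def G_simps(2-4))
 show ?thesis using h.image_ipow[OF Gp_G S.W.sm_carrier, of n] by simp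
qed

lemma dl_Gp: "a \<in> S.V 1 ==> S.dl 1 a \<in> Gp" unfolding Gp_ge by (rule S.dl_ge) simp_all

text \<open>The inclusion from left to right counts degrees. Conversely \<open>I\<^sup>n\<^sup>+\<^sup>jM\<close> is generated by products \<open>a u\<close> with \<open>a \<in> I\<close>, \<open>u \<in> I\<^sup>n\<^sup>+\<^sup>j\<^sup>-\<^sup>1M\<close>, so homogeneous vectors of degree \<open>n + j\<close> are sums of products with \<open>n\<close> factors of degree one.\<close>

theorem ipow_ge: "W.ipow Gp n (carrier W) = ge n"
proof
 show "W.ipow Gp n (carrier W) \<subseteq> ge n"
 proof (induction n)
  case 0 then show ?case by (simp add: ge_0)
 next
  case (Suc n)
  have "W.ip Gp (ge n) \<subseteq> ge (Suc n)"
  proof (rule W.ip_least[OF sm_ge])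
   fix a x assume a: "a \<in> Gp" and x: "x \<in> ge n"
   have aW: "a \<in> carrier S.W" and xW: "x \<in> carrier W" using a x ge_W S.ge_W unfolding Gp_ge by blast+
   obtain b where b: "b \<in> S.sq" "a = S.cls b" using S.W_E[OF aW] by blast
   obtain y where y: "y \<in> sq" "x = cls y" using W_E[OF xW] by blast
   have b0: "b 0 \<in> S.V (Suc 0)" using a unfolding Gp_ge b(2) S.cls_ge_iff[OF b(1)] by blast
   have yn: "\<forall>i<n. y i \<in> V (Suc i)" using x unfolding y(2) cls_ge_iff[OF y(1)] .
   have "cauchy b y k \<in> V (Suc k)" if k: "k < Suc n" for k unfolding cauchy_def
   proof (rule sm_finsum[OF smV])
    fix i assume i: "i \<in> {..k}"
    show "b i *. y (k - i) \<in> V (Suc k)"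
    proof (cases "i = 0")
     case True then show ?thesis using V_smult[OF b0 sqD(1)[OF y(1)], of k] by simp
    next
     case False
     then have "y (k - i) \<in> V (Suc (k - i))" using yn k i by simp
     then show ?thesis using V_smult[OF S.sqD(1)[OF b(1)], of "y (k - i)" "Suc (k - i)" i] i by simp
    qed
   qed simp
   then show "a \<odot>\<^bsub>W\<^esub> x \<in> ge (Suc n)"
    unfolding b(2) y(2) cls_smult[OF b(1) y(1)] cls_ge_iff[OF cauchy_sq[OF b(1) y(1)]] by blast
  qed
  then show ?case using W.ip_mono[OF Gp_G ge_W order_refl Suc] unfolding W.ipow_Suc by blast
 qed
 show "ge n \<subseteq> W.ipow Gp n (carrier W)"
 proof (rule ge_generated[OF W.sm_ipow[OF Gp_G W.sm_carrier]])
  have "v \<in> V (n + j) ==> dl (n + j) v \<in> W.ipow Gp n (carrier W)" for j v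
  proof (induction n arbitrary: v)
   case 0 then show ?case using dl_W by simp
  next
   case (Suc n)
   have sm: "W.sm (W.ipow Gp (Suc n) (carrier W))" by (rule W.sm_ipow[OF Gp_G W.sm_carrier])
   have "V (Suc n + j) \<subseteq> {v \<in> V (Suc n + j). dl (Suc n + j) v \<in> W.ipow Gp (Suc n) (carrier W)}"
    unfolding add_Suc ipow_Suc[of I "n + j"]
   proof (rule ip_least, unfold ipow_Suc[symmetric])
    show "sm {v \<in> V (Suc (n + j)). dl (Suc (n + j)) v \<in> W.ipow Gp (Suc n) (carrier W)}" by (rule sm_dl[OF sm])
    fix a u assume a: "a \<in> I" and u: "u \<in> V (n + j)"
    have a1: "a \<in> S.V 1" using I_V1 a by blast
    have "S.dl 1 a \<odot>\<^bsub>W\<^esub> dl (n + j) u \<in> W.ipow Gp (Suc n) (carrier W)"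
     unfolding W.ipow_Suc by (rule W.ipI[OF dl_Gp[OF a1] Suc.IH[OF u]])
    then show "a *. u \<in> {v \<in> V (Suc (n + j)). dl (Suc (n + j)) v \<in> W.ipow Gp (Suc n) (carrier W)}"
     using dl_smult[OF a1 u] V_smult[OF a1 u] by simp
   qed
   then show ?case using Suc.prems by blast
  qed
  then show "dl k v \<in> W.ipow Gp n (carrier W)" if "n \<le> k" "v \<in> V k" for k v using that by (metis le_Suc_ex)
 qed
qed

text \<open>Coefficients in degree \<open>n\<close> of the vectors of degree at most \<open>n\<close> in \<open>L\<close>.\<close>

definition top :: "nat => (nat => 'b set) set => 'b set"
 where "top n L = {y n |y. y \<in> sq \<and> cls y \<in> L \<and> (\<forall>k>n. y k = \<zero>\<^bsub>M\<^esub>)}"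

lemma sm_top: assumes L: "W.sm L" shows "sm (top n L)"
proof (rule smI)
 show "top n L \<subseteq> carrier M" unfolding top_def using sqD(2) by blast
 show "\<zero>\<^bsub>M\<^esub> \<in> top n L"
  unfolding top_def using zero_sq cls_zero W.sm_zero[OF L] by (auto intro!: exI[of _ "\<lambda>_. \<zero>\<^bsub>M\<^esub>"])
 fix u assume "u \<in> top n L"
 then obtain y where y: "y \<in> sq" "cls y \<in> L" "\<forall>k>n. y k = \<zero>\<^bsub>M\<^esub>" "u = y n" unfolding top_def by blast
 show "u +. v \<in> top n L" if "v \<in> top n L" for v
 proof -
  obtain z where z: "z \<in> sq" "cls z \<in> L" "\<forall>k>n. z k = \<zero>\<^bsub>M\<^esub>" "v = z n" using \<open>v \<in> top n L\<close> unfolding top_def by blast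
  show ?thesis unfolding top_def
   using y z add_sq[OF y(1) z(1)] W.sm_add[OF L y(2) z(2)] cls_add[OF y(1) z(1)]
   by (intro CollectI exI[of _ "\<lambda>k. y k +. z k"]) simp
 qed
 show "a *. u \<in> top n L" if "a \<in> carrier R" for a
 proof -
  have a: "a \<in> S.V 0" using that by simp
  have "S.dl 0 a \<odot>\<^bsub>W\<^esub> cls y \<in> L" by (rule W.sm_smult[OF L dl_scalar(2)[OF \<open>a \<in> carrier R\<close>] y(2)])
  then show ?thesis unfolding top_def
   using dl_cls[OF a y(1)] y(3,4) that by (intro CollectI exI[of _ "\<lambda>k. a *. y k"]) simp
 qed
qed

lemma top_V: "top n L \<subseteq> V n" unfolding top_def using sqD(1) by blast

lemma top_mono: "L \<subseteq> L' ==> top n L \<subseteq> top n L'" unfolding top_def by blast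

lemma top_ip: assumes L: "W.sm L" shows "ip I (top n L) \<subseteq> top (Suc n) L"
proof (rule ip_least[OF sm_top[OF L]])
 fix a u assume a: "a \<in> I" and "u \<in> top n L"
 then obtain y where y: "y \<in> sq" "cls y \<in> L" "\<forall>k>n. y k = \<zero>\<^bsub>M\<^esub>" "u = y n" unfolding top_def by blast
 have a1: "a \<in> S.V 1" using I_V1 a by blast
 have G1: "S.dl 1 a \<in> carrier G" using dl_Gp[OF a1] Gp_G by blast
 have aR: "a \<in> carrier R" using a I_sub by blast
 show "a *. u \<in> top (Suc n) L" unfolding top_def
  using dl_cls[OF a1 y(1)] y(3,4) aR W.sm_smult[OF L G1 y(2)]
  by (intro CollectI exI[of _ "\<lambda>k. if 1 \<le> k then a *. y (k - 1) else \<zero>\<^bsub>M\<^esub>"]) auto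
qed

text \<open>Subtracting a vector of \<open>L\<close> with the same top coefficient lowers the degree.\<close>

lemma top_subset_imp:
 assumes L: "W.sm L" "W.sm L'" "L \<subseteq> L'" and t: "\<And>n. top n L' \<subseteq> top n L" shows "L' \<subseteq> L"
proof
 fix x assume x: "x \<in> L'"
 then have xW: "x \<in> carrier W" using W.sm_carr[OF L(2)] by blast
 obtain y where y: "y \<in> sq" "x = cls y" using W_E[OF xW] by blast
 have "y \<in> sq ==> cls y \<in> L' ==> \<forall>k\<ge>j. y k = \<zero>\<^bsub>M\<^esub> ==> cls y \<in> L" for j y
 proof (induction j arbitrary: y)
  case 0
  then have "y = (\<lambda>_. \<zero>\<^bsub>M\<^esub>)" by auto
  then show ?case using W.sm_zero[OF L(1)] cls_zero by simp
 next
  case (Suc j)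
  have "y j \<in> top j L'" unfolding top_def using Suc.prems by (auto simp: Suc_le_eq)
  then obtain z where z: "z \<in> sq" "cls z \<in> L" "\<forall>k>j. z k = \<zero>\<^bsub>M\<^esub>" "y j = z j" using t[of j] unfolding top_def by blast
  have s: "(\<lambda>k. y k -. z k) \<in> sq" "cls y \<ominus>\<^bsub>W\<^esub> cls z = cls (\<lambda>k. y k -. z k)" using cls_sub[OF Suc.prems(1) z(1)] by auto
  have "cls (\<lambda>k. y k -. z k) \<in> L"
  proof (rule Suc.IH[OF s(1)])
   show "cls (\<lambda>k. y k -. z k) \<in> L'" using W.sm_sub[OF L(2) Suc.prems(2), of "cls z"] z(2) L(3) s(2) by auto
   show "\<forall>k\<ge>j. y k -. z k = \<zero>\<^bsub>M\<^esub>"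
   proof (intro allI impI)
    fix k assume k: "j \<le> k"
    then have "y k = z k" using Suc.prems(3) z(3,4) by (cases "k = j") auto
    then show "y k -. z k = \<zero>\<^bsub>M\<^esub>" using sub_self[OF sqD(2)[OF z(1)]] by simp
   qed
  qed
  then show ?case using W.sm_sub_mem[OF L(1) z(2) cls_W[OF Suc.prems(1)]] s(2) by simp
 qed
 then show "x \<in> L" using x y unfolding sq_def by blast
qed

text \<open>The top coefficients of the union of an ascending chain form an \<open>I\<close>-filtration, which by \<open>rees_ideal\<close> is determined
by its members up to some degree \<open>n\<^sub>0\<close>. In these finitely many degrees the chain is stable from some index on, hence so is
it in all degrees, and submodules in a chain with the same top coefficients are equal.\<close>

theorem acc_W: "W.acc {\<zero>\<^bsub>W\<^esub>} (carrier W)"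
 unfolding W.acc_def
proof (intro allI impI)
 fix L :: "nat => _"
 assume "\<forall>i. W.sm (L i) \<and> {\<zero>\<^bsub>W\<^esub>} \<subseteq> L i \<and> L i \<subseteq> carrier W \<and> L i \<subseteq> L (Suc i)"
 then have L: "\<And>i. W.sm (L i)" "\<And>i. L i \<subseteq> L (Suc i)" by auto
 define U where "U = (\<Union>i. L i)"
 have U: "W.sm U" unfolding U_def by (rule W.sm_UN_chain) (use L in auto)
 have topU: "top n U = (\<Union>j. top n (L j))" for n unfolding top_def U_def by blast
 obtain n0 where n0: "\<And>n. n \<ge> n0 ==> top (Suc n) U = ip I (top n U)"
  using rees_ideal[OF sm_carrier sm_top[OF U] top_V top_ip[OF U]] by blast
 obtain j0 where j0: "\<And>n j. n \<le> n0 ==> top n (L j) \<subseteq> top n (L j0)"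
  using stable_range[OF acc_M, of "\<lambda>n j. top n (L j)" n0] sm_top[OF L(1)] top_mono[OF L(2)] by blast
 have all: "top n U \<subseteq> top n (L j0)" for n
 proof (induction n)
  case 0 then show ?case unfolding topU using j0[of 0] by blast
 next
  case (Suc n)
  show ?case
  proof (cases "Suc n \<le> n0")
   case True then show ?thesis unfolding topU using j0 by blast
  next
   case False
   have "top (Suc n) U = ip I (top n U)" using n0 False by simp
   also have "\<dots> \<subseteq> ip I (top n (L j0))" by (rule ip_mono[OF I_sub sm_subset[OF sm_top[OF L(1)]] order_refl Suc])
   also have "\<dots> \<subseteq> top (Suc n) (L j0)" by (rule top_ip[OF L(1)])
   finally show ?thesis .
  qed
 qed
 have "L j0 \<subseteq> U" unfolding U_def by blast
 then have "U \<subseteq> L j0" by (rule top_subset_imp[OF L(1) U]) (rule all)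
 moreover have "L j0 \<subseteq> L m" if "j0 \<le> m" for m using lift_Suc_mono_le[of L j0 m] L(2) that by blast
 ultimately have "\<forall>m\<ge>j0. L m = L j0" unfolding U_def by blast
 then show "\<exists>n. \<forall>m\<ge>n. L m = L n" by blast
qed

end

context gr_noeth begin

theorem gr_noeth_mod: "noeth_mod G W Gp"
proof (intro noeth_mod.intro noeth_mod_axioms.intro gr_rmod acc_W Gp_ideal)
 show "rmod.acc G (self_mod G) {\<zero>\<^bsub>G\<^esub>} (carrier G)" using S.acc_W unfolding self_gr_acc by (simp add: G_simps(3))
qed

theorem gr_fin_self: assumes "fin_mod R (self_mod R) I" shows "fin_mod G (self_mod G) Gp"
proof (intro fin_mod.intro fin_mod_axioms.intro noeth_mod.intro noeth_mod_axioms.intro self_rmod gr_cring Gp_ideal)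
 show "rmod.acc G (self_mod G) {\<zero>\<^bsub>G\<^esub>} (carrier G)" using S.acc_W unfolding self_gr_acc by (simp add: G_simps(3))
 then show "rmod.acc G (self_mod G) {\<zero>\<^bsub>self_mod G\<^esub>} (carrier (self_mod G))" by simp
 show "rmod.len G (self_mod G) (rmod.ipow G (self_mod G) Gp n (carrier (self_mod G))) (carrier (self_mod G)) \<noteq> \<infinity>" for n
  using fin_mod.fin_M[OF assms] S.len_ge[of n] S.ipow_ge[of n] unfolding self_gr_len by (simp add: self_gr_ipow)
qed

text \<open>Generators of \<open>M\<close> in degree \<open>0\<close> generate the graded module, because \<open>I\<^sup>k\<^sup>+\<^sup>1M = I \<cdot> I\<^sup>kM\<close>.\<close>

theorem gr_fg: assumes "fg_module R M" shows "fg_module G W"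
proof -
 obtain T where T: "T \<subseteq> carrier M" "finite T" "carrier M = gen_submod R M T" using assms unfolding fg_module_def by blast
 define H where "H = gen_submod G W (dl 0 ` T)"
 have sub: "dl 0 ` T \<subseteq> carrier W" using T(1) dl_W[of _ 0] by auto
 have H: "W.sm H" unfolding H_def by (rule W.sm_gen[OF sub])
 have "gen_submod R M T \<subseteq> {v \<in> V 0. dl 0 v \<in> H}"
  by (rule gen_least[OF sm_dl[OF H]]) (use T(1) W.gen_incl[of "dl 0 ` T"] H_def in auto)
 then have d0: "carrier M \<subseteq> {v \<in> V 0. dl 0 v \<in> H}" unfolding T(3)[symmetric] .
 have "V k \<subseteq> {v \<in> V k. dl k v \<in> H}" for k
 proof (induction k)
  case 0 then show ?case using d0 by simp
 next
  case (Suc k)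
  show ?case unfolding ipow_Suc[of I k]
  proof (rule ip_least, unfold ipow_Suc[symmetric])
   show "sm {v \<in> V (Suc k). dl (Suc k) v \<in> H}" by (rule sm_dl[OF H])
   fix a u assume a: "a \<in> I" and u: "u \<in> V k"
   have a1: "a \<in> S.V 1" using I_V1 a by blast
   have G1: "S.dl 1 a \<in> carrier G" using dl_Gp[OF a1] Gp_G by blast
   have "S.dl 1 a \<odot>\<^bsub>W\<^esub> dl k u \<in> H" by (rule W.sm_smult[OF H G1]) (use Suc u in blast)
   then show "a *. u \<in> {v \<in> V (Suc k). dl (Suc k) v \<in> H}"
    using dl_smult[OF a1 u] V_smult[OF a1 u] by simp
  qed
 qed
 then have "ge 0 \<subseteq> H" by (intro ge_generated[OF H]) blast
 then have "carrier W = H" using W.sm_subset[OF H] by (simp add: ge_0)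
 then show ?thesis unfolding fg_module_def H_def using W.module_axioms T(2) sub by blast
qed

end

section \<open>Maps of associated graded modules\<close>

locale gr_hom = N: gr_noeth R N I + E: gr_noeth R E I + h: rhom R N E f
 for R :: "'a ring" and N :: "('a, 'b) module" and I and E :: "('a, 'c) module" and f
begin

abbreviation \<phi> :: "(nat => 'b set) => nat => 'c set" where "\<phi> \<equiv> gr_map R I E f"

lemma f_V: "v \<in> N.V n ==> f v \<in> E.V n"
proof -
 assume v: "v \<in> N.V n"
 have "f ` N.V n = E.ipow I n (f ` carrier N)" by (rule h.image_ipow[OF N.I_sub N.sm_carrier])
 also have "\<dots> \<subseteq> E.V n" by (rule E.ipow_mono[OF N.I_sub E.sm_carrier h.sm_image[OF N.sm_carrier]]) auto
 finally show ?thesis using v by blast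
qed

lemma f_sq: "y \<in> N.sq ==> (\<lambda>n. f (y n)) \<in> E.sq"
 unfolding N.sq_def E.sq_def using f_V h.h_zero by fastforce

lemma gr_map_cls: assumes "y \<in> N.sq" shows "\<phi> (N.cls y) = E.cls (\<lambda>n. f (y n))"
proof
 fix n
 have y: "y n \<in> N.V n" "y n \<in> carrier N" using N.sqD[OF assms] by auto
 have "E.V (Suc n) +>\<^bsub>E\<^esub> f u = E.V (Suc n) +>\<^bsub>E\<^esub> f (y n)" if "u \<in> N.cls y n" for u
 proof -
  note asm = that
  obtain w where w: "w \<in> N.V (Suc n)" "u = w \<oplus>\<^bsub>N\<^esub> y n" using asm unfolding N.cls_def N.coset_mem by blast
  have c: "w \<in> carrier N" using N.V_carr[OF w(1)] .
  have "f u \<ominus>\<^bsub>E\<^esub> f (y n) = f w" using c y w(2) by (simp add: h.h_add E.add_sub_cancel)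
  then show ?thesis using c y w f_V[OF w(1)] by (intro E.coset_eqI[OF E.smV]) auto
 qed
 moreover have "N.cls y n \<noteq> {}" using N.sm_zero[OF N.smV] unfolding N.cls_def a_r_coset_def' by blast
 ultimately show "\<phi> (N.cls y) n = E.cls (\<lambda>n. f (y n)) n"
  unfolding gr_map_def E.ideal_smult_power[OF N.I_ideal] E.cls_def by auto
qed

lemma gr_map_rhom: "rhom N.G N.W E.W \<phi>"
proof (intro rhom.intro rhom_axioms.intro N.gr_rmod E.gr_rmod)
 have car: "\<phi> x \<in> carrier E.W" if "x \<in> carrier N.W" for x
  using that by (auto elim!: N.W_E simp: gr_map_cls f_sq)
 have add: "\<phi> (x \<oplus>\<^bsub>N.W\<^esub> y) = \<phi> x \<oplus>\<^bsub>E.W\<^esub> \<phi> y" if "x \<in> carrier N.W" "y \<in> carrier N.W" for x y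
 proof -
  note asm = that
  obtain u where u: "u \<in> N.sq" "x = N.cls u" using N.W_E[OF asm(1)] .
  obtain v where v: "v \<in> N.sq" "y = N.cls v" using N.W_E[OF asm(2)] .
  show ?thesis unfolding u(2) v(2) N.cls_add[OF u(1) v(1)] gr_map_cls[OF u(1)] gr_map_cls[OF v(1)]
    E.cls_add[OF f_sq[OF u(1)] f_sq[OF v(1)]] gr_map_cls[OF N.add_sq[OF u(1) v(1)]]
   using N.sqD(2)[OF u(1)] N.sqD(2)[OF v(1)] by (simp add: h.h_add)
 qed
 have smult: "\<phi> (a \<odot>\<^bsub>N.W\<^esub> x) = a \<odot>\<^bsub>E.W\<^esub> \<phi> x" if "a \<in> carrier N.G" "x \<in> carrier N.W" for a x
 proof -
  have aW: "a \<in> carrier N.S.W" and xW: "x \<in> carrier N.W" using that by auto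
  obtain b where b: "b \<in> N.S.sq" "a = N.S.cls b" using N.S.W_E[OF aW] .
  obtain y where y: "y \<in> N.sq" "x = N.cls y" using N.W_E[OF xW] .
  have "f (N.cauchy b y n) = E.cauchy b (\<lambda>n. f (y n)) n" for n
  proof -
   have c: "b i \<in> carrier R" "y i \<in> carrier N" for i using N.S.sqD(2)[OF b(1)] N.sqD(2)[OF y(1)] by auto
   have "f (finsum N t T) = finsum E (\<lambda>i. f (t i)) T" if "finite T" "t \<in> T \<rightarrow> carrier N" for t and T :: "nat set"
    using that
   proof (induction T rule: finite_induct)
    case (insert i T)
    then have "finsum N t (insert i T) = t i \<oplus>\<^bsub>N\<^esub> finsum N t T" by (intro N.M.finsum_insert) auto
    moreover have "finsum E (\<lambda>i. f (t i)) (insert i T) = f (t i) \<oplus>\<^bsub>E\<^esub> finsum E (\<lambda>i. f (t i)) T"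
     using insert by (intro E.M.finsum_insert) auto
    moreover have "finsum N t T \<in> carrier N" "t i \<in> carrier N" using insert by auto
    ultimately show ?case using insert by (simp add: h.h_add)
   qed (simp add: h.h_zero)
   from this[of "{..n}" "\<lambda>i. b i \<odot>\<^bsub>N\<^esub> y (n - i)"] show ?thesis
    unfolding N.cauchy_def E.cauchy_def using c by (simp add: h.h_smult)
  qed
  then have "(\<lambda>n. f (N.cauchy b y n)) = E.cauchy b (\<lambda>n. f (y n))" by (rule ext)
  then show ?thesis
   unfolding b(2) y(2) N.cls_smult[OF b(1) y(1)] gr_map_cls[OF y(1)] gr_map_cls[OF N.cauchy_sq[OF b(1) y(1)]]
    E.cls_smult[OF b(1) f_sq[OF y(1)]] by simp
 qed
 show "\<phi> \<in> mod_hom N.G N.W E.W" using car add smult unfolding mod_hom_def by blast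
qed

lemma gr_map_zero_iff: "y \<in> N.sq ==> \<phi> (N.cls y) = \<zero>\<^bsub>E.W\<^esub> \<longleftrightarrow> (\<forall>n. f (y n) \<in> E.V (Suc n))"
 unfolding gr_map_cls E.W_zero fun_eq_iff using E.cls_zero_iff[OF f_sq] by blast

text \<open>The graded piece of the kernel in degree \<open>n\<close> is \<open>gap n / I\<^sup>n\<^sup>+\<^sup>1N\<close>.\<close>

definition gap :: "nat => 'b set" where "gap n = {v \<in> N.V n. f v \<in> E.V (Suc n)}"

lemma gap: "N.sm (gap n)" "N.V (Suc n) \<subseteq> gap n" "gap n \<subseteq> N.V n"
 unfolding gap_def using h.sm_vimage[OF N.smV E.smV] f_V N.V_Suc by blast+

definition ker :: "(nat => 'b set) set" where "ker = {x \<in> carrier N.W. \<phi> x = \<zero>\<^bsub>E.W\<^esub>}"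

lemma sm_ker: "N.W.sm ker"
proof -
 interpret g: rhom N.G N.W E.W \<phi> by (rule gr_map_rhom)
 show ?thesis using g.sm_vimage[OF N.W.sm_carrier E.W.sm_null] unfolding ker_def by simp
qed

text \<open>Truncating in degree \<open>n\<close>, the leading forms of the kernel contribute at most the length of \<open>gap n / I\<^sup>n\<^sup>+\<^sup>1N\<close>, and the rest embeds into the truncation in the degrees below \<open>n\<close>.\<close>

theorem kernel_growth: "N.W.len (N.ge n) (N.W.psum ker (N.ge n)) \<le> (\<Sum>i<n. N.len (N.V (Suc i)) (gap i))"
proof (induction n)
 case 0
 have "N.W.psum ker (N.ge 0) \<subseteq> N.ge 0" unfolding N.ge_0 by (rule N.W.sm_subset[OF N.W.sm_psum[OF sm_ker N.W.sm_carrier]])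
 then have "N.W.len (N.ge 0) (N.W.psum ker (N.ge 0)) \<le> N.W.len (N.ge 0) (N.ge 0)" by (rule N.W.len_mono_top)
 then show ?case by (simp add: N.W.len_refl)
next
 case (Suc n)
 define K where "K j = N.W.psum ker (N.ge j)" for j
 have K: "N.W.sm (K j)" "N.ge j \<subseteq> K j" "ker \<subseteq> K j" for j
  unfolding K_def using N.W.sm_psum[OF sm_ker N.sm_ge] N.W.psum_ub2[OF sm_ker N.sm_ge] N.W.psum_ub1[OF sm_ker N.sm_ge] by auto
 have anti: "N.ge (Suc n) \<subseteq> N.ge n" unfolding N.ge_Suc unfolding N.ge_def N.lead_def using N.V_Suc by blast
 have KK: "K (Suc n) \<subseteq> K n" unfolding K_def by (rule N.W.psum_mono[OF order_refl anti])
 have lead: "K (Suc n) \<inter> N.ge n \<subseteq> N.lead n (gap n)"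
 proof
  fix x assume x: "x \<in> K (Suc n) \<inter> N.ge n"
  then obtain k w where kw: "k \<in> ker" "w \<in> N.ge (Suc n)" "x = k \<oplus>\<^bsub>N.W\<^esub> w" unfolding K_def by (auto elim: N.W.psumE)
  have kW: "k \<in> carrier N.W" "\<phi> k = \<zero>\<^bsub>E.W\<^esub>" using kw(1) unfolding ker_def by auto
  have wn: "w \<in> N.ge n" using kw(2) anti by blast
  then have wW: "w \<in> carrier N.W" using N.ge_W by blast
  have "k = x \<ominus>\<^bsub>N.W\<^esub> w" using N.W.add_sub_cancel[OF kW(1) wW] kw(3) by simp
  then have kn: "k \<in> N.ge n" using N.W.sm_sub[OF N.sm_ge _ wn, of x] x by simp
  obtain y where y: "y \<in> N.sq" "k = N.cls y" using N.W_E[OF kW(1)] .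
  have "\<forall>i<n. y i \<in> N.V (Suc i)" using kn unfolding y(2) N.cls_ge_iff[OF y(1)] .
  moreover have "y n \<in> gap n" unfolding gap_def using kW(2) N.sqD(1)[OF y(1)] unfolding y(2) gr_map_zero_iff[OF y(1)] by blast
  ultimately have "k \<in> N.lead n (gap n)" unfolding y(2) N.cls_lead_iff[OF gap(1,2) y(1)] by blast
  moreover have "w \<in> N.lead n (gap n)" using kw(2) gap(2) unfolding N.ge_Suc N.lead_def by blast
  ultimately show "x \<in> N.lead n (gap n)" unfolding kw(3) by (rule N.W.sm_add[OF N.sm_lead[OF gap(1,2)]])
 qed
 have sub: "N.W.sm (K (Suc n) \<inter> N.ge n)" "N.ge (Suc n) \<subseteq> K (Suc n) \<inter> N.ge n"
  using N.W.sm_Int[OF K(1) N.sm_ge] K(2) anti by auto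
 have "N.W.len (N.ge (Suc n)) (K (Suc n)) = N.W.len (N.ge (Suc n)) (K (Suc n) \<inter> N.ge n) + N.W.len (K (Suc n) \<inter> N.ge n) (K (Suc n))"
  by (rule N.W.len_add[OF N.sm_ge sub(1) K(1) sub(2)]) blast
 also have "N.W.len (N.ge (Suc n)) (K (Suc n) \<inter> N.ge n) \<le> N.len (N.V (Suc n)) (gap n)"
  using N.W.len_mono_top[OF lead, of "N.ge (Suc n)"] N.len_lead[OF gap] by simp
 also have "N.W.len (K (Suc n) \<inter> N.ge n) (K (Suc n)) \<le> N.W.len (N.ge n) (K n)"
  by (rule N.W.len_second_iso_le[OF K(1) N.sm_ge K(1) order_refl KK K(2)])
 finally show ?case using Suc.IH unfolding K_def by (simp add: add_mono add.commute order_trans)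
qed

text \<open>If \<open>f v\<close> has order at least \<open>n + 1\<close> but \<open>v\<close> has order \<open>n\<close>, the leading form of \<open>v\<close> is in the kernel.\<close>

lemma ker_null_imp:
 assumes "ker = {\<zero>\<^bsub>N.W\<^esub>}" shows "v \<in> carrier N ==> f v \<in> E.V n ==> v \<in> N.V n"
proof (induction n)
 case (Suc n)
 then have v: "v \<in> N.V n" using E.V_Suc[of n] by blast
 have "\<phi> (N.cls (N.single n v)) = \<zero>\<^bsub>E.W\<^esub>" unfolding gr_map_zero_iff[OF N.single_sq[OF v]]
  using Suc.prems(2) E.sm_zero[OF E.smV] by (auto simp: N.single_def h.h_zero)
 then have "N.cls (N.single n v) = \<zero>\<^bsub>N.W\<^esub>" using assms N.dl_W[OF v] unfolding ker_def N.dl_def by blast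
 then have "N.cls (N.single n v) n = N.V (Suc n)" unfolding N.W_zero by simp
 then show ?case unfolding N.cls_zero_iff[OF N.single_sq[OF v]] by (simp add: N.single_def)
qed simp

end

text \<open>In the middle, a cycle has components \<open>y\<^sub>n \<in> I\<^sup>nE\<close> with \<open>g y\<^sub>n \<in> I\<^sup>n\<^sup>+\<^sup>1M\<close>. Changing \<open>y\<^sub>n\<close> by an element of
\<open>I\<^sup>n\<^sup>+\<^sup>1E\<close>, one gets \<open>f u\<^sub>n \<in> I\<^sup>nE\<close>, and then \<open>u\<^sub>n \<in> I\<^sup>nN\<close> because \<open>f\<close> is strict by \<open>ker_null_imp\<close>.\<close>

theorem gr_short_exact:
 fixes R :: "'a ring" and N :: "('a, 'b) module" and E :: "('a, 'c) module" and M :: "('a, 'd) module"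
 assumes f: "gr_hom R N I E f" and g: "gr_hom R E I M g" and ex: "short_exact R N E M f g"
  and ker: "gr_hom.ker R N I E f = {\<zero>\<^bsub>gr_mod R I N\<^esub>}"
 shows "short_exact (gr_ring R I) (gr_mod R I N) (gr_mod R I E) (gr_mod R I M) (gr_map R I E f) (gr_map R I M g)"
proof -
 interpret f: gr_hom R N I E f by (rule f)
 interpret g: gr_hom R E I M g by (rule g)
 interpret F: rhom "gr_ring R I" "gr_mod R I N" "gr_mod R I E" f.\<phi> by (rule f.gr_map_rhom)
 interpret H: rhom "gr_ring R I" "gr_mod R I E" "gr_mod R I M" g.\<phi> by (rule g.gr_map_rhom)
 have gf: "g (f u) = \<zero>\<^bsub>M\<^esub>" if "u \<in> carrier N" for u
  using ex that unfolding short_exact_def a_kernel_def' by blast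
 have fg: "\<exists>u\<in>carrier N. f u = e" if "e \<in> carrier E" "g e = \<zero>\<^bsub>M\<^esub>" for e
 proof -
  have "e \<in> f ` carrier N" using ex that unfolding short_exact_def a_kernel_def' by blast
  then show ?thesis by blast
 qed
 have gV: "\<exists>e\<in>f.E.V n. g e = m" if "m \<in> g.E.V n" for m n
 proof -
  have "g ` f.E.V n = g.E.ipow I n (g ` carrier E)" by (rule g.h.image_ipow[OF f.N.I_sub f.E.sm_carrier])
  then have "g ` f.E.V n = g.E.V n" using ex unfolding short_exact_def by simp
  then show ?thesis using that by (metis imageE)
 qed
 have inj: "inj_on f.\<phi> (carrier (gr_mod R I N))"
 proof (rule inj_onI)
  fix x y assume xy: "x \<in> carrier (gr_mod R I N)" "y \<in> carrier (gr_mod R I N)" "f.\<phi> x = f.\<phi> y"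
  have "f.\<phi> (x \<ominus>\<^bsub>gr_mod R I N\<^esub> y) = \<zero>\<^bsub>gr_mod R I E\<^esub>"
   using xy F.h_sub[OF xy(1,2)] f.E.W.sub_self[OF F.h_carr[OF xy(2)]] by simp
  then have d: "x \<ominus>\<^bsub>gr_mod R I N\<^esub> y = \<zero>\<^bsub>gr_mod R I N\<^esub>"
   using ker f.N.W.minus_closed_M[OF xy(1,2)] unfolding f.ker_def by blast
  have "x = (x \<ominus>\<^bsub>gr_mod R I N\<^esub> y) \<oplus>\<^bsub>gr_mod R I N\<^esub> y" using f.N.W.sub_add_cancel[OF xy(1,2)] by simp
  then show "x = y" unfolding d using xy(2) by simp
 qed
 have im: "f.\<phi> ` carrier (gr_mod R I N) = a_kernel (gr_mod R I E) (gr_mod R I M) g.\<phi>"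
 proof (intro equalityI subsetI)
  fix x assume "x \<in> f.\<phi> ` carrier (gr_mod R I N)"
  then obtain w where w: "w \<in> carrier (gr_mod R I N)" "x = f.\<phi> w" by blast
  obtain y where y: "y \<in> f.N.sq" "w = f.N.cls y" using f.N.W_E[OF w(1)] .
  have x: "x = f.E.cls (\<lambda>n. f (y n))" unfolding w(2) y(2) by (rule f.gr_map_cls[OF y(1)])
  have "g.\<phi> x = \<zero>\<^bsub>gr_mod R I M\<^esub>" unfolding x g.gr_map_zero_iff[OF f.f_sq[OF y(1)]]
   using gf[OF f.N.sqD(2)[OF y(1)]] g.E.sm_zero[OF g.E.smV] by simp
  then show "x \<in> a_kernel (gr_mod R I E) (gr_mod R I M) g.\<phi>" using w unfolding a_kernel_def' by auto
 next
  fix x assume "x \<in> a_kernel (gr_mod R I E) (gr_mod R I M) g.\<phi>"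
  then have x: "x \<in> carrier (gr_mod R I E)" "g.\<phi> x = \<zero>\<^bsub>gr_mod R I M\<^esub>" unfolding a_kernel_def' by auto
  obtain y where y: "y \<in> f.E.sq" "x = f.E.cls y" using f.E.W_E[OF x(1)] .
  have gy: "g (y n) \<in> g.E.V (Suc n)" for n using x(2) unfolding y(2) g.gr_map_zero_iff[OF y(1)] by blast
  have "\<exists>u. u \<in> f.N.V n \<and> f u \<ominus>\<^bsub>E\<^esub> y n \<in> f.E.V (Suc n) \<and> (y n = \<zero>\<^bsub>E\<^esub> \<longrightarrow> u = \<zero>\<^bsub>N\<^esub>)" for n
  proof (cases "y n = \<zero>\<^bsub>E\<^esub>")
   case True
   then show ?thesis using f.N.sm_zero[OF f.N.smV] f.E.sm_zero[OF f.E.smV] f.h.h_zero f.E.sub_self[of "\<zero>\<^bsub>E\<^esub>"]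
    by (intro exI[of _ "\<zero>\<^bsub>N\<^esub>"]) simp
  next
   case False
   obtain w where w: "w \<in> f.E.V (Suc n)" "g w = g (y n)" using gV[OF gy] by blast
   have c: "w \<in> carrier E" "y n \<in> carrier E" using f.E.V_carr[OF w(1)] f.E.sqD(2)[OF y(1)] by auto
   have "g (y n \<ominus>\<^bsub>E\<^esub> w) = \<zero>\<^bsub>M\<^esub>" using c w(2) g.E.sub_self by (simp add: g.h.h_sub)
   then obtain u where u: "u \<in> carrier N" "f u = y n \<ominus>\<^bsub>E\<^esub> w" using fg[of "y n \<ominus>\<^bsub>E\<^esub> w"] c by (auto simp: f.E.minus_closed_M)
   have "w \<in> f.E.V n" using w(1) f.E.V_Suc by blast
   then have fu: "f u \<in> f.E.V n" unfolding u(2) by (rule f.E.V_minus[OF f.E.sqD(1)[OF y(1)]])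
   have "y n \<ominus>\<^bsub>E\<^esub> f u \<in> f.E.V (Suc n)"
   proof -
    have "y n = f u \<oplus>\<^bsub>E\<^esub> w" unfolding u(2) using f.E.sub_add_cancel[OF c(2,1)] by simp
    then have "y n \<ominus>\<^bsub>E\<^esub> f u = w" using f.E.add_sub_cancel_l[of "f u" w] u(1) c by simp
    then show ?thesis using w(1) by simp
   qed
   then have "f u \<ominus>\<^bsub>E\<^esub> y n \<in> f.E.V (Suc n)"
    using f.E.sm_neg[OF f.E.smV, of "y n \<ominus>\<^bsub>E\<^esub> f u"] c u(1) by (simp add: f.E.M.minus_eq f.E.M.minus_add f.E.M.a_comm)
   then show ?thesis using f.ker_null_imp[OF ker u(1) fu] False by blast
  qed
  then obtain u where u: "\<And>n. u n \<in> f.N.V n" "\<And>n. f (u n) \<ominus>\<^bsub>E\<^esub> y n \<in> f.E.V (Suc n)" "\<And>n. y n = \<zero>\<^bsub>E\<^esub> ==> u n = \<zero>\<^bsub>N\<^esub>" by metis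
  obtain k where "\<forall>n\<ge>k. y n = \<zero>\<^bsub>E\<^esub>" using y(1) unfolding f.E.sq_def by blast
  then have us: "u \<in> f.N.sq" unfolding f.N.sq_def using u(1,3) by blast
  have "f.\<phi> (f.N.cls u) = x" unfolding f.gr_map_cls[OF us] y(2)
   by (rule ext) (use u(2) f.E.cls_cong_iff[OF f.f_sq[OF us] y(1)] in blast)
  then show "x \<in> f.\<phi> ` carrier (gr_mod R I N)" using f.N.cls_W[OF us] by blast
 qed
 have surj: "g.\<phi> ` carrier (gr_mod R I E) = carrier (gr_mod R I M)"
 proof
  show "carrier (gr_mod R I M) \<subseteq> g.\<phi> ` carrier (gr_mod R I E)"
  proof
   fix x assume x: "x \<in> carrier (gr_mod R I M)"
   obtain z where z: "z \<in> g.E.sq" "x = g.E.cls z" using g.E.W_E[OF x] .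
   have "\<exists>e. e \<in> f.E.V n \<and> g e = z n \<and> (z n = \<zero>\<^bsub>M\<^esub> \<longrightarrow> e = \<zero>\<^bsub>E\<^esub>)" for n
   proof (cases "z n = \<zero>\<^bsub>M\<^esub>")
    case True then show ?thesis using f.E.sm_zero[OF f.E.smV, of n] g.h.h_zero by (intro exI[of _ "\<zero>\<^bsub>E\<^esub>"]) simp
   next
    case False then show ?thesis using gV[OF g.E.sqD(1)[OF z(1)]] by blast
   qed
   then obtain e where e: "\<And>n. e n \<in> f.E.V n" "\<And>n. g (e n) = z n" "\<And>n. z n = \<zero>\<^bsub>M\<^esub> ==> e n = \<zero>\<^bsub>E\<^esub>" by metis
   obtain k where "\<forall>n\<ge>k. z n = \<zero>\<^bsub>M\<^esub>" using z(1) unfolding g.E.sq_def by blast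
   then have es: "e \<in> f.E.sq" unfolding f.E.sq_def using e(1,3) by blast
   have "g.\<phi> (f.E.cls e) = x" unfolding g.gr_map_cls[OF es] z(2) using e(2) by simp
   then show "x \<in> g.\<phi> ` carrier (gr_mod R I E)" using f.E.cls_W[OF es] by blast
  qed
 qed auto
 show ?thesis unfolding short_exact_def using F.hom H.hom inj im surj by blast
qed

section \<open>Dimension and local rings\<close>

lemma krull_dim_ge:
 assumes "\<And>i. i \<le> r ==> primeideal (P i) R" "\<And>i. i < r ==> P i \<subset> P (Suc i)"
 shows "enat r \<le> krull_dim R"
 unfolding krull_dim_def using assms by (intro Sup_upper) blast

text \<open>Chains of primes containing \<open>L\<close> and chains of primes of \<open>R/L\<close> correspond; this lemma and the next give the two inequalities.\<close>

lemma quotient_chain: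
 fixes R :: "'a ring"
 assumes R: "cring R" and L: "ideal L R"
  and P: "\<And>i. i \<le> r ==> primeideal (P i) R \<and> L \<subseteq> P i" "\<And>i. i < r ==> P i \<subset> P (Suc i)"
 shows "enat r \<le> krull_dim (R Quot L)"
proof (rule krull_dim_ge)
 interpret R: cring R by (rule R)
 interpret L: ideal L R by (rule L)
 define Q where "Q i = (+>\<^bsub>R\<^esub>) L ` P i" for i
 have id: "ideal (P i) R" if "i \<le> r" for i using P(1)[OF that] primeideal.axioms(1) by blast
 have Un: "P i = \<Union> (Q i)" if "i \<le> r" for i
  using R.ideal_incl_iff[OF L id[OF that]] P(1)[OF that] unfolding Q_def by blast
 have self: "x \<in> L +>\<^bsub>R\<^esub> x" if "x \<in> carrier R" for x by (rule R.a_rcosI[of "\<zero>\<^bsub>R\<^esub>" L x, simplified]) (use that L.a_subset L.zero_closed in auto)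
 show "primeideal (Q i) (R Quot L)" if i: "i \<le> r" for i
 proof (rule primeidealI)
  interpret Pi: primeideal "P i" R using P(1)[OF i] by blast
  show "ideal (Q i) (R Quot L)" unfolding Q_def by (rule R.ring_ideal_imp_quot_ideal[OF L id[OF i]])
  show "cring (R Quot L)" by (rule L.quotient_is_cring[OF R])
  have in_P: "x \<in> P i" if "x \<in> carrier R" "L +>\<^bsub>R\<^esub> x \<in> Q i" for x using self[OF that(1)] that(2) Un[OF i] by blast
  have car: "carrier (R Quot L) = (+>\<^bsub>R\<^esub>) L ` carrier R" unfolding FactRing_def A_RCOSETS_def' by auto
  show "carrier (R Quot L) \<noteq> Q i"
  proof
   assume "carrier (R Quot L) = Q i"
   then have "carrier R \<subseteq> P i" using in_P car by blast
   then show False using Pi.I_notcarr Pi.a_subset by blast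
  qed
  fix a b assume "a \<in> carrier (R Quot L)" "b \<in> carrier (R Quot L)" and ab: "a \<otimes>\<^bsub>R Quot L\<^esub> b \<in> Q i"
  then obtain x y where xy: "x \<in> carrier R" "a = L +>\<^bsub>R\<^esub> x" "y \<in> carrier R" "b = L +>\<^bsub>R\<^esub> y" unfolding car by blast
  have "L +>\<^bsub>R\<^esub> (x \<otimes>\<^bsub>R\<^esub> y) \<in> Q i" using ab xy L.rcoset_mult_add[of x y] by (simp add: FactRing_def)
  then have "x \<otimes>\<^bsub>R\<^esub> y \<in> P i" using in_P xy by simp
  then show "a \<in> Q i \<or> b \<in> Q i" using Pi.I_prime xy unfolding Q_def by blast
 qed
 show "Q i \<subset> Q (Suc i)" if "i < r" for i
 proof -
  have "P i = \<Union> (Q i)" "P (Suc i) = \<Union> (Q (Suc i))" using Un that by auto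
  then have "Q i \<noteq> Q (Suc i)" using P(2)[OF that] by (metis psubset_eq)
  moreover have "Q i \<subseteq> Q (Suc i)" unfolding Q_def using P(2)[OF that] by (intro image_mono) blast
  ultimately show ?thesis by blast
 qed
qed

lemma krull_dim_quotient_le:
 fixes R :: "'a ring"
 assumes R: "cring R" and L: "ideal L R"
  and bound: "\<And>r P. (\<And>i. i \<le> r ==> primeideal (P i) R \<and> L \<subseteq> P i) ==> (\<And>i. i < r ==> P i \<subset> P (Suc i)) ==> r \<le> d"
 shows "krull_dim (R Quot L) \<le> enat d"
 unfolding krull_dim_def
proof (rule Sup_least, safe)
 interpret R: cring R by (rule R)
 interpret L: ideal L R by (rule L)
 fix r :: nat and Q :: "nat => 'a set set"
 assume Q: "\<forall>i\<le>r. primeideal (Q i) (R Quot L)" "\<forall>i<r. Q i \<subset> Q (Suc i)"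
 have car: "carrier (R Quot L) = (+>\<^bsub>R\<^esub>) L ` carrier R" unfolding FactRing_def A_RCOSETS_def' by auto
 define P where "P i = {x \<in> carrier R. L +>\<^bsub>R\<^esub> x \<in> Q i}" for i
 have Qc: "Q i \<subseteq> carrier (R Quot L)" "L \<in> Q i" if "i \<le> r" for i
 proof -
  interpret Qi: primeideal "Q i" "R Quot L" using Q(1) that by blast
  show "Q i \<subseteq> carrier (R Quot L)" by (rule Qi.a_subset)
  have "\<zero>\<^bsub>R Quot L\<^esub> \<in> Q i" 
   by (rule additive_subgroup.zero_closed[OF ideal.axioms(1)[OF primeideal.axioms(1)[OF Qi.primeideal]]])
  then show "L \<in> Q i" unfolding FactRing_def by simp
 qed
 have "r \<le> d"
 proof (rule bound[of r P])
  fix i assume i: "i \<le> r"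
  have "primeideal (P i) R" unfolding P_def
   by (rule ring_hom_ring.primeideal_vimage[OF L.rcos_ring_hom_ring R]) (use Q(1) i in blast)
  moreover have "L \<subseteq> P i" unfolding P_def using Qc(2)[OF i] L.a_subset L.a_rcos_const by auto
  ultimately show "primeideal (P i) R \<and> L \<subseteq> P i" ..
 next
  fix i assume i: "i < r"
  then obtain X where X: "X \<in> Q (Suc i)" "X \<notin> Q i" using Q(2) by blast
  then obtain x where "x \<in> carrier R" "X = L +>\<^bsub>R\<^esub> x" using Qc(1)[of "Suc i"] i car by auto
  then have "x \<in> P (Suc i)" "x \<notin> P i" unfolding P_def using X by auto
  moreover have "P i \<subseteq> P (Suc i)" unfolding P_def using Q(2) i by blast
  ultimately show "P i \<subset> P (Suc i)" by blast
 qed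
 then show "enat r \<le> enat d" by simp
qed

lemma annihilator_ideal: assumes "module R X" shows "ideal (annihilator R X) R"
proof -
 interpret X: rmod R X by (rule rmod.intro) fact
 have "submodule (annihilator R X) R (self_mod R)"
  by (rule rmod.smI[OF self_rmod[OF X.R.is_cring]]) (auto simp: annihilator_def X.smult_l_distr X.smult_assoc1)
 then show ?thesis using self_sm_iff[OF X.R.is_cring] by blast
qed

lemma mod_dim_ge_of_growth:
 assumes base: "fin_mod R (self_mod R) I" and X: "fg_module R X"
  and big: "\<not> small r p" and p: "\<And>n. enat (p n) \<le> rmod.len R X (rmod.ipow R X I n (carrier X)) (carrier X)"
 shows "enat r \<le> mod_dim R X"
proof -
 have X': "module R X" using X unfolding fg_module_def by blast
 note ann = annihilator_ideal[OF X']
 have "cring R" using X' unfolding module_def by blast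
 obtain k where k: "\<And>n. rmod.len R X (rmod.ipow R X I n (carrier X)) (carrier X) \<le> enat (k * rmod.hs R (self_mod R) I (annihilator R X) n)"
  using fg_fin(3)[OF base X] by blast
 have "\<not> small r (rmod.hs R (self_mod R) I (annihilator R X))"
 proof
  assume "small r (rmod.hs R (self_mod R) I (annihilator R X))"
  then have "small r (\<lambda>n. k * rmod.hs R (self_mod R) I (annihilator R X) n)" by (rule small_cmult)
  moreover have "p n \<le> k * rmod.hs R (self_mod R) I (annihilator R X) n" for n using order_trans[OF p k] by simp
  ultimately show False using big small_mono by blast
 qed
 from prime_chain_of_growth[OF base ann this] obtain P :: "nat => 'a set"
  where "\<And>i. i \<le> r ==> primeideal (P i) R \<and> annihilator R X \<subseteq> P i" "\<And>i. i < r ==> P i \<subset> P (Suc i)" by blast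
 then show ?thesis unfolding mod_dim_def by (rule quotient_chain[OF \<open>cring R\<close> ann])
qed

text \<open>A prime containing the annihilator of the middle module contains that of one of the outer modules.\<close>

lemma mod_dim_extension_le:
 assumes mods: "rmod R N" "rmod R E" "rmod R M" and ex: "short_exact R N E M f g"
  and chN: "\<And>r P. (\<And>i. i \<le> r ==> primeideal (P i) R \<and> annihilator R N \<subseteq> P i) ==> (\<And>i. i < r ==> P i \<subset> P (Suc i)) ==> r \<le> (d::nat)"
  and chM: "\<And>r P. (\<And>i. i \<le> r ==> primeideal (P i) R \<and> annihilator R M \<subseteq> P i) ==> (\<And>i. i < r ==> P i \<subset> P (Suc i)) ==> r \<le> d"
 shows "mod_dim R E \<le> enat d"
proof -
 interpret N: rmod R N by fact
 interpret E: rmod R E by fact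
 interpret M: rmod R M by fact
 interpret f: rhom R N E f by (intro rhom.intro rhom_axioms.intro mods) (use ex short_exact_def in blast)
 interpret g: rhom R E M g by (intro rhom.intro rhom_axioms.intro mods) (use ex short_exact_def in blast)
 have prod: "a \<otimes>\<^bsub>R\<^esub> b \<in> annihilator R E" if a: "a \<in> annihilator R N" and b: "b \<in> annihilator R M" for a b
 proof -
  have ab: "a \<in> carrier R" "b \<in> carrier R" using a b unfolding annihilator_def by auto
  have "(a \<otimes>\<^bsub>R\<^esub> b) \<odot>\<^bsub>E\<^esub> x = \<zero>\<^bsub>E\<^esub>" if x: "x \<in> carrier E" for x
  proof -
   have "g (b \<odot>\<^bsub>E\<^esub> x) = \<zero>\<^bsub>M\<^esub>" using b x ab unfolding annihilator_def by (simp add: g.h_smult)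
   then have "b \<odot>\<^bsub>E\<^esub> x \<in> f ` carrier N" using ex ab x unfolding short_exact_def a_kernel_def' by auto
   then obtain u where "u \<in> carrier N" "b \<odot>\<^bsub>E\<^esub> x = f u" by blast
   then have "a \<odot>\<^bsub>E\<^esub> (b \<odot>\<^bsub>E\<^esub> x) = \<zero>\<^bsub>E\<^esub>"
    using a ab f.h_zero f.h_smult[of a u] unfolding annihilator_def by simp
   then show ?thesis using ab x by (simp add: E.smult_assoc1)
  qed
  then show ?thesis using ab unfolding annihilator_def by simp
 qed
 show ?thesis unfolding mod_dim_def
 proof (rule krull_dim_quotient_le[OF N.R.is_cring annihilator_ideal[OF E.module_axioms]])
  fix r and P :: "nat => 'a set"
  assume P: "\<And>i. i \<le> r ==> primeideal (P i) R \<and> annihilator R E \<subseteq> P i" "\<And>i. i < r ==> P i \<subset> P (Suc i)"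
  have mono: "P 0 \<subseteq> P i" if "i \<le> r" for i using that
  proof (induction i)
   case (Suc i) then show ?case using P(2)[of i] by auto
  qed simp
  interpret P0: primeideal "P 0" R using P(1)[of 0] by blast
  have "annihilator R N \<subseteq> P 0 \<or> annihilator R M \<subseteq> P 0"
  proof (rule ccontr)
   assume "\<not> (annihilator R N \<subseteq> P 0 \<or> annihilator R M \<subseteq> P 0)"
   then obtain a b where ab: "a \<in> annihilator R N" "b \<in> annihilator R M" "a \<notin> P 0" "b \<notin> P 0" by blast
   have "a \<otimes>\<^bsub>R\<^esub> b \<in> P 0" using prod[OF ab(1,2)] P(1)[of 0] by blast
   moreover have "a \<in> carrier R" "b \<in> carrier R" using ab unfolding annihilator_def by auto
   ultimately show False using P0.I_prime ab(3,4) by blast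
  qed
  then show "r \<le> d"
  proof
   assume "annihilator R N \<subseteq> P 0"
   then show ?thesis using chN[of r P] P mono by (meson order_trans)
  next
   assume "annihilator R M \<subseteq> P 0"
   then show ?thesis using chM[of r P] P mono by (meson order_trans)
  qed
 qed
qed

text \<open>If \<open>U\<close> has \<open>k\<close> generators, \<open>U/\<mm>U\<close> is a quotient of \<open>(R/\<mm>)\<^sup>k\<close> and so has length at most \<open>k\<close>.\<close>

theorem local_ring_fin_mod:
 fixes R :: "'a ring" assumes "local_ring R \<mm>" shows "fin_mod R (self_mod R) \<mm>"
proof -
 have R: "cring R" "noetherian_ring R" and mx: "maximalideal \<mm> R" using assms unfolding local_ring_def by auto
 interpret m: maximalideal \<mm> R by (rule mx)
 interpret S: rmod R "self_mod R" by (rule self_rmod[OF R(1)])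
 have mR: "\<mm> \<subseteq> carrier R" by (rule m.a_subset)
 have acc: "S.acc {\<zero>\<^bsub>R\<^esub>} (carrier R)" unfolding S.acc_def
 proof (intro allI impI)
  fix H :: "nat => 'a set"
  assume H: "\<forall>i. S.sm (H i) \<and> {\<zero>\<^bsub>R\<^esub>} \<subseteq> H i \<and> H i \<subseteq> carrier R \<and> H i \<subseteq> H (Suc i)"
  have mono: "H i \<subseteq> H j" if "i \<le> j" for i j using lift_Suc_mono_le[of H i j] H that by blast
  have "H i \<subset> H j \<or> H i = H j \<or> H j \<subset> H i" for i j using mono[of i j] mono[of j i] by (cases "i \<le> j") auto
  moreover have "ideal (H i) R" for i using H self_sm_iff[OF R(1)] by blast
  ultimately have "subset.chain {I. ideal I R} (range H)" unfolding pred_on.chain_def by auto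
  then have "\<Union>(range H) \<in> range H" by (intro noetherian_ring.ideal_chain_is_trivial[OF R(2)]) auto
  then obtain n where "\<Union>(range H) = H n" by blast
  then have "\<forall>m\<ge>n. H m = H n" using mono by blast
  then show "\<exists>n. \<forall>m\<ge>n. H m = H n" by blast
 qed
 interpret nm: noeth_mod R "self_mod R" \<mm>
  by (intro noeth_mod.intro noeth_mod_axioms.intro S.rmod_axioms m.is_ideal) (simp_all add: acc)
 have field: "S.len \<mm> (carrier R) \<le> 1"
 proof (rule S.len_le_1)
  fix H assume "S.sm H" "\<mm> \<subseteq> H" "H \<subseteq> carrier R"
  then show "H = \<mm> \<or> H = carrier R" using m.I_maximal self_sm_iff[OF R(1)] by blast
 qed
 have step: "S.len (S.ip \<mm> U) U \<noteq> \<infinity>" if U: "S.sm U" for U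
 proof -
  have UR: "U \<subseteq> carrier R" using S.sm_subset[OF U] by simp
  have "S.acc {\<zero>\<^bsub>R\<^esub>} U" by (rule S.acc_sub[OF acc order_refl UR])
  then obtain T where T: "finite T" "T \<subseteq> U" "gen_submod R (self_mod R) T = U" using S.acc_imp_fg[of U] U by auto
  obtain gs where gs: "set gs = T" using finite_list[OF T(1)] by blast
  define P where "P = self_mod R\<lparr>carrier := U\<rparr>"
  interpret P: rmod R P unfolding P_def by (rule S.restrict_rmod[OF U])
  have ipU: "S.sm (S.ip \<mm> U)" "S.ip \<mm> U \<subseteq> U" using S.sm_ip'[OF mR U] S.ip_subset[OF mR U] by auto
  have Y: "P.sm (S.ip \<mm> U)" unfolding P_def S.restrict_sm[OF U] using ipU by blast
  have gP: "carrier P = gen_submod R P (set gs)"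
  proof
   show "gen_submod R P (set gs) \<subseteq> carrier P" by (rule P.gen_least[OF P.sm_carrier]) (use T gs P_def in auto)
   have "P.sm (gen_submod R P (set gs))" by (rule P.sm_gen) (use T gs P_def in auto)
   then have "S.sm (gen_submod R P (set gs))" unfolding P_def S.restrict_sm[OF U] by blast
   then have "gen_submod R (self_mod R) T \<subseteq> gen_submod R P (set gs)" by (rule S.gen_least) (use P.gen_incl gs in blast)
   then show "carrier P \<subseteq> gen_submod R P (set gs)" using T(3) by (simp add: P_def)
  qed
  have "P.len (S.ip \<mm> U) (carrier P) \<le> enat (length gs) * S.len \<mm> (carrier R)"
  proof (rule P.fg_growth[OF _ gP Y mR])
   show "set gs \<subseteq> carrier P" using T gs by (simp add: P_def)
   fix a v assume "a \<in> \<mm>" "v \<in> set gs"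
   then have "a \<odot>\<^bsub>self_mod R\<^esub> v \<in> S.ip \<mm> U" using T(2) gs by (intro S.ipI) auto
   then show "a \<odot>\<^bsub>P\<^esub> v \<in> S.ip \<mm> U" by (simp add: P_def)
  qed
  also have "\<dots> \<le> enat (length gs) * 1" by (rule mult_left_mono[OF field]) simp
  finally have "S.len (S.ip \<mm> U) U \<le> enat (length gs)"
   using S.restrict_len[OF U order_refl, of "S.ip \<mm> U"] unfolding P_def by simp
  then show ?thesis by (metis enat_ord_simps(5) infinity_ileE)
 qed
 have "S.len (S.ipow \<mm> n (carrier R)) (carrier R) \<noteq> \<infinity>" for n
 proof (induction n)
  case 0 then show ?case by (simp add: S.len_refl)
 next
  case (Suc n)
  have sm: "S.sm (S.ipow \<mm> k (carrier R))" for k using S.sm_ipow[OF mR S.sm_carrier] by simp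
  have "S.len (S.ipow \<mm> (Suc n) (carrier R)) (carrier R)
    = S.len (S.ipow \<mm> (Suc n) (carrier R)) (S.ipow \<mm> n (carrier R)) + S.len (S.ipow \<mm> n (carrier R)) (carrier R)"
   using S.sm_carrier S.ipow_Suc_subset[OF mR S.sm_carrier, of n] S.sm_subset[OF sm, of n] by (intro S.len_add sm) auto
  then show ?case using Suc step[OF sm, of n] by (auto simp: S.ipow_Suc plus_eq_infty_iff_enat)
 qed
 then show ?thesis by (intro fin_mod.intro fin_mod_axioms.intro nm.noeth_mod_axioms) simp
qed

text \<open>Krull's theorem gives \<open>a \<in> \<mm>\<close> with \<open>(1 - a) z = 0\<close>. The annihilator of \<open>z \<noteq> 0\<close> is a proper ideal, hence contained in
\<open>\<mm>\<close>, and then \<open>1 = (1 - a) + a \<in> \<mm>\<close>.\<close>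

lemma local_separated:
 fixes R :: "'a ring" and X :: "('a, 'm) module"
 assumes loc: "local_ring R \<mm>" and X: "noeth_mod R X \<mm>" and z: "z \<in> carrier X" "z \<noteq> \<zero>\<^bsub>X\<^esub>"
 shows "\<exists>q. z \<notin> rmod.ipow R X \<mm> q (carrier X)"
proof (rule ccontr)
 interpret X: noeth_mod R X \<mm> by (rule X)
 interpret m: maximalideal \<mm> R using loc unfolding local_ring_def by blast
 assume "\<not> ?thesis"
 then have "z \<in> X.psum {\<zero>\<^bsub>X\<^esub>} (X.ipow \<mm> q (carrier X))" for q
  using X.psum_null[OF X.sm_ipow[OF X.I_sub X.sm_carrier]] by simp
 then obtain a where a: "a \<in> \<mm>" "z \<ominus>\<^bsub>X\<^esub> a \<odot>\<^bsub>X\<^esub> z \<in> {\<zero>\<^bsub>X\<^esub>}" using X.krull_intersection[OF X.sm_null z(1)] by blast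
 have aR: "a \<in> carrier R" using a(1) m.Icarr by blast
 define b where "b = \<one>\<^bsub>R\<^esub> \<ominus>\<^bsub>R\<^esub> a"
 have bR: "b \<in> carrier R" unfolding b_def using aR by simp
 have bz: "b \<odot>\<^bsub>X\<^esub> z = \<zero>\<^bsub>X\<^esub>" unfolding b_def using X.sub_smult[of "\<one>\<^bsub>R\<^esub>" a z] aR z(1) a(2) by simp
 define L where "L = annihilator R (X\<lparr>carrier := X.cyc z\<rparr>)"
 have cyc: "X.sm (X.cyc z)" by (rule X.sm_cyc[OF z(1)])
 have L: "ideal L R" unfolding L_def
  using annihilator_ideal rmod.axioms X.restrict_rmod[OF cyc] by blast
 have bL: "b \<in> L"
 proof -
  have "b \<odot>\<^bsub>X\<^esub> (c \<odot>\<^bsub>X\<^esub> z) = \<zero>\<^bsub>X\<^esub>" if "c \<in> carrier R" for c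
   using X.smult_commute[OF bR that z(1)] bz that by simp
  then show ?thesis unfolding L_def annihilator_def X.cyc_def using bR by auto
 qed
 have "\<one>\<^bsub>R\<^esub> \<notin> L" using X.cyc_self[OF z(1)] z X.smult_one[OF z(1)] unfolding L_def annihilator_def by force
 then obtain J where J: "ideal J R \<and> \<one>\<^bsub>R\<^esub> \<notin> J" "L \<subseteq> J" "\<And>J'. ideal J' R \<and> \<one>\<^bsub>R\<^esub> \<notin> J' ==> J \<subseteq> J' ==> J' = J"
  using X.max_ideal_exists[of "\<lambda>J. ideal J R \<and> \<one>\<^bsub>R\<^esub> \<notin> J" L] L by blast
 have "maximalideal J R"
 proof (rule maximalidealI)
  show "ideal J R" "carrier R \<noteq> J" using J(1) X.R.one_closed by auto
  fix J' assume J': "ideal J' R" "J \<subseteq> J'" "J' \<subseteq> carrier R"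
  show "J' = J \<or> J' = carrier R"
   using J(3)[of J'] J' ideal.one_imp_carrier[OF J'(1)] by blast
 qed
 then have "J = \<mm>" using loc unfolding local_ring_def by blast
 then have bm: "b \<in> \<mm>" using bL J(2) by blast
 have "b \<oplus>\<^bsub>R\<^esub> a = \<one>\<^bsub>R\<^esub>" unfolding b_def using aR by (simp add: X.R.minus_eq X.R.a_assoc X.R.l_neg)
 then have "\<one>\<^bsub>R\<^esub> \<in> \<mm>" using m.a_closed[OF bm a(1)] by simp
 then show False using m.one_imp_carrier m.I_notcarr by blast
qed

section \<open>Depth and dimension of the associated graded module\<close>

locale gr_local = gr_noeth +
 fixes d :: nat
 assumes loc: "local_ring R I" and dim: "krull_dim R = enat d" and fg: "fg_module R M"
begin

lemma fin_base: "fin_mod R (self_mod R) I" by (rule local_ring_fin_mod[OF loc])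

text \<open>Otherwise there would be a chain of \<open>d + 2\<close> primes.\<close>

lemma hs_small: "small (Suc d) (rmod.hs R (self_mod R) I {\<zero>})"
proof (rule ccontr)
 assume *: "\<not> ?thesis"
 interpret F: fin_mod R "self_mod R" I by (rule fin_base)
 have "ideal {\<zero>} R" using self_sm_iff[OF cringR] S.sm_null by simp
 then obtain P :: "nat => 'a set" where "\<forall>i\<le>Suc d. primeideal (P i) R" "\<forall>i<Suc d. P i \<subset> P (Suc i)"
  using prime_chain_of_growth[OF fin_base _ *] by blast
 then have "enat (Suc d) \<le> krull_dim R" using krull_dim_ge[of "Suc d" P R] by blast
 then show False using dim by simp
qed

definition P :: "nat => nat" where "P n = the_enat (len (V n) (carrier M))"

lemma P: "len (V n) (carrier M) = enat (P n)"
 using fin_mod.fin_M[OF fg_fin(2)[OF fin_base fg], of n] unfolding P_def by auto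

lemma small_P: "small (Suc d) P"
proof -
 obtain k where k: "\<And>n. len (V n) (carrier M) \<le> enat (k * rmod.hs R (self_mod R) I (annihilator R M) n)"
  using fg_fin(3)[OF fin_base fg] by blast
 interpret F: fin_mod R "self_mod R" I by (rule fin_base)
 have ann: "S.sm (annihilator R M)" unfolding self_sm_iff[OF cringR] by (rule annihilator_ideal[OF module_axioms])
 have "P n \<le> k * S.hs I {\<zero>} n" for n
 proof -
  have "P n \<le> k * S.hs I (annihilator R M) n" using k[of n] P[of n] by simp
  also have "\<dots> \<le> k * S.hs I {\<zero>} n"
   using F.hs_anti[OF S.sm_null ann, of n] S.sm_zero[OF ann] by (intro mult_le_mono2) simp
  finally show ?thesis .
 qed
 then show ?thesis using small_mono[OF small_cmult[OF hs_small, of k]] by blast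
qed

lemma P_big: assumes "dep I d {\<zero>\<^bsub>M\<^esub>}" "carrier M \<noteq> {\<zero>\<^bsub>M\<^esub>}" shows "\<not> small d P"
proof -
 interpret F: fin_pair R M I by (rule fg_fin(1)[OF fin_base fg])
 obtain z where z: "z \<in> carrier M" "z \<noteq> \<zero>\<^bsub>M\<^esub>" using assms(2) M.zero_closed by blast
 obtain q where q: "z \<notin> V q" using local_separated[OF loc noeth_mod_axioms z] by blast
 have "len (V n) (cyc z [+] V n) \<le> enat (P n)" for n
  unfolding P[symmetric] by (rule len_mono_top[OF sm_subset[OF sm_psum[OF sm_cyc[OF z(1)] smV]]])
 then show ?thesis by (rule F.unmixed_growth[OF assms(1) z(1) q])
qed

lemma W_fin_pair: "fin_pair G W Gp"
 by (intro fin_pair.intro fin_pair_axioms.intro gr_noeth_mod gr_fin_self fin_base)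

lemma gr_separated: assumes "z \<in> carrier W" "z \<noteq> \<zero>\<^bsub>W\<^esub>" shows "\<exists>q. z \<notin> ge q"
proof -
 obtain y where y: "y \<in> sq" "z = cls y" using W_E[OF assms(1)] .
 obtain n where "cls y n \<noteq> V (Suc n)" using assms(2) unfolding y(2) W_zero by blast
 then have "y n \<notin> V (Suc n)" using cls_zero_iff[OF y(1)] by blast
 then have "z \<notin> ge (Suc n)" unfolding y(2) cls_ge_iff[OF y(1)] by blast
 then show ?thesis by blast
qed

lemma W_null: assumes "carrier M = {\<zero>\<^bsub>M\<^esub>}" shows "carrier W = {\<zero>\<^bsub>W\<^esub>}"
proof -
 have "y = (\<lambda>_. \<zero>\<^bsub>M\<^esub>)" if "y \<in> sq" for y using sqD(2)[OF that] assms by blast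
 then have "sq = {\<lambda>_. \<zero>\<^bsub>M\<^esub>}" using zero_sq by blast
 then show ?thesis unfolding W_carrier cls_zero[symmetric] by simp
qed

text \<open>A regular sequence of length \<open>d + 1\<close> would force growth of order \<open>d + 1\<close>, whereas \<open>G(M)\<close> grows like \<open>M\<close>.\<close>

lemma gr_depth_le: assumes "carrier W \<noteq> {\<zero>\<^bsub>W\<^esub>}" shows "depth G Gp W \<le> enat d"
proof (rule ccontr)
 interpret F: fin_pair G W Gp by (rule W_fin_pair)
 assume "\<not> ?thesis"
 then have "enat (Suc d) \<le> depth G Gp W" by (simp add: Suc_ile_eq)
 then have dep: "W.dep Gp (Suc d) {\<zero>\<^bsub>W\<^esub>}" by (rule F.depth_ge_imp_dep)
 obtain z where z: "z \<in> carrier W" "z \<noteq> \<zero>\<^bsub>W\<^esub>" using assms W.M.zero_closed by blast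
 obtain q where "z \<notin> ge q" using gr_separated[OF z] by blast
 then have q: "z \<notin> F.JM q" unfolding ipow_ge .
 have "W.len (F.JM n) (W.psum (W.cyc z) (F.JM n)) \<le> enat (P n)" for n
  unfolding P[symmetric] len_ge[symmetric] ipow_ge
  by (rule W.len_mono_top[OF W.sm_subset[OF W.sm_psum[OF W.sm_cyc[OF z(1)] sm_ge]]])
 then have "\<not> small (Suc d) P" by (rule F.unmixed_growth[OF dep z(1) q])
 then show False using small_P by blast
qed

lemma mcm_depth: assumes "max_cohen_macaulay R I M" shows "dep I d {\<zero>\<^bsub>M\<^esub>} \<or> carrier M = {\<zero>\<^bsub>M\<^esub>}"
proof -
 have "carrier M = {\<zero>\<^bsub>M\<^esub>} \<or> depth R I M = enat d"
  using assms dim unfolding max_cohen_macaulay_def cohen_macaulay_def by auto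
 then show ?thesis using depth_ge_imp_dep[of d] by auto
qed

text \<open>As \<open>M\<close> has depth \<open>d\<close>, its length function is large of order \<open>d\<close>, and so is that of \<open>G(M)\<close>.\<close>

lemma gr_mod_dim_ge: assumes "max_cohen_macaulay R I M" "carrier W \<noteq> {\<zero>\<^bsub>W\<^esub>}" shows "enat d \<le> mod_dim G W"
proof (rule mod_dim_ge_of_growth[OF gr_fin_self[OF fin_base] gr_fg[OF fg]])
 have "carrier M \<noteq> {\<zero>\<^bsub>M\<^esub>}" using W_null assms(2) by blast
 then show "\<not> small d P" using P_big mcm_depth[OF assms(1)] by blast
 show "enat (P n) \<le> W.len (W.ipow Gp n (carrier W)) (carrier W)" for n unfolding ipow_ge len_ge P by simp
qed

lemma gr_cm_dep: assumes "max_cohen_macaulay R I M" "gr_cohen_macaulay R I M" shows "W.dep Gp d {\<zero>\<^bsub>W\<^esub>}"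
proof (cases "carrier W = {\<zero>\<^bsub>W\<^esub>}")
 case True
 have "W.dep Gp r {\<zero>\<^bsub>W\<^esub>}" for r
 proof (induction r)
  case (Suc r)
  have z: "\<zero>\<^bsub>G\<^esub> \<in> Gp" using additive_subgroup.zero_closed[OF ideal.axioms(1)[OF Gp_ideal]] .
  have "W.sc \<zero>\<^bsub>G\<^esub> (carrier W) = {\<zero>\<^bsub>W\<^esub>}" unfolding W.sc_def True by simp
  then have "W.psum {\<zero>\<^bsub>W\<^esub>} (W.sc \<zero>\<^bsub>G\<^esub> (carrier W)) = {\<zero>\<^bsub>W\<^esub>}" using W.psum_null[OF W.sm_null] by simp
  then show ?case using Suc z unfolding W.dep.simps W.nzd_def True by (intro bexI[of _ "\<zero>\<^bsub>G\<^esub>"]) auto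
 qed simp
 then show ?thesis .
next
 case False
 interpret F: fin_pair G W Gp by (rule W_fin_pair)
 have "depth G Gp W = mod_dim G W" using assms(2) False unfolding cohen_macaulay_def by blast
 then show ?thesis using F.depth_ge_imp_dep gr_mod_dim_ge[OF assms(1) False] by simp
qed

text \<open>The bound \<open>dim G(M) = depth G(M) \<le> d\<close>, stated on chains so that it also makes sense for the zero module, where it holds vacuously.\<close>

lemma gr_cm_chain:
 assumes "gr_cohen_macaulay R I M"
  and Q: "\<And>i. i \<le> r ==> primeideal (Q i) G \<and> annihilator G W \<subseteq> Q i" "\<And>i. i < r ==> Q i \<subset> Q (Suc i)"
 shows "r \<le> d"
proof (cases "carrier W = {\<zero>\<^bsub>W\<^esub>}")
 case True
 interpret Q0: primeideal "Q 0" G using Q(1)[of 0] by blast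
 have "a \<odot>\<^bsub>W\<^esub> \<zero>\<^bsub>W\<^esub> = \<zero>\<^bsub>W\<^esub>" if "a \<in> carrier G" for a using W.smult_r_null[OF that] .
 then have "annihilator G W = carrier G" unfolding annihilator_def True by auto
 then show ?thesis using Q(1)[of 0] Q0.I_notcarr Q0.a_subset by blast
next
 case False
 have "enat r \<le> mod_dim G W" unfolding mod_dim_def
  by (rule quotient_chain[where P = Q, OF gr_cring annihilator_ideal[OF W.module_axioms]]) (use Q in auto)
 also have "\<dots> = depth G Gp W" using assms(1) False unfolding cohen_macaulay_def by simp
 also have "\<dots> \<le> enat d" by (rule gr_depth_le[OF False])
 finally show ?thesis by simp
qed

lemma eT_limit:
 assumes "d \<ge> 1"
 shows "\<exists>t. (\<forall>n. mod_length R (tor1 R M (quot_mod (self_mod R) (ideal_power R I (n + 1)))) = enat (t n)) \<and>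
  (\<lambda>n. real (t n) / real n ^ (d - 1)) \<longlonglongrightarrow> eT R I M / fact (d - 1)"
proof -
 have "small (Suc (Suc (d - 1))) (rmod.hs R (self_mod R) I {\<zero>})" using hs_small assms by simp
 from tor_growth_converges[OF fin_base fg this] obtain t
  where t: "\<And>n. mod_length R (tor1 R M (quot_mod (self_mod R) (ideal_power R I (n + 1)))) = enat (t n)"
   "convergent (\<lambda>n. real (t n) / real n ^ (d - 1))" by blast
 obtain L where L: "(\<lambda>n. real (t n) / real n ^ (d - 1)) \<longlonglongrightarrow> L" using t(2) unfolding convergent_def by blast
 have "(\<lambda>n. fact (d - 1) * (real (t n) / real n ^ (d - 1))) \<longlonglongrightarrow> fact (d - 1) * L"
  by (rule tendsto_mult_left[OF L])
 then have "lim (\<lambda>n. fact (d - 1) / real n ^ (d - 1) * real (t n)) = fact (d - 1) * L"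
  by (intro limI) simp
 then have "eT R I M = fact (d - 1) * L" unfolding eT_def Let_def dim t(1) by simp
 then have "eT R I M / fact (d - 1) = L" by simp
 then show ?thesis using t(1) L by auto
qed

end

section \<open>T-split sequences\<close>

text \<open>By \<open>torl_short_exact\<close> the length in question is at most \<open>t\<^sub>N + t\<^sub>M - t\<^sub>E\<close>. Divided by \<open>n\<^sup>d\<^sup>-\<^sup>1\<close>, this tends to \<open>(e\<^sub>N + e\<^sub>M - e\<^sub>E) / (d - 1)! = 0\<close>.\<close>

lemma T_split_gap:
 fixes A :: "'a ring" and N :: "('a, 'b) module" and E :: "('a, 'c) module" and M :: "('a, 'd) module"
 assumes N: "gr_local A N \<mm> d" and E: "gr_local A E \<mm> d" and M: "gr_local A M \<mm> d" and d: "d \<ge> 1"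
  and ex: "short_exact A N E M f g" and split: "T_split A \<mm> N E M"
 obtains u where "small (d - 1) u"
  "\<And>n. rmod.len A N (rmod.ipow A N \<mm> (Suc n) (carrier N)) {v \<in> carrier N. f v \<in> rmod.ipow A E \<mm> (Suc n) (carrier E)} = enat (u n)"
proof -
 interpret N: gr_local A N \<mm> d by (rule N)
 interpret E: gr_local A E \<mm> d by (rule E)
 interpret M: gr_local A M \<mm> d by (rule M)
 obtain tN where tN: "\<And>n. mod_length A (tor1 A N (quot_mod (self_mod A) (ideal_power A \<mm> (n + 1)))) = enat (tN n)"
  "(\<lambda>n. real (tN n) / real n ^ (d - 1)) \<longlonglongrightarrow> eT A \<mm> N / fact (d - 1)" using N.eT_limit[OF d] by blast
 obtain tE where tE: "\<And>n. mod_length A (tor1 A E (quot_mod (self_mod A) (ideal_power A \<mm> (n + 1)))) = enat (tE n)"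
  "(\<lambda>n. real (tE n) / real n ^ (d - 1)) \<longlonglongrightarrow> eT A \<mm> E / fact (d - 1)" using E.eT_limit[OF d] by blast
 obtain tM where tM: "\<And>n. mod_length A (tor1 A M (quot_mod (self_mod A) (ideal_power A \<mm> (n + 1)))) = enat (tM n)"
  "(\<lambda>n. real (tM n) / real n ^ (d - 1)) \<longlonglongrightarrow> eT A \<mm> M / fact (d - 1)" using M.eT_limit[OF d] by blast
 define F where "F n = {v \<in> carrier N. f v \<in> E.V (Suc n)}" for n
 have key: "enat (tE n) + N.len (N.V (Suc n)) (F n) \<le> enat (tN n) + enat (tM n)" for n
 proof -
  define Q where "Q = ideal_power A \<mm> (n + 1)"
  interpret C: cyclic_quot A Q
   by (intro cyclic_quot.intro cyclic_quot_axioms.intro N.cringR) (simp only: Q_def N.ideal_power_ideal[OF N.I_ideal])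
  have "C.torl E + N.len (N.ip Q (carrier N)) {v \<in> carrier N. f v \<in> E.ip Q (carrier E)} \<le> C.torl N + C.torl M"
   by (rule C.torl_short_exact[OF N.rmod_axioms E.rmod_axioms M.rmod_axioms ex])
  moreover have "N.ip Q (carrier N) = N.V (Suc n)" "E.ip Q (carrier E) = E.V (Suc n)"
   unfolding Q_def using N.ip_ideal_power[OF N.I_ideal N.sm_carrier, of "Suc n"] E.ip_ideal_power[OF N.I_ideal E.sm_carrier, of "Suc n"] by simp_all
  moreover have "C.torl N = enat (tN n)" "C.torl E = enat (tE n)" "C.torl M = enat (tM n)"
   unfolding C.torl_def unfolding Q_def by (rule tN(1) tE(1) tM(1))+
  ultimately show ?thesis unfolding F_def by simp
 qed
 define u where "u n = the_enat (N.len (N.V (Suc n)) (F n))" for n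
 have u: "N.len (N.V (Suc n)) (F n) = enat (u n)" and ule: "tE n + u n \<le> tN n + tM n" for n
 proof -
  have "N.len (N.V (Suc n)) (F n) \<noteq> \<infinity>" using key[of n] by (cases "N.len (N.V (Suc n)) (F n)") auto
  then show "N.len (N.V (Suc n)) (F n) = enat (u n)" unfolding u_def by auto
  then show "tE n + u n \<le> tN n + tM n" using key[of n] by simp
 qed
 have "(\<lambda>n. real (tN n) / real n ^ (d - 1) + real (tM n) / real n ^ (d - 1) - real (tE n) / real n ^ (d - 1))
   \<longlonglongrightarrow> eT A \<mm> N / fact (d - 1) + eT A \<mm> M / fact (d - 1) - eT A \<mm> E / fact (d - 1)"
  by (intro tendsto_diff tendsto_add tN tE tM)
 moreover have "eT A \<mm> N / fact (d - 1) + eT A \<mm> M / fact (d - 1) - eT A \<mm> E / fact (d - 1) = 0"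
 proof -
  have "eT A \<mm> E = eT A \<mm> N + eT A \<mm> M" using split unfolding T_split_def eT_seq_def by simp
  then show ?thesis by (simp add: add_divide_distrib)
 qed
 ultimately have lim: "(\<lambda>n. real (tN n) / real n ^ (d - 1) + real (tM n) / real n ^ (d - 1) - real (tE n) / real n ^ (d - 1)) \<longlonglongrightarrow> 0" by simp
 have "small (d - 1) u" unfolding small_def
 proof (rule tendsto_sandwich[OF _ _ tendsto_const lim])
  show "\<forall>\<^sub>F n in sequentially. 0 \<le> real (u n) / real n ^ (d - 1)" by simp
  have "real (u n) / real n ^ (d - 1) \<le> real (tN n) / real n ^ (d - 1) + real (tM n) / real n ^ (d - 1) - real (tE n) / real n ^ (d - 1)" for n
  proof -
   have "real (u n) \<le> real (tN n) + real (tM n) - real (tE n)" using ule[of n] by linarith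
   then have "real (u n) / real n ^ (d - 1) \<le> (real (tN n) + real (tM n) - real (tE n)) / real n ^ (d - 1)"
    by (intro divide_right_mono) simp_all
   then show ?thesis by (simp add: add_divide_distrib diff_divide_distrib)
  qed
  then show "\<forall>\<^sub>F n in sequentially. real (u n) / real n ^ (d - 1)
   \<le> real (tN n) / real n ^ (d - 1) + real (tM n) / real n ^ (d - 1) - real (tE n) / real n ^ (d - 1)" by simp
 qed
 then show ?thesis using that u unfolding F_def by blast
qed

theorem lemma1p7:
  fixes A :: "'a ring" and \<mm> :: "'a set" and d :: nat
    and N :: "('a, 'b) module" and E :: "('a, 'c) module" and M :: "('a, 'd) module"
    and f :: "'b \<Rightarrow> 'c" and g :: "'c \<Rightarrow> 'd"
  assumes "cm_local_ring A \<mm>"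
    and "krull_dim A = enat d" and "d \<ge> 1"
    and "max_cohen_macaulay A \<mm> N" and "max_cohen_macaulay A \<mm> E" and "max_cohen_macaulay A \<mm> M"
    and "short_exact A N E M f g"
    and "T_split A \<mm> N E M"
    and "gr_cohen_macaulay A \<mm> N"
  shows "short_exact (gr_ring A \<mm>) (gr_mod A \<mm> N) (gr_mod A \<mm> E) (gr_mod A \<mm> M)
           (gr_map A \<mm> E f) (gr_map A \<mm> M g) \<and>
         (gr_cohen_macaulay A \<mm> M \<longrightarrow> gr_cohen_macaulay A \<mm> E)"
proof -
 have loc: "local_ring A \<mm>" using assms(1) unfolding cm_local_ring_def by blast
 have fg: "fg_module A N" "fg_module A E" "fg_module A M"
  using assms(4-6) unfolding max_cohen_macaulay_def cohen_macaulay_def by auto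
 \<comment> \<open>That \<open>G(A)\<close> is a commutative ring is part of the hypothesis on \<open>G(N)\<close>.\<close>
 have "module (gr_ring A \<mm>) (gr_mod A \<mm> N)" using assms(9) unfolding cohen_macaulay_def fg_module_def by blast
 then have gr: "cring (gr_ring A \<mm>)" by (rule module.axioms(1))
 note base = local_ring_fin_mod[OF loc]
 have gl: "gr_local A X \<mm> d" if "fg_module A X" for X :: "('a, 'x) module"
  using fg_fin(2)[OF base that] gr loc assms(2) that
  by (intro gr_local.intro gr_local_axioms.intro gr_noeth.intro gr_noeth_axioms.intro fin_mod.axioms(1))
 interpret N: gr_local A N \<mm> d by (rule gl[OF fg(1)])
 interpret E: gr_local A E \<mm> d by (rule gl[OF fg(2)])
 interpret M: gr_local A M \<mm> d by (rule gl[OF fg(3)])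
 have rf: "rhom A N E f" "rhom A E M g"
  using assms(7) unfolding short_exact_def
  by (auto intro!: rhom.intro rhom_axioms.intro N.rmod_axioms E.rmod_axioms M.rmod_axioms)
 have F: "gr_hom A N \<mm> E f" by (intro gr_hom.intro N.gr_noeth_axioms E.gr_noeth_axioms rf)
 have H: "gr_hom A E \<mm> M g" by (intro gr_hom.intro E.gr_noeth_axioms M.gr_noeth_axioms rf)
 interpret F: gr_hom A N \<mm> E f by (rule F)
 obtain u where u: "small (d - 1) u"
  "\<And>n. N.len (N.V (Suc n)) {v \<in> carrier N. f v \<in> E.V (Suc n)} = enat (u n)"
  using T_split_gap[OF N.gr_local_axioms E.gr_local_axioms M.gr_local_axioms assms(3,7,8)] by blast
 \<comment> \<open>The sum includes \<open>u n\<close> so that \<open>p (Suc n) = p n + u (Suc n)\<close>, the form needed for \<open>small_sum\<close>.\<close>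
 define p where "p n = (\<Sum>i\<le>n. u i)" for n
 have sp: "small d p" using small_sum[OF _ u(1), of p] assms(3) by (simp add: p_def)
 have growth: "N.W.len (N.ge n) (N.W.psum F.ker (N.ge n)) \<le> enat (p n)" for n
 proof -
  have "N.len (N.V (Suc i)) (F.gap i) \<le> enat (u i)" for i
   unfolding u(2)[symmetric] by (rule N.len_mono_top) (auto simp: F.gap_def N.V_carr)
  then have "(\<Sum>i<n. N.len (N.V (Suc i)) (F.gap i)) \<le> (\<Sum>i<n. enat (u i))" by (rule sum_mono)
  also have "\<dots> = enat (\<Sum>i<n. u i)" by (induction n) (simp_all add: zero_enat_def)
  also have "\<dots> \<le> enat (p n)" unfolding p_def by (auto intro!: sum_mono2)
  finally show ?thesis using F.kernel_growth[of n] by (rule order_trans[rotated])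
 qed
 have ker: "F.ker = {\<zero>\<^bsub>gr_mod A \<mm> N\<^esub>}"
 proof (rule ccontr)
  assume "F.ker \<noteq> {\<zero>\<^bsub>gr_mod A \<mm> N\<^esub>}"
  then obtain z where z: "z \<in> F.ker" "z \<noteq> \<zero>\<^bsub>gr_mod A \<mm> N\<^esub>" using N.W.sm_zero[OF F.sm_ker] by blast
  have zW: "z \<in> carrier N.W" by (rule N.W.sm_carr[OF F.sm_ker z(1)])
  interpret P: fin_pair N.G N.W N.Gp by (rule N.W_fin_pair)
  obtain q where "z \<notin> N.ge q" using N.gr_separated[OF zW z(2)] by blast
  then have q: "z \<notin> P.JM q" unfolding N.ipow_ge .
  have "N.W.len (P.JM n) (N.W.psum (N.W.cyc z) (P.JM n)) \<le> enat (p n)" for n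
   unfolding N.ipow_ge
   using N.W.len_mono_top[OF N.W.psum_mono[OF N.W.cyc_least[OF F.sm_ker z(1)] order_refl]] growth by (rule order_trans)
  then have "\<not> small d p" by (rule P.unmixed_growth[OF N.gr_cm_dep[OF assms(4,9)] zW q])
  then show False using sp by blast
 qed
 have ex: "short_exact (gr_ring A \<mm>) (gr_mod A \<mm> N) (gr_mod A \<mm> E) (gr_mod A \<mm> M) (gr_map A \<mm> E f) (gr_map A \<mm> M g)"
  by (rule gr_short_exact[OF F H assms(7) ker])
 have "gr_cohen_macaulay A \<mm> E" if gM: "gr_cohen_macaulay A \<mm> M"
 proof (cases "carrier E.W = {\<zero>\<^bsub>E.W\<^esub>}")
  case True then show ?thesis unfolding cohen_macaulay_def using E.gr_fg[OF fg(2)] by blast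
 next
  case False
  interpret \<phi>: rhom E.G N.W E.W F.\<phi> by (rule F.gr_map_rhom)
  interpret \<psi>: rhom E.G E.W M.W "gr_map A \<mm> M g" by (rule gr_hom.gr_map_rhom[OF H])
  have "E.W.dep E.Gp d {\<zero>\<^bsub>E.W\<^esub>}"
  proof (rule depth_extension[OF N.gr_noeth_mod E.gr_rmod M.gr_noeth_mod ex E.W.sm_null])
   have "{n \<in> carrier N.W. F.\<phi> n \<in> {\<zero>\<^bsub>E.W\<^esub>}} = {\<zero>\<^bsub>N.W\<^esub>}" using ker unfolding F.ker_def by simp
   then show "N.W.dep E.Gp d {n \<in> carrier N.W. F.\<phi> n \<in> {\<zero>\<^bsub>E.W\<^esub>}}" using N.gr_cm_dep[OF assms(4,9)] by simp
   show "M.W.dep E.Gp d (gr_map A \<mm> M g ` {\<zero>\<^bsub>E.W\<^esub>})" using M.gr_cm_dep[OF assms(6) gM] \<psi>.h_zero by simp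
  qed
  moreover have "E.W.ip E.Gp (carrier E.W) \<noteq> carrier E.W"
  proof
   assume *: "E.W.ip E.Gp (carrier E.W) = carrier E.W"
   have "E.ge q = carrier E.W" for q unfolding E.ipow_ge[symmetric] by (induction q) (simp_all add: E.W.ipow_Suc *)
   then show False using E.gr_separated False E.W.M.zero_closed by blast
  qed
  ultimately have "enat d \<le> depth E.G E.Gp E.W" by (rule noeth_mod.dep_imp_depth_ge[OF E.gr_noeth_mod])
  then have depth: "depth E.G E.Gp E.W = enat d" using E.gr_depth_le[OF False] by (rule antisym[rotated])
  have "mod_dim E.G E.W \<le> enat d"
   by (rule mod_dim_extension_le[OF N.gr_rmod E.gr_rmod M.gr_rmod ex])
    (rule N.gr_cm_chain[OF assms(9)], assumption+, rule M.gr_cm_chain[OF gM], assumption+)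
  then have "mod_dim E.G E.W = enat d" using E.gr_mod_dim_ge[OF assms(5) False] by (rule antisym)
  then show ?thesis unfolding cohen_macaulay_def using E.gr_fg[OF fg(2)] depth by simp
 qed
 then show ?thesis using ex by blast
qed

end
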